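(* Suppose that the data $(G,K,b,\sigma,\theta,\{X^u_0\},\{Y^u_0\})$ satisfy the conditions (RD) stated in the context. Let $X^u$ be the solution of (X) and $\bar X^{u,h}$ its continuous-time Euler scheme with step $h$, as in the context. (i) There exist $h_0,\widehat C>0$ such that $$\sup_{t\ge0}\sup_{u\in I}\mathbb E\big[|X^u_t|^2\big]\vee\sup_{h\in(0,h_0)}\sup_{t\ge0}\sup_{u\in I}\mathbb E\big[|\bar X^{u,h}_t|^2\big]\le\widehat C.$$ Moreover, there exists a constant $\widehat\kappa$ such that for any $h\in(0,h_0)$ and every $t\ge 0$, with $t_m=mh$ and $m=\lfloor t/h\rfloor$, $$\sup_{u\in I}\mathbb E\big[|\bar X^{u,h}_t-\bar X^{u,h}_{t_m}|^2\big]\le\widehat\kappa(t-t_m)\le\widehat\kappa h.$$ (ii) With $h_0$ as in (i), there exists $\widehat\gamma>0$ such that for any $h\in(0,h_0)$, $$\sup_{t\ge0}\sup_{u\in I}\mathbb E\big[|X^u_t-\bar X^{u,h}_t|^2\big]\le\widehat\gamma h^{1\wedge2\rho}.$$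
   Context: Notation. $I=[0,1]$. A graphon is a symmetric measurable function $I\times I\to I$. $|\cdot|$ is the Euclidean norm; for a $d\times q$ real matrix $A\in\mathbb M^{d\times q}(\mathbb R)$, $\|A\|=\sup_{|z|\le 1}|Az|$. $\mathcal P_2(\mathbb R^d)$ (resp. $\mathcal M_2(\mathbb R^d)$) is the set of Borel probability (resp. finite positive Borel) measures on $\mathbb R^d$ with finite second moment; $\mathcal W_2$ is the 2-Wasserstein distance. For $\mu\in\mathcal M_2(\mathbb R^d)$ let $m_\mu=\mu(\mathbb R^d)$; fix a reference point $x_0\in\mathbb R^d$, put $\overline\mu=\mu/m_\mu$ if $m_\mu>0$ and $\overline\mu=\delta_{x_0}$ otherwise, $T_a(x)=a(x-x_0)+x_0$, and $$\mathcal{WOP}_2^2(\mu,\nu)=(m_\mu-m_\nu)^2+\mathcal W_2^2\big(T_{m_\mu}\#\overline\mu,\,T_{m_\nu}\#\overline\nu\big),$$ where $\#$ denotes pushforward. $\mathcal H(\mathbb R^d)$ is the set of families $\boldsymbol\mu=\{\mu^u\}_{u\in I}\in\mathcal P_2(\mathbb R^d)^I$ such that $u\mapsto\mu^u(B)$ is measurable for every Borel $B$ and $\sup_{u\in I}\int|x|^2\mu^u(dx)<\infty$. For a graphon $G$ and $\boldsymbol\mu\in\mathcal H(\mathbb R^d)$, $[G\boldsymbol\mu]^u(dx):=\int_I G(u,v)\mu^v(dx)\,dv\in\mathcal M_2(\mathbb R^d)$. $\boldsymbol\delta_0$ is the family with $\delta_0^u=\delta_0$ for all $u$. System. $G,K$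 are graphons, $b:\mathbb R_+\times\mathbb R^d\to\mathbb R^d$, $\sigma,\theta:\mathbb R_+\times\mathbb R^d\times\mathcal M_2(\mathbb R^d)\to\mathbb M^{d\times q}(\mathbb R)$. On a filtered probability space, $\{B^u\}_{u\in I}$ are i.i.d. $q$-dimensional standard Brownian motions and $\{X^u_0,Y^u_0,B^u:u\in I\}$ are mutually independent. For all $u\in I$, $t\ge0$: (X) $X^u_t=X^u_0+\int_0^tb(s,X^u_s)ds+\int_0^t\sigma(s,X^u_s,[G\boldsymbol\mu_s]^u)dB^u_s$, $\boldsymbol\mu_s=\{\mathcal L(X^u_s)\}_{u\in I}$. Euler scheme. With step $h>0$ and $t_m=mh$: $\bar X^{u,h}_0=X^u_0$ and for $m\in\mathbb N$, $t\in[t_m,t_{m+1}]$, $\bar X^{u,h}_t=\bar X^{u,h}_{t_m}+b(t_m,\bar X^{u,h}_{t_m})(t-t_m)+\sigma(t_m,\bar X^{u,h}_{t_m},[G\bar{\boldsymbol\mu}^h_{t_m}]^u)(B^u_t-B^u_{t_m})$, where $\bar{\boldsymbol\mu}^h_{t_m}=\{\mathcal L(\bar X^{u,h}_{t_m})\}_{u\in I}$. Conditions (RD). (i) There are $\rho\in(0,1]$, $\tilde L>0$, $L>0$ such that for all $t\ge s\ge 0$, $x,y\in\mathbb R^d$, $\mu,\nu\in\mathcal M_2(\mathbb R^d)$: $|b(t,x)-b(s,x)|\vee\|\sigma(t,x,\mu)-\sigma(s,x,\mu)\|\vee\|\theta(t,x,\mu)-\theta(s,x,\mu)\|\le\tilde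 L(1+|x|+\mathcal{WOP}_2(\mu,m_\mu\delta_0))(t-s)^\rho$ and $|b(t,x)-b(t,y)|\vee\|\sigma(t,x,\mu)-\sigma(t,y,\nu)\|\vee\|\theta(t,x,\mu)-\theta(t,y,\nu)\|\le L(|x-y|+\mathcal{WOP}_2(\mu,\nu))$. (ii) $u\mapsto\mathcal L(X^u_0)$ and $u\mapsto\mathcal L(Y^u_0)$ are measurable from $I$ to $\mathcal P(\mathbb R^d)$, and $\sup_u\mathbb E|X_0^u|^2<\infty$, $\sup_u\mathbb E|Y_0^u|^2<\infty$. (iii) There is $c_0\in(0,\infty)$ with $(x_1-x_2)\cdot(b(t,x_1)-b(t,x_2))\le-c_0|x_1-x_2|^2$ for all $t\ge 0$, $x_1,x_2\in\mathbb R^d$, and $\kappa_1:=c_0-8L^2q>0$. (iv) $\kappa_2:=\sup_{t}|b(t,0)|\vee\sup_{t}\sup_{u}\|\sigma(t,0,[G\boldsymbol\delta_0]^u)\|\vee\sup_{t}\sup_{u}\|\theta(t,0,[K\boldsymbol\delta_0]^u)\|<\infty$. *)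

theory Defs
  imports "HOL-Probability.Probability"
begin

section \<open>Measures with finite second moment and the distance WOP\<close>

abbreviation unit_I :: "real set" where
  "unit_I \<equiv> {0..1}"

text \<open>Expectations of nonnegative quantities are Lebesgue integrals with values in
  \<^typ>\<open>ennreal\<close>, so that an upper bound on them includes finiteness.\<close>

definition sq_moment :: "'w measure \<Rightarrow> ('w \<Rightarrow> 'a::real_normed_vector) \<Rightarrow> ennreal" where
  "sq_moment M Z = (\<integral>\<^sup>+\<omega>. ennreal ((norm (Z \<omega>))\<^sup>2) \<partial>M)"

definition M2 :: "'a::euclidean_space measure set" where
  "M2 = {\<mu>. sets \<mu> = sets borel \<and> finite_measure \<mu> \<and> sq_moment \<mu> (\<lambda>x. x) < \<infinity>}"

definition P2 :: "'a::euclidean_space measure set" where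
  "P2 = {\<mu>. sets \<mu> = sets borel \<and> prob_space \<mu> \<and> sq_moment \<mu> (\<lambda>x. x) < \<infinity>}"

abbreviation mass :: "'a measure \<Rightarrow> real" where
  "mass \<mu> \<equiv> measure \<mu> (space \<mu>)"

definition couplings ::
  "'a::euclidean_space measure \<Rightarrow> 'a measure \<Rightarrow> ('a \<times> 'a) measure set" where
  "couplings \<mu> \<nu> = {\<pi>. sets \<pi> = sets (borel \<Otimes>\<^sub>M borel) \<and>
     distr \<pi> borel fst = \<mu> \<and> distr \<pi> borel snd = \<nu>}"

definition W2 :: "'a::euclidean_space measure \<Rightarrow> 'a measure \<Rightarrow> real" where
  "W2 \<mu> \<nu> = sqrt (enn2real
     (INF \<pi>\<in>couplings \<mu> \<nu>. \<integral>\<^sup>+z. ennreal ((norm (fst z - snd z))\<^sup>2) \<partial>\<pi>))"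

definition normalized :: "'a::euclidean_space \<Rightarrow> 'a measure \<Rightarrow> 'a measure" where
  "normalized x0 \<mu> =
     (if mass \<mu> > 0 then scale_measure (ennreal (1 / mass \<mu>)) \<mu> else return borel x0)"

definition dilation :: "'a::euclidean_space \<Rightarrow> real \<Rightarrow> 'a \<Rightarrow> 'a" where
  "dilation x0 a x = a *\<^sub>R (x - x0) + x0"

definition WOP2 :: "'a::euclidean_space \<Rightarrow> 'a measure \<Rightarrow> 'a measure \<Rightarrow> real" where
  "WOP2 x0 \<mu> \<nu> = sqrt ((mass \<mu> - mass \<nu>)\<^sup>2 +
     (W2 (distr (normalized x0 \<mu>) borel (dilation x0 (mass \<mu>)))
         (distr (normalized x0 \<nu>) borel (dilation x0 (mass \<nu>))))\<^sup>2)"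

text \<open>The matrix norm in the conditions is the operator norm for the Euclidean norms.  The
  \<^const>\<open>norm\<close> that the library puts on \<^typ>\<open>real^'q^'d\<close> is the Frobenius norm.\<close>

definition mat_norm :: "real^'q^'d \<Rightarrow> real" where
  "mat_norm A = onorm (\<lambda>z. A *v z)"


section \<open>Graphons and families of laws\<close>

definition graphon :: "(real \<Rightarrow> real \<Rightarrow> real) \<Rightarrow> bool" where
  "graphon G \<longleftrightarrow>
     (\<forall>u\<in>unit_I. \<forall>v\<in>unit_I. G u v \<in> unit_I \<and> G u v = G v u) \<and>
     (\<lambda>(u, v). G u v) \<in> borel_measurable (restrict_space borel (unit_I \<times> unit_I))"

definition law_families :: "(real \<Rightarrow> 'a::euclidean_space measure) set" where
  "law_families = {\<mu>. (\<forall>u\<in>unit_I. \<mu> u \<in> P2) \<and>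
     (\<forall>A\<in>sets borel. (\<lambda>u. emeasure (\<mu> u) A) \<in> borel_measurable (restrict_space borel unit_I)) \<and>
     (SUP u\<in>unit_I. sq_moment (\<mu> u) (\<lambda>x. x)) < \<infinity>}"

definition graphon_op ::
  "(real \<Rightarrow> real \<Rightarrow> real) \<Rightarrow> (real \<Rightarrow> 'a::euclidean_space measure) \<Rightarrow> real \<Rightarrow> 'a measure" where
  "graphon_op G \<mu> u = measure_of UNIV (sets borel)
     (\<lambda>A. \<integral>\<^sup>+v\<in>unit_I. (ennreal (G u v) * emeasure (\<mu> v) A) \<partial>lborel)"

definition laws :: "'w measure \<Rightarrow> (real \<Rightarrow> 'w \<Rightarrow> 'a::euclidean_space) \<Rightarrow> real \<Rightarrow> 'a measure" where
  "laws M Z u = distr M borel (Z u)"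


section \<open>Filtration, Brownian motion, independence\<close>

text \<open>Processes and filtrations are indexed by \<^typ>\<open>real\<close>; only times \<open>t \<ge> 0\<close> matter.
  The usual conditions are not required.\<close>

definition filtered_prob_space :: "'w measure \<Rightarrow> (real \<Rightarrow> 'w measure) \<Rightarrow> bool" where
  "filtered_prob_space M F \<longleftrightarrow> prob_space M \<and> (\<forall>t\<ge>0. subalgebra M (F t)) \<and>
     (\<forall>s t. 0 \<le> s \<and> s \<le> t \<longrightarrow> sets (F s) \<subseteq> sets (F t))"

definition generated_events :: "'w measure \<Rightarrow> ('w \<Rightarrow> 'a::topological_space) \<Rightarrow> 'w set set" where
  "generated_events M Z = {Z -` A \<inter> space M | A. A \<in> sets borel}"

definition brownian_motion ::
  "'w measure \<Rightarrow> (real \<Rightarrow> 'w measure) \<Rightarrow> (real \<Rightarrow> 'w \<Rightarrow> real^'q) \<Rightarrow> bool" where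
  "brownian_motion M F W \<longleftrightarrow>
     (\<forall>t\<ge>0. W t \<in> borel_measurable (F t)) \<and>
     (AE \<omega> in M. W 0 \<omega> = 0) \<and>
     (AE \<omega> in M. continuous_on {0..} (\<lambda>t. W t \<omega>)) \<and>
     (\<forall>s t. 0 \<le> s \<and> s < t \<longrightarrow>
        prob_space.indep_set M (sets (F s)) (generated_events M (\<lambda>\<omega>. W t \<omega> - W s \<omega>)) \<and>
        distributed M lborel (\<lambda>\<omega>. W t \<omega> - W s \<omega>)
          (\<lambda>x. ennreal (\<Prod>i\<in>UNIV. normal_density 0 (sqrt (t - s)) (x $ i))))"

definition path_events :: "'w measure \<Rightarrow> (real \<Rightarrow> 'w \<Rightarrow> 'a::topological_space) \<Rightarrow> 'w set set" where
  "path_events M W = sigma_sets (space M) (\<Union>t\<in>{0..}. generated_events M (W t))"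

text \<open>Index type for the mutual independence of the whole family
  \<open>{X0 u, Y0 u, B u : u \<in> I}\<close>.\<close>

datatype source = Init_X real | Init_Y real | Driver real

primrec source_events ::
  "'w measure \<Rightarrow> (real \<Rightarrow> 'w \<Rightarrow> real^'d) \<Rightarrow> (real \<Rightarrow> 'w \<Rightarrow> real^'d) \<Rightarrow>
   (real \<Rightarrow> real \<Rightarrow> 'w \<Rightarrow> real^'q) \<Rightarrow> source \<Rightarrow> 'w set set" where
  "source_events M X0 Y0 B (Init_X u) = generated_events M (X0 u)"
| "source_events M X0 Y0 B (Init_Y u) = generated_events M (Y0 u)"
| "source_events M X0 Y0 B (Driver u) = path_events M (B u)"

definition random_inputs ::
  "'w measure \<Rightarrow> (real \<Rightarrow> 'w measure) \<Rightarrow> (real \<Rightarrow> 'w \<Rightarrow> real^'d) \<Rightarrow> (real \<Rightarrow> 'w \<Rightarrow> real^'d) \<Rightarrow>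
   (real \<Rightarrow> real \<Rightarrow> 'w \<Rightarrow> real^'q) \<Rightarrow> bool" where
  "random_inputs M F X0 Y0 B \<longleftrightarrow> filtered_prob_space M F \<and>
     (\<forall>u\<in>unit_I. X0 u \<in> borel_measurable (F 0) \<and> Y0 u \<in> borel_measurable (F 0) \<and>
        brownian_motion M F (B u)) \<and>
     prob_space.indep_sets M (source_events M X0 Y0 B)
       (Init_X ` unit_I \<union> Init_Y ` unit_I \<union> Driver ` unit_I)"


section \<open>The Ito integral\<close>

text \<open>A simple integrand takes the bounded value \<open>\<xi> i\<close>, measurable at time \<open>\<tau> i\<close>, on the interval
  from \<open>\<tau> i\<close> (excluded) to \<open>\<tau> (Suc i)\<close> (included), for \<open>i < n\<close>, and vanishes elsewhere.\<close>

definition simple_integrand ::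
  "'w measure \<Rightarrow> (real \<Rightarrow> 'w measure) \<Rightarrow> nat \<Rightarrow> (nat \<Rightarrow> real) \<Rightarrow>
   (nat \<Rightarrow> 'w \<Rightarrow> real^'q^'d) \<Rightarrow> bool" where
  "simple_integrand M F n \<tau> \<xi> \<longleftrightarrow> 0 \<le> \<tau> 0 \<and>
     (\<forall>i<n. \<tau> i < \<tau> (Suc i) \<and> \<xi> i \<in> borel_measurable (F (\<tau> i)) \<and>
        (\<exists>C. \<forall>\<omega>\<in>space M. norm (\<xi> i \<omega>) \<le> C))"

definition simple_process ::
  "nat \<Rightarrow> (nat \<Rightarrow> real) \<Rightarrow> (nat \<Rightarrow> 'w \<Rightarrow> real^'q^'d) \<Rightarrow> real \<Rightarrow> 'w \<Rightarrow> real^'q^'d" where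
  "simple_process n \<tau> \<xi> t \<omega> = (\<Sum>i<n. indicator {\<tau> i<..\<tau> (Suc i)} t *\<^sub>R \<xi> i \<omega>)"

definition simple_integral ::
  "nat \<Rightarrow> (nat \<Rightarrow> real) \<Rightarrow> (nat \<Rightarrow> 'w \<Rightarrow> real^'q^'d) \<Rightarrow> (real \<Rightarrow> 'w \<Rightarrow> real^'q) \<Rightarrow>
   real \<Rightarrow> 'w \<Rightarrow> real^'d" where
  "simple_integral n \<tau> \<xi> W t \<omega> =
     (\<Sum>i<n. \<xi> i \<omega> *v (W (min t (\<tau> (Suc i))) \<omega> - W (min t (\<tau> i)) \<omega>))"

definition progressive ::
  "(real \<Rightarrow> 'w measure) \<Rightarrow> (real \<Rightarrow> 'w \<Rightarrow> 'a::topological_space) \<Rightarrow> bool" where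
  "progressive F H \<longleftrightarrow>
     (\<forall>T\<ge>0. (\<lambda>(t, \<omega>). H t \<omega>) \<in> borel_measurable (restrict_space borel {0..T} \<Otimes>\<^sub>M F T))"

text \<open>\<open>J\<close> is a continuous version of the integral process of \<open>H\<close> against \<open>W\<close>: the limit, in mean
  square at each time, of the integrals of simple integrands that converge to \<open>H\<close> in mean square
  on bounded time intervals.  In particular \<open>H\<close> is square integrable over the probability space
  and every bounded time interval.\<close>

definition ito_integral ::
  "'w measure \<Rightarrow> (real \<Rightarrow> 'w measure) \<Rightarrow> (real \<Rightarrow> 'w \<Rightarrow> real^'q) \<Rightarrow>
   (real \<Rightarrow> 'w \<Rightarrow> real^'q^'d) \<Rightarrow> (real \<Rightarrow> 'w \<Rightarrow> real^'d) \<Rightarrow> bool" where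
  "ito_integral M F W H J \<longleftrightarrow> progressive F H \<and>
     (\<forall>t\<ge>0. J t \<in> borel_measurable M) \<and>
     (AE \<omega> in M. continuous_on {0..} (\<lambda>t. J t \<omega>)) \<and>
     (\<exists>n \<tau> \<xi>. (\<forall>k::nat. simple_integrand M F (n k) (\<tau> k) (\<xi> k)) \<and>
        (\<forall>T\<ge>0.
           (\<lambda>k. \<integral>\<^sup>+\<omega>. (\<integral>\<^sup>+t\<in>{0..T}.
              ennreal ((norm (simple_process (n k) (\<tau> k) (\<xi> k) t \<omega> - H t \<omega>))\<^sup>2) \<partial>lborel) \<partial>M)
             \<longlonglongrightarrow> 0 \<and>
           (\<lambda>k. sq_moment M (\<lambda>\<omega>. simple_integral (n k) (\<tau> k) (\<xi> k) W T \<omega> - J T \<omega>))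
             \<longlonglongrightarrow> 0))"


section \<open>The graphon system and its Euler scheme\<close>

definition graphon_sde_solution ::
  "'w measure \<Rightarrow> (real \<Rightarrow> 'w measure) \<Rightarrow> (real \<Rightarrow> real \<Rightarrow> 'w \<Rightarrow> real^'q) \<Rightarrow>
   (real \<Rightarrow> real \<Rightarrow> real) \<Rightarrow> (real \<Rightarrow> real^'d \<Rightarrow> real^'d) \<Rightarrow>
   (real \<Rightarrow> real^'d \<Rightarrow> (real^'d) measure \<Rightarrow> real^'q^'d) \<Rightarrow>
   (real \<Rightarrow> 'w \<Rightarrow> real^'d) \<Rightarrow> (real \<Rightarrow> real \<Rightarrow> 'w \<Rightarrow> real^'d) \<Rightarrow> bool" where
  "graphon_sde_solution M F B G b \<sigma> X0 X \<longleftrightarrow>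
     (\<forall>u\<in>unit_I. \<forall>t\<ge>0. X u t \<in> borel_measurable (F t)) \<and>
     (\<forall>u\<in>unit_I. AE \<omega> in M. continuous_on {0..} (\<lambda>t. X u t \<omega>)) \<and>
     (\<forall>t\<ge>0. laws M (\<lambda>u. X u t) \<in> law_families) \<and>
     (\<forall>u\<in>unit_I. \<exists>J.
        ito_integral M F (B u)
          (\<lambda>s \<omega>. \<sigma> s (X u s \<omega>) (graphon_op G (laws M (\<lambda>v. X v s)) u)) J \<and>
        (\<forall>t\<ge>0. AE \<omega> in M.
           X u t \<omega> = X0 u \<omega> + integral {0..t} (\<lambda>s. b s (X u s \<omega>)) + J t \<omega>))"

definition euler_scheme ::
  "'w measure \<Rightarrow> (real \<Rightarrow> real \<Rightarrow> 'w \<Rightarrow> real^'q) \<Rightarrow>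
   (real \<Rightarrow> real \<Rightarrow> real) \<Rightarrow> (real \<Rightarrow> real^'d \<Rightarrow> real^'d) \<Rightarrow>
   (real \<Rightarrow> real^'d \<Rightarrow> (real^'d) measure \<Rightarrow> real^'q^'d) \<Rightarrow>
   (real \<Rightarrow> 'w \<Rightarrow> real^'d) \<Rightarrow> real \<Rightarrow> (real \<Rightarrow> real \<Rightarrow> 'w \<Rightarrow> real^'d) \<Rightarrow> bool" where
  "euler_scheme M B G b \<sigma> X0 h Z \<longleftrightarrow>
     (\<forall>u\<in>unit_I. \<forall>\<omega>\<in>space M. Z u 0 \<omega> = X0 u \<omega> \<and>
        (\<forall>m::nat. let tm = real m * h in
           \<forall>t\<in>{tm..real (Suc m) * h}.
             Z u t \<omega> = Z u tm \<omega> + (t - tm) *\<^sub>R b tm (Z u tm \<omega>) +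
               \<sigma> tm (Z u tm \<omega>) (graphon_op G (laws M (\<lambda>v. Z v tm)) u) *v
                 (B u t \<omega> - B u tm \<omega>)))"


section \<open>The conditions on the data\<close>

definition RD ::
  "real^'d \<Rightarrow> 'w measure \<Rightarrow> (real \<Rightarrow> real \<Rightarrow> real) \<Rightarrow> (real \<Rightarrow> real \<Rightarrow> real) \<Rightarrow>
   (real \<Rightarrow> real^'d \<Rightarrow> real^'d) \<Rightarrow>
   (real \<Rightarrow> real^'d \<Rightarrow> (real^'d) measure \<Rightarrow> real^'q^'d) \<Rightarrow>
   (real \<Rightarrow> real^'d \<Rightarrow> (real^'d) measure \<Rightarrow> real^'q^'d) \<Rightarrow>
   (real \<Rightarrow> 'w \<Rightarrow> real^'d) \<Rightarrow> (real \<Rightarrow> 'w \<Rightarrow> real^'d) \<Rightarrow>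
   real \<Rightarrow> real \<Rightarrow> real \<Rightarrow> real \<Rightarrow> bool" where
  "RD x0 M G K b \<sigma> \<theta> X0 Y0 \<rho> Lt L c0 \<longleftrightarrow>
     \<rho> \<in> {0<..1} \<and> Lt > 0 \<and> L > 0 \<and>
     (\<forall>s t x. \<forall>\<mu>\<in>M2. 0 \<le> s \<and> s \<le> t \<longrightarrow>
        max (max (norm (b t x - b s x)) (mat_norm (\<sigma> t x \<mu> - \<sigma> s x \<mu>)))
            (mat_norm (\<theta> t x \<mu> - \<theta> s x \<mu>))
        \<le> Lt * (1 + norm x + WOP2 x0 \<mu> (scale_measure (ennreal (mass \<mu>)) (return borel 0)))
             * (t - s) powr \<rho>) \<and>
     (\<forall>t\<ge>0. \<forall>x y. \<forall>\<mu>\<in>M2. \<forall>\<nu>\<in>M2.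
        max (max (norm (b t x - b t y)) (mat_norm (\<sigma> t x \<mu> - \<sigma> t y \<nu>)))
            (mat_norm (\<theta> t x \<mu> - \<theta> t y \<nu>))
        \<le> L * (norm (x - y) + WOP2 x0 \<mu> \<nu>)) \<and>
     laws M X0 \<in> measurable (restrict_space borel unit_I) (prob_algebra borel) \<and>
     laws M Y0 \<in> measurable (restrict_space borel unit_I) (prob_algebra borel) \<and>
     (SUP u\<in>unit_I. sq_moment M (X0 u)) < \<infinity> \<and>
     (SUP u\<in>unit_I. sq_moment M (Y0 u)) < \<infinity> \<and>
     c0 > 0 \<and>
     (\<forall>t\<ge>0. \<forall>x1 x2. (x1 - x2) \<bullet> (b t x1 - b t x2) \<le> - c0 * (norm (x1 - x2))\<^sup>2) \<and>
     c0 - 8 * L\<^sup>2 * real CARD('q) > 0 \<and>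
     max (max (SUP t\<in>{0..}. ennreal (norm (b t 0)))
              (SUP t\<in>{0..}. SUP u\<in>unit_I.
                 ennreal (mat_norm (\<sigma> t 0 (graphon_op G (\<lambda>v. return borel 0) u)))))
         (SUP t\<in>{0..}. SUP u\<in>unit_I.
            ennreal (mat_norm (\<theta> t 0 (graphon_op K (\<lambda>v. return borel 0) u)))) < \<infinity>"

end

theory Submission
  imports Defs
begin

text \<open>
  No Ito formula is used.  If \<open>Z\<close> and \<open>A\<close> are known at time \<open>s\<close>, then \<open>Z\<close> is orthogonal to the
  increment over \<open>{s<..t}\<close> of an Ito integral minus \<open>A (W t - W s)\<close>, and the isometry gives the second
  moment of that increment exactly.  Hence the mean square of one step of the difference
  between the solution and its Euler scheme splits into an old error, contracted by dissipativity, a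
  diffusion term, absorbed because \<open>c0 > 8 L\<^sup>2 q\<close>, and regularity terms of order
  \<open>h powr min 1 (2 * \<rho>)\<close>.  The resulting recursion is stable uniformly in time, and comparison
  with the scheme bounds the moments of the solution.

  The moments of the solution are only assumed finite at each time.  Orthogonality gives
  \<open>E |X s|\<^sup>2 \<le> E |X t - \<integral> b|\<^sup>2\<close>, and with the linear growth of \<open>b\<close> the second moments on a short window
  are bounded by those at its end, uniformly in the index.

  The coefficient depends on the index through \<open>graphon_op G \<mu> u\<close>.  Both the measurability of this
  dependence and the Lipschitz bound for couplings that do not depend measurably on the index are
  obtained from quantised measures at countably many representative indices.
\<close>

section \<open>Kernels over the unit interval and the graphon operator\<close>

text \<open>The constant in the gap condition is a product of three losses. The isometry produces
  the Frobenius norm, which costs a factor q over the operator norm; state and law enter with equal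
  weight, and squaring their sum gives \<open>4 * L^2 * q\<close> for an error uniform in the index;
  separating this error from the time regularity doubles it. Dissipativity offers
  \<open>2 * c0\<close> against it. Moment bound and error bound cannot be proved one after the
  other: regularity of the solution on a step needs its moments at the left end, and these are known
  only through the error. The induction over the grid therefore carries one statement, that the
  error is at most \<open>err_const * h powr p\<close>. For small h this is at most 1, which bounds
  the moments of the solution by a fixed constant; that constant bounds the regularity terms of the
  next step, and \<open>err_const\<close> is large enough for the step to reproduce the bound. In
  the exponent, 1 comes from Brownian increments and \<open>2 * \<rho>\<close> from the coefficients
  in time. The distance enters only through upper bounds; triangle inequalities are those of the
  matrix norm of differences of \<sigma>.\<close>

abbreviation kernel_on_I :: "(real \<Rightarrow> 'a::euclidean_space measure) \<Rightarrow> bool" where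
  "kernel_on_I \<mu> \<equiv> \<mu> \<in> measurable (restrict_space borel unit_I) (prob_algebra borel)"

lemma kernel_on_I_iff:
  "kernel_on_I \<mu> \<longleftrightarrow> (\<forall>v\<in>unit_I. prob_space (\<mu> v) \<and> sets (\<mu> v) = sets borel) \<and>
     (\<forall>A\<in>sets borel. (\<lambda>v. emeasure (\<mu> v) A) \<in> borel_measurable (restrict_space borel unit_I))"
  (is "?L \<longleftrightarrow> ?R")
proof
  assume L: ?L
  have "prob_space (\<mu> v)" "sets (\<mu> v) = sets borel" if "v \<in> unit_I" for v
    using measurable_space[OF L, of v] that by (auto simp: space_prob_algebra space_restrict_space)
  moreover have "(\<lambda>v. emeasure (\<mu> v) A) \<in> borel_measurable (restrict_space borel unit_I)"
    if "A \<in> sets borel" for A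
    by (rule measurable_compose[OF measurable_prob_algebraD[OF L]
          measurable_emeasure_subprob_algebra[OF that]])
  ultimately show ?R by auto
next
  assume R: ?R
  have "prob_space (\<mu> v)" "sets (\<mu> v) = sets borel" if "v \<in> unit_I" for v using R that by auto
  then show ?L using R
    by (intro measurable_prob_algebraI measurable_subprob_algebra)
       (auto simp: space_restrict_space intro: prob_space_imp_subprob_space)
qed

lemma kernel_on_I_D:
  assumes "kernel_on_I \<mu>" "v \<in> unit_I"
  shows "prob_space (\<mu> v)" "sets (\<mu> v) = sets borel" "space (\<mu> v) = UNIV"
proof -
  show "prob_space (\<mu> v)" and s: "sets (\<mu> v) = sets borel"
    using assms kernel_on_I_iff by blast+
  show "space (\<mu> v) = UNIV" using sets_eq_imp_space_eq[OF s] by simp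
qed

lemma kernel_on_I_distr:
  assumes "kernel_on_I \<mu>" "f \<in> borel_measurable borel"
  shows "kernel_on_I (\<lambda>v. distr (\<mu> v) borel f)"
  unfolding kernel_on_I_iff
proof (intro conjI ballI)
  fix v assume v: "v \<in> unit_I"
  have "f \<in> measurable (\<mu> v) borel"
    using assms(2) kernel_on_I_D(2)[OF assms(1) v] measurable_cong_sets by blast
  then show "prob_space (distr (\<mu> v) borel f)"
    using kernel_on_I_D(1)[OF assms(1) v] by (intro prob_space.prob_space_distr)
next
  fix A :: "'b set" assume A: "A \<in> sets borel"
  have pre: "f -` A \<in> sets borel" using measurable_sets[OF assms(2) A] by simp
  have "emeasure (distr (\<mu> v) borel f) A = emeasure (\<mu> v) (f -` A)" if "v \<in> unit_I" for v
  proof -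
    have "f \<in> measurable (\<mu> v) borel"
      using assms(2) kernel_on_I_D(2)[OF assms(1) that] measurable_cong_sets by blast
    then show ?thesis using A kernel_on_I_D(3)[OF assms(1) that] by (simp add: emeasure_distr)
  qed
  then show "(\<lambda>v. emeasure (distr (\<mu> v) borel f) A) \<in> borel_measurable (restrict_space borel unit_I)"
    using assms(1) pre unfolding kernel_on_I_iff
    by (subst measurable_cong[where g="\<lambda>v. emeasure (\<mu> v) (f -` A)"]) (auto simp: space_restrict_space)
qed auto

lemma graphon_section_measurable:
  assumes "graphon G" "u \<in> unit_I"
  shows "(\<lambda>v. G u v) \<in> borel_measurable (restrict_space borel unit_I)"
proof -
  have "(\<lambda>v. (u, v)) \<in> measurable (restrict_space borel unit_I) (restrict_space borel (unit_I \<times> unit_I))"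
    using assms(2) by (intro measurable_restrict_space3) auto
  from measurable_compose[OF this, of "\<lambda>(u,v). G u v" borel] show ?thesis
    using assms(1) unfolding graphon_def by auto
qed

lemma graphon_bounds:
  assumes "graphon G" "u \<in> unit_I" "v \<in> unit_I" shows "0 \<le> G u v" "G u v \<le> 1"
  using assms unfolding graphon_def by auto

lemma restrict_space_lborel_measurable:
  "measurable (restrict_space lborel unit_I) N = measurable (restrict_space borel unit_I) N"
  by (rule measurable_cong_sets) (auto simp: sets_restrict_space)

text \<open>\<open>measure_of\<close> yields the intended set function only if that function is a
  measure. Writing the operator as a bind, a density in v followed by the kernel, supplies countable
  additivity and the integration rules at once.\<close>

lemma graphon_op_bind:
  assumes G: "graphon G" and u: "u \<in> unit_I" and k: "kernel_on_I \<mu>"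
  shows "graphon_op G \<mu> u = density (restrict_space lborel unit_I) (\<lambda>v. ennreal (G u v)) \<bind> \<mu>"
    (is "_ = ?N")
proof -
  have gm: "(\<lambda>v. ennreal (G u v)) \<in> borel_measurable (restrict_space lborel unit_I)"
    using graphon_section_measurable[OF G u] by (simp add: restrict_space_lborel_measurable)
  have km: "\<mu> \<in> measurable (density (restrict_space lborel unit_I) (\<lambda>v. ennreal (G u v))) (subprob_algebra borel)"
    using measurable_prob_algebraD[OF k] by (simp add: restrict_space_lborel_measurable)
  have ne: "space (density (restrict_space lborel unit_I) (\<lambda>v. ennreal (G u v))) \<noteq> {}"
    by (auto simp: space_restrict_space)
  have sets: "sets ?N = sets borel" using sets_bind[OF _ ne, of \<mu> borel] kernel_on_I_D(2)[OF k]
    by (auto simp: space_restrict_space)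
  have sp: "space ?N = UNIV" using sets_eq_imp_space_eq[OF sets] by simp
  have em: "emeasure ?N A = (\<integral>\<^sup>+v\<in>unit_I. (ennreal (G u v) * emeasure (\<mu> v) A) \<partial>lborel)"
    if A: "A \<in> sets borel" for A
  proof -
    have am: "(\<lambda>v. emeasure (\<mu> v) A) \<in> borel_measurable (restrict_space lborel unit_I)"
      using k A unfolding kernel_on_I_iff by (simp add: restrict_space_lborel_measurable)
    show ?thesis
      by (subst emeasure_bind[OF ne km A], subst nn_integral_density[OF gm am])
         (simp add: nn_integral_restrict_space)
  qed
  have "graphon_op G \<mu> u = measure_of UNIV (sets borel) (emeasure ?N)"
    unfolding graphon_op_def
    by (rule measure_of_eq) (auto simp: em sets.sigma_sets_eq[of borel, simplified])
  also have "\<dots> = ?N" using measure_of_of_measure[of ?N] sets sp by simp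
  finally show ?thesis .
qed

context
  fixes G :: "real \<Rightarrow> real \<Rightarrow> real" and u :: real and \<mu> :: "real \<Rightarrow> 'a::euclidean_space measure"
  assumes G: "graphon G" and u: "u \<in> unit_I" and k: "kernel_on_I \<mu>"
begin

lemma graphon_op_aux:
  shows "(\<lambda>v. ennreal (G u v)) \<in> borel_measurable (restrict_space lborel unit_I)"
    "\<mu> \<in> measurable (density (restrict_space lborel unit_I) (\<lambda>v. ennreal (G u v))) (subprob_algebra borel)"
    "space (density (restrict_space lborel unit_I) (\<lambda>v. ennreal (G u v))) \<noteq> {}"
  using graphon_section_measurable[OF G u] measurable_prob_algebraD[OF k]
  by (auto simp add: restrict_space_lborel_measurable space_restrict_space)

lemma sets_graphon_op: "sets (graphon_op G \<mu> u) = sets borel"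
  unfolding graphon_op_bind[OF G u k]
  using sets_bind[OF _ graphon_op_aux(3), of \<mu> borel] kernel_on_I_D(2)[OF k]
  by (auto simp: space_restrict_space)

lemma space_graphon_op: "space (graphon_op G \<mu> u) = UNIV"
  using sets_eq_imp_space_eq[OF sets_graphon_op] by simp

lemma nn_integral_graphon_op:
  assumes f: "f \<in> borel_measurable borel"
  shows "(\<integral>\<^sup>+x. f x \<partial>graphon_op G \<mu> u) =
    (\<integral>\<^sup>+v. ennreal (G u v) * (\<integral>\<^sup>+x. f x \<partial>\<mu> v) \<partial>restrict_space lborel unit_I)"
proof -
  have am: "(\<lambda>v. \<integral>\<^sup>+x. f x \<partial>\<mu> v) \<in> borel_measurable (restrict_space lborel unit_I)"
    using measurable_compose[OF measurable_prob_algebraD[OF k] nn_integral_measurable_subprob_algebra[OF f]]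
    by (simp add: restrict_space_lborel_measurable)
  show ?thesis
    unfolding graphon_op_bind[OF G u k]
    by (subst nn_integral_bind[OF f graphon_op_aux(2)], subst nn_integral_density[OF graphon_op_aux(1) am]) simp
qed

lemma emeasure_graphon_op:
  assumes A: "A \<in> sets borel"
  shows "emeasure (graphon_op G \<mu> u) A =
    (\<integral>\<^sup>+v. ennreal (G u v) * emeasure (\<mu> v) A \<partial>restrict_space lborel unit_I)"
proof -
  have "emeasure (graphon_op G \<mu> u) A = (\<integral>\<^sup>+x. indicator A x \<partial>graphon_op G \<mu> u)"
    using A by (simp add: sets_graphon_op)
  also have "\<dots> = (\<integral>\<^sup>+v. ennreal (G u v) * (\<integral>\<^sup>+x. indicator A x \<partial>\<mu> v) \<partial>restrict_space lborel unit_I)"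
    using A by (intro nn_integral_graphon_op) auto
  also have "\<dots> = (\<integral>\<^sup>+v. ennreal (G u v) * emeasure (\<mu> v) A \<partial>restrict_space lborel unit_I)"
    using A kernel_on_I_D(2)[OF k]
    by (intro nn_integral_cong) (auto simp: space_restrict_space)
  finally show ?thesis .
qed

lemma nn_integral_graphon_op_le:
  assumes f: "f \<in> borel_measurable borel" and le: "\<And>v. v \<in> unit_I \<Longrightarrow> (\<integral>\<^sup>+x. f x \<partial>\<mu> v) \<le> C"
  shows "(\<integral>\<^sup>+x. f x \<partial>graphon_op G \<mu> u) \<le> C"
proof -
  have "(\<integral>\<^sup>+x. f x \<partial>graphon_op G \<mu> u) \<le> (\<integral>\<^sup>+v. C \<partial>restrict_space lborel unit_I)"
    unfolding nn_integral_graphon_op[OF f]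
  proof (intro nn_integral_mono)
    fix v assume "v \<in> space (restrict_space lborel unit_I)"
    then have v: "v \<in> unit_I" by (simp add: space_restrict_space)
    have "ennreal (G u v) * (\<integral>\<^sup>+x. f x \<partial>\<mu> v) \<le> 1 * C"
      using graphon_bounds[OF G u v] le[OF v] by (intro mult_mono) auto
    then show "ennreal (G u v) * (\<integral>\<^sup>+x. f x \<partial>\<mu> v) \<le> C" by simp
  qed
  also have "\<dots> = C" by (simp add: emeasure_restrict_space space_restrict_space)
  finally show ?thesis .
qed

lemma finite_measure_graphon_op: "finite_measure (graphon_op G \<mu> u)"
  and mass_graphon_op: "mass (graphon_op G \<mu> u) \<le> 1"
proof -
  have "emeasure (\<mu> v) UNIV = 1" if "v \<in> unit_I" for v
    using kernel_on_I_D[OF k that] prob_space.emeasure_space_1 by metis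
  then have "(\<integral>\<^sup>+x. 1 \<partial>graphon_op G \<mu> u) \<le> 1"
    using kernel_on_I_D[OF k] by (intro nn_integral_graphon_op_le) auto
  then have *: "emeasure (graphon_op G \<mu> u) (space (graphon_op G \<mu> u)) \<le> 1" by simp
  show "finite_measure (graphon_op G \<mu> u)"
    by (rule finite_measureI) (use * in \<open>auto simp: top_unique\<close>)
  show "mass (graphon_op G \<mu> u) \<le> 1"
    using * unfolding measure_def by (auto intro: enn2real_leI)
qed

lemma graphon_op_in_M2:
  assumes "\<And>v. v \<in> unit_I \<Longrightarrow> sq_moment (\<mu> v) (\<lambda>x. x) \<le> ennreal C"
  shows "graphon_op G \<mu> u \<in> M2" "sq_moment (graphon_op G \<mu> u) (\<lambda>x. x) \<le> ennreal C"
proof -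
  show *: "sq_moment (graphon_op G \<mu> u) (\<lambda>x. x) \<le> ennreal C"
    unfolding sq_moment_def
    by (rule nn_integral_graphon_op_le) (use assms in \<open>auto simp: sq_moment_def\<close>)
  then show "graphon_op G \<mu> u \<in> M2" 
    unfolding M2_def using sets_graphon_op finite_measure_graphon_op
    by (auto simp: less_top[symmetric] top_unique)
qed

text \<open>Meant for the two projections: with it, a mixture of couplings has the mixtures of the
  marginals as its own marginals.\<close>

lemma distr_graphon_op:
  assumes f: "f \<in> borel_measurable borel"
  shows "distr (graphon_op G \<mu> u) borel f = graphon_op G (\<lambda>v. distr (\<mu> v) borel f) u"
proof (rule measure_eqI)
  have k': "kernel_on_I (\<lambda>v. distr (\<mu> v) borel f)" by (rule kernel_on_I_distr[OF k f])
  have fm: "f \<in> measurable (graphon_op G \<mu> u) borel" 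
    using f sets_graphon_op measurable_cong_sets by blast
  have setseq: "sets (graphon_op G (\<lambda>v. distr (\<mu> v) borel f) u) = sets borel"
    unfolding graphon_op_def
    using sets.sigma_sets_eq[of borel] by (subst sets_measure_of) auto
  then show "sets (distr (graphon_op G \<mu> u) borel f) = sets (graphon_op G (\<lambda>v. distr (\<mu> v) borel f) u)"
    by simp
  fix A assume "A \<in> sets (distr (graphon_op G \<mu> u) borel f)"
  then have A: "A \<in> sets borel" by simp
  have pre: "f -` A \<in> sets borel" using measurable_sets[OF f A] by simp
  show "emeasure (distr (graphon_op G \<mu> u) borel f) A = emeasure (graphon_op G (\<lambda>v. distr (\<mu> v) borel f) u) A"
    using A pre fm
    apply (simp add: emeasure_distr space_graphon_op emeasure_graphon_op)
    apply (subst graphon_op_bind[OF G u k'])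
    apply (subst emeasure_bind[where N=borel])
       apply (auto simp: space_restrict_space restrict_space_lborel_measurable intro: measurable_prob_algebraD[OF k'])[3]
    apply (subst nn_integral_density[OF graphon_op_aux(1)])
    using k' unfolding kernel_on_I_iff apply (simp add: restrict_space_lborel_measurable)
    apply (intro nn_integral_cong)
    subgoal for v
      using kernel_on_I_D[OF k, of v] f by (auto simp: space_restrict_space emeasure_distr measurable_cong_sets[of "\<mu> v" borel borel borel])
    done
qed

end

section \<open>Upper bounds for the distance\<close>

lemma couplings_measurable:
  assumes "\<pi> \<in> couplings \<mu> \<nu>"
  shows "fst \<in> measurable \<pi> borel" "snd \<in> measurable \<pi> borel" "sets \<pi> = sets (borel \<Otimes>\<^sub>M borel)"
    "space \<pi> = UNIV" "sets \<mu> = sets borel" "sets \<nu> = sets borel"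
proof -
  show s: "sets \<pi> = sets (borel \<Otimes>\<^sub>M borel)" using assms by (simp add: couplings_def)
  show "fst \<in> measurable \<pi> borel" "snd \<in> measurable \<pi> borel"
    by (subst measurable_cong_sets[OF s refl]; simp)+
  show "space \<pi> = UNIV" using sets_eq_imp_space_eq[OF s] by (simp add: space_pair_measure)
  show "sets \<mu> = sets borel" "sets \<nu> = sets borel" using assms by (auto simp: couplings_def)
qed

text \<open>\<open>enn2real\<close> sends an infinite infimum to 0; one coupling with finite cost
  makes the infimum finite, so the conversion is harmless here.\<close>

lemma W2_le:
  assumes "\<pi> \<in> couplings \<mu> \<nu>" "(\<integral>\<^sup>+z. ennreal ((norm (fst z - snd z))\<^sup>2) \<partial>\<pi>) \<le> ennreal (c\<^sup>2)" "0 \<le> c"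
  shows "W2 \<mu> \<nu> \<le> c"
proof -
  have "(INF \<pi>\<in>couplings \<mu> \<nu>. \<integral>\<^sup>+z. ennreal ((norm (fst z - snd z))\<^sup>2) \<partial>\<pi>) \<le> ennreal (c\<^sup>2)"
    using assms(1,2) by (rule INF_lower2)
  then have "enn2real (INF \<pi>\<in>couplings \<mu> \<nu>. \<integral>\<^sup>+z. ennreal ((norm (fst z - snd z))\<^sup>2) \<partial>\<pi>) \<le> c\<^sup>2"
    by (intro enn2real_leI) auto
  then show ?thesis unfolding W2_def using assms(3) real_le_lsqrt by (simp add: real_sqrt_le_iff[symmetric, of _ "c\<^sup>2"])
qed

lemma W2_nonneg: "0 \<le> W2 \<mu> \<nu>" unfolding W2_def by simp

lemma W2_refl: 
  fixes \<mu> :: "'a::euclidean_space measure"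
  assumes "sets \<mu> = sets borel" shows "W2 \<mu> \<mu> = 0"
proof -
  have m: "(\<lambda>x. (x, x)) \<in> measurable \<mu> (borel \<Otimes>\<^sub>M borel)"
    by (subst measurable_cong_sets[OF assms refl]) simp
  let ?\<pi> = "distr \<mu> (borel \<Otimes>\<^sub>M borel) (\<lambda>x. (x, x))"
  have d: "distr \<mu> borel (\<lambda>x. x) = \<mu>" by (rule distr_id2) (simp add: assms)
  have "?\<pi> \<in> couplings \<mu> \<mu>" unfolding couplings_def
    using m by (simp add: distr_distr o_def d)
  moreover have "(\<integral>\<^sup>+z. ennreal ((norm (fst z - snd z))\<^sup>2) \<partial>?\<pi>) \<le> ennreal (0\<^sup>2)"
    by (subst nn_integral_distr[OF m]) simp_all
  ultimately have "W2 \<mu> \<mu> \<le> 0" by (rule W2_le) simp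
  then show ?thesis using W2_nonneg[of \<mu> \<mu>] by simp
qed

lemma measurable_dilation[measurable]: "dilation x0 a \<in> borel_measurable borel"
  unfolding dilation_def by measurable

lemma WOP2_zero_mass: 
  assumes "mass \<mu> = 0" "mass \<nu> = 0" shows "WOP2 x0 \<mu> \<nu> = 0"
  unfolding WOP2_def normalized_def using assms by (simp add: W2_refl)

text \<open>The two dilations carry a coupling of the normalised measures to a coupling of the
  dilated ones. The centre \<open>x0\<close> is added back on both sides and cancels in the
  difference, which leaves the cost in \<open>le\<close>.\<close>

lemma WOP2_le_normalized_coupling:
  assumes \<pi>: "\<pi> \<in> couplings (normalized x0 \<mu>) (normalized x0 \<nu>)"
    and le: "(\<integral>\<^sup>+z. ennreal ((norm (mass \<mu> *\<^sub>R (fst z - x0) - mass \<nu> *\<^sub>R (snd z - x0)))\<^sup>2) \<partial>\<pi>) \<le> ennreal (c\<^sup>2)"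
    and c: "0 \<le> c"
  shows "WOP2 x0 \<mu> \<nu> \<le> sqrt ((mass \<mu> - mass \<nu>)\<^sup>2 + c\<^sup>2)"
proof -
  let ?Ta = "dilation x0 (mass \<mu>)" and ?Tb = "dilation x0 (mass \<nu>)"
  let ?T = "\<lambda>z. (?Ta (fst z), ?Tb (snd z))"
  note cm = couplings_measurable[OF \<pi>]
  have Ta: "(\<lambda>z. ?Ta (fst z)) \<in> measurable \<pi> borel" and Tb: "(\<lambda>z. ?Tb (snd z)) \<in> measurable \<pi> borel"
    using cm(1,2) by measurable
  then have Tm: "?T \<in> measurable \<pi> (borel \<Otimes>\<^sub>M borel)" by measurable
  have d: "distr \<pi> borel fst = normalized x0 \<mu>" "distr \<pi> borel snd = normalized x0 \<nu>"
    using \<pi> by (auto simp: couplings_def)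
  have "distr (distr \<pi> (borel \<Otimes>\<^sub>M borel) ?T) borel fst = distr (normalized x0 \<mu>) borel ?Ta"
    unfolding d[symmetric] using Tm cm(1) by (simp add: distr_distr o_def)
  moreover have "distr (distr \<pi> (borel \<Otimes>\<^sub>M borel) ?T) borel snd = distr (normalized x0 \<nu>) borel ?Tb"
    unfolding d[symmetric] using Tm cm(2) by (simp add: distr_distr o_def)
  ultimately have "distr \<pi> (borel \<Otimes>\<^sub>M borel) ?T \<in>
      couplings (distr (normalized x0 \<mu>) borel ?Ta) (distr (normalized x0 \<nu>) borel ?Tb)"
    by (simp add: couplings_def)
  then have "W2 (distr (normalized x0 \<mu>) borel ?Ta) (distr (normalized x0 \<nu>) borel ?Tb) \<le> c"
  proof (rule W2_le)
    show "(\<integral>\<^sup>+z. ennreal ((norm (fst z - snd z))\<^sup>2) \<partial>distr \<pi> (borel \<Otimes>\<^sub>M borel) ?T) \<le> ennreal (c\<^sup>2)"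
      using le Tm by (subst nn_integral_distr) (auto simp: dilation_def)
  qed fact
  then show ?thesis unfolding WOP2_def
    using W2_nonneg by (intro real_sqrt_le_mono add_left_mono power_mono) auto
qed

lemma distr_scale_measure:
  assumes "f \<in> measurable M N"
  shows "distr (scale_measure r M) N f = scale_measure r (distr M N f)"
  using assms by (intro measure_eqI) (auto simp: emeasure_distr space_scale_measure)

text \<open>A coupling forces equal masses \<open>a\<close>, so the mass term vanishes. Normalising
  divides the cost by \<open>a\<close> and the dilations multiply it by the square of
  \<open>a\<close>; the net factor is \<open>a\<close>, and \<open>m1\<close> makes it at most
  1.\<close>

lemma WOP2_le_coupling:
  fixes \<mu> \<nu> :: "'a::euclidean_space measure"
  assumes \<pi>: "\<pi> \<in> couplings \<mu> \<nu>" and fin: "finite_measure \<mu>" and m1: "mass \<mu> \<le> 1"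
    and le: "(\<integral>\<^sup>+z. ennreal ((norm (fst z - snd z))\<^sup>2) \<partial>\<pi>) \<le> ennreal (c\<^sup>2)" and c: "0 \<le> c"
  shows "WOP2 x0 \<mu> \<nu> \<le> c"
proof -
  note cm = couplings_measurable[OF \<pi>]
  have d: "distr \<pi> borel fst = \<mu>" "distr \<pi> borel snd = \<nu>"
    using \<pi> by (auto simp: couplings_def)
  have sp: "space \<mu> = UNIV" "space \<nu> = UNIV"
    using sets_eq_imp_space_eq[OF cm(5)] sets_eq_imp_space_eq[OF cm(6)] by auto
  have e: "emeasure \<mu> UNIV = emeasure \<pi> UNIV" "emeasure \<nu> UNIV = emeasure \<pi> UNIV"
    unfolding d[symmetric] using cm by (auto simp: emeasure_distr)
  then have eqm: "mass \<mu> = mass \<nu>" by (simp add: measure_def sp)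
  show ?thesis
  proof (cases "mass \<mu> > 0")
    case False
    then have "mass \<mu> = 0" "mass \<nu> = 0" using eqm measure_nonneg[of \<mu> "space \<mu>"] by linarith+
    from WOP2_zero_mass[OF this] show ?thesis using c by simp
  next
    case True
    define a where "a = mass \<mu>"
    have a: "0 < a" "a \<le> 1" using True m1 a_def by auto
    have n: "normalized x0 \<mu> = scale_measure (ennreal (1/a)) \<mu>" "normalized x0 \<nu> = scale_measure (ennreal (1/a)) \<nu>"
      using True eqm by (auto simp: normalized_def a_def)
    let ?p = "scale_measure (ennreal (1/a)) \<pi>"
    have "?p \<in> couplings (normalized x0 \<mu>) (normalized x0 \<nu>)"
      unfolding couplings_def n using cm by (simp add: distr_scale_measure d)
    moreover have "(\<integral>\<^sup>+z. ennreal ((norm (mass \<mu> *\<^sub>R (fst z - x0) - mass \<nu> *\<^sub>R (snd z - x0)))\<^sup>2) \<partial>?p) \<le> ennreal (c\<^sup>2)"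
    proof -
      have eq: "(norm (mass \<mu> *\<^sub>R (fst z - x0) - mass \<nu> *\<^sub>R (snd z - x0)))\<^sup>2 = a\<^sup>2 * (norm (fst z - snd z))\<^sup>2" for z :: "'a \<times> 'a"
        unfolding eqm[symmetric] a_def[symmetric] scaleR_diff_right[symmetric]
        by (simp add: power_mult_distrib)
      have meas: "(\<lambda>z. ennreal ((norm (fst z - snd z))\<^sup>2)) \<in> borel_measurable \<pi>" using cm(1,2) by measurable
      have "(\<integral>\<^sup>+z. ennreal ((norm (mass \<mu> *\<^sub>R (fst z - x0) - mass \<nu> *\<^sub>R (snd z - x0)))\<^sup>2) \<partial>?p) =
        ennreal (1/a) * (ennreal (a\<^sup>2) * (\<integral>\<^sup>+z. ennreal ((norm (fst z - snd z))\<^sup>2) \<partial>\<pi>))"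
        unfolding eq using meas by (subst nn_integral_scale_measure) (simp_all add: ennreal_mult nn_integral_cmult)
      also have "\<dots> \<le> ennreal (1/a) * (ennreal (a\<^sup>2) * ennreal (c\<^sup>2))"
        using le by (intro mult_left_mono) auto
      also have "\<dots> = ennreal (a * c\<^sup>2)"
        using a by (simp add: ennreal_mult[symmetric] power2_eq_square)
      also have "\<dots> \<le> ennreal (c\<^sup>2)" using a by (intro ennreal_leI) (simp add: mult_left_le_one_le)
      finally show ?thesis .
    qed
    ultimately have "WOP2 x0 \<mu> \<nu> \<le> sqrt ((mass \<mu> - mass \<nu>)\<^sup>2 + c\<^sup>2)"
      using c by (rule WOP2_le_normalized_coupling)
    then show ?thesis using eqm c by simp
  qed
qed

lemma WOP2_refl: 
  fixes \<mu> :: "'a::euclidean_space measure"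
  assumes "sets \<mu> = sets borel" shows "WOP2 x0 \<mu> \<mu> = 0"
proof -
  have "sets (distr (normalized x0 \<mu>) borel (dilation x0 (mass \<mu>))) = sets borel" by simp
  then show ?thesis unfolding WOP2_def by (simp add: W2_refl)
qed

section \<open>Measures with a common finite support\<close>

lemma emeasure_finite_support:
  assumes fm: "finite_measure \<mu>" and s: "sets \<mu> = sets (borel :: 'a::euclidean_space measure)"
    and S: "finite S" and z: "emeasure \<mu> (- S) = 0" and A: "A \<in> sets borel"
  shows "emeasure \<mu> A = ennreal (\<Sum>k\<in>S \<inter> A. measure \<mu> {k})"
proof -
  have Sb: "S \<in> sets borel" "S \<inter> A \<in> sets borel" using S by (auto intro: finite_imp_closed borel_closed A)
  have "emeasure \<mu> A = emeasure \<mu> (A \<inter> S) + emeasure \<mu> (A - S)"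
    using A Sb s by (subst plus_emeasure) (auto simp: Int_Diff_Un)
  also have "emeasure \<mu> (A - S) = 0"
    using emeasure_mono[of "A - S" "-S" \<mu>] z Sb s by auto
  also have "emeasure \<mu> (A \<inter> S) = (\<Sum>k\<in>S \<inter> A. emeasure \<mu> {k})"
    using S s by (subst emeasure_eq_sum_singleton) (auto simp: Int_commute)
  also have "\<dots> = ennreal (\<Sum>k\<in>S \<inter> A. measure \<mu> {k})"
    by (simp add: finite_measure.emeasure_eq_measure[OF fm])
  finally show ?thesis by simp
qed

text \<open>Most of the mass can stay in place: the fraction \<open>s^2\<close> of the normalised
  \<open>\<nu>\<close> is put on the diagonal, and the rest, of total mass \<open>1 - s^2\<close>,
  is coupled independently. With D = R + norm x0, a diagonal point costs at most the square of
  \<open>(1 - s) * D\<close> and any pair at most the square of \<open>2 * D\<close>. Since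
  \<open>1 - s^2\<close> is at most \<open>2 * (1 - s)\<close>, the cost is at most
  \<open>(1 + 8) * D^2 * (1 - s)\<close>, which is the 9; the additional 1 pays for the squared
  difference of the masses.\<close>

lemma WOP2_le_finite_support:
  fixes \<mu> \<nu> :: "'a::euclidean_space measure"
  assumes \<mu>: "finite_measure \<mu>" "sets \<mu> = sets borel" "mass \<mu> \<le> 1"
    and \<nu>: "finite_measure \<nu>" "sets \<nu> = sets borel" "mass \<nu> \<le> 1"
    and S: "finite S" "\<And>x. x \<in> S \<Longrightarrow> norm x \<le> R" "emeasure \<mu> (- S) = 0" "emeasure \<nu> (- S) = 0"
    and s: "0 < s" "s \<le> 1"
    and close: "\<And>x. x \<in> S \<Longrightarrow> s * measure \<nu> {x} \<le> measure \<mu> {x}" "\<And>x. x \<in> S \<Longrightarrow> s * measure \<mu> {x} \<le> measure \<nu> {x}"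
  shows "WOP2 x0 \<mu> \<nu> \<le> sqrt ((1 + 9 * (R + norm x0)\<^sup>2) * (1 - s))"
proof -
  define a b where "a = mass \<mu>" and "b = mass \<nu>"
  define p r where "p k = measure \<mu> {k}" and "r k = measure \<nu> {k}" for k
  have sp: "space \<mu> = UNIV" "space \<nu> = UNIV"
    using sets_eq_imp_space_eq[OF \<mu>(2)] sets_eq_imp_space_eq[OF \<nu>(2)] by auto
  have a: "a = (\<Sum>k\<in>S. p k)" 
    using emeasure_finite_support[OF \<mu>(1,2) S(1,3), of UNIV]
    by (simp add: a_def sp p_def measure_def[of \<mu> UNIV] sum_nonneg)
  have b: "b = (\<Sum>k\<in>S. r k)" 
    using emeasure_finite_support[OF \<nu>(1,2) S(1,4), of UNIV]
    by (simp add: b_def sp r_def measure_def[of \<nu> UNIV] sum_nonneg)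
  have p0: "p k \<ge> 0" "r k \<ge> 0" for k by (auto simp: p_def r_def)
  have sba: "s * b \<le> a" "s * a \<le> b" unfolding a b sum_distrib_left
    using close by (auto intro!: sum_mono simp: p_def r_def)
  have ab: "0 \<le> a" "a \<le> 1" "0 \<le> b" "b \<le> 1" using \<mu>(3) \<nu>(3) by (auto simp: a_def b_def)
  show ?thesis
  proof (cases "a = 0 \<or> b = 0")
    \<comment> \<open>Closeness of all atoms passes to the total masses, so one mass vanishes only
      together with the other.\<close>
    case True
    then have "a = 0 \<and> b = 0" using sba s ab by (auto simp: mult_le_0_iff)
    then show ?thesis using WOP2_zero_mass[of \<mu> \<nu>] s by (simp add: a_def b_def)
  next
    case False
    then have ab0: "a > 0" "b > 0" using ab by auto
    define c where "c k l = (if k = l then s\<^sup>2 * (r k / b) else 0) + (p k / a - s\<^sup>2 * (r k / b)) * (r l / b)" for k l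
    \<comment> \<open>The ratio enters squared: one factor \<open>s\<close> compares the atoms, the
      other compares the normalising masses \<open>a\<close> and \<open>b\<close>.\<close>
    have le: "s\<^sup>2 * (r k / b) \<le> p k / a" if "k \<in> S" for k
    proof -
      have "s\<^sup>2 * (r k / b) = s * (s * r k) / b" by (simp add: power2_eq_square)
      also have "\<dots> \<le> s * p k / b" using close(1)[OF that] s ab0 by (intro divide_right_mono mult_left_mono) (auto simp: p_def r_def)
      also have "\<dots> \<le> p k / a" using sba(2) ab0 p0[of k] 
        by (simp add: field_simps) (metis mult.assoc mult.commute mult_left_mono)
      finally show ?thesis .
    qed
    have c0: "c k l \<ge> 0" if "k \<in> S" for k l
      unfolding c_def using le[OF that] p0 ab0 s by (intro add_nonneg_nonneg mult_nonneg_nonneg) auto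
    have pb1: "(\<Sum>k\<in>S. p k / a) = 1" "(\<Sum>k\<in>S. r k / b) = 1"
      using ab0 a b by (auto simp: sum_divide_distrib[symmetric])
    have row: "(\<Sum>l\<in>S. c k l) = p k / a" if "k \<in> S" for k
      unfolding c_def sum.distrib sum_distrib_left[symmetric] pb1 using that S(1) by simp
    have "(\<Sum>k\<in>S. p k / a - s\<^sup>2 * (r k / b)) = 1 - s\<^sup>2"
      unfolding sum_subtractf sum_distrib_left[symmetric] pb1 by simp
    then have left: "(\<Sum>k\<in>S. (p k / a - s\<^sup>2 * (r k / b)) * y) = (1 - s\<^sup>2) * y" for y
      by (simp add: sum_distrib_right[symmetric])
    have col: "(\<Sum>k\<in>S. c k l) = r l / b" if "l \<in> S" for l
      unfolding c_def sum.distrib left using that S(1) by (simp add: algebra_simps)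
    define \<pi>0 where "\<pi>0 = point_measure (S \<times> S) (\<lambda>(k, l). ennreal (c k l))"
    \<comment> \<open>\<open>couplings\<close> asks for the product Borel sigma-algebra, whereas
      \<open>point_measure\<close> carries all subsets; the image under the identity changes only
      the sigma-algebra.\<close>
    define \<pi> where "\<pi> = distr \<pi>0 (borel \<Otimes>\<^sub>M borel) (\<lambda>z. z)"
    have m0: "(\<lambda>z. z) \<in> measurable \<pi>0 (borel \<Otimes>\<^sub>M borel)" by (simp add: \<pi>0_def space_pair_measure)
    have m1: "fst \<in> measurable \<pi>0 borel" "snd \<in> measurable \<pi>0 borel" by (simp_all add: \<pi>0_def)
    have nn: "(\<integral>\<^sup>+z. f z \<partial>\<pi>0) = (\<Sum>k\<in>S. \<Sum>l\<in>S. ennreal (c k l) * f (k, l))" for f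
      unfolding \<pi>0_def using S(1)
      by (subst nn_integral_point_measure_finite) (auto simp: sum.cartesian_product case_prod_beta)
    have em1: "emeasure (distr \<pi>0 borel fst) A = emeasure (normalized x0 \<mu>) A" if A: "A \<in> sets borel" for A
    proof -
      have "emeasure (distr \<pi>0 borel fst) A = (\<integral>\<^sup>+z. indicator A (fst z) \<partial>\<pi>0)"
        using nn_integral_distr[OF m1(1), of "indicator A"] A by simp
      also have "\<dots> = (\<Sum>k\<in>S. \<Sum>l\<in>S. ennreal (c k l * indicator A k))"
        unfolding nn by (intro sum.cong refl) (auto simp: indicator_def)
      also have "\<dots> = ennreal (\<Sum>k\<in>S. \<Sum>l\<in>S. c k l * indicator A k)"
        using c0 by (subst sum_ennreal[symmetric]) (auto intro!: sum.cong sum_nonneg sum_ennreal[symmetric])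
      also have "(\<Sum>k\<in>S. \<Sum>l\<in>S. c k l * indicator A k) = (\<Sum>k\<in>S \<inter> A. p k) / a"
        unfolding sum_distrib_right[symmetric] sum_divide_distrib using S(1) 
        by (auto simp: row indicator_def sum.inter_restrict intro!: sum.cong)
      also have "ennreal \<dots> = emeasure (normalized x0 \<mu>) A"
        using ab0 emeasure_finite_support[OF \<mu>(1,2) S(1,3) A]
        by (simp add: normalized_def a_def[symmetric] p_def ennreal_mult[symmetric] sum_nonneg)
      finally show ?thesis .
    qed
    have em2: "emeasure (distr \<pi>0 borel snd) A = emeasure (normalized x0 \<nu>) A" if A: "A \<in> sets borel" for A
    proof -
      have "emeasure (distr \<pi>0 borel snd) A = (\<integral>\<^sup>+z. indicator A (snd z) \<partial>\<pi>0)"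
        using nn_integral_distr[OF m1(2), of "indicator A"] A by simp
      also have "\<dots> = (\<Sum>k\<in>S. \<Sum>l\<in>S. ennreal (c k l * indicator A l))"
        unfolding nn by (intro sum.cong refl) (auto simp: indicator_def)
      also have "\<dots> = ennreal (\<Sum>k\<in>S. \<Sum>l\<in>S. c k l * indicator A l)"
        using c0 by (subst sum_ennreal[symmetric]) (auto intro!: sum.cong sum_nonneg sum_ennreal[symmetric])
      also have "(\<Sum>k\<in>S. \<Sum>l\<in>S. c k l * indicator A l) = (\<Sum>k\<in>S \<inter> A. r k) / b"
        apply (subst sum.swap)
        unfolding sum_distrib_right[symmetric] sum_divide_distrib using S(1) 
        by (auto simp: col indicator_def sum.inter_restrict intro!: sum.cong)
      also have "ennreal \<dots> = emeasure (normalized x0 \<nu>) A"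
        using ab0 emeasure_finite_support[OF \<nu>(1,2) S(1,4) A]
        by (simp add: normalized_def b_def[symmetric] r_def ennreal_mult[symmetric] sum_nonneg)
      finally show ?thesis .
    qed
    have sn: "sets (normalized x0 \<mu>) = sets borel" "sets (normalized x0 \<nu>) = sets borel"
      using \<mu>(2) \<nu>(2) by (auto simp: normalized_def)
    have "distr \<pi> borel fst = normalized x0 \<mu>" "distr \<pi> borel snd = normalized x0 \<nu>"
      unfolding \<pi>_def
      by (rule measure_eqI; simp add: distr_distr[OF _ m0] o_def sn em1 em2)+
    then have cp: "\<pi> \<in> couplings (normalized x0 \<mu>) (normalized x0 \<nu>)"
      by (simp add: couplings_def \<pi>_def)
    define D where "D = R + norm x0"
    have nx: "norm (x - x0) \<le> D" if "x \<in> S" for x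
      using S(2)[OF that] norm_triangle_ineq4[of x x0] by (simp add: D_def)
    define g where "g k l = (norm (a *\<^sub>R (k - x0) - b *\<^sub>R (l - x0)))\<^sup>2" for k l
    have dab: "\<bar>a - b\<bar> \<le> 1 - s"
    proof -
      have "a - b \<le> a * (1 - s)" using sba by (simp add: algebra_simps)
      also have "\<dots> \<le> 1 - s" using mult_right_mono[OF ab(2), of "1 - s"] s by simp
      finally have 1: "a - b \<le> 1 - s" .
      have "b - a \<le> b * (1 - s)" using sba by (simp add: algebra_simps)
      also have "\<dots> \<le> 1 - s" using mult_right_mono[OF ab(4), of "1 - s"] s by simp
      finally show ?thesis using 1 by (simp add: abs_le_iff)
    qed
    have gd: "g k k \<le> ((1 - s) * D)\<^sup>2" if "k \<in> S" for k
    proof -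
      have "norm (a *\<^sub>R (k - x0) - b *\<^sub>R (k - x0)) = \<bar>a - b\<bar> * norm (k - x0)"
        unfolding scaleR_diff_left[symmetric] by simp
      also have "\<dots> \<le> (1 - s) * D" using dab nx[OF that] s by (intro mult_mono) auto
      finally show ?thesis unfolding g_def by (intro power_mono) auto
    qed
    have go: "g k l \<le> (2 * D)\<^sup>2" if "k \<in> S" "l \<in> S" for k l
    proof -
      have "norm (a *\<^sub>R (k - x0) - b *\<^sub>R (l - x0)) \<le> a * norm (k - x0) + b * norm (l - x0)"
        using norm_triangle_ineq4[of "a *\<^sub>R (k - x0)" "b *\<^sub>R (l - x0)"] ab by simp
      also have "\<dots> \<le> 1 * D + 1 * D" using ab nx that by (intro add_mono mult_mono) auto
      finally show ?thesis unfolding g_def by (intro power_mono) auto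
    qed
    have "(\<Sum>k\<in>S. \<Sum>l\<in>S. c k l * g k l) = (\<Sum>k\<in>S. s\<^sup>2 * (r k / b) * g k k) + (\<Sum>k\<in>S. \<Sum>l\<in>S. (p k / a - s\<^sup>2 * (r k / b)) * (r l / b) * g k l)"
    proof -
      have "c k l * g k l = (if l = k then s\<^sup>2 * (r k / b) * g k k else 0) + (p k / a - s\<^sup>2 * (r k / b)) * (r l / b) * g k l" for k l
        by (auto simp: c_def algebra_simps)
      then show ?thesis using S(1) by (simp add: sum.distrib)
    qed
    also have "\<dots> \<le> (\<Sum>k\<in>S. s\<^sup>2 * (r k / b) * ((1 - s) * D)\<^sup>2) + (\<Sum>k\<in>S. \<Sum>l\<in>S. (p k / a - s\<^sup>2 * (r k / b)) * (r l / b) * (2 * D)\<^sup>2)"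
      using gd go le p0 ab0 by (intro add_mono sum_mono mult_left_mono) auto
    also have "\<dots> = s\<^sup>2 * ((1 - s) * D)\<^sup>2 + (1 - s\<^sup>2) * (2 * D)\<^sup>2"
    proof -
      have "(\<Sum>k\<in>S. s\<^sup>2 * (r k / b) * ((1 - s) * D)\<^sup>2) = s\<^sup>2 * ((1 - s) * D)\<^sup>2"
        unfolding sum_distrib_right[symmetric] sum_distrib_left[symmetric] pb1 by simp
      moreover have "(\<Sum>k\<in>S. \<Sum>l\<in>S. (p k / a - s\<^sup>2 * (r k / b)) * (r l / b) * (2 * D)\<^sup>2) = (1 - s\<^sup>2) * (2 * D)\<^sup>2"
        unfolding sum_distrib_right[symmetric] sum_distrib_left[symmetric] pb1 using left[of 1] by simp
      ultimately show ?thesis by simp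
    qed
    also have "\<dots> \<le> 9 * D\<^sup>2 * (1 - s)"
    proof -
      have s2: "s\<^sup>2 \<le> 1" using s by (simp add: power_le_one)
      have "s\<^sup>2 * ((1 - s) * D)\<^sup>2 \<le> 1 * ((1 - s) * D)\<^sup>2" using s2 by (intro mult_right_mono) auto
      also have "\<dots> = (1 - s) * ((1 - s) * D\<^sup>2)" by (simp add: power2_eq_square)
      also have "\<dots> \<le> 1 * ((1 - s) * D\<^sup>2)" using s by (intro mult_right_mono) auto
      finally have 1: "s\<^sup>2 * ((1 - s) * D)\<^sup>2 \<le> (1 - s) * D\<^sup>2" by simp
      have "(1 - s\<^sup>2) = (1 - s) * (1 + s)" by (simp add: power2_eq_square algebra_simps)
      also have "\<dots> \<le> (1 - s) * 2" using s by (intro mult_left_mono) auto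
      finally have "(1 - s\<^sup>2) * (2 * D)\<^sup>2 \<le> (1 - s) * 2 * (2 * D)\<^sup>2" by (intro mult_right_mono) auto
      then show ?thesis using 1 by (simp add: power_mult_distrib algebra_simps)
    qed
    finally have sumle: "(\<Sum>k\<in>S. \<Sum>l\<in>S. c k l * g k l) \<le> 9 * D\<^sup>2 * (1 - s)" .
    have cost: "(\<integral>\<^sup>+z. ennreal ((norm (mass \<mu> *\<^sub>R (fst z - x0) - mass \<nu> *\<^sub>R (snd z - x0)))\<^sup>2) \<partial>\<pi>) \<le> ennreal ((sqrt (9 * D\<^sup>2 * (1 - s)))\<^sup>2)"
    proof -
      have "(\<integral>\<^sup>+z. ennreal ((norm (mass \<mu> *\<^sub>R (fst z - x0) - mass \<nu> *\<^sub>R (snd z - x0)))\<^sup>2) \<partial>\<pi>)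
         = (\<integral>\<^sup>+z. ennreal (g (fst z) (snd z)) \<partial>\<pi>0)"
        unfolding \<pi>_def a_def[symmetric] b_def[symmetric] g_def using m0
        by (subst nn_integral_distr) auto
      also have "\<dots> = (\<Sum>k\<in>S. \<Sum>l\<in>S. ennreal (c k l * g k l))"
        unfolding nn using c0 by (intro sum.cong refl) (auto simp: ennreal_mult g_def)
      also have "\<dots> = ennreal (\<Sum>k\<in>S. \<Sum>l\<in>S. c k l * g k l)"
        using c0 by (subst sum_ennreal[symmetric]) (auto intro!: sum.cong sum_nonneg sum_ennreal[symmetric] simp: g_def)
      also have "\<dots> \<le> ennreal (9 * D\<^sup>2 * (1 - s))" using sumle by (rule ennreal_leI)
      finally show ?thesis using s by simp
    qed
    have "WOP2 x0 \<mu> \<nu> \<le> sqrt ((a - b)\<^sup>2 + (sqrt (9 * D\<^sup>2 * (1 - s)))\<^sup>2)"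
      unfolding a_def b_def using s by (intro WOP2_le_normalized_coupling[OF cp cost]) auto
    also have "\<dots> \<le> sqrt ((1 + 9 * D\<^sup>2) * (1 - s))"
    proof (rule real_sqrt_le_mono)
      have "(a - b)\<^sup>2 \<le> (1 - s)\<^sup>2" using dab s by (metis abs_le_square_iff abs_of_nonneg diff_ge_0_iff_ge)
      also have "\<dots> \<le> 1 * (1 - s)" unfolding power2_eq_square using s by (intro mult_right_mono) auto
      finally have "(a - b)\<^sup>2 \<le> 1 - s" by simp
      moreover have "(sqrt (9 * D\<^sup>2 * (1 - s)))\<^sup>2 = 9 * D\<^sup>2 * (1 - s)" using s by simp
      ultimately have "(a - b)\<^sup>2 + (sqrt (9 * D\<^sup>2 * (1 - s)))\<^sup>2 \<le> (1 - s) + 9 * D\<^sup>2 * (1 - s)" by linarith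
      then show "(a - b)\<^sup>2 + (sqrt (9 * D\<^sup>2 * (1 - s)))\<^sup>2 \<le> (1 + 9 * D\<^sup>2) * (1 - s)"
        by (simp only: distrib_right mult_1_left)
    qed
    finally show ?thesis by (simp add: D_def)
  qed
qed

text \<open>The classes are the level sets of the integer parts of the logarithms of the \<open>f j\<close> to base
  \<open>1 / s\<close>, with the zeros kept apart.\<close>

lemma exists_countable_representatives:
  fixes f :: "'j \<Rightarrow> real \<Rightarrow> real"
  assumes J: "finite J" and fm: "\<And>j. j \<in> J \<Longrightarrow> f j \<in> borel_measurable (restrict_space borel unit_I)"
    and f0: "\<And>j v. j \<in> J \<Longrightarrow> v \<in> unit_I \<Longrightarrow> 0 \<le> f j v" and s: "0 < s" "s < 1"
  obtains r C where "countable C" "C \<subseteq> unit_I" "r \<in> measurable (restrict_space borel unit_I) (count_space C)"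
    "\<And>j v. j \<in> J \<Longrightarrow> v \<in> unit_I \<Longrightarrow> s * f j (r v) \<le> f j v"
    "\<And>j v. j \<in> J \<Longrightarrow> v \<in> unit_I \<Longrightarrow> s * f j v \<le> f j (r v)"
proof -
  let ?I = "restrict_space borel unit_I"
  define code where "code j v = (if f j v = 0 then None else Some \<lfloor>ln (f j v) / ln (1 / s)\<rfloor>)" for j v
  define N where "N v = restrict (\<lambda>j. code j v) J" for v
  define A where "A = N ` unit_I"
  have "countable (PiE J (\<lambda>_. UNIV :: int option set))" by (intro countable_PiE J) auto
  moreover have "A \<subseteq> PiE J (\<lambda>_. UNIV)" by (auto simp: A_def N_def)
  ultimately have cA: "countable A" by (rule countable_subset[rotated])
  have cm: "code j \<in> measurable ?I (count_space UNIV)" if "j \<in> J" for j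
  proof -
    note [measurable] = fm[OF that]
    show ?thesis unfolding code_def by measurable
  qed
  have Nm: "N \<in> measurable ?I (count_space A)"
    unfolding measurable_count_space_eq_countable[OF cA]
  proof (intro conjI ballI)
    show "N \<in> space ?I \<rightarrow> A" by (auto simp: A_def space_restrict_space)
    fix n assume "n \<in> A"
    then have next': "n \<in> extensional J" by (auto simp: A_def N_def)
    have "N -` {n} \<inter> space ?I = {v \<in> space ?I. \<forall>j\<in>J. code j v = n j}"
      using next' by (auto simp: N_def fun_eq_iff extensional_def restrict_def)
    also have "\<dots> \<in> sets ?I"
    proof (rule sets.sets_Collect_finite_All[OF _ J])
      fix j assume "j \<in> J"
      from measurable_sets[OF cm[OF this], of "{n j}"]
      show "{v \<in> space ?I. code j v = n j} \<in> sets ?I" by (simp add: vimage_def Int_def conj_commute)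
    qed
    finally show "N -` {n} \<inter> space ?I \<in> sets ?I" .
  qed
  define rep where "rep n = (SOME w. w \<in> unit_I \<and> N w = n)" for n
  have rep: "rep n \<in> unit_I \<and> N (rep n) = n" if "n \<in> A" for n
    unfolding rep_def by (rule someI_ex) (use that in \<open>auto simp: A_def\<close>)
  have close: "s * f j w \<le> f j v" if "j \<in> J" "v \<in> unit_I" "w \<in> unit_I" "N v = N w" for j v w
  proof -
    have code: "code j v = code j w" using that(1,4) by (metis N_def restrict_apply')
    show ?thesis
    proof (cases "f j w = 0")
      case True then show ?thesis using f0[OF that(1,2)] by simp
    next
      case False
      then have nz: "f j v > 0" "f j w > 0" using code f0[OF that(1,2)] f0[OF that(1,3)]
        by (auto simp: code_def split: if_splits)
      have fl: "\<lfloor>ln (f j v) / ln (1 / s)\<rfloor> = \<lfloor>ln (f j w) / ln (1 / s)\<rfloor>" using code nz by (simp add: code_def)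
      have l: "ln (1 / s) > 0" using s by (intro ln_gt_zero) simp
      have "ln (f j w) / ln (1 / s) - ln (f j v) / ln (1 / s) \<le> 1" using fl by linarith
      then have "ln (f j w) - ln (f j v) \<le> ln (1 / s)" using l by (simp add: diff_divide_distrib[symmetric] divide_le_eq)
      then have "ln (s * f j w) \<le> ln (f j v)" using s nz by (simp add: ln_mult ln_div)
      then show ?thesis using s nz by (subst (asm) ln_le_cancel_iff) auto
    qed
  qed
  show ?thesis
  proof (rule that[of "rep ` A" "\<lambda>v. rep (N v)"])
    show "countable (rep ` A)" using cA by simp
    show "rep ` A \<subseteq> unit_I" using rep by auto
    \<comment> \<open>The discrete sigma-algebra on the target is the point of the construction: any
      function of the representative is then measurable in the index, even one obtained by arbitrary
      choices.\<close>
    show "(\<lambda>v. rep (N v)) \<in> measurable ?I (count_space (rep ` A))"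
      by (rule measurable_compose[OF Nm]) simp
    fix j v assume jv: "j \<in> J" "v \<in> unit_I"
    then have "N v \<in> A" by (auto simp: A_def)
    from rep[OF this] jv show "s * f j (rep (N v)) \<le> f j v" "s * f j v \<le> f j (rep (N v))"
      by (auto intro!: close)
  qed
qed

section \<open>Quantisation\<close>

text \<open>The nonnegative square of \<open>sqrt e *\<^sub>R x - (1 / sqrt e) *\<^sub>R y\<close>,
  expanded. A small weight keeps the coefficient of the leading term close to 1, which the
  contraction estimate and the limits depend on.\<close>

lemma sq_sum_le_weighted:
  fixes x y :: "'a::real_inner"
  assumes "0 < e"
  shows "(norm (x + y))\<^sup>2 \<le> (1 + e) * (norm x)\<^sup>2 + (1 + 1 / e) * (norm y)\<^sup>2"
proof -
  have "0 \<le> (norm (sqrt e *\<^sub>R x - (1 / sqrt e) *\<^sub>R y))\<^sup>2" by simp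
  also have "\<dots> = e * (norm x)\<^sup>2 - 2 * (x \<bullet> y) + (1 / e) * (norm y)\<^sup>2"
    using assms
    by (simp add: power2_norm_eq_inner inner_diff_left inner_diff_right inner_commute field_simps)
  finally show ?thesis
    by (simp add: power2_norm_eq_inner inner_add_left inner_add_right inner_commute algebra_simps)
qed

lemma norm_sum3_sq_le:
  fixes x y z :: "'a::real_inner"
  assumes "0 < e"
  shows "(norm (x + y + z))\<^sup>2 \<le> (1 + e) * (norm y)\<^sup>2 + (1 + 1 / e) * 2 * ((norm x)\<^sup>2 + (norm z)\<^sup>2)"
proof -
  have "(norm (y + (x + z)))\<^sup>2 \<le> (1 + e) * (norm y)\<^sup>2 + (1 + 1 / e) * (norm (x + z))\<^sup>2"
    by (rule sq_sum_le_weighted[OF assms])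
  moreover have "(1 + 1 / e) * (norm (x + z))\<^sup>2 \<le> (1 + 1 / e) * (2 * ((norm x)\<^sup>2 + (norm z)\<^sup>2))"
    using sq_sum_le_weighted[of 1 x z] assms by (intro mult_left_mono) auto
  moreover have "y + (x + z) = x + y + z" by simp
  ultimately show ?thesis by (simp only: mult.assoc)
qed

lemma M2_D:
  assumes "\<mu> \<in> M2"
  shows "sets \<mu> = sets borel" "space \<mu> = UNIV" "finite_measure \<mu>" "sq_moment \<mu> (\<lambda>x. x) < \<infinity>"
  using assms sets_eq_imp_space_eq[of \<mu> borel] by (auto simp: M2_def)

text \<open>The cost of the coupling that moves each x to \<open>Q x\<close>, hence an upper bound
  for the squared distance from \<mu> to its quantisation when the mass is at most 1.\<close>

definition quant_err :: "('a::euclidean_space \<Rightarrow> 'a) \<Rightarrow> 'a measure \<Rightarrow> ennreal" where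
  "quant_err Q \<mu> = (\<integral>\<^sup>+x. ennreal ((norm (x - Q x))\<^sup>2) \<partial>\<mu>)"

lemma quantisation_error_le:
  fixes Q :: "'a::euclidean_space \<Rightarrow> 'a"
  assumes "norm (Q x) \<le> 2 * norm x"
  shows "ennreal ((norm (x - Q x))\<^sup>2) \<le> 9 * ennreal ((norm x)\<^sup>2)"
proof -
  have "norm (x - Q x) \<le> 3 * norm x" using assms norm_triangle_ineq4[of x "Q x"] by linarith
  then have "(norm (x - Q x))\<^sup>2 \<le> (3 * norm x)\<^sup>2" by (intro power_mono) auto
  then have "ennreal ((norm (x - Q x))\<^sup>2) \<le> ennreal (9 * (norm x)\<^sup>2)"
    by (intro ennreal_leI) (simp add: power_mult_distrib)
  then show ?thesis by (simp add: ennreal_mult)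
qed

text \<open>Dominated convergence along simple functions that tend to the identity: the squared
  error is at most nine times the square of \<open>norm x\<close>, which is integrable for every
  measure in \<open>M2\<close>. One sequence serves all measures, so the level can be chosen for two
  measures at once.\<close>

lemma exists_quantisers:
  obtains Q :: "nat \<Rightarrow> 'a::euclidean_space \<Rightarrow> 'a"
  where "\<And>n. simple_function borel (Q n)" "\<And>n x. norm (Q n x) \<le> 2 * norm x"
    "\<And>\<mu>. \<mu> \<in> M2 \<Longrightarrow> (\<lambda>n. quant_err (Q n) \<mu>) \<longlonglongrightarrow> 0"
proof -
  from borel_measurable_implies_sequence_metric[of "\<lambda>x::'a. x" borel 0]
  obtain Q :: "nat \<Rightarrow> 'a \<Rightarrow> 'a" where Q: "\<And>n. simple_function borel (Q n)"
    "\<And>x. (\<lambda>n. Q n x) \<longlonglongrightarrow> x" "\<And>n x. norm (Q n x) \<le> 2 * norm x" by auto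
  have "(\<lambda>n. quant_err (Q n) \<mu>) \<longlonglongrightarrow> 0" if \<mu>: "\<mu> \<in> M2" for \<mu>
  proof -
    note M = M2_D[OF \<mu>]
    have qm: "Q n \<in> borel_measurable \<mu>" for n
      using borel_measurable_simple_function[OF Q(1)] M(1) measurable_cong_sets by blast
    have im: "(\<lambda>x. x) \<in> borel_measurable \<mu>"
      using M(1) by (simp cong: measurable_cong_sets)
    have "(\<lambda>n. \<integral>\<^sup>+x. ennreal ((norm (x - Q n x))\<^sup>2) \<partial>\<mu>) \<longlonglongrightarrow> (\<integral>\<^sup>+x. 0 \<partial>\<mu>)"
    proof (rule nn_integral_dominated_convergence[where w="\<lambda>x. 9 * ennreal ((norm x)\<^sup>2)"])
      show "(\<lambda>x. ennreal ((norm (x - Q n x))\<^sup>2)) \<in> borel_measurable \<mu>" for n using qm im by measurable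
      show "(\<lambda>x. 9 * ennreal ((norm x)\<^sup>2)) \<in> borel_measurable \<mu>" using im by measurable
      show "(\<integral>\<^sup>+x. 9 * ennreal ((norm x)\<^sup>2) \<partial>\<mu>) < \<infinity>"
        using M(4) im by (subst nn_integral_cmult) (auto simp: sq_moment_def ennreal_mult_less_top)
      show "AE x in \<mu>. ennreal ((norm (x - Q j x))\<^sup>2) \<le> 9 * ennreal ((norm x)\<^sup>2)" for j
        by (intro AE_I2 quantisation_error_le Q(3))
      show "AE x in \<mu>. (\<lambda>i. ennreal ((norm (x - Q i x))\<^sup>2)) \<longlonglongrightarrow> 0"
      proof (rule AE_I2)
        fix x
        have "(\<lambda>i. ennreal ((norm (x - Q i x))\<^sup>2)) \<longlonglongrightarrow> ennreal ((norm (x - x))\<^sup>2)"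
          by (intro tendsto_intros Q(2))
        then show "(\<lambda>i. ennreal ((norm (x - Q i x))\<^sup>2)) \<longlonglongrightarrow> 0" by simp
      qed
    qed simp
    then show ?thesis by (simp add: quant_err_def)
  qed
  then show ?thesis using that Q(1,3) by blast
qed

context
  fixes \<mu> :: "'a::euclidean_space measure" and Q :: "'a \<Rightarrow> 'a"
  assumes \<mu>: "\<mu> \<in> M2" and Q: "simple_function borel Q"
begin

lemma quantiser_measurable: "Q \<in> borel_measurable borel" "Q \<in> borel_measurable \<mu>"
  using borel_measurable_simple_function[OF Q] M2_D(1)[OF \<mu>] measurable_cong_sets by blast+

lemma mass_quantised: "mass (distr \<mu> borel Q) = mass \<mu>"
  using M2_D(2)[OF \<mu>] quantiser_measurable by (simp add: measure_distr)

lemma quantised_in_M2: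
  assumes le: "\<And>x. norm (Q x) \<le> 2 * norm x"
  shows "distr \<mu> borel Q \<in> M2"
proof -
  note M = M2_D[OF \<mu>]
  have im: "(\<lambda>x. x) \<in> borel_measurable \<mu>" using M(1) by (simp cong: measurable_cong_sets)
  have "sq_moment (distr \<mu> borel Q) (\<lambda>x. x) = (\<integral>\<^sup>+x. ennreal ((norm (Q x))\<^sup>2) \<partial>\<mu>)"
    unfolding sq_moment_def using quantiser_measurable by (subst nn_integral_distr) auto
  also have "\<dots> \<le> (\<integral>\<^sup>+x. 4 * ennreal ((norm x)\<^sup>2) \<partial>\<mu>)"
  proof (rule nn_integral_mono)
    fix x
    have "(norm (Q x))\<^sup>2 \<le> (2 * norm x)\<^sup>2" using le by (intro power_mono) auto
    then have "ennreal ((norm (Q x))\<^sup>2) \<le> ennreal (4 * (norm x)\<^sup>2)" by (intro ennreal_leI) (simp add: power_mult_distrib)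
    then show "ennreal ((norm (Q x))\<^sup>2) \<le> 4 * ennreal ((norm x)\<^sup>2)" by (simp add: ennreal_mult)
  qed
  also have "\<dots> < \<infinity>" using M(4) im by (subst nn_integral_cmult) (auto simp: sq_moment_def ennreal_mult_less_top)
  finally show ?thesis unfolding M2_def using finite_measure.finite_measure_distr[OF M(3) quantiser_measurable(2)] by simp
qed

text \<open>The graph of \<open>Q\<close> is a coupling of \<mu> with its image, in either
  order.\<close>

lemma WOP2_quantised_le:
  assumes m1: "mass \<mu> \<le> 1" and c: "0 \<le> c" "quant_err Q \<mu> \<le> ennreal (c\<^sup>2)"
  shows "WOP2 x0 \<mu> (distr \<mu> borel Q) \<le> c" "WOP2 x0 (distr \<mu> borel Q) \<mu> \<le> c"
proof -
  note M = M2_D[OF \<mu>]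
  have im: "(\<lambda>x. x) \<in> borel_measurable \<mu>" using M(1) by (simp cong: measurable_cong_sets)
  have id: "distr \<mu> borel (\<lambda>x. x) = \<mu>" using M(1) by (intro distr_id2) simp
  note [measurable] = im quantiser_measurable(2)
  have "distr \<mu> (borel \<Otimes>\<^sub>M borel) (\<lambda>x. (x, Q x)) \<in> couplings \<mu> (distr \<mu> borel Q)"
    unfolding couplings_def by (simp add: distr_distr o_def id)
  from WOP2_le_coupling[OF this M(3) m1 _ c(1)] show "WOP2 x0 \<mu> (distr \<mu> borel Q) \<le> c"
    using c(2) by (simp add: nn_integral_distr quant_err_def)
  have "distr \<mu> (borel \<Otimes>\<^sub>M borel) (\<lambda>x. (Q x, x)) \<in> couplings (distr \<mu> borel Q) \<mu>"
    unfolding couplings_def by (simp add: distr_distr o_def id)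
  from WOP2_le_coupling[OF this finite_measure.finite_measure_distr[OF M(3) quantiser_measurable(2)] _ _ c(1)] 
  show "WOP2 x0 (distr \<mu> borel Q) \<mu> \<le> c"
    using c(2) m1 mass_quantised by (simp add: nn_integral_distr quant_err_def norm_minus_commute)
qed

end

lemma WOP2_quantised_close:
  fixes \<mu> \<nu> :: "'a::euclidean_space measure" and Q :: "'a \<Rightarrow> 'a"
  assumes \<mu>: "\<mu> \<in> M2" "mass \<mu> \<le> 1" and \<nu>: "\<nu> \<in> M2" "mass \<nu> \<le> 1"
    and Q: "simple_function borel Q" "\<And>x. norm (Q x) \<le> R" and s: "0 < s" "s \<le> 1"
    and close: "\<And>k. k \<in> range Q \<Longrightarrow> s * measure \<nu> (Q -` {k}) \<le> measure \<mu> (Q -` {k})"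
      "\<And>k. k \<in> range Q \<Longrightarrow> s * measure \<mu> (Q -` {k}) \<le> measure \<nu> (Q -` {k})"
  shows "WOP2 x0 (distr \<mu> borel Q) (distr \<nu> borel Q) \<le> sqrt ((1 + 9 * (R + norm x0)\<^sup>2) * (1 - s))"
proof (rule WOP2_le_finite_support[where S="range Q"])
  note q = quantiser_measurable(2)[OF \<mu>(1) Q(1)] quantiser_measurable(2)[OF \<nu>(1) Q(1)]
  note sp = M2_D(2)[OF \<mu>(1)] M2_D(2)[OF \<nu>(1)]
  show "finite_measure (distr \<mu> borel Q)" "finite_measure (distr \<nu> borel Q)"
    by (intro finite_measure.finite_measure_distr M2_D(3) \<mu> \<nu> q)+
  show "mass (distr \<mu> borel Q) \<le> 1" "mass (distr \<nu> borel Q) \<le> 1"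
    unfolding mass_quantised[OF \<mu>(1) Q(1)] mass_quantised[OF \<nu>(1) Q(1)] by fact+
  show fin: "finite (range Q)" using simple_functionD(1)[OF Q(1)] by simp
  have "closed (range Q)" using fin by (rule finite_imp_closed)
  then have "- range Q \<in> sets borel" by auto
  moreover have "Q -` (- range Q) = {}" by auto
  ultimately show "emeasure (distr \<mu> borel Q) (- range Q) = 0" "emeasure (distr \<nu> borel Q) (- range Q) = 0"
    using q by (auto simp: emeasure_distr)
  show "s * measure (distr \<nu> borel Q) {x} \<le> measure (distr \<mu> borel Q) {x}"
      "s * measure (distr \<mu> borel Q) {x} \<le> measure (distr \<nu> borel Q) {x}" if "x \<in> range Q" for x
    using close[OF that] q sp by (auto simp: measure_distr)
qed (use s Q(2) in auto)

section \<open>Lipschitz functionals of the graphon operator\<close>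

lemma graphon_measurable_pair:
  assumes "graphon G"
  shows "(\<lambda>z. indicator (unit_I \<times> unit_I) z *\<^sub>R G (fst z) (snd z)) \<in> borel_measurable (borel \<Otimes>\<^sub>M borel)"
proof -
  have "(\<lambda>z. G (fst z) (snd z)) \<in> borel_measurable (restrict_space borel (unit_I \<times> unit_I))"
    using assms by (simp add: graphon_def case_prod_beta')
  then have "(\<lambda>z. indicator (unit_I \<times> unit_I) z *\<^sub>R G (fst z) (snd z)) \<in> borel_measurable borel"
    by (subst (asm) borel_measurable_restrict_space_iff) (auto intro: borel_closed closed_Times)
  then show ?thesis by (simp add: borel_prod)
qed

text \<open>Tonelli's theorem, after graphon and kernel are extended by zero off the unit interval
  so that the integrand is jointly measurable on the plane.\<close>

lemma measurable_nn_integral_graphon_op: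
  fixes \<mu> :: "real \<Rightarrow> 'a::euclidean_space measure"
  assumes G: "graphon G" and k: "kernel_on_I \<mu>" and f: "f \<in> borel_measurable borel"
  shows "(\<lambda>u. \<integral>\<^sup>+x. f x \<partial>graphon_op G \<mu> u) \<in> borel_measurable (restrict_space borel unit_I)"
proof -
  define h where "h v = (\<integral>\<^sup>+x. f x \<partial>\<mu> v)" for v
  have "h \<in> borel_measurable (restrict_space borel unit_I)" unfolding h_def
    by (rule measurable_compose[OF measurable_prob_algebraD[OF k] nn_integral_measurable_subprob_algebra[OF f]])
  then have hm: "(\<lambda>v. h v * indicator unit_I v) \<in> borel_measurable borel"
    by (subst (asm) borel_measurable_restrict_space_iff_ennreal) auto
  have "(\<lambda>z. ennreal (indicator (unit_I \<times> unit_I) z *\<^sub>R G (fst z) (snd z)) * (h (snd z) * indicator unit_I (snd z))) \<in> borel_measurable (borel \<Otimes>\<^sub>M borel)"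
    by (rule borel_measurable_times_ennreal[OF measurable_compose[OF graphon_measurable_pair[OF G] measurable_ennreal]
          measurable_compose[OF measurable_snd hm]])
  also have "borel_measurable (borel \<Otimes>\<^sub>M borel) = borel_measurable (borel \<Otimes>\<^sub>M lborel)"
    by (intro measurable_cong_sets sets_pair_measure_cong) auto
  finally have "(\<lambda>u. \<integral>\<^sup>+v. ennreal (indicator (unit_I \<times> unit_I) (u, v) *\<^sub>R G u v) * (h v * indicator unit_I v) \<partial>lborel) \<in> borel_measurable borel"
    by (intro lborel.borel_measurable_nn_integral) (simp add: case_prod_beta')
  then have "(\<lambda>u. \<integral>\<^sup>+v. ennreal (indicator (unit_I \<times> unit_I) (u, v) *\<^sub>R G u v) * (h v * indicator unit_I v) \<partial>lborel) \<in> borel_measurable (restrict_space borel unit_I)"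
    by (rule measurable_restrict_space1)
  then show ?thesis
    apply (rule measurable_cong[THEN iffD1, rotated])
    subgoal for u
      apply (subst nn_integral_graphon_op[OF G _ k f])
       apply (simp add: space_restrict_space)
      apply (subst nn_integral_restrict_space)
       apply simp
      apply (intro nn_integral_cong)
      apply (auto simp: h_def indicator_def space_restrict_space)
      done
    done
qed

lemma measurable_measure_graphon_op:
  fixes \<mu> :: "real \<Rightarrow> 'a::euclidean_space measure"
  assumes G: "graphon G" and k: "kernel_on_I \<mu>" and A: "A \<in> sets borel"
  shows "(\<lambda>u. measure (graphon_op G \<mu> u) A) \<in> borel_measurable (restrict_space borel unit_I)"
proof -
  have "(\<lambda>u. enn2real (\<integral>\<^sup>+x. indicator A x \<partial>graphon_op G \<mu> u)) \<in> borel_measurable (restrict_space borel unit_I)"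
    using measurable_nn_integral_graphon_op[OF G k, of "indicator A"] A by measurable
  then show ?thesis
    by (rule measurable_cong[THEN iffD1, rotated])
       (use A sets_graphon_op[OF G _ k] in \<open>auto simp: space_restrict_space measure_def\<close>)
qed

lemma quant_err_le:
  fixes Q :: "'a::euclidean_space \<Rightarrow> 'a"
  assumes "sets \<mu> = sets borel" "Q \<in> borel_measurable borel" "\<And>x. norm (Q x) \<le> 2 * norm x"
    "sq_moment \<mu> (\<lambda>x. x) \<le> ennreal C" "0 \<le> C"
  shows "quant_err Q \<mu> \<le> ennreal (9 * C)"
proof -
  have im: "(\<lambda>x. x) \<in> borel_measurable \<mu>" using assms(1) by (simp cong: measurable_cong_sets)
  have "quant_err Q \<mu> \<le> (\<integral>\<^sup>+x. 9 * ennreal ((norm x)\<^sup>2) \<partial>\<mu>)"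
    unfolding quant_err_def
    by (intro nn_integral_mono quantisation_error_le assms)
  also have "\<dots> = 9 * sq_moment \<mu> (\<lambda>x. x)" using im unfolding sq_moment_def by (subst nn_integral_cmult) auto
  also have "\<dots> \<le> 9 * ennreal C" by (intro mult_left_mono assms) auto
  also have "\<dots> = ennreal (9 * C)" using assms(5) by (simp add: ennreal_mult)
  finally show ?thesis .
qed

text \<open>The lower bound 1/4 serves another purpose than the smallness condition: it keeps the
  quantisation errors at an index and at its representative within a factor 4 of each other.\<close>

lemma exists_close_ratio:
  fixes K \<eta> :: real assumes "0 \<le> K" "0 < \<eta>"
  obtains s :: real where "1/4 \<le> s" "s < 1" "sqrt (K * (1 - s)) \<le> \<eta>"
proof -
  define e where "e = min (3/4) (\<eta>\<^sup>2 / (K + 1))"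
  have e: "0 < e" using assms by (auto simp: e_def)
  have e2: "e \<le> 3/4" unfolding e_def by (rule min.cobounded1)
  have "K * e \<le> (K + 1) * e" using e by simp
  also have "\<dots> \<le> (K + 1) * (\<eta>\<^sup>2 / (K + 1))" using assms by (intro mult_left_mono) (auto simp: e_def)
  also have "\<dots> = \<eta>\<^sup>2" using assms by simp
  finally have "sqrt (K * e) \<le> \<eta>" using assms by (intro real_le_lsqrt) auto
  then show ?thesis using e e2 by (intro that[of "1 - e"]) auto
qed

lemma simple_function_norm_bound:
  assumes "simple_function borel (Q :: 'a::euclidean_space \<Rightarrow> 'a)"
  obtains R where "\<And>x. norm (Q x) \<le> R"
proof -
  have "finite (norm ` range Q)" using simple_functionD(1)[OF assms] by simp
  then have "norm (Q x) \<le> Max (norm ` range Q)" for x by (intro Max_ge) auto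
  then show ?thesis by (rule that)
qed

lemma graphon_op_cong:
  assumes "\<And>v. v \<in> unit_I \<Longrightarrow> \<mu> v = \<nu> v"
  shows "graphon_op G \<mu> u = graphon_op G \<nu> u"
  unfolding graphon_op_def
  by (intro arg_cong[where f="measure_of UNIV (sets borel)"] ext nn_integral_cong)
     (auto simp: assms indicator_def)

lemma simple_vimage_borel:
  assumes "simple_function borel (Q :: 'a::euclidean_space \<Rightarrow> 'a)" shows "Q -` {k} \<in> sets borel"
  using simple_functionD(2)[OF assms, of "{k}"] by simp

text \<open>A Lipschitz bound for the distance carries no measurability in the index, so
  \<open>f\<close> is evaluated along a measurable reindexing \<open>r\<close> with countably many
  values. Going from u to \<open>r u\<close> through the quantised measures costs
  \<open>sqrt (D n u)\<close> at u, at most \<open>1 / real (Suc n)\<close> between quantised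
  measures with close cell masses, and at most \<open>2 * sqrt (D n u)\<close> at the
  representative; hence the 3. As n grows, the functional becomes a pointwise limit of measurable
  functions.\<close>

lemma borel_measurable_lipschitz_graphon_op:
  fixes f :: "'a::euclidean_space measure \<Rightarrow> real"
  assumes G: "graphon G" and k: "kernel_on_I \<mu>" and C: "0 \<le> C" "\<And>v. v \<in> unit_I \<Longrightarrow> sq_moment (\<mu> v) (\<lambda>x. x) \<le> ennreal C"
    and lip: "\<And>\<mu> \<nu>. \<mu> \<in> M2 \<Longrightarrow> \<nu> \<in> M2 \<Longrightarrow> \<bar>f \<mu> - f \<nu>\<bar> \<le> L * WOP2 x0 \<mu> \<nu>" and L: "0 \<le> L"
  shows "(\<lambda>u. f (graphon_op G \<mu> u)) \<in> borel_measurable (restrict_space borel unit_I)"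
proof -
  obtain Q :: "nat \<Rightarrow> 'a \<Rightarrow> 'a" where Q: "\<And>n. simple_function borel (Q n)" "\<And>n x. norm (Q n x) \<le> 2 * norm x"
    "\<And>\<mu>. \<mu> \<in> M2 \<Longrightarrow> (\<lambda>n. quant_err (Q n) \<mu>) \<longlonglongrightarrow> 0" using exists_quantisers by metis
  let ?m = "graphon_op G \<mu>"
  have M: "?m u \<in> M2" "sq_moment (?m u) (\<lambda>x. x) \<le> ennreal C" "mass (?m u) \<le> 1" if "u \<in> unit_I" for u
    using graphon_op_in_M2[OF G that k C(2)] mass_graphon_op[OF G that k] by auto
  define D where "D n u = enn2real (quant_err (Q n) (?m u))" for n u
  have D: "ennreal (D n u) = quant_err (Q n) (?m u)" "0 \<le> D n u" if "u \<in> unit_I" for n u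
  proof -
    have "quant_err (Q n) (?m u) \<le> ennreal (9 * C)"
      by (intro quant_err_le M(2)[OF that] C(1) Q(2) borel_measurable_simple_function Q(1)
          sets_graphon_op[OF G that k])
    then show "ennreal (D n u) = quant_err (Q n) (?m u)" unfolding D_def
      by (intro ennreal_enn2real) (auto simp: top_unique less_top[symmetric] intro: le_less_trans)
    show "0 \<le> D n u" by (simp add: D_def)
  qed
  have "\<exists>g. g \<in> borel_measurable (restrict_space borel unit_I) \<and>
      (\<forall>u\<in>unit_I. \<bar>f (?m u) - g u\<bar> \<le> L * (3 * sqrt (D n u) + 1 / real (Suc n)))" for n
  proof -
    obtain R where R: "\<And>x. norm (Q n x) \<le> R" using simple_function_norm_bound[OF Q(1)] by metis
    obtain s where s: "1/4 \<le> s" "s < 1" "sqrt ((1 + 9 * (R + norm x0)\<^sup>2) * (1 - s)) \<le> 1 / real (Suc n)"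
      using exists_close_ratio[of "1 + 9 * (R + norm x0)\<^sup>2" "1 / real (Suc n)"] by auto
    \<comment> \<open>\<open>None\<close> stands for the quantisation error and
      \<open>Some x\<close> for the mass of the cell over x; a representative matches its index in
      all of these finitely many quantities.\<close>
    let ?J = "insert None (Some ` range (Q n))"
    define F where "F j u = (case j of None \<Rightarrow> D n u | Some x \<Rightarrow> measure (?m u) (Q n -` {x}))" for j u
    have F1: "F j \<in> borel_measurable (restrict_space borel unit_I)" if "j \<in> ?J" for j
    proof (cases j)
      case None
      have "(\<lambda>u. quant_err (Q n) (?m u)) \<in> borel_measurable (restrict_space borel unit_I)"
        unfolding quant_err_def
        by (rule measurable_nn_integral_graphon_op[OF G k]) (use borel_measurable_simple_function[OF Q(1)] in measurable)
      then have "D n \<in> borel_measurable (restrict_space borel unit_I)" unfolding D_def by measurable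
      then show ?thesis using None by (simp add: F_def[abs_def])
    next
      case (Some x)
      then show ?thesis using measurable_measure_graphon_op[OF G k simple_vimage_borel[OF Q(1)]]
        by (simp add: F_def[abs_def])
    qed
    have F0: "0 \<le> F j v" if "v \<in> unit_I" for j v using D(2)[OF that] by (cases j) (auto simp: F_def)
    have finJ: "finite ?J" using simple_functionD(1)[OF Q(1), of n] by simp
    obtain r Cr where r: "countable Cr" "Cr \<subseteq> unit_I" "r \<in> measurable (restrict_space borel unit_I) (count_space Cr)"
      "\<And>j v. j \<in> ?J \<Longrightarrow> v \<in> unit_I \<Longrightarrow> s * F j (r v) \<le> F j v"
      "\<And>j v. j \<in> ?J \<Longrightarrow> v \<in> unit_I \<Longrightarrow> s * F j v \<le> F j (r v)"
      by (rule exists_countable_representatives[of ?J F s]) (use finJ F1 F0 s in auto)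
    have rI: "r u \<in> unit_I" if "u \<in> unit_I" for u
      using measurable_space[OF r(3), of u] that r(2) by (auto simp: space_restrict_space)
    show ?thesis
    proof (intro exI conjI ballI)
      show "(\<lambda>u. f (?m (r u))) \<in> borel_measurable (restrict_space borel unit_I)"
        by (rule measurable_compose[OF r(3)]) simp
      fix u assume u: "u \<in> unit_I"
      let ?q = "\<lambda>u. distr (?m u) borel (Q n)"
      have qM: "?q u \<in> M2" if "u \<in> unit_I" for u using quantised_in_M2[OF M(1)[OF that] Q(1)] Q(2) by auto
      have "\<bar>f (?m u) - f (?q u)\<bar> \<le> L * sqrt (D n u)"
      proof -
        have "WOP2 x0 (?m u) (?q u) \<le> sqrt (D n u)"
          using D[OF u] by (intro WOP2_quantised_le M u Q) auto
        then show ?thesis using lip[OF M(1)[OF u] qM[OF u]] L by (meson mult_left_mono order_trans)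
      qed
      moreover have "\<bar>f (?q u) - f (?q (r u))\<bar> \<le> L * (1 / real (Suc n))"
      proof -
        have "WOP2 x0 (?q u) (?q (r u)) \<le> sqrt ((1 + 9 * (R + norm x0)\<^sup>2) * (1 - s))"
        proof (rule WOP2_quantised_close[OF M(1)[OF u] M(3)[OF u] M(1)[OF rI[OF u]] M(3)[OF rI[OF u]] Q(1) R])
          show "0 < s" "s \<le> 1" using s by auto
          fix x assume "x \<in> range (Q n)"
          then have x: "Some x \<in> ?J" by simp
          show "s * measure (?m (r u)) (Q n -` {x}) \<le> measure (?m u) (Q n -` {x})"
            "s * measure (?m u) (Q n -` {x}) \<le> measure (?m (r u)) (Q n -` {x})"
            using r(4)[OF x u] r(5)[OF x u] by (simp_all add: F_def)
        qed
        then have "WOP2 x0 (?q u) (?q (r u)) \<le> 1 / real (Suc n)" using s(3) by linarith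
        then show ?thesis using lip[OF qM[OF u] qM[OF rI[OF u]]] L by (meson mult_left_mono order_trans)
      qed
      moreover have "\<bar>f (?q (r u)) - f (?m (r u))\<bar> \<le> L * (2 * sqrt (D n u))"
      proof -
        have "WOP2 x0 (?q (r u)) (?m (r u)) \<le> sqrt (D n (r u))"
          using D[OF rI[OF u]] by (intro WOP2_quantised_le M u rI Q) auto
        also have "\<dots> \<le> sqrt (4 * D n u)"
        proof (rule real_sqrt_le_mono)
          have "s * D n (r u) \<le> D n u" using r(4)[of None u] u by (simp add: F_def)
          moreover have "1/4 * D n (r u) \<le> s * D n (r u)" using s D(2)[OF rI[OF u]] by (intro mult_right_mono) auto
          ultimately show "D n (r u) \<le> 4 * D n u" by linarith
        qed
        also have "\<dots> = 2 * sqrt (D n u)" by (simp add: real_sqrt_mult)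
        finally show ?thesis using lip[OF qM[OF rI[OF u]] M(1)[OF rI[OF u]]] L by (meson mult_left_mono order_trans)
      qed
      ultimately show "\<bar>f (?m u) - f (?m (r u))\<bar> \<le> L * (3 * sqrt (D n u) + 1 / real (Suc n))"
        by (simp add: algebra_simps)
    qed
  qed
  then obtain g where g: "\<And>n. g n \<in> borel_measurable (restrict_space borel unit_I)"
    "\<And>n u. u \<in> unit_I \<Longrightarrow> \<bar>f (?m u) - g n u\<bar> \<le> L * (3 * sqrt (D n u) + 1 / real (Suc n))" by metis
  show ?thesis
  proof (rule borel_measurable_LIMSEQ_real[OF _ g(1)])
    fix u assume "u \<in> space (restrict_space borel unit_I)"
    then have u: "u \<in> unit_I" by (simp add: space_restrict_space)
    have "(\<lambda>n. enn2real (quant_err (Q n) (?m u))) \<longlonglongrightarrow> 0"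
      by (rule tendsto_enn2real) (use Q(3)[OF M(1)[OF u]] in auto)
    then have "(\<lambda>n. D n u) \<longlonglongrightarrow> 0" by (simp add: D_def)
    then have "(\<lambda>n. L * (3 * sqrt (D n u) + 1 / real (Suc n))) \<longlonglongrightarrow> L * (3 * sqrt 0 + 0)"
      by (intro tendsto_intros LIMSEQ_Suc[OF lim_1_over_n])
    then have lim0: "(\<lambda>n. L * (3 * sqrt (D n u) + 1 / real (Suc n))) \<longlonglongrightarrow> 0" by simp
    have "(\<lambda>n. f (?m u) - g n u) \<longlonglongrightarrow> 0"
      by (rule Lim_null_comparison[OF always_eventually lim0]) (use g(2)[OF u] in simp)
    then have "(\<lambda>n. f (?m u) - (f (?m u) - g n u)) \<longlonglongrightarrow> f (?m u) - 0" by (intro tendsto_intros)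
    then show "(\<lambda>n. g n u) \<longlonglongrightarrow> f (?m u)" by simp
  qed
qed

section \<open>Lipschitz bounds from couplings without measurability in the index\<close>

lemma graphon_op_measure_close:
  fixes \<mu> \<nu> :: "real \<Rightarrow> 'a::euclidean_space measure"
  assumes G: "graphon G" and u: "u \<in> unit_I" and k: "kernel_on_I \<mu>" "kernel_on_I \<nu>" and A: "A \<in> sets borel"
    and s: "0 \<le> s" and le: "\<And>v. v \<in> unit_I \<Longrightarrow> s * measure (\<mu> v) A \<le> measure (\<nu> v) A"
  shows "s * measure (graphon_op G \<mu> u) A \<le> measure (graphon_op G \<nu> u) A"
proof -
  interpret m: finite_measure "graphon_op G \<mu> u" by (rule finite_measure_graphon_op[OF G u k(1)])
  interpret n: finite_measure "graphon_op G \<nu> u" by (rule finite_measure_graphon_op[OF G u k(2)])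
  have am: "(\<lambda>v. ennreal (G u v) * emeasure (\<mu> v) A) \<in> borel_measurable (restrict_space lborel unit_I)"
    using graphon_section_measurable[OF G u] k(1) A unfolding kernel_on_I_iff
    by (intro borel_measurable_times_ennreal) (auto simp: restrict_space_lborel_measurable)
  have "ennreal s * emeasure (graphon_op G \<mu> u) A = (\<integral>\<^sup>+v. ennreal s * (ennreal (G u v) * emeasure (\<mu> v) A) \<partial>restrict_space lborel unit_I)"
    unfolding emeasure_graphon_op[OF G u k(1) A] using am by (simp add: nn_integral_cmult)
  also have "\<dots> \<le> (\<integral>\<^sup>+v. ennreal (G u v) * emeasure (\<nu> v) A \<partial>restrict_space lborel unit_I)"
  proof (rule nn_integral_mono)
    fix v assume "v \<in> space (restrict_space lborel unit_I)"
    then have v: "v \<in> unit_I" by (simp add: space_restrict_space)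
    interpret mv: prob_space "\<mu> v" by (rule kernel_on_I_D[OF k(1) v])
    interpret nv: prob_space "\<nu> v" by (rule kernel_on_I_D[OF k(2) v])
    have "ennreal s * emeasure (\<mu> v) A \<le> emeasure (\<nu> v) A"
      using le[OF v] s by (simp add: mv.emeasure_eq_measure nv.emeasure_eq_measure ennreal_mult[symmetric] ennreal_leI)
    then show "ennreal s * (ennreal (G u v) * emeasure (\<mu> v) A) \<le> ennreal (G u v) * emeasure (\<nu> v) A"
      by (metis mult.left_commute mult_left_mono zero_le)
  qed
  also have "\<dots> = emeasure (graphon_op G \<nu> u) A" unfolding emeasure_graphon_op[OF G u k(2) A] ..
  finally show ?thesis
    using s by (simp add: m.emeasure_eq_measure n.emeasure_eq_measure ennreal_mult[symmetric])
qed

text \<open>All preimages under \<open>r\<close> of sets of representatives are measurable, so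
  \<open>\<kappa>\<close> may be chosen arbitrarily at each representative.\<close>

lemma kernel_on_I_reindex:
  assumes r: "r \<in> measurable (restrict_space borel unit_I) (count_space C)" "C \<subseteq> unit_I"
    and p: "\<And>w. w \<in> unit_I \<Longrightarrow> prob_space (\<kappa> w)" "\<And>w. w \<in> unit_I \<Longrightarrow> sets (\<kappa> w) = sets borel"
  shows "kernel_on_I (\<lambda>v. \<kappa> (r v))"
proof -
  have "r v \<in> unit_I" if "v \<in> unit_I" for v
    using measurable_space[OF r(1), of v] that r(2) by (auto simp: space_restrict_space)
  moreover have "(\<lambda>v. emeasure (\<kappa> (r v)) A) \<in> borel_measurable (restrict_space borel unit_I)" for A
    by (rule measurable_compose[OF r(1)]) simp
  ultimately show ?thesis using p unfolding kernel_on_I_iff by auto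
qed

lemma graphon_op_quant_err_le:
  fixes \<mu> \<nu> :: "real \<Rightarrow> 'a::euclidean_space measure"
  assumes G: "graphon G" and u: "u \<in> unit_I" and k: "kernel_on_I \<mu>" "kernel_on_I \<nu>"
    and Q: "Q \<in> borel_measurable borel"
    and le: "\<And>v. v \<in> unit_I \<Longrightarrow> quant_err Q (\<mu> v) \<le> 4 * quant_err Q (\<nu> v)"
  shows "quant_err Q (graphon_op G \<mu> u) \<le> 4 * quant_err Q (graphon_op G \<nu> u)"
proof -
  have m: "(\<lambda>x. ennreal ((norm (x - Q x))\<^sup>2)) \<in> borel_measurable borel" using Q by measurable
  have am: "(\<lambda>v. ennreal (G u v) * quant_err Q (\<nu> v)) \<in> borel_measurable (restrict_space lborel unit_I)"
    unfolding quant_err_def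
    using graphon_section_measurable[OF G u] measurable_compose[OF measurable_prob_algebraD[OF k(2)] nn_integral_measurable_subprob_algebra[OF m]]
    by (intro borel_measurable_times_ennreal) (auto simp: restrict_space_lborel_measurable)
  have "quant_err Q (graphon_op G \<mu> u) = (\<integral>\<^sup>+v. ennreal (G u v) * quant_err Q (\<mu> v) \<partial>restrict_space lborel unit_I)"
    unfolding quant_err_def by (rule nn_integral_graphon_op[OF G u k(1) m])
  also have "\<dots> \<le> (\<integral>\<^sup>+v. 4 * (ennreal (G u v) * quant_err Q (\<nu> v)) \<partial>restrict_space lborel unit_I)"
  proof (rule nn_integral_mono)
    fix v assume "v \<in> space (restrict_space lborel unit_I)"
    then have v: "v \<in> unit_I" by (simp add: space_restrict_space)
    show "ennreal (G u v) * quant_err Q (\<mu> v) \<le> 4 * (ennreal (G u v) * quant_err Q (\<nu> v))"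
      using mult_left_mono[OF le[OF v], of "ennreal (G u v)"] by (simp add: mult_ac)
  qed
  also have "\<dots> = 4 * (\<integral>\<^sup>+v. ennreal (G u v) * quant_err Q (\<nu> v) \<partial>restrict_space lborel unit_I)"
    using am by (simp add: nn_integral_cmult)
  also have "(\<integral>\<^sup>+v. ennreal (G u v) * quant_err Q (\<nu> v) \<partial>restrict_space lborel unit_I) = quant_err Q (graphon_op G \<nu> u)"
    unfolding quant_err_def by (rule nn_integral_graphon_op[OF G u k(2) m, symmetric])
  finally show ?thesis .
qed

text \<open>The difference of the two images is the original difference plus two quantisation
  errors. The original cost keeps the weight 1 + e; the errors, each at most \<open>d\<close> and
  each with a factor 2, make the 4.\<close>

lemma quantised_coupling_cost:
  fixes \<pi> :: "('a::euclidean_space \<times> 'a) measure"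
  assumes \<pi>: "\<pi> \<in> couplings \<mu> \<nu>" and Q: "Q \<in> borel_measurable borel"
    and cost: "(\<integral>\<^sup>+z. ennreal ((norm (fst z - snd z))\<^sup>2) \<partial>\<pi>) \<le> ennreal (c\<^sup>2)"
    and err: "quant_err Q \<mu> \<le> ennreal d" "quant_err Q \<nu> \<le> ennreal d" and d: "0 \<le> d" and e: "0 < e"
  shows "(\<integral>\<^sup>+z. ennreal ((norm (Q (fst z) - Q (snd z)))\<^sup>2) \<partial>\<pi>) \<le> ennreal ((1 + e) * c\<^sup>2 + (1 + 1 / e) * 4 * d)"
proof -
  note [measurable] = couplings_measurable(1,2)[OF \<pi>] Q
  have dist: "distr \<pi> borel fst = \<mu>" "distr \<pi> borel snd = \<nu>" using \<pi> by (auto simp: couplings_def)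
  have qe: "(\<integral>\<^sup>+z. ennreal ((norm (fst z - Q (fst z)))\<^sup>2) \<partial>\<pi>) = quant_err Q \<mu>"
    "(\<integral>\<^sup>+z. ennreal ((norm (snd z - Q (snd z)))\<^sup>2) \<partial>\<pi>) = quant_err Q \<nu>"
    unfolding quant_err_def dist[symmetric] by (subst nn_integral_distr; measurable)+
  have pw: "ennreal ((norm (Q (fst z) - Q (snd z)))\<^sup>2) \<le> ennreal (1 + e) * ennreal ((norm (fst z - snd z))\<^sup>2)
    + ennreal ((1 + 1 / e) * 2) * (ennreal ((norm (fst z - Q (fst z)))\<^sup>2) + ennreal ((norm (snd z - Q (snd z)))\<^sup>2))" for z :: "'a \<times> 'a"
  proof -
    have "(norm ((Q (fst z) - fst z) + (fst z - snd z) + (snd z - Q (snd z))))\<^sup>2 \<le> (1 + e) * (norm (fst z - snd z))\<^sup>2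
      + (1 + 1 / e) * 2 * ((norm (Q (fst z) - fst z))\<^sup>2 + (norm (snd z - Q (snd z)))\<^sup>2)"
      by (rule norm_sum3_sq_le[OF e])
    then have "(norm (Q (fst z) - Q (snd z)))\<^sup>2 \<le> (1 + e) * (norm (fst z - snd z))\<^sup>2
      + (1 + 1 / e) * 2 * ((norm (fst z - Q (fst z)))\<^sup>2 + (norm (snd z - Q (snd z)))\<^sup>2)"
      by (simp add: norm_minus_commute)
    from ennreal_leI[OF this] show ?thesis using e by (simp add: ennreal_plus ennreal_mult del: ennreal_numeral)
  qed
  have "(\<integral>\<^sup>+z. ennreal ((norm (Q (fst z) - Q (snd z)))\<^sup>2) \<partial>\<pi>) \<le> (\<integral>\<^sup>+z. ennreal (1 + e) * ennreal ((norm (fst z - snd z))\<^sup>2)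
    + ennreal ((1 + 1 / e) * 2) * (ennreal ((norm (fst z - Q (fst z)))\<^sup>2) + ennreal ((norm (snd z - Q (snd z)))\<^sup>2)) \<partial>\<pi>)"
    by (intro nn_integral_mono pw)
  also have "\<dots> = ennreal (1 + e) * (\<integral>\<^sup>+z. ennreal ((norm (fst z - snd z))\<^sup>2) \<partial>\<pi>) + ennreal ((1 + 1 / e) * 2) * (quant_err Q \<mu> + quant_err Q \<nu>)"
    by (simp add: nn_integral_add nn_integral_cmult qe)
  also have "\<dots> \<le> ennreal (1 + e) * ennreal (c\<^sup>2) + ennreal ((1 + 1 / e) * 2) * (ennreal d + ennreal d)"
    by (intro add_mono mult_left_mono cost err) auto
  also have "\<dots> = ennreal ((1 + e) * c\<^sup>2 + (1 + 1 / e) * 4 * d)"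
    using e d by (simp add: ennreal_plus[symmetric] ennreal_mult[symmetric] del: ennreal_plus)
  finally show ?thesis .
qed

text \<open>The couplings in the hypothesis need not depend measurably on the index.  Both families
  are replaced by quantisations at countably many representative indices, where they do.\<close>

lemma graphon_op_lipschitz_of_couplings:
  fixes \<mu> \<nu> :: "real \<Rightarrow> 'a::euclidean_space measure" and d :: "'a measure \<Rightarrow> 'a measure \<Rightarrow> real"
  assumes G: "graphon G" and u: "u \<in> unit_I" and k: "kernel_on_I \<mu>" "kernel_on_I \<nu>"
    and C: "0 \<le> C" "\<And>v. v \<in> unit_I \<Longrightarrow> sq_moment (\<mu> v) (\<lambda>x. x) \<le> ennreal C" "\<And>v. v \<in> unit_I \<Longrightarrow> sq_moment (\<nu> v) (\<lambda>x. x) \<le> ennreal C"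
    and c: "0 \<le> c" and cp: "\<And>v. v \<in> unit_I \<Longrightarrow> \<exists>\<pi>\<in>couplings (\<mu> v) (\<nu> v). (\<integral>\<^sup>+z. ennreal ((norm (fst z - snd z))\<^sup>2) \<partial>\<pi>) \<le> ennreal (c\<^sup>2)"
    and tri: "\<And>\<mu>1 \<mu>2 \<mu>3. \<mu>1 \<in> M2 \<Longrightarrow> \<mu>2 \<in> M2 \<Longrightarrow> \<mu>3 \<in> M2 \<Longrightarrow> d \<mu>1 \<mu>3 \<le> d \<mu>1 \<mu>2 + d \<mu>2 \<mu>3"
    and lip: "\<And>\<mu>1 \<mu>2. \<mu>1 \<in> M2 \<Longrightarrow> \<mu>2 \<in> M2 \<Longrightarrow> d \<mu>1 \<mu>2 \<le> L * WOP2 x0 \<mu>1 \<mu>2" and L: "0 \<le> L"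
  shows "d (graphon_op G \<mu> u) (graphon_op G \<nu> u) \<le> L * c"
proof -
  let ?P = "graphon_op G \<mu> u" and ?N = "graphon_op G \<nu> u"
  note PM = graphon_op_in_M2[OF G u k(1) C(2)] mass_graphon_op[OF G u k(1)]
  note NM = graphon_op_in_M2[OF G u k(2) C(3)] mass_graphon_op[OF G u k(2)]
  \<comment> \<open>Five moves lead from one measure to the other: quantise, pass to
    representatives, use the couplings, pass back, undo the quantisation. Each move except the
    middle one costs \<open>L * \<eta>\<close>, so the six multiples of \<eta> in the bound leave
    slack. The triangle inequality is that of \<open>d\<close>.\<close>
  have main: "d ?P ?N \<le> L * (5 * \<eta> + sqrt ((1 + \<eta>) * c\<^sup>2 + (1 + 1 / \<eta>) * 4 * (4 * \<eta>\<^sup>2))) + L * \<eta>" if \<eta>: "0 < \<eta>" for \<eta>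
  proof -
    obtain Q where Q: "simple_function borel Q" "\<And>x::'a. norm (Q x) \<le> 2 * norm x"
      and qe: "quant_err Q ?P \<le> ennreal (\<eta>\<^sup>2)" "quant_err Q ?N \<le> ennreal (\<eta>\<^sup>2)"
    proof -
      obtain Q :: "nat \<Rightarrow> 'a \<Rightarrow> 'a" where Q: "\<And>n. simple_function borel (Q n)" "\<And>n x. norm (Q n x) \<le> 2 * norm x"
        "\<And>\<mu>. \<mu> \<in> M2 \<Longrightarrow> (\<lambda>n. quant_err (Q n) \<mu>) \<longlonglongrightarrow> 0" using exists_quantisers by metis
      have pos: "0 < ennreal (\<eta>\<^sup>2)" using \<eta> by simp
      have "eventually (\<lambda>n. quant_err (Q n) ?P < ennreal (\<eta>\<^sup>2) \<and> quant_err (Q n) ?N < ennreal (\<eta>\<^sup>2)) sequentially"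
        by (intro eventually_conj order_tendstoD(2)[OF Q(3)[OF PM(1)] pos] order_tendstoD(2)[OF Q(3)[OF NM(1)] pos])
      then obtain n where "quant_err (Q n) ?P < ennreal (\<eta>\<^sup>2)" "quant_err (Q n) ?N < ennreal (\<eta>\<^sup>2)"
        unfolding eventually_sequentially by blast
      then show ?thesis using that[of "Q n"] Q(1,2) by auto
    qed
    have Qm: "Q \<in> borel_measurable borel" by (rule borel_measurable_simple_function[OF Q(1)])
    obtain R where R: "\<And>x. norm (Q x) \<le> R" using simple_function_norm_bound[OF Q(1)] by metis
    obtain s where s: "1/4 \<le> s" "s < 1" "sqrt ((1 + 9 * (R + norm x0)\<^sup>2) * (1 - s)) \<le> \<eta>"
      using exists_close_ratio[of "1 + 9 * (R + norm x0)\<^sup>2" \<eta>] \<eta> by auto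
    \<comment> \<open>Both families have to be read at the same representative, because the coupling
      at \<open>r v\<close> joins \<open>\<mu> (r v)\<close> with \<open>\<nu> (r v)\<close>. The
      Boolean index lets one classification of the indices serve both.\<close>
    define M where "M b = (if b then \<mu> else \<nu>)" for b
    have Mk: "kernel_on_I (M b)" and MC: "\<And>v. v \<in> unit_I \<Longrightarrow> sq_moment (M b v) (\<lambda>x. x) \<le> ennreal C" for b
      using k C by (auto simp: M_def)
    define F where "F j v = (case j of (b, None) \<Rightarrow> enn2real (quant_err Q (M b v)) | (b, Some x) \<Rightarrow> measure (M b v) (Q -` {x}))" for j v
    let ?J = "(UNIV :: bool set) \<times> insert None (Some ` range Q)"
    have finJ: "finite ?J" using simple_functionD(1)[OF Q(1)] by simp
    have F1: "F j \<in> borel_measurable (restrict_space borel unit_I)" if "j \<in> ?J" for j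
    proof (cases j)
      case (Pair b o')
      have em: "(\<lambda>v. emeasure (M b v) A) \<in> borel_measurable (restrict_space borel unit_I)" if "A \<in> sets borel" for A
        using Mk[of b] that unfolding kernel_on_I_iff by auto
      have qm: "(\<lambda>v. quant_err Q (M b v)) \<in> borel_measurable (restrict_space borel unit_I)"
        unfolding quant_err_def
        by (rule measurable_compose[OF measurable_prob_algebraD[OF Mk] nn_integral_measurable_subprob_algebra])
           (use Qm in measurable)
      show ?thesis
      proof (cases o')
        case None then show ?thesis using qm Pair by (simp add: F_def[abs_def])
      next
        case (Some x) then show ?thesis using em[OF simple_vimage_borel[OF Q(1)]] Pair
          by (simp add: F_def[abs_def] measure_def)
      qed
    qed
    have F0: "0 \<le> F j v" for j v by (auto simp: F_def split: prod.split option.split)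
    obtain r Cr where r: "countable Cr" "Cr \<subseteq> unit_I" "r \<in> measurable (restrict_space borel unit_I) (count_space Cr)"
      "\<And>j v. j \<in> ?J \<Longrightarrow> v \<in> unit_I \<Longrightarrow> s * F j (r v) \<le> F j v"
      "\<And>j v. j \<in> ?J \<Longrightarrow> v \<in> unit_I \<Longrightarrow> s * F j v \<le> F j (r v)"
      by (rule exists_countable_representatives[of ?J F s]) (use finJ F1 F0 s in auto)
    have rI: "r v \<in> unit_I" if "v \<in> unit_I" for v
      using measurable_space[OF r(3), of v] that r(2) by (auto simp: space_restrict_space)
    have rk: "kernel_on_I (\<lambda>v. M b (r v))" for b
      by (rule kernel_on_I_reindex[OF r(3,2)]) (use kernel_on_I_D[OF Mk] in auto)
    have rC: "sq_moment (M b (r v)) (\<lambda>x. x) \<le> ennreal C" if "v \<in> unit_I" for b v using MC rI that by auto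
    let ?M = "\<lambda>b. graphon_op G (M b) u" and ?Mr = "\<lambda>b. graphon_op G (\<lambda>v. M b (r v)) u"
    have M2s: "?M b \<in> M2" "?Mr b \<in> M2" "mass (?M b) \<le> 1" "mass (?Mr b) \<le> 1" for b
      using graphon_op_in_M2[OF G u Mk MC] graphon_op_in_M2[OF G u rk rC] mass_graphon_op[OF G u Mk] mass_graphon_op[OF G u rk] by auto
    have qeM: "quant_err Q (?M b) \<le> ennreal (\<eta>\<^sup>2)" for b using qe by (cases b) (auto simp: M_def)
    have qv: "quant_err Q (M b (r v)) \<le> 4 * quant_err Q (M b v)" if v: "v \<in> unit_I" for b v
    proof -
      have fin: "quant_err Q (M b w) = ennreal (F (b, None) w)" if w: "w \<in> unit_I" for w
      proof -
        have "quant_err Q (M b w) \<le> ennreal (9 * C)"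
          by (intro quant_err_le kernel_on_I_D(2)[OF Mk w] Qm Q(2) MC[OF w] C(1))
        then show ?thesis unfolding F_def 
          by (auto simp: top_unique less_top[symmetric] intro!: ennreal_enn2real[symmetric] intro: le_less_trans)
      qed
      have "s * F (b, None) (r v) \<le> F (b, None) v" by (rule r(4)) (use v in auto)
      moreover have "1/4 * F (b, None) (r v) \<le> s * F (b, None) (r v)" using s F0 by (intro mult_right_mono) auto
      ultimately have "F (b, None) (r v) \<le> 4 * F (b, None) v" by linarith
      then have "ennreal (F (b, None) (r v)) \<le> ennreal (4 * F (b, None) v)" by (rule ennreal_leI)
      then show ?thesis unfolding fin[OF v] fin[OF rI[OF v]] using F0 by (simp add: ennreal_mult)
    qed
    have qer: "quant_err Q (?Mr b) \<le> ennreal (4 * \<eta>\<^sup>2)" for b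
    proof -
      have "quant_err Q (?Mr b) \<le> 4 * quant_err Q (?M b)"
        by (rule graphon_op_quant_err_le[OF G u rk Mk Qm qv])
      also have "\<dots> \<le> 4 * ennreal (\<eta>\<^sup>2)" by (intro mult_left_mono qeM) auto
      also have "\<dots> = ennreal (4 * \<eta>\<^sup>2)" by (simp add: ennreal_mult)
      finally show ?thesis .
    qed
    have qM: "distr (?M b) borel Q \<in> M2" "distr (?Mr b) borel Q \<in> M2" for b
      using quantised_in_M2[OF M2s(1) Q] quantised_in_M2[OF M2s(2) Q] by auto
    have close: "s * measure (?Mr b) (Q -` {x}) \<le> measure (?M b) (Q -` {x})"
        "s * measure (?M b) (Q -` {x}) \<le> measure (?Mr b) (Q -` {x})" if "x \<in> range Q" for b x
    proof -
      have J: "(b, Some x) \<in> ?J" using that by simp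
      show "s * measure (?Mr b) (Q -` {x}) \<le> measure (?M b) (Q -` {x})"
        by (rule graphon_op_measure_close[OF G u rk Mk simple_vimage_borel[OF Q(1)]])
           (use s r(4)[OF J] in \<open>auto simp: F_def\<close>)
      show "s * measure (?M b) (Q -` {x}) \<le> measure (?Mr b) (Q -` {x})"
        by (rule graphon_op_measure_close[OF G u Mk rk simple_vimage_borel[OF Q(1)]])
           (use s r(5)[OF J] in \<open>auto simp: F_def\<close>)
    qed
    have s01: "0 < s" "s \<le> 1" using s by auto
    have st1: "d (?M True) (distr (?M True) borel Q) \<le> L * \<eta>"
      by (rule order_trans[OF lip[OF M2s(1) qM(1)] mult_left_mono[OF WOP2_quantised_le(1)[OF M2s(1) Q(1) M2s(3) less_imp_le[OF \<eta>] qeM] L]])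
    have st5: "d (distr (?M False) borel Q) (?M False) \<le> L * \<eta>"
      by (rule order_trans[OF lip[OF qM(1) M2s(1)] mult_left_mono[OF WOP2_quantised_le(2)[OF M2s(1) Q(1) M2s(3) less_imp_le[OF \<eta>] qeM] L]])
    have st2: "d (distr (?M True) borel Q) (distr (?Mr True) borel Q) \<le> L * \<eta>"
      by (rule order_trans[OF lip[OF qM(1) qM(2)] mult_left_mono[OF order_trans[OF WOP2_quantised_close[OF M2s(1,3) M2s(2,4) Q(1) R s01 close(1,2)] s(3)] L]])
    have st4: "d (distr (?Mr False) borel Q) (distr (?M False) borel Q) \<le> L * \<eta>"
      by (rule order_trans[OF lip[OF qM(2) qM(1)] mult_left_mono[OF order_trans[OF WOP2_quantised_close[OF M2s(2,4) M2s(1,3) Q(1) R s01 close(2,1)] s(3)] L]])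
    have st3: "d (distr (?Mr True) borel Q) (distr (?Mr False) borel Q) \<le> L * sqrt ((1 + \<eta>) * c\<^sup>2 + (1 + 1 / \<eta>) * 4 * (4 * \<eta>\<^sup>2))"
    proof -
      \<comment> \<open>This choice is arbitrary in v. Read at \<open>r v\<close> it becomes a
        kernel, and its mixture couples the two operators at the representatives.\<close>
      from cp obtain \<pi> where \<pi>: "\<And>v. v \<in> unit_I \<Longrightarrow> \<pi> v \<in> couplings (\<mu> v) (\<nu> v)"
        "\<And>v. v \<in> unit_I \<Longrightarrow> (\<integral>\<^sup>+z. ennreal ((norm (fst z - snd z))\<^sup>2) \<partial>\<pi> v) \<le> ennreal (c\<^sup>2)" by metis
      have \<pi>k: "kernel_on_I (\<lambda>v. \<pi> (r v))"
      proof (rule kernel_on_I_reindex[OF r(3,2)])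
        fix w assume w: "w \<in> unit_I"
        note cm = couplings_measurable[OF \<pi>(1)[OF w]]
        show "sets (\<pi> w) = sets borel" using cm(3) unfolding borel_prod .
        have "emeasure (\<pi> w) (space (\<pi> w)) = emeasure (distr (\<pi> w) borel fst) UNIV"
          using cm by (simp add: emeasure_distr)
        also have "\<dots> = 1" using \<pi>(1)[OF w] kernel_on_I_D[OF k(1) w] prob_space.emeasure_space_1[of "\<mu> w"]
          by (simp add: couplings_def)
        finally show "prob_space (\<pi> w)" by (rule prob_spaceI)
      qed
      let ?\<Pi> = "graphon_op G (\<lambda>v. \<pi> (r v)) u"
      have fs: "(fst :: 'a \<times> 'a \<Rightarrow> 'a) \<in> borel_measurable borel" "(snd :: 'a \<times> 'a \<Rightarrow> 'a) \<in> borel_measurable borel"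
        by (simp_all add: borel_prod[symmetric])
      have "distr ?\<Pi> borel fst = ?Mr True" "distr ?\<Pi> borel snd = ?Mr False"
        unfolding distr_graphon_op[OF G u \<pi>k fs(1)] distr_graphon_op[OF G u \<pi>k fs(2)]
        using \<pi>(1)[OF rI] by (auto intro!: graphon_op_cong simp: couplings_def M_def)
      then have cpl: "?\<Pi> \<in> couplings (?Mr True) (?Mr False)"
        unfolding couplings_def borel_prod using sets_graphon_op[OF G u \<pi>k] by simp
      have costm: "(\<lambda>z. ennreal ((norm (fst z - snd z))\<^sup>2)) \<in> borel_measurable (borel :: ('a \<times> 'a) measure)"
        unfolding borel_prod[symmetric] by measurable
      have cost: "(\<integral>\<^sup>+z. ennreal ((norm (fst z - snd z))\<^sup>2) \<partial>?\<Pi>) \<le> ennreal (c\<^sup>2)"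
        by (rule nn_integral_graphon_op_le[OF G u \<pi>k costm]) (use \<pi>(2) rI in auto)
      note cm = couplings_measurable[OF cpl]
      note [measurable] = cm(1,2) Qm
      let ?\<Pi>Q = "distr ?\<Pi> (borel \<Otimes>\<^sub>M borel) (\<lambda>z. (Q (fst z), Q (snd z)))"
      have dist: "distr ?\<Pi> borel fst = ?Mr True" "distr ?\<Pi> borel snd = ?Mr False" using cpl by (auto simp: couplings_def)
      have cplQ: "?\<Pi>Q \<in> couplings (distr (?Mr True) borel Q) (distr (?Mr False) borel Q)"
        unfolding couplings_def dist[symmetric] by (simp add: distr_distr o_def)
      have tot: "0 \<le> (1 + \<eta>) * c\<^sup>2 + (1 + 1 / \<eta>) * 4 * (4 * \<eta>\<^sup>2)"
        using \<eta> by (intro add_nonneg_nonneg mult_nonneg_nonneg) auto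
      have "WOP2 x0 (distr (?Mr True) borel Q) (distr (?Mr False) borel Q) \<le> sqrt ((1 + \<eta>) * c\<^sup>2 + (1 + 1 / \<eta>) * 4 * (4 * \<eta>\<^sup>2))"
      proof (rule WOP2_le_coupling[OF cplQ])
        show "finite_measure (distr (?Mr True) borel Q)" using M2_D(3)[OF qM(2)] .
        show "mass (distr (?Mr True) borel Q) \<le> 1" unfolding mass_quantised[OF M2s(2) Q(1)] by (rule M2s)
        show "(\<integral>\<^sup>+z. ennreal ((norm (fst z - snd z))\<^sup>2) \<partial>?\<Pi>Q) \<le> ennreal ((sqrt ((1 + \<eta>) * c\<^sup>2 + (1 + 1 / \<eta>) * 4 * (4 * \<eta>\<^sup>2)))\<^sup>2)"
          using quantised_coupling_cost[OF cpl Qm cost qer qer _ \<eta>] tot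
          by (simp add: nn_integral_distr)
      qed (use tot in simp)
      then show ?thesis using lip[OF qM(2) qM(2), of True False] L by (meson mult_left_mono order_trans)
    qed
    have "d (?M True) (?M False) \<le> d (?M True) (distr (?M True) borel Q) + d (distr (?M True) borel Q) (?M False)"
      by (rule tri[OF M2s(1) qM(1) M2s(1)])
    moreover have "d (distr (?M True) borel Q) (?M False) \<le> d (distr (?M True) borel Q) (distr (?Mr True) borel Q) + d (distr (?Mr True) borel Q) (?M False)"
      by (rule tri[OF qM(1) qM(2) M2s(1)])
    moreover have "d (distr (?Mr True) borel Q) (?M False) \<le> d (distr (?Mr True) borel Q) (distr (?Mr False) borel Q) + d (distr (?Mr False) borel Q) (?M False)"
      by (rule tri[OF qM(2) qM(2) M2s(1)])
    moreover have "d (distr (?Mr False) borel Q) (?M False) \<le> d (distr (?Mr False) borel Q) (distr (?M False) borel Q) + d (distr (?M False) borel Q) (?M False)"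
      by (rule tri[OF qM(2) qM(1) M2s(1)])
    ultimately have "d (?M True) (?M False) \<le> L * \<eta> + (L * \<eta> + (L * sqrt ((1 + \<eta>) * c\<^sup>2 + (1 + 1 / \<eta>) * 4 * (4 * \<eta>\<^sup>2)) + (L * \<eta> + L * \<eta>)))"
      using st1 st2 st3 st4 st5 by linarith
    then have "d ?P ?N \<le> L * \<eta> + (L * \<eta> + (L * sqrt ((1 + \<eta>) * c\<^sup>2 + (1 + 1 / \<eta>) * 4 * (4 * \<eta>\<^sup>2)) + (L * \<eta> + L * \<eta>)))"
      by (simp add: M_def)
    then show ?thesis using mult_nonneg_nonneg[OF L less_imp_le[OF \<eta>]] by (simp only: distrib_left)
  qed
  \<comment> \<open>The errors at the representatives are at most \<open>4 * \<eta>^2\<close>, and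
    the weight \<open>(1 + 1 / \<eta>) * 4\<close> turns them into
    \<open>16 * \<eta>^2 + 16 * \<eta>\<close>, which vanishes with \<eta>; the square root then
    tends to c.\<close>
  have "((\<lambda>\<eta>. L * (5 * \<eta> + sqrt ((1 + \<eta>) * c\<^sup>2 + 16 * \<eta>\<^sup>2 + 16 * \<eta>)) + L * \<eta>) \<longlongrightarrow> L * (5 * 0 + sqrt ((1 + 0) * c\<^sup>2 + 16 * 0\<^sup>2 + 16 * 0)) + L * 0) (at_right 0)"
    by (intro tendsto_intros)
  then have "((\<lambda>\<eta>. L * (5 * \<eta> + sqrt ((1 + \<eta>) * c\<^sup>2 + 16 * \<eta>\<^sup>2 + 16 * \<eta>)) + L * \<eta>) \<longlongrightarrow> L * c) (at_right 0)"
    using c by simp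
  moreover have "eventually (\<lambda>\<eta>. d ?P ?N \<le> L * (5 * \<eta> + sqrt ((1 + \<eta>) * c\<^sup>2 + 16 * \<eta>\<^sup>2 + 16 * \<eta>)) + L * \<eta>) (at_right 0)"
  proof -
    have "d ?P ?N \<le> L * (5 * \<eta> + sqrt ((1 + \<eta>) * c\<^sup>2 + 16 * \<eta>\<^sup>2 + 16 * \<eta>)) + L * \<eta>" if \<eta>: "0 < \<eta>" for \<eta>
    proof -
      have eq: "(1 + \<eta>) * c\<^sup>2 + (1 + 1 / \<eta>) * 4 * (4 * \<eta>\<^sup>2) = (1 + \<eta>) * c\<^sup>2 + 16 * \<eta>\<^sup>2 + 16 * \<eta>"
        using \<eta> by (simp add: field_simps power2_eq_square)
      show ?thesis using main[OF \<eta>] unfolding eq .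
    qed
    then show ?thesis by (simp add: eventually_at_right_less eventually_at_filter)
  qed
  ultimately show ?thesis by (rule tendsto_lowerbound) simp
qed

section \<open>Gaussian increments\<close>

text \<open>The law of a Brownian increment over a time span \<tau>: independent centred normal
  coordinates of variance \<tau>. The density is spelled as in \<open>brownian_motion\<close>, so
  that the two match literally.\<close>

definition gauss :: "real \<Rightarrow> (real^'q) measure" where
  "gauss \<tau> = density lborel (\<lambda>x. ennreal (\<Prod>i\<in>UNIV. normal_density 0 (sqrt \<tau>) (x $ i)))"

lemma sets_gauss[simp, measurable_cong]: "sets (gauss \<tau>) = sets borel"
  by (simp add: gauss_def)

text \<open>Lebesgue measure on vectors is the image of a product of one-dimensional measures,
  indexed by the basis, under the map that assembles a vector from its coordinates. Along this map a
  product of functions of single coordinates becomes a product function, to which Fubini's theorem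
  applies.\<close>

lemma has_bochner_integral_lborel_vec_prod:
  fixes h :: "'q::finite \<Rightarrow> real \<Rightarrow> real"
  assumes "\<And>i. integrable lborel (h i)"
  shows "has_bochner_integral lborel (\<lambda>x::real^'q. \<Prod>i\<in>UNIV. h i (x $ i)) (\<Prod>i\<in>UNIV. \<integral>x. h i x \<partial>lborel)"
proof -
  interpret product_sigma_finite "\<lambda>b::real^'q. lborel :: real measure" ..
  have inj: "inj_on (\<lambda>i::'q. axis i (1::real)) UNIV" by (auto simp: inj_on_def axis_eq_axis)
  have B: "(Basis :: (real^'q) set) = (\<lambda>i. axis i 1) ` UNIV" by (auto simp: Basis_vec_def)
  let ?T = "\<lambda>f. \<Sum>b\<in>(Basis :: (real^'q) set). f b *\<^sub>R b"
  have T: "?T f $ i = f (axis i 1)" for f i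
  proof -
    have "?T f $ i = (\<Sum>j\<in>UNIV. f (axis j 1) * (axis j (1::real) $ i))"
      unfolding B by (simp add: sum.reindex[OF inj])
    also have "\<dots> = (\<Sum>j\<in>UNIV. if j = i then f (axis j 1) else 0)"
      by (intro sum.cong refl) (auto simp: axis_def)
    finally show ?thesis by simp
  qed
  have P: "(\<Prod>i\<in>UNIV. h i (?T f $ i)) = (\<Prod>b\<in>Basis. h (axis_index b) (f b))" for f
    unfolding T unfolding B by (simp add: prod.reindex[OF inj])
  have I: "(\<Prod>b\<in>(Basis::(real^'q) set). \<integral>x. h (axis_index b) x \<partial>lborel) = (\<Prod>i\<in>UNIV. \<integral>x. h i x \<partial>lborel)"
    unfolding B by (simp add: prod.reindex[OF inj])
  have hm: "h i \<in> borel_measurable borel" for i using assms[of i] by auto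
  have m: "(\<lambda>x::real^'q. \<Prod>i\<in>UNIV. h i (x $ i)) \<in> borel_measurable borel"
    by (intro borel_measurable_prod measurable_compose[OF _ hm]) simp
  have Tm: "?T \<in> measurable (\<Pi>\<^sub>M b\<in>Basis. lborel) borel" by measurable
  have int: "integrable (\<Pi>\<^sub>M b\<in>Basis. lborel) (\<lambda>f. \<Prod>b\<in>(Basis::(real^'q) set). h (axis_index b) (f b))"
    by (rule product_integrable_prod) (auto simp: assms)
  have val: "(\<integral>f. (\<Prod>b\<in>(Basis::(real^'q) set). h (axis_index b) (f b)) \<partial>(\<Pi>\<^sub>M b\<in>Basis. lborel)) = (\<Prod>b\<in>(Basis::(real^'q) set). \<integral>x. h (axis_index b) x \<partial>lborel)"
    by (rule product_integral_prod) (auto simp: assms)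
  show ?thesis
    unfolding has_bochner_integral_iff
    unfolding lborel_eq[where 'a="real^'q"]
    using int val
    by (simp only: integrable_distr_eq[OF Tm m] integral_distr[OF Tm m] P I simp_thms)
qed

lemma power2_norm_vec: "(norm (x :: real^'d))\<^sup>2 = (\<Sum>i\<in>UNIV. (x $ i)\<^sup>2)"
  unfolding power2_norm_eq_inner inner_vec_def by (simp add: power2_eq_square)

lemma power2_norm_matrix: "(norm (A :: real^'q^'d))\<^sup>2 = (\<Sum>i\<in>UNIV. \<Sum>j\<in>UNIV. (A $ i $ j)\<^sup>2)"
  unfolding power2_norm_eq_inner inner_vec_def by (simp add: power2_eq_square)

context
  fixes \<tau> :: real assumes \<tau>: "0 < \<tau>"
begin

lemma has_bochner_integral_gauss_monomial:
  fixes a :: "'q::finite \<Rightarrow> nat"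
  shows "has_bochner_integral (gauss \<tau>) (\<lambda>x::real^'q. \<Prod>i\<in>UNIV. (x $ i) ^ a i)
    (\<Prod>i\<in>UNIV. \<integral>x. normal_density 0 (sqrt \<tau>) x * x ^ a i \<partial>lborel)"
proof -
  have "integrable lborel (\<lambda>x. normal_density 0 (sqrt \<tau>) x * x ^ k)" for k
    using integrable_normal_moment[of "sqrt \<tau>" 0 k] \<tau> by simp
  from has_bochner_integral_lborel_vec_prod[of "\<lambda>i x. normal_density 0 (sqrt \<tau>) x * x ^ a i", OF this]
  show ?thesis unfolding gauss_def
    by (intro has_bochner_integral_density) (auto simp: prod.distrib intro!: prod_nonneg)
qed

lemma normal_moments:
  "(\<integral>x. normal_density 0 (sqrt \<tau>) x * x ^ 0 \<partial>lborel) = 1"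
  "(\<integral>x. normal_density 0 (sqrt \<tau>) x * x ^ 1 \<partial>lborel) = 0"
  "(\<integral>x. normal_density 0 (sqrt \<tau>) x * x ^ 2 \<partial>lborel) = \<tau>"
  using \<tau> integral_normal_moment_even[of "sqrt \<tau>" 0 1] integral_normal_moment_odd[of "sqrt \<tau>" 0 0]
  by (simp_all add: fact_numeral)

lemma gauss_second_moments:
  "has_bochner_integral (gauss \<tau>) (\<lambda>x::real^'q. 1::real) 1"
  "has_bochner_integral (gauss \<tau>) (\<lambda>x::real^'q::finite. x $ j) 0"
  "has_bochner_integral (gauss \<tau>) (\<lambda>x::real^'q. x $ j * x $ k) (if j = k then \<tau> else 0)"
proof -
  show "has_bochner_integral (gauss \<tau>) (\<lambda>x::real^'q. 1::real) 1"
    using has_bochner_integral_gauss_monomial[where 'q='q and a="\<lambda>i. 0"] normal_moments(1) by simp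
  \<comment> \<open>A coordinate is the monomial whose exponent vector is an indicator; a product of
    two coordinates adds two such vectors.\<close>
  have 0: "(\<Prod>i\<in>UNIV. (x $ i) ^ (of_bool (i = j) :: nat)) = x $ j" for x :: "real^'q"
    using prod.remove[of UNIV j "\<lambda>i. (x $ i) ^ (of_bool (i = j) :: nat)"] by simp
  have 1: "(\<Prod>i\<in>UNIV. \<integral>x. normal_density 0 (sqrt \<tau>) x * x ^ (of_bool (i = j) :: nat) \<partial>lborel) = 0"
    using normal_moments(2) by (intro prod_zero) (auto intro!: bexI[of _ j])
  show "has_bochner_integral (gauss \<tau>) (\<lambda>x::real^'q. x $ j) 0"
    using has_bochner_integral_gauss_monomial[of "\<lambda>i. of_bool (i = j)"] unfolding 0 1 .
  have 1: "(\<Prod>i\<in>UNIV. (x $ i) ^ (of_bool (i = j) + of_bool (i = k) :: nat)) = x $ j * x $ k" for x :: "real^'q"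
  proof -
    have e: "(\<Prod>i\<in>UNIV. (x $ i) ^ (of_bool (i = l) :: nat)) = x $ l" for l
      using prod.remove[of UNIV l "\<lambda>i. (x $ i) ^ (of_bool (i = l) :: nat)"] by simp
    show ?thesis unfolding power_add prod.distrib e ..
  qed
  have 2: "(\<Prod>i\<in>UNIV. \<integral>x. normal_density 0 (sqrt \<tau>) x * x ^ (of_bool (i = j) + of_bool (i = k) :: nat) \<partial>lborel) = (if j = k then \<tau> else 0)"
  proof (cases "j = k")
    case True
    have "(\<Prod>i\<in>UNIV. \<integral>x. normal_density 0 (sqrt \<tau>) x * x ^ (of_bool (i = j) + of_bool (i = k) :: nat) \<partial>lborel) =
      (\<integral>x. normal_density 0 (sqrt \<tau>) x * x ^ 2 \<partial>lborel)"
      using True normal_moments(1) by (subst prod.remove[of UNIV j]) (auto simp: numeral_2_eq_2)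
    then show ?thesis using True normal_moments(3) by simp
  next
    case False
    then show ?thesis using normal_moments(2) by (auto intro!: prod_zero bexI[of _ j])
  qed
  show "has_bochner_integral (gauss \<tau>) (\<lambda>x::real^'q. x $ j * x $ k) (if j = k then \<tau> else 0)"
    using has_bochner_integral_gauss_monomial[of "\<lambda>i. of_bool (i = j) + of_bool (i = k)"] unfolding 1 2 .
qed

lemma prob_space_gauss: "prob_space (gauss \<tau> :: (real^'q) measure)"
proof (rule prob_spaceI)
  have "(\<integral>\<^sup>+x. ennreal 1 \<partial>(gauss \<tau> :: (real^'q) measure)) = ennreal 1"
    using gauss_second_moments(1) by (subst nn_integral_eq_integral) (auto simp: has_bochner_integral_iff)
  then show "emeasure (gauss \<tau> :: (real^'q) measure) (space (gauss \<tau>)) = 1" by simp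
qed

text \<open>Linear terms have mean zero and distinct coordinates are uncorrelated, so only the
  diagonal of the quadratic part survives. It sums the squared entries of A, which is the square of
  the library norm on matrices and not of the operator norm.\<close>

lemma nn_integral_gauss_affine:
  fixes z :: "real^'d" and A :: "real^'q^'d"
  shows "(\<integral>\<^sup>+x. ennreal ((norm (z + A *v x))\<^sup>2) \<partial>gauss \<tau>) = ennreal ((norm z)\<^sup>2 + \<tau> * (norm A)\<^sup>2)"
proof -
  note g = gauss_second_moments
  have ex: "(norm (z + A *v x))\<^sup>2 = (\<Sum>i\<in>UNIV. (z $ i)\<^sup>2 * 1 + (\<Sum>j\<in>UNIV. 2 * z $ i * A $ i $ j * x $ j) + (\<Sum>j\<in>UNIV. \<Sum>k\<in>UNIV. A $ i $ j * A $ i $ k * (x $ j * x $ k)))" for x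
    unfolding power2_norm_vec
  proof (intro sum.cong refl)
    fix i
    have "((z + A *v x) $ i)\<^sup>2 = (z $ i)\<^sup>2 + 2 * z $ i * (\<Sum>j\<in>UNIV. A $ i $ j * x $ j) + (\<Sum>j\<in>UNIV. A $ i $ j * x $ j) * (\<Sum>j\<in>UNIV. A $ i $ j * x $ j)"
      by (simp add: matrix_vector_mult_def power2_eq_square algebra_simps)
    then show "((z + A *v x) $ i)\<^sup>2 = (z $ i)\<^sup>2 * 1 + (\<Sum>j\<in>UNIV. 2 * z $ i * A $ i $ j * x $ j) + (\<Sum>j\<in>UNIV. \<Sum>k\<in>UNIV. A $ i $ j * A $ i $ k * (x $ j * x $ k))"
      unfolding sum_product by (simp add: sum_distrib_left mult_ac)
  qed
  have "has_bochner_integral (gauss \<tau>) (\<lambda>x. (norm (z + A *v x))\<^sup>2)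
     (\<Sum>i\<in>UNIV. (z $ i)\<^sup>2 * 1 + (\<Sum>j\<in>UNIV. 2 * z $ i * A $ i $ j * 0) + (\<Sum>j\<in>UNIV. \<Sum>k\<in>UNIV. A $ i $ j * A $ i $ k * (if j = k then \<tau> else 0)))"
    unfolding ex
    by (intro has_bochner_integral_sum has_bochner_integral_add has_bochner_integral_mult_right g)
  also have "(\<Sum>i\<in>UNIV. (z $ i)\<^sup>2 * 1 + (\<Sum>j\<in>UNIV. 2 * z $ i * A $ i $ j * 0) + (\<Sum>j\<in>UNIV. \<Sum>k\<in>UNIV. A $ i $ j * A $ i $ k * (if j = k then \<tau> else 0)))
    = (norm z)\<^sup>2 + \<tau> * (norm A)\<^sup>2"
    unfolding power2_norm_vec[of z] power2_norm_matrix
    by (simp add: sum.distrib sum_distrib_left power2_eq_square mult_ac if_distrib cong: if_cong)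
  finally show ?thesis by (subst nn_integral_eq_integral) (auto simp: has_bochner_integral_iff)
qed

end

section \<open>Brownian increments and the filtration\<close>

lemma bounded_bilinear_matrix_vector_mult:
  "bounded_bilinear ((*v) :: real^'q^'d \<Rightarrow> real^'q \<Rightarrow> real^'d)"
  unfolding bilinear_conv_bounded_bilinear[symmetric] bilinear_def
  by (auto intro!: linearI simp: matrix_vector_mult_add_rdistrib matrix_vector_right_distrib
      scaleR_matrix_vector_assoc matrix_vector_mult_scaleR)

lemma borel_measurable_matrix_vector_mult:
  fixes A :: "'w \<Rightarrow> real^'q^'d"
  assumes "A \<in> borel_measurable N" "v \<in> borel_measurable N"
  shows "(\<lambda>\<omega>. A \<omega> *v v \<omega>) \<in> borel_measurable N"
  by (rule borel_measurable_continuous_Pair[where H="(*v)", OF assms])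
     (auto intro!: bounded_bilinear.continuous_on[OF bounded_bilinear_matrix_vector_mult] continuous_intros)

locale filtered_bm = prob_space M for M :: "'w measure" +
  fixes F :: "real \<Rightarrow> 'w measure" and W :: "real \<Rightarrow> 'w \<Rightarrow> real^'q"
  assumes filtered: "filtered_prob_space M F" and bm: "brownian_motion M F W"
begin

lemma space_F: "0 \<le> t \<Longrightarrow> space (F t) = space M"
  and sets_F: "0 \<le> t \<Longrightarrow> sets (F t) \<subseteq> sets M"
  and sets_F_mono: "0 \<le> s \<Longrightarrow> s \<le> t \<Longrightarrow> sets (F s) \<subseteq> sets (F t)"
  using filtered by (auto simp: filtered_prob_space_def subalgebra_def)

lemma measurable_F_mono: "0 \<le> s \<Longrightarrow> s \<le> t \<Longrightarrow> f \<in> measurable (F s) N \<Longrightarrow> f \<in> measurable (F t) N"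
  using sets_F_mono[of s t] space_F[of s] space_F[of t] by (auto simp: measurable_def)

lemma measurable_F_M: "0 \<le> s \<Longrightarrow> f \<in> measurable (F s) N \<Longrightarrow> f \<in> measurable M N"
  using sets_F[of s] space_F[of s] by (auto simp: measurable_def)

lemma W_measurable: "0 \<le> t \<Longrightarrow> W t \<in> borel_measurable (F t)"
  using bm by (auto simp: brownian_motion_def)

lemma joint_distr_increment:
  assumes st: "0 \<le> s" "s < t" and Y: "Y \<in> measurable (F s) N"
  shows "distr M N Y \<Otimes>\<^sub>M gauss (t - s) = distr M (N \<Otimes>\<^sub>M borel) (\<lambda>\<omega>. (Y \<omega>, W t \<omega> - W s \<omega>))"
proof -
  let ?D = "\<lambda>\<omega>. W t \<omega> - W s \<omega>"
  have i: "indep_set (sets (F s)) (generated_events M ?D)"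
    using bm st by (auto simp: brownian_motion_def)
  have Wm[measurable]: "W s \<in> borel_measurable M" "W t \<in> borel_measurable M"
    using measurable_F_M[OF st(1) W_measurable[OF st(1)]] measurable_F_M[OF _ W_measurable, of t] st by auto
  have Dm: "?D \<in> borel_measurable M" by measurable
  note Ym[measurable] = measurable_F_M[OF st(1) Y]
  have "distributed M lborel ?D (\<lambda>x. ennreal (\<Prod>i\<in>UNIV. normal_density 0 (sqrt (t - s)) (x $ i)))"
    using bm st by (auto simp: brownian_motion_def)
  then have "distr M lborel ?D = gauss (t - s)" by (simp add: distributed_def gauss_def)
  moreover have "distr M lborel ?D = distr M borel ?D" by (rule distr_cong) auto
  ultimately have dD: "gauss (t - s) = distr M borel ?D" by simp
  interpret d1: prob_space "distr M N Y" by (rule prob_space_distr[OF Ym])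
  interpret d2: prob_space "distr M borel ?D" by (rule prob_space_distr[OF Dm])
  show ?thesis unfolding dD
  proof (rule pair_measure_eqI)
    fix A B assume "A \<in> sets (distr M N Y)" "B \<in> sets (distr M borel ?D)"
    then have A: "A \<in> sets N" and B: "B \<in> sets borel" by auto
    have a: "Y -` A \<inter> space M \<in> sets (F s)" using measurable_sets[OF Y A] space_F[OF st(1)] by simp
    have b: "?D -` B \<inter> space M \<in> generated_events M ?D" using B by (auto simp: generated_events_def)
    have "emeasure (distr M (N \<Otimes>\<^sub>M borel) (\<lambda>\<omega>. (Y \<omega>, ?D \<omega>))) (A \<times> B) = emeasure M ((Y -` A \<inter> space M) \<inter> (?D -` B \<inter> space M))"
      using A B by (subst emeasure_distr) (auto intro!: arg_cong[where f="emeasure M"])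
    also have "\<dots> = emeasure (distr M N Y) A * emeasure (distr M borel ?D) B"
      using A B indep_setD[OF i a b] Dm by (simp add: emeasure_distr emeasure_eq_measure ennreal_mult)
    finally show "emeasure (distr M N Y) A * emeasure (distr M borel ?D) B = emeasure (distr M (N \<Otimes>\<^sub>M borel) (\<lambda>\<omega>. (Y \<omega>, ?D \<omega>))) (A \<times> B)" ..
  qed (auto intro: d1.sigma_finite_measure_axioms d2.sigma_finite_measure_axioms cong: sets_pair_measure_cong)
qed

text \<open>Freezing: what is known at time s is independent of the increment and acts as a
  parameter while the increment is integrated out. This takes the place of conditional
  expectations.\<close>

lemma nn_integral_increment:
  assumes st: "0 \<le> s" "s < t" and Y: "Y \<in> measurable (F s) N"
    and f: "f \<in> borel_measurable (N \<Otimes>\<^sub>M borel)"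
  shows "(\<integral>\<^sup>+\<omega>. f (Y \<omega>, W t \<omega> - W s \<omega>) \<partial>M) = (\<integral>\<^sup>+\<omega>. (\<integral>\<^sup>+x. f (Y \<omega>, x) \<partial>gauss (t - s)) \<partial>M)"
proof -
  let ?D = "\<lambda>\<omega>. W t \<omega> - W s \<omega>"
  note Ym[measurable] = measurable_F_M[OF st(1) Y]
  have Wm[measurable]: "W s \<in> borel_measurable M" "W t \<in> borel_measurable M"
    using measurable_F_M[OF st(1) W_measurable[OF st(1)]] measurable_F_M[OF _ W_measurable, of t] st by auto
  interpret g: prob_space "gauss (t - s)" by (rule prob_space_gauss) (use st in simp)
  have fm: "f \<in> borel_measurable (distr M N Y \<Otimes>\<^sub>M gauss (t - s))" "f \<in> borel_measurable (N \<Otimes>\<^sub>M gauss (t - s))"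
    using f by (simp_all cong: measurable_cong_sets sets_pair_measure_cong)
  have im: "(\<lambda>y. \<integral>\<^sup>+x. f (y, x) \<partial>gauss (t - s)) \<in> borel_measurable N"
    using fm(2) by (intro g.borel_measurable_nn_integral) (simp add: case_prod_beta')
  have "(\<integral>\<^sup>+\<omega>. f (Y \<omega>, ?D \<omega>) \<partial>M) = (\<integral>\<^sup>+z. f z \<partial>distr M (N \<Otimes>\<^sub>M borel) (\<lambda>\<omega>. (Y \<omega>, ?D \<omega>)))"
    using f by (subst nn_integral_distr) auto
  also have "\<dots> = (\<integral>\<^sup>+y. (\<integral>\<^sup>+x. f (y, x) \<partial>gauss (t - s)) \<partial>distr M N Y)"
    unfolding joint_distr_increment[OF st Y, symmetric] using g.nn_integral_fst[OF fm(1)] by simp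
  also have "\<dots> = (\<integral>\<^sup>+\<omega>. (\<integral>\<^sup>+x. f (Y \<omega>, x) \<partial>gauss (t - s)) \<partial>M)"
    using im by (subst nn_integral_distr[OF Ym]) auto
  finally show ?thesis .
qed

text \<open>The pair of \<open>Z\<close> and \<open>A\<close> is frozen and the Gaussian mean is
  taken first. Only nonnegative quantities are integrated, so the identity holds in
  \<open>ennreal\<close> even when a moment is infinite.\<close>

lemma sq_moment_add_increment:
  fixes Z :: "'w \<Rightarrow> real^'d" and A :: "'w \<Rightarrow> real^'q^'d"
  assumes st: "0 \<le> s" "s \<le> t" and Z: "Z \<in> borel_measurable (F s)" and A: "A \<in> borel_measurable (F s)"
  shows "sq_moment M (\<lambda>\<omega>. Z \<omega> + A \<omega> *v (W t \<omega> - W s \<omega>)) = sq_moment M Z + ennreal (t - s) * sq_moment M A"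
proof (cases "s = t")
  case True then show ?thesis by simp
next
  case False
  then have st': "s < t" using st by simp
  have Zm: "Z \<in> borel_measurable M" "A \<in> borel_measurable M" using Z A st by (auto intro: measurable_F_M)
  have cont: "continuous_on UNIV (\<lambda>((z::real^'d, A::real^'q^'d), x). (norm (z + A *v x))\<^sup>2)"
  proof -
    have "continuous_on UNIV (\<lambda>p::((real^'d) \<times> (real^'q^'d)) \<times> (real^'q). snd (fst p) *v snd p)"
      by (intro bounded_bilinear.continuous_on[OF bounded_bilinear_matrix_vector_mult] continuous_intros)
    then show ?thesis unfolding case_prod_beta' by (intro continuous_intros)
  qed
  have fm: "(\<lambda>((z::real^'d, A::real^'q^'d), x). ennreal ((norm (z + A *v x))\<^sup>2)) \<in> borel_measurable ((borel \<Otimes>\<^sub>M borel) \<Otimes>\<^sub>M borel)"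
    using borel_measurable_continuous_onI[OF cont] unfolding borel_prod case_prod_beta' by measurable
  have Ym: "(\<lambda>\<omega>. (Z \<omega>, A \<omega>)) \<in> measurable (F s) (borel \<Otimes>\<^sub>M borel)" using Z A by measurable
  have "sq_moment M (\<lambda>\<omega>. Z \<omega> + A \<omega> *v (W t \<omega> - W s \<omega>)) = (\<integral>\<^sup>+\<omega>. (\<integral>\<^sup>+x. ennreal ((norm (Z \<omega> + A \<omega> *v x))\<^sup>2) \<partial>gauss (t - s)) \<partial>M)"
    using nn_integral_increment[OF st(1) st' Ym fm] by (simp add: sq_moment_def)
  also have "\<dots> = (\<integral>\<^sup>+\<omega>. ennreal ((norm (Z \<omega>))\<^sup>2) + ennreal (t - s) * ennreal ((norm (A \<omega>))\<^sup>2) \<partial>M)"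
    using st' by (simp add: nn_integral_gauss_affine ennreal_mult ennreal_plus)
  also have "\<dots> = sq_moment M Z + ennreal (t - s) * sq_moment M A"
    unfolding sq_moment_def using Zm by (subst nn_integral_add) (auto simp: nn_integral_cmult)
  finally show ?thesis .
qed

end

section \<open>Mean square calculus\<close>

lemma sq_moment_add_le:
  fixes f g :: "'w \<Rightarrow> 'a::euclidean_space"
  assumes [measurable]: "f \<in> borel_measurable N" "g \<in> borel_measurable N" and e: "0 < e"
  shows "sq_moment N (\<lambda>\<omega>. f \<omega> + g \<omega>) \<le> ennreal (1 + e) * sq_moment N f + ennreal (1 + 1 / e) * sq_moment N g"
proof -
  have "sq_moment N (\<lambda>\<omega>. f \<omega> + g \<omega>) \<le> (\<integral>\<^sup>+\<omega>. ennreal (1 + e) * ennreal ((norm (f \<omega>))\<^sup>2) + ennreal (1 + 1 / e) * ennreal ((norm (g \<omega>))\<^sup>2) \<partial>N)"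
    unfolding sq_moment_def
  proof (rule nn_integral_mono)
    fix \<omega>
    from ennreal_leI[OF sq_sum_le_weighted[OF e, of "f \<omega>" "g \<omega>"]]
    show "ennreal ((norm (f \<omega> + g \<omega>))\<^sup>2) \<le> ennreal (1 + e) * ennreal ((norm (f \<omega>))\<^sup>2) + ennreal (1 + 1 / e) * ennreal ((norm (g \<omega>))\<^sup>2)"
      using e by (simp add: ennreal_plus[symmetric] ennreal_mult[symmetric] del: ennreal_plus)
  qed
  also have "\<dots> = ennreal (1 + e) * sq_moment N f + ennreal (1 + 1 / e) * sq_moment N g"
    unfolding sq_moment_def by (simp add: nn_integral_add nn_integral_cmult)
  finally show ?thesis .
qed

lemma sq_moment_add_le2:
  fixes f g :: "'w \<Rightarrow> 'a::euclidean_space"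
  assumes "f \<in> borel_measurable N" "g \<in> borel_measurable N"
  shows "sq_moment N (\<lambda>\<omega>. f \<omega> + g \<omega>) \<le> 2 * sq_moment N f + 2 * sq_moment N g"
  using sq_moment_add_le[OF assms, of 1] by simp

lemma sq_moment_minus: "sq_moment N (\<lambda>\<omega>. - f \<omega>) = sq_moment N f"
  by (simp add: sq_moment_def)

lemma sq_moment_diff_le2:
  fixes f g :: "'w \<Rightarrow> 'a::euclidean_space"
  assumes "f \<in> borel_measurable N" "g \<in> borel_measurable N"
  shows "sq_moment N (\<lambda>\<omega>. f \<omega> - g \<omega>) \<le> 2 * sq_moment N f + 2 * sq_moment N g"
  using sq_moment_add_le2[OF assms(1), of "\<lambda>\<omega>. - g \<omega>"] assms(2) by (simp add: sq_moment_minus)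

lemma sq_moment_mono:
  assumes "AE \<omega> in N. norm (f \<omega>) \<le> norm (g \<omega>)" shows "sq_moment N f \<le> sq_moment N g"
  unfolding sq_moment_def using assms
  by (intro nn_integral_mono_AE) (auto elim!: eventually_mono intro!: ennreal_leI power_mono)

lemma sq_moment_cong_AE:
  assumes "AE \<omega> in N. f \<omega> = g \<omega>" shows "sq_moment N f = sq_moment N g"
  unfolding sq_moment_def using assms by (intro nn_integral_cong_AE) (auto elim!: eventually_mono)

text \<open>Continuity of the mean square norm: each moment is at most 1 + e times the other plus a
  multiple of the squared distance, and e shrinks along the sequence.\<close>

lemma sq_moment_tendsto:
  fixes f :: "nat \<Rightarrow> 'w \<Rightarrow> 'a::euclidean_space"
  assumes fm: "\<And>k. f k \<in> borel_measurable N" "g \<in> borel_measurable N"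
    and fin: "\<And>k. sq_moment N (f k) < \<infinity>"
    and lim: "(\<lambda>k. sq_moment N (\<lambda>\<omega>. f k \<omega> - g \<omega>)) \<longlonglongrightarrow> 0"
  shows "(\<lambda>k. sq_moment N (f k)) \<longlonglongrightarrow> sq_moment N g" "sq_moment N g < \<infinity>"
proof -
  let ?d = "\<lambda>k. sq_moment N (\<lambda>\<omega>. f k \<omega> - g \<omega>)"
  note [measurable] = fm
  have up: "sq_moment N (f k) \<le> ennreal (1 + e) * sq_moment N g + ennreal (1 + 1 / e) * ?d k" if "0 < e" for k e
    using sq_moment_add_le[of g N "\<lambda>\<omega>. f k \<omega> - g \<omega>" e] that by simp
  have lo: "sq_moment N g \<le> ennreal (1 + e) * sq_moment N (f k) + ennreal (1 + 1 / e) * ?d k" if "0 < e" for k e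
    using sq_moment_add_le[of "f k" N "\<lambda>\<omega>. - (f k \<omega> - g \<omega>)" e] that by (simp add: sq_moment_minus del: minus_diff_eq)
  have ev: "eventually (\<lambda>k. ?d k < 1) sequentially" by (rule order_tendstoD(2)[OF lim]) simp
  then obtain k0 where k0: "\<And>k. k \<ge> k0 \<Longrightarrow> ?d k < 1" unfolding eventually_sequentially by blast
  have "sq_moment N g \<le> ennreal (1 + 1) * sq_moment N (f k0) + ennreal (1 + 1 / 1) * ?d k0" by (rule lo) simp
  also have "\<dots> < \<infinity>" using fin[of k0] k0[of k0] by (auto simp: ennreal_mult_less_top intro: less_trans)
  finally show gfin: "sq_moment N g < \<infinity>" .
  define A where "A = enn2real (sq_moment N g)"
  define a where "a k = enn2real (sq_moment N (f k))" for k
  define d where "d k = enn2real (?d k)" for k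
  have A: "sq_moment N g = ennreal A" "0 \<le> A" using gfin by (auto simp: A_def)
  have a: "sq_moment N (f k) = ennreal (a k)" "0 \<le> a k" for k using fin[of k] by (auto simp: a_def)
  have d: "?d k = ennreal (d k)" if "k \<ge> k0" for k 
    using k0[OF that] unfolding d_def by (subst ennreal_enn2real) (auto intro: less_trans)
  have d0: "0 \<le> d k" for k by (simp add: d_def)
  have "(\<lambda>k. enn2real (?d k)) \<longlonglongrightarrow> 0" by (rule tendsto_enn2real) (use lim in auto)
  then have dl: "d \<longlonglongrightarrow> 0" by (simp add: d_def[abs_def])
  \<comment> \<open>The weight must vanish while \<open>d k / e k\<close> vanishes too, which
    suggests \<open>sqrt (d k)\<close>; the summand \<open>1 / real (Suc k)\<close> keeps it
    positive.\<close>
  define e where "e k = sqrt (d k) + 1 / real (Suc k)" for k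
  have e: "0 < e k" for k unfolding e_def using d0[of k] by (intro add_nonneg_pos) auto
  have el: "e \<longlonglongrightarrow> 0"
  proof -
    have "(\<lambda>k. sqrt (d k) + 1 / real (Suc k)) \<longlonglongrightarrow> sqrt 0 + 0"
      by (intro tendsto_intros dl LIMSEQ_Suc[OF lim_1_over_n])
    then show ?thesis by (simp add: e_def[abs_def])
  qed
  have de: "(1 + 1 / e k) * d k \<le> d k + sqrt (d k)" for k
  proof -
    have "d k = sqrt (d k) * sqrt (d k)" using d0 by simp
    also have "\<dots> \<le> sqrt (d k) * e k" unfolding e_def using d0 by (intro mult_left_mono) auto
    finally have "d k / e k \<le> sqrt (d k)" using e[of k] by (simp add: divide_le_eq)
    then show ?thesis by (simp add: algebra_simps)
  qed
  have up': "a k \<le> (1 + e k) * A + (d k + sqrt (d k))" if "k \<ge> k0" for k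
  proof -
    have "ennreal (a k) \<le> ennreal ((1 + e k) * A + (1 + 1 / e k) * d k)"
      using up[OF e, of k k] e[of k] d0[of k] A(2) unfolding A(1) a(1) d[OF that]
      by (simp add: ennreal_mult ennreal_plus)
    then have "a k \<le> (1 + e k) * A + (1 + 1 / e k) * d k"
      using e[of k] d0[of k] A(2) by (subst (asm) ennreal_le_iff) auto
    then show ?thesis using de[of k] by linarith
  qed
  have lo': "(A - (d k + sqrt (d k))) / (1 + e k) \<le> a k" if "k \<ge> k0" for k
  proof -
    have "ennreal A \<le> ennreal ((1 + e k) * a k + (1 + 1 / e k) * d k)"
      using lo[OF e, of k k] e[of k] d0[of k] a(2)[of k] unfolding A(1) a(1) d[OF that]
      by (simp add: ennreal_mult ennreal_plus)
    then have "A \<le> (1 + e k) * a k + (1 + 1 / e k) * d k"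
      using e[of k] d0[of k] a(2)[of k] by (subst (asm) ennreal_le_iff) auto
    then have "A - (d k + sqrt (d k)) \<le> a k * (1 + e k)" using de[of k] by (simp add: mult.commute)
    then show ?thesis using e[of k] by (simp add: divide_le_eq)
  qed
  have "(\<lambda>k. (A - (d k + sqrt (d k))) / (1 + e k)) \<longlonglongrightarrow> (A - (0 + sqrt 0)) / (1 + 0)"
    by (intro tendsto_intros dl el) simp
  moreover have "(\<lambda>k. (1 + e k) * A + (d k + sqrt (d k))) \<longlonglongrightarrow> (1 + 0) * A + (0 + sqrt 0)"
    by (intro tendsto_intros dl el)
  ultimately have "a \<longlonglongrightarrow> A"
    using up' lo'
    by (intro real_tendsto_sandwich[of "\<lambda>k. (A - (d k + sqrt (d k))) / (1 + e k)" a sequentially "\<lambda>k. (1 + e k) * A + (d k + sqrt (d k))" A])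
       (auto simp: eventually_sequentially)
  then show "(\<lambda>k. sq_moment N (f k)) \<longlonglongrightarrow> sq_moment N g"
    unfolding A(1) a(1) by (intro tendsto_ennrealI)
qed

section \<open>The Ito isometry\<close>

lemma nn_integral_step:
  fixes p :: "nat \<Rightarrow> real" and g :: "real \<Rightarrow> ennreal"
  assumes p: "\<And>i. i < N \<Longrightarrow> p i \<le> p (Suc i)"
    and g: "\<And>i r. i < N \<Longrightarrow> p i < r \<Longrightarrow> r \<le> p (Suc i) \<Longrightarrow> g r = c i"
  shows "(\<integral>\<^sup>+r. g r * indicator {p 0<..p N} r \<partial>lborel) = (\<Sum>i<N. ennreal (p (Suc i) - p i) * c i)
    \<and> (\<lambda>r. g r * indicator {p 0<..p N} r) \<in> borel_measurable borel \<and> p 0 \<le> p N"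
  using assms
proof (induction N)
  case 0
  show ?case by simp
next
  case (Suc N)
  then have IH: "(\<integral>\<^sup>+r. g r * indicator {p 0<..p N} r \<partial>lborel) = (\<Sum>i<N. ennreal (p (Suc i) - p i) * c i)"
    and m[measurable]: "(\<lambda>r. g r * indicator {p 0<..p N} r) \<in> borel_measurable borel" and le: "p 0 \<le> p N"
    by auto
  have pN: "p N \<le> p (Suc N)" using Suc.prems by simp
  have split: "g r * indicator {p 0<..p (Suc N)} r = g r * indicator {p 0<..p N} r + c N * indicator {p N<..p (Suc N)} r" for r
    using Suc.prems(2)[of N r] pN le by (auto simp: indicator_def)
  have "(\<integral>\<^sup>+r. g r * indicator {p 0<..p (Suc N)} r \<partial>lborel) = (\<Sum>i<N. ennreal (p (Suc i) - p i) * c i) + c N * ennreal (p (Suc N) - p N)"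
    unfolding split using pN by (subst nn_integral_add) (simp_all add: IH nn_integral_cmult_indicator)
  then show ?case unfolding split using pN le by (auto simp: mult.commute)
qed

context filtered_bm
begin

lemma measurable_M_F: "0 \<le> t \<Longrightarrow> (\<lambda>\<omega>. \<omega>) \<in> measurable M (F t)"
  using sets_F[of t] space_F[of t] sets.sets_into_space by (auto simp: measurable_def Int_absorb2)

text \<open>Induction over the partition with \<open>sq_moment_add_increment\<close>; adaptedness of
  the partial sum and the order of the end points are carried along because the next interval uses
  them. Integrands have to be adapted only on intervals of positive length: the clipped partitions
  below contain degenerate intervals on which adaptedness may fail.\<close>

lemma sq_moment_elementary_integral:
  fixes Z :: "'w \<Rightarrow> real^'d" and \<eta> :: "nat \<Rightarrow> 'w \<Rightarrow> real^'q^'d"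
  assumes p0: "0 \<le> p 0" and p: "\<And>i. i < N \<Longrightarrow> p i \<le> p (Suc i)" and Z: "Z \<in> borel_measurable (F (p 0))"
    and \<eta>: "\<And>i. i < N \<Longrightarrow> p i < p (Suc i) \<Longrightarrow> \<eta> i \<in> borel_measurable (F (p i))"
  shows "sq_moment M (\<lambda>\<omega>. Z \<omega> + (\<Sum>i<N. \<eta> i \<omega> *v (W (p (Suc i)) \<omega> - W (p i) \<omega>)))
      = sq_moment M Z + (\<Sum>i<N. ennreal (p (Suc i) - p i) * sq_moment M (\<eta> i))
    \<and> (\<lambda>\<omega>. Z \<omega> + (\<Sum>i<N. \<eta> i \<omega> *v (W (p (Suc i)) \<omega> - W (p i) \<omega>))) \<in> borel_measurable (F (p N)) \<and> p 0 \<le> p N"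
  using p \<eta>
proof (induction N)
  case 0 then show ?case using Z by simp
next
  case (Suc N)
  let ?S = "\<lambda>N \<omega>. Z \<omega> + (\<Sum>i<N. \<eta> i \<omega> *v (W (p (Suc i)) \<omega> - W (p i) \<omega>))"
  have IH: "sq_moment M (?S N) = sq_moment M Z + (\<Sum>i<N. ennreal (p (Suc i) - p i) * sq_moment M (\<eta> i))"
    "?S N \<in> borel_measurable (F (p N))" "p 0 \<le> p N" using Suc by auto
  have pN: "p N \<le> p (Suc N)" "0 \<le> p N" using Suc.prems(1)[of N] IH(3) p0 by auto
  have S: "?S (Suc N) = (\<lambda>\<omega>. ?S N \<omega> + \<eta> N \<omega> *v (W (p (Suc N)) \<omega> - W (p N) \<omega>))"
    by (simp add: add.assoc)
  show ?case
  proof (cases "p N = p (Suc N)")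
    case True
    then show ?thesis unfolding S using IH by simp
  next
    case False
    then have lt: "p N < p (Suc N)" using pN by simp
    note \<eta>N = Suc.prems(2)[OF lessI lt]
    have [measurable]: "?S N \<in> borel_measurable (F (p (Suc N)))" "\<eta> N \<in> borel_measurable (F (p (Suc N)))"
      "W (p N) \<in> borel_measurable (F (p (Suc N)))" "W (p (Suc N)) \<in> borel_measurable (F (p (Suc N)))"
      using measurable_F_mono[OF pN(2,1)] IH(2) \<eta>N W_measurable pN by auto
    have mv: "(\<lambda>\<omega>. \<eta> N \<omega> *v (W (p (Suc N)) \<omega> - W (p N) \<omega>)) \<in> borel_measurable (F (p (Suc N)))"
      by (rule borel_measurable_matrix_vector_mult) measurable
    have "(\<lambda>\<omega>. ?S N \<omega> + \<eta> N \<omega> *v (W (p (Suc N)) \<omega> - W (p N) \<omega>)) \<in> borel_measurable (F (p (Suc N)))"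
      by (rule borel_measurable_add[OF measurable_F_mono[OF pN(2,1) IH(2)] mv])
    then show ?thesis unfolding S
      using sq_moment_add_increment[OF pN(2,1) IH(2) \<eta>N] IH(1,3) pN by (simp add: add.assoc[symmetric])
  qed
qed

end

context filtered_bm
begin

text \<open>Over the window, the increment of the simple integral minus \<open>A\<close> times the
  Brownian increment is a single elementary integral, whose integrand is the difference of the two
  integrands.\<close>

lemma simple_integral_isometry:
  fixes Z :: "'w \<Rightarrow> real^'d" and A :: "'w \<Rightarrow> real^'q^'d"
  assumes si: "simple_integrand M F n \<tau> \<xi>" and st: "0 \<le> s" "s \<le> t"
    and Z: "Z \<in> borel_measurable (F s)" and A: "A \<in> borel_measurable (F s)"
  shows "sq_moment M (\<lambda>\<omega>. Z \<omega> + (simple_integral n \<tau> \<xi> W t \<omega> - simple_integral n \<tau> \<xi> W s \<omega>) - A \<omega> *v (W t \<omega> - W s \<omega>))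
    = sq_moment M Z + (\<integral>\<^sup>+\<omega>. (\<integral>\<^sup>+r. ennreal ((norm (simple_process n \<tau> \<xi> r \<omega> - A \<omega>))\<^sup>2) * indicator {s<..t} r \<partial>lborel) \<partial>M)"
proof -
  have \<tau>0: "0 \<le> \<tau> 0" and \<tau>s: "\<And>i. i < n \<Longrightarrow> \<tau> i < \<tau> (Suc i)" and \<xi>: "\<And>i. i < n \<Longrightarrow> \<xi> i \<in> borel_measurable (F (\<tau> i))"
    using si by (auto simp: simple_integrand_def)
  have \<tau>m: "\<tau> i \<le> \<tau> j" if "i \<le> j" "j \<le> n" for i j
    using that
  proof (induction j)
    case (Suc j)
    then show ?case using \<tau>s[of j] by (cases "i = Suc j") auto
  qed simp
  have \<tau>nn: "0 \<le> \<tau> i" if "i \<le> n" for i using \<tau>m[of 0 i] that \<tau>0 by simp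
  \<comment> \<open>The points of the simple integrand are clipped to {s..t}, and s and t are added
    as first and last point, which gives n + 2 intervals. On interval j with j between 1 and n the
    integrand is \<open>\<xi> (j - 1)\<close>; on the two outer intervals it is 0.\<close>
  define c where "c x = max s (min t x)" for x
  define p where "p j = (if j = 0 then s else if j \<le> Suc n then c (\<tau> (j - 1)) else t)" for j
  define \<zeta> where "\<zeta> j \<omega> = (if 1 \<le> j \<and> j \<le> n then \<xi> (j - 1) \<omega> else 0)" for j \<omega>
  define \<eta> where "\<eta> j \<omega> = \<zeta> j \<omega> - A \<omega>" for j \<omega>
  let ?N = "Suc (Suc n)"
  have cst: "s \<le> c x" "c x \<le> t" for x using st by (auto simp: c_def)
  have cmono: "c x \<le> c y" if "x \<le> y" for x y using that by (auto simp: c_def)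
  have ps: "s \<le> p j" for j using cst st by (auto simp: p_def)
  have pm: "p j \<le> p (Suc j)" if "j < ?N" for j
    using that cst st \<tau>m[of "j - 1" j] by (auto simp: p_def intro!: cmono)
  have Am: "A \<in> borel_measurable M" using measurable_F_M[OF st(1) A] .
  have \<zeta>M: "\<zeta> j \<in> borel_measurable M" for j
  proof (cases "1 \<le> j \<and> j \<le> n")
    case True
    then have "\<xi> (j - 1) \<in> borel_measurable M"
      by (intro measurable_F_M[OF _ \<xi>[of "j - 1"]] \<tau>nn) auto
    then show ?thesis using True by (simp add: \<zeta>_def[abs_def])
  next
    case False
    then have "\<zeta> j = (\<lambda>\<omega>. 0)" by (simp only: \<zeta>_def[abs_def] if_False)
    then show ?thesis by simp
  qed
  have \<eta>M: "\<eta> j \<in> borel_measurable M" for j unfolding \<eta>_def using \<zeta>M Am by measurable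
  have \<eta>F: "\<eta> j \<in> borel_measurable (F (p j))" if "j < ?N" "p j < p (Suc j)" for j
  proof -
    have AF: "A \<in> borel_measurable (F (p j))" by (rule measurable_F_mono[OF st(1) ps A])
    have "\<zeta> j \<in> borel_measurable (F (p j))"
    proof (cases "1 \<le> j \<and> j \<le> n")
      case True
      then have pj: "p j = c (\<tau> (j - 1))" "p (Suc j) = c (\<tau> j)" by (auto simp: p_def)
      \<comment> \<open>Had the left end been cut down to t, the clipped interval would be
        degenerate. Otherwise clipping can only raise the left end, so \<open>\<xi> (j - 1)\<close>
        is known at time \<open>p j\<close>.\<close>
      have "\<tau> (j - 1) < t"
      proof (rule ccontr)
        assume "\<not> \<tau> (j - 1) < t"
        moreover have "\<tau> (j - 1) \<le> \<tau> j" using True by (intro \<tau>m) auto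
        ultimately have "c (\<tau> (j - 1)) = c (\<tau> j)" by (simp add: c_def)
        then show False using that(2) pj by simp
      qed
      then have "\<tau> (j - 1) \<le> p j" unfolding pj c_def by simp
      moreover have "0 \<le> \<tau> (j - 1)" using True by (intro \<tau>nn) auto
      moreover have "\<xi> (j - 1) \<in> borel_measurable (F (\<tau> (j - 1)))" using True by (intro \<xi>) auto
      ultimately have "\<xi> (j - 1) \<in> borel_measurable (F (p j))" by (intro measurable_F_mono[of "\<tau> (j - 1)" "p j"])
      then show ?thesis using True by (simp add: \<zeta>_def[abs_def])
    next
      case False
      then have "\<zeta> j = (\<lambda>\<omega>. 0)" by (simp only: \<zeta>_def[abs_def] if_False)
      then show ?thesis by simp
    qed
    then show ?thesis unfolding \<eta>_def using AF by measurable
  qed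
  have p0: "p 0 = s" and pN: "p ?N = t" by (auto simp: p_def)
  have sumid: "(\<Sum>j<?N. \<eta> j \<omega> *v (W (p (Suc j)) \<omega> - W (p j) \<omega>)) =
    (simple_integral n \<tau> \<xi> W t \<omega> - simple_integral n \<tau> \<xi> W s \<omega>) - A \<omega> *v (W t \<omega> - W s \<omega>)" for \<omega>
  proof -
    let ?D = "\<lambda>j. W (p (Suc j)) \<omega> - W (p j) \<omega>"
    \<comment> \<open>This form of the clipped value turns each increment over the window into the
      increment stopped at t minus the increment stopped at s.\<close>
    have cl: "W (c x) \<omega> = W (min t x) \<omega> + W s \<omega> - W (min s x) \<omega>" for x
      using st by (cases "x \<le> s") (auto simp: c_def min_def max_def)
    have Dj: "?D (Suc j) = (W (min t (\<tau> (Suc j))) \<omega> - W (min t (\<tau> j)) \<omega>) - (W (min s (\<tau> (Suc j))) \<omega> - W (min s (\<tau> j)) \<omega>)" if "j < n" for j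
      using that by (simp add: p_def cl)
    have "(\<Sum>j<?N. \<zeta> j \<omega> *v ?D j) = (\<Sum>j<n. \<xi> j \<omega> *v ?D (Suc j))"
      by (subst sum.lessThan_Suc_shift) (simp add: \<zeta>_def)
    also have "\<dots> = simple_integral n \<tau> \<xi> W t \<omega> - simple_integral n \<tau> \<xi> W s \<omega>"
      unfolding simple_integral_def sum_subtractf[symmetric]
      by (intro sum.cong refl) (simp only: lessThan_iff Dj matrix_vector_mult_diff_distrib)
    finally have 1: "(\<Sum>j<?N. \<zeta> j \<omega> *v ?D j) = simple_integral n \<tau> \<xi> W t \<omega> - simple_integral n \<tau> \<xi> W s \<omega>" .
    have "(\<Sum>j<?N. A \<omega> *v ?D j) = A \<omega> *v (\<Sum>j<?N. ?D j)"
      by (rule linear_sum[OF matrix_vector_mul_linear, symmetric])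
    also have "(\<Sum>j<?N. ?D j) = W t \<omega> - W s \<omega>"
      using sum_lessThan_telescope[of "\<lambda>j. W (p j) \<omega>" ?N] by (simp only: p0 pN)
    finally show ?thesis unfolding \<eta>_def matrix_vector_mult_diff_rdistrib sum_subtractf 1 by simp
  qed
  have proc: "simple_process n \<tau> \<xi> r \<omega> = \<zeta> j \<omega>" if j: "j < ?N" and r: "p j < r" "r \<le> p (Suc j)" for j r \<omega>
  proof -
    have sr: "s < r" using ps[of j] r(1) by simp
    have "p (Suc j) \<le> t" by (simp add: p_def cst)
    then have rt: "r \<le> t" using r(2) by simp
    have c1: "c x < r \<longleftrightarrow> x < r" for x using sr rt by (auto simp: c_def)
    have c2: "r \<le> c x \<longleftrightarrow> r \<le> x" for x using c1[of x] by linarith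
    have ind: "indicator {\<tau> i<..\<tau> (Suc i)} r *\<^sub>R \<xi> i \<omega> = (if Suc i = j then \<xi> i \<omega> else 0)" if i: "i < n" for i
    proof (cases "Suc i = j")
      case True
      then have "p j = c (\<tau> i)" "p (Suc j) = c (\<tau> (Suc i))" using i by (auto simp: p_def)
      then show ?thesis using r c1 c2 True by simp
    next
      case False
      then consider "Suc i < j" | "j \<le> i" by linarith
      then have "\<not> (\<tau> i < r \<and> r \<le> \<tau> (Suc i))"
      proof cases
        case 1
        then have "\<tau> (j - 1) < r" using r(1) j c1 by (simp add: p_def)
        moreover have "\<tau> (Suc i) \<le> \<tau> (j - 1)" using 1 j by (intro \<tau>m) auto
        ultimately show ?thesis by simp
      next
        case 2
        then have "r \<le> \<tau> j" using r(2) i c2 by (simp add: p_def)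
        moreover have "\<tau> j \<le> \<tau> i" using 2 i by (intro \<tau>m) auto
        ultimately show ?thesis by simp
      qed
      then show ?thesis using False by auto
    qed
    have "simple_process n \<tau> \<xi> r \<omega> = (\<Sum>i<n. if Suc i = j then \<xi> i \<omega> else 0)"
      unfolding simple_process_def by (intro sum.cong refl ind) simp
    also have "\<dots> = \<zeta> j \<omega>"
    proof (cases "1 \<le> j \<and> j \<le> n")
      case True
      then have "(\<Sum>i<n. if Suc i = j then \<xi> i \<omega> else 0) = (\<Sum>i<n. if i = j - 1 then \<xi> i \<omega> else 0)"
        by (intro sum.cong) auto
      moreover have "j - 1 < n" using True by linarith
      ultimately show ?thesis using True by (simp add: \<zeta>_def)
    next
      case False
      then show ?thesis by (auto simp: \<zeta>_def intro!: sum.neutral)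
    qed
    finally show ?thesis .
  qed
  have "sq_moment M (\<lambda>\<omega>. Z \<omega> + (\<Sum>j<?N. \<eta> j \<omega> *v (W (p (Suc j)) \<omega> - W (p j) \<omega>)))
      = sq_moment M Z + (\<Sum>j<?N. ennreal (p (Suc j) - p j) * sq_moment M (\<eta> j))"
    using sq_moment_elementary_integral[of p ?N Z \<eta>] pm \<eta>F Z st by (simp only: p0)
  also have "(\<Sum>j<?N. ennreal (p (Suc j) - p j) * sq_moment M (\<eta> j)) =
    (\<integral>\<^sup>+\<omega>. (\<Sum>j<?N. ennreal (p (Suc j) - p j) * ennreal ((norm (\<eta> j \<omega>))\<^sup>2)) \<partial>M)"
    unfolding sq_moment_def using \<eta>M by (subst nn_integral_sum) (auto simp: nn_integral_cmult)
  also have "\<dots> = (\<integral>\<^sup>+\<omega>. (\<integral>\<^sup>+r. ennreal ((norm (simple_process n \<tau> \<xi> r \<omega> - A \<omega>))\<^sup>2) * indicator {s<..t} r \<partial>lborel) \<partial>M)"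
  proof (rule nn_integral_cong)
    fix \<omega>
    have "(\<integral>\<^sup>+r. ennreal ((norm (simple_process n \<tau> \<xi> r \<omega> - A \<omega>))\<^sup>2) * indicator {p 0<..p ?N} r \<partial>lborel)
      = (\<Sum>j<?N. ennreal (p (Suc j) - p j) * ennreal ((norm (\<eta> j \<omega>))\<^sup>2))"
      by (rule nn_integral_step[THEN conjunct1]) (auto simp: pm proc \<eta>_def)
    then show "(\<Sum>j<?N. ennreal (p (Suc j) - p j) * ennreal ((norm (\<eta> j \<omega>))\<^sup>2)) =
      (\<integral>\<^sup>+r. ennreal ((norm (simple_process n \<tau> \<xi> r \<omega> - A \<omega>))\<^sup>2) * indicator {s<..t} r \<partial>lborel)"
      unfolding p0 pN ..
  qed
  finally show ?thesis unfolding sumid by (simp add: add_diff_eq)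
qed

section \<open>From simple integrands to Ito integrals\<close>

lemma iterated_time_integral:
  fixes s t :: real
  assumes h: "(\<lambda>(r, \<omega>). h r \<omega>) \<in> borel_measurable (restrict_space borel {s..t} \<Otimes>\<^sub>M M)"
  shows "(\<integral>\<^sup>+\<omega>. (\<integral>\<^sup>+r\<in>{s..t}. h r \<omega> \<partial>lborel) \<partial>M) =
     (\<integral>\<^sup>+z. (case z of (r, \<omega>) \<Rightarrow> h r \<omega>) \<partial>(restrict_space lborel {s..t} \<Otimes>\<^sub>M M))"
    "(\<integral>\<^sup>+\<omega>. (\<integral>\<^sup>+r\<in>{s..t}. h r \<omega> \<partial>lborel) \<partial>M) = (\<integral>\<^sup>+r\<in>{s..t}. (\<integral>\<^sup>+\<omega>. h r \<omega> \<partial>M) \<partial>lborel)"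
proof -
  have sfl: "sigma_finite_measure (restrict_space lborel {s..t})"
    by (rule sigma_finite_measure_restrict_space) (auto intro: lborel.sigma_finite_measure_axioms)
  interpret L: sigma_finite_measure "restrict_space lborel {s..t}" by (rule sfl)
  interpret P: pair_sigma_finite "restrict_space lborel {s..t}" M ..
  have h': "(\<lambda>(r, \<omega>). h r \<omega>) \<in> borel_measurable (restrict_space lborel {s..t} \<Otimes>\<^sub>M M)"
    using h by (simp cong: measurable_cong_sets sets_pair_measure_cong add: sets_restrict_space)
  show "(\<integral>\<^sup>+\<omega>. (\<integral>\<^sup>+r\<in>{s..t}. h r \<omega> \<partial>lborel) \<partial>M) =
     (\<integral>\<^sup>+z. (case z of (r, \<omega>) \<Rightarrow> h r \<omega>) \<partial>(restrict_space lborel {s..t} \<Otimes>\<^sub>M M))"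
    using P.nn_integral_snd[OF h'] by (simp add: nn_integral_restrict_space)
  show "(\<integral>\<^sup>+\<omega>. (\<integral>\<^sup>+r\<in>{s..t}. h r \<omega> \<partial>lborel) \<partial>M) = (\<integral>\<^sup>+r\<in>{s..t}. (\<integral>\<^sup>+\<omega>. h r \<omega> \<partial>M) \<partial>lborel)"
    using P.Fubini'[OF h'] by (simp add: nn_integral_restrict_space)
qed

lemma progressive_measurable:
  fixes H :: "real \<Rightarrow> 'w \<Rightarrow> 'a::topological_space"
  assumes H: "progressive F H" and st: "0 \<le> s" "s \<le> t"
  shows "(\<lambda>(r, \<omega>). H r \<omega>) \<in> borel_measurable (restrict_space borel {s..t} \<Otimes>\<^sub>M M)"
proof -
  have 1: "(\<lambda>(r, \<omega>). H r \<omega>) \<in> borel_measurable (restrict_space borel {0..t} \<Otimes>\<^sub>M F t)"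
    using H st by (auto simp: progressive_def)
  have "fst \<in> measurable (restrict_space borel {s..t} \<Otimes>\<^sub>M M) (restrict_space borel {0..t})"
    by (rule measurable_compose[OF measurable_fst]) (use st in \<open>auto intro!: measurable_restrict_space3\<close>)
  moreover have "snd \<in> measurable (restrict_space borel {s..t} \<Otimes>\<^sub>M M) (F t)"
    by (rule measurable_compose[OF measurable_snd measurable_M_F]) (use st in simp)
  ultimately have "(\<lambda>z. (fst z, snd z)) \<in> measurable (restrict_space borel {s..t} \<Otimes>\<^sub>M M) (restrict_space borel {0..t} \<Otimes>\<^sub>M F t)"
    by (rule measurable_Pair)
  from measurable_compose[OF this 1] show ?thesis by simp
qed

lemma nn_integral_half_open:
  "(\<integral>\<^sup>+r. g r * indicator {s<..t} r \<partial>lborel) = (\<integral>\<^sup>+r\<in>{s..t}. g r \<partial>lborel)" for g :: "real \<Rightarrow> ennreal"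
  by (intro nn_integral_cong_AE AE_I[where N="{s}"]) (auto simp: indicator_def)

text \<open>Both sides pass to the limit along the approximating simple integrands;
  \<open>sq_moment_tendsto\<close> is applied once on \<open>M\<close> and once on the product of
  the time window with \<open>M\<close>. The matrix \<open>A\<close> is there for the Euler scheme,
  whose diffusion coefficient is frozen at the left end; with \<open>A\<close> equal to 0 it is the
  usual isometry together with the orthogonality of \<open>Z\<close>.\<close>

lemma ito_isometry:
  fixes Z :: "'w \<Rightarrow> real^'d" and A :: "'w \<Rightarrow> real^'q^'d"
  assumes ito: "ito_integral M F W H J" and st: "0 \<le> s" "s \<le> t"
    and Z: "Z \<in> borel_measurable (F s)" "sq_moment M Z < \<infinity>"
    and A: "A \<in> borel_measurable (F s)" "sq_moment M A < \<infinity>"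
  shows "sq_moment M (\<lambda>\<omega>. Z \<omega> + (J t \<omega> - J s \<omega>) - A \<omega> *v (W t \<omega> - W s \<omega>))
    = sq_moment M Z + (\<integral>\<^sup>+\<omega>. (\<integral>\<^sup>+r\<in>{s..t}. ennreal ((norm (H r \<omega> - A \<omega>))\<^sup>2) \<partial>lborel) \<partial>M)"
    and "(\<integral>\<^sup>+\<omega>. (\<integral>\<^sup>+r\<in>{s..t}. ennreal ((norm (H r \<omega> - A \<omega>))\<^sup>2) \<partial>lborel) \<partial>M) < \<infinity>"
proof -
  have prog: "progressive F H" and Jm: "\<And>t. 0 \<le> t \<Longrightarrow> J t \<in> borel_measurable M"
    using ito by (auto simp: ito_integral_def)
  from ito obtain n \<tau> \<xi> where si: "\<And>k. simple_integrand M F (n k) (\<tau> k) (\<xi> k)"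
    and lim1: "\<And>T. 0 \<le> T \<Longrightarrow> (\<lambda>k. \<integral>\<^sup>+\<omega>. (\<integral>\<^sup>+t\<in>{0..T}. ennreal ((norm (simple_process (n k) (\<tau> k) (\<xi> k) t \<omega> - H t \<omega>))\<^sup>2) \<partial>lborel) \<partial>M) \<longlonglongrightarrow> 0"
    and lim2: "\<And>T. 0 \<le> T \<Longrightarrow> (\<lambda>k. sq_moment M (\<lambda>\<omega>. simple_integral (n k) (\<tau> k) (\<xi> k) W T \<omega> - J T \<omega>)) \<longlonglongrightarrow> 0"
    unfolding ito_integral_def by blast
  let ?I = "\<lambda>k t \<omega>. simple_integral (n k) (\<tau> k) (\<xi> k) W t \<omega>"
  let ?P = "\<lambda>k r \<omega>. simple_process (n k) (\<tau> k) (\<xi> k) r \<omega>"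
  have t0: "0 \<le> t" using st by simp
  have Zm: "Z \<in> borel_measurable M" and Am: "A \<in> borel_measurable M" using measurable_F_M[OF st(1)] Z(1) A(1) by auto
  have Wm: "W x \<in> borel_measurable M" if "0 \<le> x" for x using measurable_F_M[OF that W_measurable[OF that]] .
  have \<tau>nn: "0 \<le> \<tau> k i" if "i \<le> n k" for k i
    using that
  proof (induction i)
    case 0 show ?case using si[of k] by (simp add: simple_integrand_def)
  next
    case (Suc i)
    then have "\<tau> k i < \<tau> k (Suc i)" using si[of k] by (simp add: simple_integrand_def)
    then show ?case using Suc by simp
  qed
  have \<xi>m: "\<xi> k i \<in> borel_measurable M" if "i < n k" for k i
    using measurable_F_M[OF \<tau>nn[of i k], of "\<xi> k i" borel] that si[of k] by (auto simp: simple_integrand_def)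
  have Im: "?I k x \<in> borel_measurable M" if "0 \<le> x" for k x
    unfolding simple_integral_def
    by (intro borel_measurable_sum borel_measurable_matrix_vector_mult \<xi>m borel_measurable_diff Wm) (use that \<tau>nn[of _ k] in \<open>auto simp: min_def\<close>)
  let ?L = "restrict_space borel {s..t} \<Otimes>\<^sub>M M"
  have Pm: "(\<lambda>(r, \<omega>). ?P k r \<omega>) \<in> borel_measurable ?L" for k
  proof -
    have "(\<lambda>z. \<Sum>i<n k. indicator {\<tau> k i<..\<tau> k (Suc i)} (fst z) *\<^sub>R \<xi> k i (snd z)) \<in> borel_measurable ?L"
      using \<xi>m by (intro borel_measurable_sum borel_measurable_scaleR measurable_compose[OF measurable_fst] measurable_compose[OF measurable_snd])
                  (auto intro!: measurable_restrict_space1)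
    then show ?thesis by (simp add: simple_process_def case_prod_beta')
  qed
  have Hm: "(\<lambda>(r, \<omega>). H r \<omega>) \<in> borel_measurable ?L" by (rule progressive_measurable[OF prog st])
  have A2: "(\<lambda>(r, \<omega>). A \<omega>) \<in> borel_measurable ?L"
    using measurable_compose[OF measurable_snd Am] by (simp add: case_prod_beta')
  have setsL: "sets (restrict_space lborel {s..t} \<Otimes>\<^sub>M M) = sets ?L"
    by (intro sets_pair_measure_cong) (auto simp: sets_restrict_space)
  let ?N = "restrict_space lborel {s..t} \<Otimes>\<^sub>M M"
  have nest: "(\<integral>\<^sup>+\<omega>. (\<integral>\<^sup>+r\<in>{s..t}. ennreal ((norm (f r \<omega>))\<^sup>2) \<partial>lborel) \<partial>M) = sq_moment ?N (\<lambda>(r, \<omega>). f r \<omega>)"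
    if "(\<lambda>(r, \<omega>). f r \<omega>) \<in> borel_measurable ?L" for f :: "real \<Rightarrow> 'w \<Rightarrow> real^'q^'d"
  proof -
    have "(\<lambda>(r, \<omega>). ennreal ((norm (f r \<omega>))\<^sup>2)) \<in> borel_measurable ?L"
      using that unfolding case_prod_beta' by measurable
    from iterated_time_integral(1)[OF this] show ?thesis
      unfolding sq_moment_def by (simp add: case_prod_beta')
  qed
  have PAm: "(\<lambda>(r, \<omega>). ?P k r \<omega> - A \<omega>) \<in> borel_measurable ?L" for k
    using Pm[of k] A2 unfolding case_prod_beta' by measurable
  have HAm: "(\<lambda>(r, \<omega>). H r \<omega> - A \<omega>) \<in> borel_measurable ?L"
    using Hm A2 unfolding case_prod_beta' by measurable
  have PHm: "(\<lambda>(r, \<omega>). ?P k r \<omega> - H r \<omega>) \<in> borel_measurable ?L" for k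
    using Pm[of k] Hm unfolding case_prod_beta' by measurable
  define f where "f k \<omega> = Z \<omega> + (?I k t \<omega> - ?I k s \<omega>) - A \<omega> *v (W t \<omega> - W s \<omega>)" for k \<omega>
  define g where "g \<omega> = Z \<omega> + (J t \<omega> - J s \<omega>) - A \<omega> *v (W t \<omega> - W s \<omega>)" for \<omega>
  have AWm: "(\<lambda>\<omega>. A \<omega> *v (W t \<omega> - W s \<omega>)) \<in> borel_measurable M" using Wm st t0 Am by (intro borel_measurable_matrix_vector_mult) auto
  have fm: "f k \<in> borel_measurable M" for k unfolding f_def using Zm Im[OF t0, of k] Im[OF st(1), of k] AWm by measurable
  have gm: "g \<in> borel_measurable M" unfolding g_def using Zm Jm[OF t0] Jm[OF st(1)] AWm by measurable
  have iso: "sq_moment M (f k) = sq_moment M Z + sq_moment ?N (\<lambda>(r, \<omega>). ?P k r \<omega> - A \<omega>)" for k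
    unfolding f_def simple_integral_isometry[OF si st Z(1) A(1)] nn_integral_half_open nest[OF PAm] ..
  have Pfin: "sq_moment ?N (\<lambda>(r, \<omega>). ?P k r \<omega> - A \<omega>) < \<infinity>" for k
  proof -
    have "\<exists>C. \<forall>\<omega>\<in>space M. norm (\<xi> k i \<omega>) \<le> C" if "i < n k" for i
      using si[of k] that by (auto simp: simple_integrand_def)
    then obtain C where C: "\<And>i \<omega>. i < n k \<Longrightarrow> \<omega> \<in> space M \<Longrightarrow> norm (\<xi> k i \<omega>) \<le> C i" by metis
    define D where "D = (\<Sum>i<n k. \<bar>C i\<bar>)"
    have bd: "norm (?P k r \<omega>) \<le> D" if "\<omega> \<in> space M" for r \<omega>
      unfolding simple_process_def D_def
      by (intro sum_norm_le) (use C[OF _ that] in \<open>auto simp: indicator_def intro: order_trans[OF _ abs_ge_self]\<close>)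
    have "sq_moment ?N (\<lambda>(r, \<omega>). ?P k r \<omega> - A \<omega>) = (\<integral>\<^sup>+\<omega>. (\<integral>\<^sup>+r\<in>{s..t}. ennreal ((norm (?P k r \<omega> - A \<omega>))\<^sup>2) \<partial>lborel) \<partial>M)"
      by (rule nest[OF PAm, symmetric])
    also have "\<dots> \<le> (\<integral>\<^sup>+\<omega>. (2 * ennreal (D\<^sup>2) + 2 * ennreal ((norm (A \<omega>))\<^sup>2)) * ennreal (t - s) \<partial>M)"
    proof (rule nn_integral_mono)
      fix \<omega> assume \<omega>: "\<omega> \<in> space M"
      have "ennreal ((norm (?P k r \<omega> - A \<omega>))\<^sup>2) \<le> 2 * ennreal (D\<^sup>2) + 2 * ennreal ((norm (A \<omega>))\<^sup>2)" for r
      proof -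
        have "(norm (?P k r \<omega> - A \<omega>))\<^sup>2 \<le> 2 * (norm (?P k r \<omega>))\<^sup>2 + 2 * (norm (A \<omega>))\<^sup>2"
          using sq_sum_le_weighted[of 1 "?P k r \<omega>" "- A \<omega>"] by simp
        also have "(norm (?P k r \<omega>))\<^sup>2 \<le> D\<^sup>2" using bd[OF \<omega>] by (intro power_mono) auto
        finally have "ennreal ((norm (?P k r \<omega> - A \<omega>))\<^sup>2) \<le> ennreal (2 * D\<^sup>2 + 2 * (norm (A \<omega>))\<^sup>2)" by (intro ennreal_leI) simp
        then show ?thesis by (simp add: ennreal_plus ennreal_mult)
      qed
      then have "(\<integral>\<^sup>+r\<in>{s..t}. ennreal ((norm (?P k r \<omega> - A \<omega>))\<^sup>2) \<partial>lborel) \<le> (\<integral>\<^sup>+r. (2 * ennreal (D\<^sup>2) + 2 * ennreal ((norm (A \<omega>))\<^sup>2)) * indicator {s..t} r \<partial>lborel)"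
        by (intro nn_integral_mono mult_right_mono) auto
      also have "\<dots> = (2 * ennreal (D\<^sup>2) + 2 * ennreal ((norm (A \<omega>))\<^sup>2)) * ennreal (t - s)"
        using st by (simp add: nn_integral_cmult_indicator)
      finally show "(\<integral>\<^sup>+r\<in>{s..t}. ennreal ((norm (?P k r \<omega> - A \<omega>))\<^sup>2) \<partial>lborel) \<le> (2 * ennreal (D\<^sup>2) + 2 * ennreal ((norm (A \<omega>))\<^sup>2)) * ennreal (t - s)" .
    qed
    also have "\<dots> = (2 * ennreal (D\<^sup>2) + 2 * sq_moment M A) * ennreal (t - s)"
      unfolding sq_moment_def using Am by (simp add: nn_integral_multc nn_integral_add nn_integral_cmult emeasure_space_1)
    also have "\<dots> < \<infinity>" using A(2) by (auto simp: ennreal_mult_less_top)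
    finally show ?thesis .
  qed
  have L1: "(\<lambda>k. sq_moment M (f k)) \<longlonglongrightarrow> sq_moment M g"
  proof (rule sq_moment_tendsto(1)[OF fm gm])
    show "sq_moment M (f k) < \<infinity>" for k unfolding iso using Z(2) Pfin[of k] by simp
    have "(\<lambda>k. 2 * sq_moment M (\<lambda>\<omega>. ?I k t \<omega> - J t \<omega>) + 2 * sq_moment M (\<lambda>\<omega>. ?I k s \<omega> - J s \<omega>)) \<longlonglongrightarrow> 2 * 0 + 2 * 0"
      by (intro tendsto_add ennreal_tendsto_cmult lim2 t0 st) auto
    then have up: "(\<lambda>k. 2 * sq_moment M (\<lambda>\<omega>. ?I k t \<omega> - J t \<omega>) + 2 * sq_moment M (\<lambda>\<omega>. ?I k s \<omega> - J s \<omega>)) \<longlonglongrightarrow> 0" by simp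
    have "sq_moment M (\<lambda>\<omega>. f k \<omega> - g \<omega>) \<le> 2 * sq_moment M (\<lambda>\<omega>. ?I k t \<omega> - J t \<omega>) + 2 * sq_moment M (\<lambda>\<omega>. ?I k s \<omega> - J s \<omega>)" for k
    proof -
      have "f k \<omega> - g \<omega> = (?I k t \<omega> - J t \<omega>) - (?I k s \<omega> - J s \<omega>)" for \<omega> by (simp add: f_def g_def)
      then show ?thesis using Im[OF t0, of k] Im[OF st(1), of k] Jm[OF t0] Jm[OF st(1)] by (simp only:) (intro sq_moment_diff_le2 borel_measurable_diff)
    qed
    then show "(\<lambda>k. sq_moment M (\<lambda>\<omega>. f k \<omega> - g \<omega>)) \<longlonglongrightarrow> 0"
      by (intro tendsto_sandwich[OF _ _ tendsto_const up]) auto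
  qed
  have conv: "(\<lambda>k. sq_moment ?N (\<lambda>z. (case z of (r, \<omega>) \<Rightarrow> ?P k r \<omega> - A \<omega>) - (case z of (r, \<omega>) \<Rightarrow> H r \<omega> - A \<omega>))) \<longlonglongrightarrow> 0"
  proof -
    have eq: "(\<lambda>z. (case z of (r, \<omega>) \<Rightarrow> ?P k r \<omega> - A \<omega>) - (case z of (r, \<omega>) \<Rightarrow> H r \<omega> - A \<omega>)) = (\<lambda>(r, \<omega>). ?P k r \<omega> - H r \<omega>)" for k
      by auto
    have "sq_moment ?N (\<lambda>(r, \<omega>). ?P k r \<omega> - H r \<omega>) \<le> (\<integral>\<^sup>+\<omega>. (\<integral>\<^sup>+r\<in>{0..t}. ennreal ((norm (?P k r \<omega> - H r \<omega>))\<^sup>2) \<partial>lborel) \<partial>M)" for k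
      unfolding nest[OF PHm, symmetric] using st by (intro nn_integral_mono mult_left_mono) (auto simp: indicator_def)
    then show ?thesis unfolding eq by (intro tendsto_sandwich[OF _ _ tendsto_const lim1[OF t0]]) auto
  qed
  have Nm: "(\<lambda>(r, \<omega>). ?P k r \<omega> - A \<omega>) \<in> borel_measurable ?N" "(\<lambda>(r, \<omega>). H r \<omega> - A \<omega>) \<in> borel_measurable ?N" for k
    using PAm[of k] HAm measurable_cong_sets[OF setsL refl] by blast+
  note L2 = sq_moment_tendsto[OF Nm(1) Nm(2) Pfin conv]
  have "(\<lambda>k. sq_moment M (f k)) \<longlonglongrightarrow> sq_moment M Z + sq_moment ?N (\<lambda>(r, \<omega>). H r \<omega> - A \<omega>)"
    unfolding iso by (intro tendsto_add tendsto_const L2(1))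
  from LIMSEQ_unique[OF L1 this] show "sq_moment M (\<lambda>\<omega>. Z \<omega> + (J t \<omega> - J s \<omega>) - A \<omega> *v (W t \<omega> - W s \<omega>))
    = sq_moment M Z + (\<integral>\<^sup>+\<omega>. (\<integral>\<^sup>+r\<in>{s..t}. ennreal ((norm (H r \<omega> - A \<omega>))\<^sup>2) \<partial>lborel) \<partial>M)"
    unfolding nest[OF HAm] by (simp add: g_def[abs_def])
  show "(\<integral>\<^sup>+\<omega>. (\<integral>\<^sup>+r\<in>{s..t}. ennreal ((norm (H r \<omega> - A \<omega>))\<^sup>2) \<partial>lborel) \<partial>M) < \<infinity>"
    unfolding nest[OF HAm] by (rule L2(2))
qed

end

section \<open>Time integrals of continuous processes\<close>

lemma integral_partition:
  fixes f :: "real \<Rightarrow> 'a::euclidean_space"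
  assumes p: "\<And>i. i < N \<Longrightarrow> p i \<le> p (Suc i)" and f: "continuous_on {p 0..p N} f"
  shows "integral {p 0..p N} f = (\<Sum>i<N. integral {p i..p (Suc i)} f) \<and> p 0 \<le> p N"
  using assms
proof (induction N)
  case (Suc N)
  have pN: "p N \<le> p (Suc N)" using Suc.prems by simp
  note step = Suc.prems(1)
  have "k \<le> N \<Longrightarrow> p 0 \<le> p k" for k
  proof (induction k)
    case (Suc k)
    have "p k \<le> p (Suc k)" using Suc.prems by (intro step) simp
    then show ?case using Suc by simp
  qed simp
  then have "p 0 \<le> p N" by simp
  have "continuous_on {p 0..p N} f" by (rule continuous_on_subset[OF Suc.prems(2)]) (use pN in auto)
  then have IH: "integral {p 0..p N} f = (\<Sum>i<N. integral {p i..p (Suc i)} f)"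
    using Suc.IH step by simp
  have "integral {p 0..p N} f + integral {p N..p (Suc N)} f = integral {p 0..p (Suc N)} f"
    using \<open>p 0 \<le> p N\<close> pN Suc.prems(2) by (intro Henstock_Kurzweil_Integration.integral_combine integrable_continuous_real)
  then show ?case using IH \<open>p 0 \<le> p N\<close> pN by simp
qed simp

definition riemann_sum :: "real \<Rightarrow> real \<Rightarrow> (real \<Rightarrow> 'a::real_vector) \<Rightarrow> nat \<Rightarrow> 'a" where
  "riemann_sum s t f n = (\<Sum>i<Suc n. ((t - s) / real (Suc n)) *\<^sub>R f (s + (t - s) / real (Suc n) * real (Suc i)))"

lemma riemann_point: 
  assumes "s \<le> t" "i \<le> Suc n" shows "s + (t - s) / real (Suc n) * real i \<in> {s..t::real}"
proof -
  have "(t - s) / real (Suc n) * real i \<le> (t - s) / real (Suc n) * real (Suc n)"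
    using assms by (intro mult_left_mono) auto
  also have "\<dots> = t - s" by simp
  finally show ?thesis using assms by simp
qed

lemma riemann_sum_tendsto:
  fixes f :: "real \<Rightarrow> 'a::euclidean_space"
  assumes st: "s \<le> t" and f: "continuous_on {s..t} f"
  shows "riemann_sum s t f \<longlonglongrightarrow> integral {s..t} f"
proof (rule LIMSEQ_I)
  fix e :: real assume e: "0 < e"
  define D where "D = t - s + 1"
  define e' where "e' = e / (2 * D)"
  have D: "0 < D" using st by (simp add: D_def)
  have e': "0 < e'" using e D by (simp add: e'_def)
  have "uniformly_continuous_on {s..t} f" using f by (intro compact_uniformly_continuous) auto
  then obtain d where d: "0 < d" "\<And>x y. x \<in> {s..t} \<Longrightarrow> y \<in> {s..t} \<Longrightarrow> dist y x < d \<Longrightarrow> dist (f y) (f x) < e'"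
    using e' unfolding uniformly_continuous_on_def by meson
  obtain n0 :: nat where n0: "(t - s) / d < real n0" using reals_Archimedean2 by blast
  show "\<exists>no. \<forall>n\<ge>no. norm (riemann_sum s t f n - integral {s..t} f) < e"
  proof (intro exI allI impI)
    fix n assume n: "n0 \<le> n"
    define w where "w = (t - s) / real (Suc n)"
    define p where "p i = s + w * real i" for i
    have w0: "0 \<le> w" using st by (simp add: w_def)
    have wd: "w < d"
    proof -
      have "(t - s) / d < real (Suc n)" using n0 n by linarith
      then show ?thesis using d(1) by (simp add: w_def field_simps)
    qed
    have p: "p i \<le> p (Suc i)" "p (Suc i) - p i = w" for i using w0 by (auto simp: p_def algebra_simps)
    have pe: "p 0 = s" "p (Suc n) = t" by (auto simp: p_def w_def)
    have pin: "p i \<in> {s..t}" if "i \<le> Suc n" for i using riemann_point[OF st that] by (simp add: p_def w_def)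
    have sub: "{p i..p (Suc i)} \<subseteq> {s..t}" if "i < Suc n" for i using pin[of i] pin[of "Suc i"] that by auto
    have "integral {s..t} f = (\<Sum>i<Suc n. integral {p i..p (Suc i)} f)"
      using integral_partition[of "Suc n" p f] p f pe by simp
    moreover have "riemann_sum s t f n = (\<Sum>i<Suc n. w *\<^sub>R f (p (Suc i)))"
      by (simp add: riemann_sum_def p_def w_def)
    ultimately have "norm (riemann_sum s t f n - integral {s..t} f) = norm (\<Sum>i<Suc n. w *\<^sub>R f (p (Suc i)) - integral {p i..p (Suc i)} f)"
      by (simp add: sum_subtractf)
    also have "\<dots> \<le> (\<Sum>i<Suc n. e' * w)"
    proof (rule sum_norm_le)
      fix i assume "i \<in> {..<Suc n}"
      then have i: "i < Suc n" by simp
      have fi: "f integrable_on {p i..p (Suc i)}"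
        by (intro integrable_continuous_real continuous_on_subset[OF f sub[OF i]])
      have "w *\<^sub>R f (p (Suc i)) - integral {p i..p (Suc i)} f = integral {p i..p (Suc i)} (\<lambda>r. f (p (Suc i)) - f r)"
        using p[of i] fi by (subst Henstock_Kurzweil_Integration.integral_diff) auto
      also have "norm \<dots> \<le> integral {p i..p (Suc i)} (\<lambda>r. e')"
      proof (rule integral_norm_bound_integral)
        show "(\<lambda>r. f (p (Suc i)) - f r) integrable_on {p i..p (Suc i)}" using fi by (intro integrable_diff) auto
        fix r assume r: "r \<in> {p i..p (Suc i)}"
        have "dist (p (Suc i)) r < d" using r p[of i] wd by (auto simp: dist_real_def)
        then show "norm (f (p (Suc i)) - f r) \<le> e'"
          using d(2)[of r "p (Suc i)"] r sub[OF i] pin[of "Suc i"] i by (auto simp: dist_norm less_imp_le)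
      qed auto
      also have "\<dots> = e' * w" using p[of i] by (simp add: mult.commute)
      finally show "norm (w *\<^sub>R f (p (Suc i)) - integral {p i..p (Suc i)} f) \<le> e' * w" .
    qed
    also have "\<dots> = e' * (t - s)" by (simp add: w_def)
    also have "\<dots> < e"
    proof -
      have "e' * (t - s) \<le> e' * D" using e' by (simp add: D_def)
      also have "\<dots> = e / 2" using D by (simp add: e'_def)
      finally show ?thesis using e by simp
    qed
    finally show "norm (riemann_sum s t f n - integral {s..t} f) < e" .
  qed
qed

lemma norm_riemann_sum_sq_le:
  fixes f :: "real \<Rightarrow> 'a::real_inner"
  assumes "s \<le> t"
  shows "(norm (riemann_sum s t f n))\<^sup>2 \<le> (t - s)\<^sup>2 / real (Suc n) * (\<Sum>i<Suc n. (norm (f (s + (t - s) / real (Suc n) * real (Suc i))))\<^sup>2)"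
proof -
  let ?x = "\<lambda>i. s + (t - s) / real (Suc n) * real (Suc i)" and ?w = "(t - s) / real (Suc n)"
  have "norm (riemann_sum s t f n) \<le> (\<Sum>i<Suc n. norm (?w *\<^sub>R f (?x i)))"
    unfolding riemann_sum_def by (rule norm_sum)
  also have "\<dots> = ?w * (\<Sum>i<Suc n. norm (f (?x i)))"
    using assms by (subst sum_distrib_left) (intro sum.cong refl, simp)
  finally have "(norm (riemann_sum s t f n))\<^sup>2 \<le> (?w * (\<Sum>i<Suc n. norm (f (?x i))))\<^sup>2" by (intro power_mono) auto
  also have "\<dots> = ?w\<^sup>2 * (\<Sum>i<Suc n. norm (f (?x i)))\<^sup>2" by (rule power_mult_distrib)
  also have "\<dots> \<le> ?w\<^sup>2 * ((\<Sum>i<Suc n. (norm (f (?x i)))\<^sup>2) * real (card {..<Suc n}))"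
    by (intro mult_left_mono sum_squared_le_sum_of_squares) auto
  also have "\<dots> = (t - s)\<^sup>2 / real (Suc n) * (\<Sum>i<Suc n. (norm (f (?x i)))\<^sup>2)"
    by (simp add: power_divide power2_eq_square del: sum.lessThan_Suc of_nat_Suc)
  finally show ?thesis .
qed

text \<open>Riemann sums are used so that measurability at single times suffices: each sum is
  bounded by the Cauchy-Schwarz inequality, and Fatou's lemma transfers the bound to the
  integral.\<close>

lemma sq_moment_time_integral_le:
  fixes Y :: "real \<Rightarrow> 'w \<Rightarrow> 'a::euclidean_space"
  assumes st: "s \<le> t" and Ym: "\<And>r. r \<in> {s..t} \<Longrightarrow> Y r \<in> borel_measurable M"
    and cont: "AE \<omega> in M. continuous_on {s..t} (\<lambda>r. Y r \<omega>)"
    and K: "0 \<le> K" "\<And>r. r \<in> {s..t} \<Longrightarrow> sq_moment M (Y r) \<le> ennreal K"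
  shows "sq_moment M (\<lambda>\<omega>. integral {s..t} (\<lambda>r. Y r \<omega>)) \<le> ennreal ((t - s)\<^sup>2 * K)"
proof -
  let ?R = "\<lambda>n \<omega>. riemann_sum s t (\<lambda>r. Y r \<omega>) n"
  let ?x = "\<lambda>n i. s + (t - s) / real (Suc n) * real (Suc i)"
  have xin: "?x n i \<in> {s..t}" if "i < Suc n" for n i by (rule riemann_point[OF st]) (use that in simp)
  have Yx: "Y (?x n i) \<in> borel_measurable M" if "i < Suc n" for n i by (rule Ym[OF xin[OF that]])
  have Rm: "?R n \<in> borel_measurable M" for n
    unfolding riemann_sum_def by (intro borel_measurable_sum borel_measurable_scaleR Yx) auto
  have le: "(\<integral>\<^sup>+\<omega>. ennreal ((norm (?R n \<omega>))\<^sup>2) \<partial>M) \<le> ennreal ((t - s)\<^sup>2 * K)" for n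
  proof -
    have "(\<integral>\<^sup>+\<omega>. ennreal ((norm (?R n \<omega>))\<^sup>2) \<partial>M) \<le> (\<integral>\<^sup>+\<omega>. ennreal ((t - s)\<^sup>2 / real (Suc n)) * (\<Sum>i<Suc n. ennreal ((norm (Y (?x n i) \<omega>))\<^sup>2)) \<partial>M)"
    proof (rule nn_integral_mono)
      fix \<omega>
      have "ennreal ((norm (?R n \<omega>))\<^sup>2) \<le> ennreal ((t - s)\<^sup>2 / real (Suc n) * (\<Sum>i<Suc n. (norm (Y (?x n i) \<omega>))\<^sup>2))"
        by (rule ennreal_leI[OF norm_riemann_sum_sq_le[OF st]])
      also have "\<dots> = ennreal ((t - s)\<^sup>2 / real (Suc n)) * ennreal (\<Sum>i<Suc n. (norm (Y (?x n i) \<omega>))\<^sup>2)"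
        by (intro ennreal_mult sum_nonneg) auto
      also have "ennreal (\<Sum>i<Suc n. (norm (Y (?x n i) \<omega>))\<^sup>2) = (\<Sum>i<Suc n. ennreal ((norm (Y (?x n i) \<omega>))\<^sup>2))"
        by (rule sum_ennreal[symmetric]) simp
      finally show "ennreal ((norm (?R n \<omega>))\<^sup>2) \<le> ennreal ((t - s)\<^sup>2 / real (Suc n)) * (\<Sum>i<Suc n. ennreal ((norm (Y (?x n i) \<omega>))\<^sup>2))" .
    qed
    also have "\<dots> = ennreal ((t - s)\<^sup>2 / real (Suc n)) * (\<Sum>i<Suc n. sq_moment M (Y (?x n i)))"
    proof -
      have 1: "(\<lambda>\<omega>. ennreal ((norm (Y (?x n i) \<omega>))\<^sup>2)) \<in> borel_measurable M" if "i \<in> {..<Suc n}" for i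
      proof -
        have "Y (?x n i) \<in> borel_measurable M" by (rule Yx) (use that in simp)
        then show ?thesis by measurable
      qed
      show ?thesis unfolding sq_moment_def
        by (subst nn_integral_cmult[OF borel_measurable_sum[OF 1]], assumption, subst nn_integral_sum[OF 1]) auto
    qed
    also have "\<dots> \<le> ennreal ((t - s)\<^sup>2 / real (Suc n)) * (\<Sum>i<Suc n. ennreal K)"
      by (intro mult_left_mono sum_mono K(2) xin) auto
    also have "(\<Sum>i<Suc n. ennreal K) = ennreal (real (Suc n) * K)"
      using sum_ennreal[of "{..<Suc n}" "\<lambda>_. K"] K(1) by (simp only: sum_constant card_lessThan)
    also have "ennreal ((t - s)\<^sup>2 / real (Suc n)) * ennreal (real (Suc n) * K) = ennreal ((t - s)\<^sup>2 / real (Suc n) * (real (Suc n) * K))"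
      using K(1) by (intro ennreal_mult[symmetric]) auto
    also have "(t - s)\<^sup>2 / real (Suc n) * (real (Suc n) * K) = (t - s)\<^sup>2 * K" by simp
    finally show ?thesis .
  qed
  \<comment> \<open>Path continuity makes the sums converge, so the integrand is almost surely the
    limit inferior; Fatou's lemma then asks only for measurability of the sums.\<close>
  have "sq_moment M (\<lambda>\<omega>. integral {s..t} (\<lambda>r. Y r \<omega>)) \<le> (\<integral>\<^sup>+\<omega>. liminf (\<lambda>n. ennreal ((norm (?R n \<omega>))\<^sup>2)) \<partial>M)"
    unfolding sq_moment_def
  proof (rule nn_integral_mono_AE)
    show "AE \<omega> in M. ennreal ((norm (integral {s..t} (\<lambda>r. Y r \<omega>)))\<^sup>2) \<le> liminf (\<lambda>n. ennreal ((norm (?R n \<omega>))\<^sup>2))"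
      using cont
    proof eventually_elim
      case (elim \<omega>)
      have "(\<lambda>n. ennreal ((norm (?R n \<omega>))\<^sup>2)) \<longlonglongrightarrow> ennreal ((norm (integral {s..t} (\<lambda>r. Y r \<omega>)))\<^sup>2)"
        by (intro tendsto_ennrealI tendsto_power tendsto_norm riemann_sum_tendsto[OF st elim])
      from lim_imp_Liminf[OF _ this] show ?case by (simp only: trivial_limit_sequentially not_False_eq_True order_refl)
    qed
  qed
  also have "\<dots> \<le> liminf (\<lambda>n. \<integral>\<^sup>+\<omega>. ennreal ((norm (?R n \<omega>))\<^sup>2) \<partial>M)"
    using Rm by (intro nn_integral_liminf) measurable
  also have "\<dots> \<le> liminf (\<lambda>n. ennreal ((t - s)\<^sup>2 * K))"
    by (intro Liminf_mono always_eventually allI le)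
  also have "\<dots> = ennreal ((t - s)\<^sup>2 * K)" by (simp add: Liminf_const)
  finally show ?thesis .
qed

section \<open>Caratheodory functions and matrix norms\<close>

text \<open>With the second argument replaced by a simple function of it, a finite sum of measurable
  functions remains; continuity in that argument makes these converge pointwise.\<close>

lemma borel_measurable_caratheodory:
  fixes f :: "'v \<Rightarrow> 'a::euclidean_space \<Rightarrow> 'b::euclidean_space"
  assumes m: "\<And>x. (\<lambda>v. f v x) \<in> borel_measurable N" and c: "\<And>v. v \<in> space N \<Longrightarrow> continuous_on UNIV (f v)"
  shows "(\<lambda>z. f (fst z) (snd z)) \<in> borel_measurable (N \<Otimes>\<^sub>M borel)"
proof -
  from borel_measurable_implies_sequence_metric[of "\<lambda>x::'a. x" borel 0]
  obtain Q :: "nat \<Rightarrow> 'a \<Rightarrow> 'a" where Q: "\<And>n. simple_function borel (Q n)" "\<And>x. (\<lambda>n. Q n x) \<longlonglongrightarrow> x" by auto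
  show ?thesis
  proof (rule borel_measurable_LIMSEQ_metric)
    fix n
    have fin: "finite (range (Q n))" using simple_functionD(1)[OF Q(1)] by simp
    have eq: "f v (Q n x) = (\<Sum>k\<in>range (Q n). indicator (Q n -` {k}) x *\<^sub>R f v k)" for v x
    proof -
      have "(\<Sum>k\<in>range (Q n). indicator (Q n -` {k}) x *\<^sub>R f v k) = (\<Sum>k\<in>range (Q n). if k = Q n x then f v k else 0)"
        by (intro sum.cong refl) (auto simp: indicator_def)
      then show ?thesis using fin by simp
    qed
    have Qi: "(\<lambda>z. indicator (Q n -` {k}) (snd z) :: real) \<in> borel_measurable (N \<Otimes>\<^sub>M borel)" for k
      by (rule measurable_compose[OF measurable_snd borel_measurable_indicator])
         (use simple_functionD(2)[OF Q(1)[of n], of "{k}"] in simp)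
    show "(\<lambda>z. f (fst z) (Q n (snd z))) \<in> borel_measurable (N \<Otimes>\<^sub>M borel)"
      unfolding eq
      by (intro borel_measurable_sum borel_measurable_scaleR Qi measurable_compose[OF measurable_fst m])
  next
    fix z assume "z \<in> space (N \<Otimes>\<^sub>M (borel :: 'a measure))"
    then have "fst z \<in> space N" by (auto simp: space_pair_measure)
    from c[OF this] have "isCont (f (fst z)) (snd z)" by (simp add: continuous_on_eq_continuous_at)
    then show "(\<lambda>n. f (fst z) (Q n (snd z))) \<longlonglongrightarrow> f (fst z) (snd z)"
      by (rule isCont_tendsto_compose) (rule Q(2))
  qed
qed

lemma bounded_linear_mat: "bounded_linear (\<lambda>z. (A :: real^'q^'d) *v z)"
  by (rule matrix_vector_mul_bounded_linear)

lemma mat_norm_triangle: "mat_norm (A + B) \<le> mat_norm A + mat_norm (B :: real^'q^'d)"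
  unfolding mat_norm_def matrix_vector_mult_add_rdistrib
  by (rule onorm_triangle[OF bounded_linear_mat bounded_linear_mat])

lemma mat_norm_diff_triangle: "mat_norm (A - C) \<le> mat_norm (A - B) + mat_norm (B - C :: real^'q^'d)"
  using mat_norm_triangle[of "A - B" "B - C"] by simp

lemma mat_norm_nonneg: "0 \<le> mat_norm (A :: real^'q^'d)"
  unfolding mat_norm_def by (rule onorm_pos_le[OF bounded_linear_mat])

text \<open>The squared Frobenius norm sums over the q columns, and each column is the image of a
  unit vector. This conversion is the source of \<open>CARD('q)\<close> in the later
  constants.\<close>

lemma norm_le_mat_norm: "(norm (A :: real^'q^'d))\<^sup>2 \<le> real CARD('q) * (mat_norm A)\<^sup>2"
proof -
  have col: "(norm (A *v axis j 1))\<^sup>2 = (\<Sum>i\<in>UNIV. (A $ i $ j)\<^sup>2)" for j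
    by (simp add: power2_norm_vec matrix_vector_mult_basis column_def)
  have "(norm A)\<^sup>2 = (\<Sum>j\<in>UNIV. (norm (A *v axis j 1))\<^sup>2)"
    unfolding power2_norm_matrix col by (rule sum.swap)
  also have "\<dots> \<le> (\<Sum>j\<in>(UNIV :: 'q set). (mat_norm A)\<^sup>2)"
  proof (intro sum_mono power_mono)
    fix j :: 'q
    have "norm (A *v axis j 1) \<le> onorm ((*v) A) * norm (axis j (1::real))" by (rule onorm[OF bounded_linear_mat])
    then show "norm (A *v axis j 1) \<le> mat_norm A" by (simp add: mat_norm_def norm_axis_1)
  qed auto
  finally show ?thesis by simp
qed

lemma sq_moment_cong:
  assumes "\<And>\<omega>. \<omega> \<in> space M \<Longrightarrow> f \<omega> = g \<omega>" shows "sq_moment M f = sq_moment M g"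
  unfolding sq_moment_def by (intro nn_integral_cong) (simp add: assms)

text \<open>Transfers a pointwise quadratic bound to second moments. There are two variables because
  the regularity bounds involve both an increment and a value; where one suffices, \<open>c2\<close>
  is 0.\<close>

lemma (in prob_space) sq_moment_affine_le:
  fixes g1 g2 :: "'a \<Rightarrow> 'b::euclidean_space" and f :: "'a \<Rightarrow> 'c::real_normed_vector"
  assumes g: "g1 \<in> borel_measurable M" "g2 \<in> borel_measurable M"
    and le: "\<And>\<omega>. \<omega> \<in> space M \<Longrightarrow> (norm (f \<omega>))\<^sup>2 \<le> a + c1 * (norm (g1 \<omega>))\<^sup>2 + c2 * (norm (g2 \<omega>))\<^sup>2"
    and nn: "0 \<le> a" "0 \<le> c1" "0 \<le> c2" "0 \<le> C1" "0 \<le> C2"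
    and C: "sq_moment M g1 \<le> ennreal C1" "sq_moment M g2 \<le> ennreal C2"
  shows "sq_moment M f \<le> ennreal (a + c1 * C1 + c2 * C2)"
proof -
  note [measurable] = g
  have "sq_moment M f \<le> (\<integral>\<^sup>+\<omega>. ennreal a + ennreal c1 * ennreal ((norm (g1 \<omega>))\<^sup>2) + ennreal c2 * ennreal ((norm (g2 \<omega>))\<^sup>2) \<partial>M)"
    unfolding sq_moment_def
  proof (rule nn_integral_mono)
    fix \<omega> assume "\<omega> \<in> space M"
    from ennreal_leI[OF le[OF this]]
    show "ennreal ((norm (f \<omega>))\<^sup>2) \<le> ennreal a + ennreal c1 * ennreal ((norm (g1 \<omega>))\<^sup>2) + ennreal c2 * ennreal ((norm (g2 \<omega>))\<^sup>2)"
      using nn by (simp add: ennreal_plus[symmetric] ennreal_mult[symmetric] del: ennreal_plus)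
  qed
  also have "\<dots> = ennreal a + ennreal c1 * sq_moment M g1 + ennreal c2 * sq_moment M g2"
    unfolding sq_moment_def by (simp add: nn_integral_add nn_integral_cmult emeasure_space_1)
  also have "\<dots> \<le> ennreal a + ennreal c1 * ennreal C1 + ennreal c2 * ennreal C2"
    by (intro add_mono mult_left_mono C) auto
  also have "\<dots> = ennreal (a + c1 * C1 + c2 * C2)"
    using nn by (simp add: ennreal_plus[symmetric] ennreal_mult[symmetric] del: ennreal_plus)
  finally show ?thesis .
qed

lemma norm_add_scaleR_sq:
  "(norm (x + a *\<^sub>R y))\<^sup>2 = (norm x)\<^sup>2 + 2 * a * (x \<bullet> y) + a\<^sup>2 * (norm y)\<^sup>2" for x y :: "'a::real_inner"
  unfolding power2_norm_eq_inner
  by (simp add: inner_add_left inner_add_right inner_commute power2_eq_square algebra_simps)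

lemma sum_sq_le2: "(a + b)\<^sup>2 \<le> 2 * a\<^sup>2 + 2 * b\<^sup>2" for a b :: real
  using zero_le_power2[of "a - b"] by (simp add: power2_eq_square algebra_simps)

lemma sum_sq_le3: "(a + b + c)\<^sup>2 \<le> 3 * a\<^sup>2 + 3 * b\<^sup>2 + 3 * c\<^sup>2" for a b c :: real
  using zero_le_power2[of "a - b"] zero_le_power2[of "a - c"] zero_le_power2[of "b - c"]
  by (simp add: power2_eq_square algebra_simps)

section \<open>The graphon system\<close>

text \<open>The conditions in real-valued form: \<open>C0\<close> and \<open>\<kappa>\<close> bound
  suprema that are finite by assumption. The conditions on the drift stand apart from those on
  \<sigma>; they are obtained by testing with a Dirac mass, where the distances vanish.\<close>

locale graphon_sde =
  fixes M :: "'w measure" and F :: "real \<Rightarrow> 'w measure" and G :: "real \<Rightarrow> real \<Rightarrow> real"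
    and b :: "real \<Rightarrow> real^'d \<Rightarrow> real^'d" and \<sigma> :: "real \<Rightarrow> real^'d \<Rightarrow> (real^'d) measure \<Rightarrow> real^'q^'d"
    and X0 :: "real \<Rightarrow> 'w \<Rightarrow> real^'d" and B :: "real \<Rightarrow> real \<Rightarrow> 'w \<Rightarrow> real^'q" and x0 :: "real^'d"
    and \<rho> Lt L c0 \<kappa> C0 :: real
  assumes graphon: "graphon G" and filtered: "filtered_prob_space M F"
    and bm: "\<And>u. u \<in> unit_I \<Longrightarrow> brownian_motion M F (B u)"
    and X0_meas: "\<And>u. u \<in> unit_I \<Longrightarrow> X0 u \<in> borel_measurable (F 0)"
    and X0_kernel: "kernel_on_I (laws M X0)"
    and X0_sq: "\<And>u. u \<in> unit_I \<Longrightarrow> sq_moment M (X0 u) \<le> ennreal C0" and C0: "0 \<le> C0"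
    and \<rho>: "0 < \<rho>" "\<rho> \<le> 1" and Lt: "0 < Lt" and L: "0 < L" and c0: "0 < c0"
    and gap: "8 * L\<^sup>2 * real CARD('q) < c0" and \<kappa>: "0 \<le> \<kappa>"
    and b_lip: "\<And>t x y. 0 \<le> t \<Longrightarrow> norm (b t x - b t y) \<le> L * norm (x - y)"
    and b_time: "\<And>s t x. 0 \<le> s \<Longrightarrow> s \<le> t \<Longrightarrow> norm (b t x - b s x) \<le> Lt * (1 + norm x) * (t - s) powr \<rho>"
    and b_mono: "\<And>t x y. 0 \<le> t \<Longrightarrow> (x - y) \<bullet> (b t x - b t y) \<le> - c0 * (norm (x - y))\<^sup>2"
    and b_0: "\<And>t. 0 \<le> t \<Longrightarrow> norm (b t 0) \<le> \<kappa>"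
    and sig_lip: "\<And>t x y \<mu> \<nu>. 0 \<le> t \<Longrightarrow> \<mu> \<in> M2 \<Longrightarrow> \<nu> \<in> M2 \<Longrightarrow>
        mat_norm (\<sigma> t x \<mu> - \<sigma> t y \<nu>) \<le> L * (norm (x - y) + WOP2 x0 \<mu> \<nu>)"
    and sig_time: "\<And>s t x \<mu>. 0 \<le> s \<Longrightarrow> s \<le> t \<Longrightarrow> \<mu> \<in> M2 \<Longrightarrow>
        mat_norm (\<sigma> t x \<mu> - \<sigma> s x \<mu>) \<le>
          Lt * (1 + norm x + WOP2 x0 \<mu> (scale_measure (ennreal (mass \<mu>)) (return borel 0))) * (t - s) powr \<rho>"
    and sig_0: "\<And>t u. 0 \<le> t \<Longrightarrow> u \<in> unit_I \<Longrightarrow> mat_norm (\<sigma> t 0 (graphon_op G (\<lambda>v. return borel 0) u)) \<le> \<kappa>"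
begin

sublocale prob_space M using filtered by (simp add: filtered_prob_space_def)

abbreviation gl :: "(real \<Rightarrow> 'w \<Rightarrow> real^'d) \<Rightarrow> real \<Rightarrow> (real^'d) measure" where
  "gl U u \<equiv> graphon_op G (laws M U) u"

text \<open>Only the laws are asked to be measurable in the index. The random variables are driven
  by independent motions, and no joint measurability in index and sample is available for
  them.\<close>

definition family :: "(real \<Rightarrow> 'w \<Rightarrow> real^'d) \<Rightarrow> real \<Rightarrow> bool" where
  "family U C \<longleftrightarrow> 0 \<le> C \<and> kernel_on_I (laws M U) \<and>
     (\<forall>u\<in>unit_I. U u \<in> borel_measurable M \<and> sq_moment M (U u) \<le> ennreal C)"

lemma familyD:
  assumes "family U C"
  shows "0 \<le> C" "kernel_on_I (laws M U)" "\<And>u. u \<in> unit_I \<Longrightarrow> U u \<in> borel_measurable M"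
    "\<And>u. u \<in> unit_I \<Longrightarrow> sq_moment M (U u) \<le> ennreal C"
  using assms by (auto simp: family_def)

lemma family_mono: "family U C \<Longrightarrow> C \<le> C' \<Longrightarrow> family U C'"
  unfolding family_def by (auto intro: order_trans[OF _ ennreal_leI])

lemma sq_moment_laws:
  assumes "U u \<in> borel_measurable M" shows "sq_moment (laws M U u) (\<lambda>x. x) = sq_moment M (U u)"
  unfolding sq_moment_def laws_def using assms by (subst nn_integral_distr) auto

lemma family_laws_sq:
  assumes "family U C" "u \<in> unit_I" shows "sq_moment (laws M U u) (\<lambda>x. x) \<le> ennreal C"
  using sq_moment_laws[of U u, OF familyD(3)[OF assms]] familyD(4)[OF assms] by simp

lemma gl_M2:
  assumes "family U C" "u \<in> unit_I"
  shows "gl U u \<in> M2" "sq_moment (gl U u) (\<lambda>x. x) \<le> ennreal C" "mass (gl U u) \<le> 1"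
  using graphon_op_in_M2[OF graphon assms(2) familyD(2)[OF assms(1)] family_laws_sq[OF assms(1)]]
    mass_graphon_op[OF graphon assms(2) familyD(2)[OF assms(1)]] by auto

lemma coupling_of_random_variables:
  assumes "U \<in> borel_measurable M" "V \<in> borel_measurable M"
  shows "distr M (borel \<Otimes>\<^sub>M borel) (\<lambda>\<omega>. (U \<omega>, V \<omega>)) \<in> couplings (distr M borel U) (distr M borel V)"
    "(\<integral>\<^sup>+z. ennreal ((norm (fst z - snd z))\<^sup>2) \<partial>distr M (borel \<Otimes>\<^sub>M borel) (\<lambda>\<omega>. (U \<omega>, V \<omega>))) = sq_moment M (\<lambda>\<omega>. U \<omega> - V \<omega>)"
proof -
  note [measurable] = assms
  show "distr M (borel \<Otimes>\<^sub>M borel) (\<lambda>\<omega>. (U \<omega>, V \<omega>)) \<in> couplings (distr M borel U) (distr M borel V)"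
    unfolding couplings_def by (simp add: distr_distr o_def)
  show "(\<integral>\<^sup>+z. ennreal ((norm (fst z - snd z))\<^sup>2) \<partial>distr M (borel \<Otimes>\<^sub>M borel) (\<lambda>\<omega>. (U \<omega>, V \<omega>))) = sq_moment M (\<lambda>\<omega>. U \<omega> - V \<omega>)"
    by (simp add: nn_integral_distr sq_moment_def)
qed

text \<open>The law is changed at fixed state and then the state at fixed law. For the law, the
  joint distribution of \<open>U v\<close> and \<open>V v\<close> is the coupling at v; its
  dependence on v is uncontrolled, which is the situation covered by
  \<open>graphon_op_lipschitz_of_couplings\<close>.\<close>

lemma sig_diff:
  assumes U: "family U C" and V: "family V C" and d: "\<And>v. v \<in> unit_I \<Longrightarrow> sq_moment M (\<lambda>\<omega>. U v \<omega> - V v \<omega>) \<le> ennreal (c\<^sup>2)"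
    and c: "0 \<le> c" and t: "0 \<le> t" and u: "u \<in> unit_I"
  shows "mat_norm (\<sigma> t x (gl U u) - \<sigma> t y (gl V u)) \<le> L * (norm (x - y) + c)"
proof -
  have "mat_norm (\<sigma> t x (gl U u) - \<sigma> t x (gl V u)) \<le> L * c"
  proof (rule graphon_op_lipschitz_of_couplings[where d="\<lambda>\<mu> \<nu>. mat_norm (\<sigma> t x \<mu> - \<sigma> t x \<nu>)", OF graphon u familyD(2)[OF U] familyD(2)[OF V] familyD(1)[OF U] family_laws_sq[OF U] family_laws_sq[OF V] c])
    fix v assume v: "v \<in> unit_I"
    show "\<exists>\<pi>\<in>couplings (laws M U v) (laws M V v). (\<integral>\<^sup>+z. ennreal ((norm (fst z - snd z))\<^sup>2) \<partial>\<pi>) \<le> ennreal (c\<^sup>2)"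
      using coupling_of_random_variables[OF familyD(3)[OF U v] familyD(3)[OF V v]] d[OF v]
      unfolding laws_def by (metis (no_types, lifting))
  next
    show "mat_norm (\<sigma> t x \<mu>1 - \<sigma> t x \<mu>3) \<le> mat_norm (\<sigma> t x \<mu>1 - \<sigma> t x \<mu>2) + mat_norm (\<sigma> t x \<mu>2 - \<sigma> t x \<mu>3)" for \<mu>1 \<mu>2 \<mu>3
      by (rule mat_norm_diff_triangle)
    show "mat_norm (\<sigma> t x \<mu>1 - \<sigma> t x \<mu>2) \<le> L * WOP2 x0 \<mu>1 \<mu>2" if "\<mu>1 \<in> M2" "\<mu>2 \<in> M2" for \<mu>1 \<mu>2
      using sig_lip[OF t that, of x x] by simp
  qed (use L in auto)
  moreover have "mat_norm (\<sigma> t x (gl V u) - \<sigma> t y (gl V u)) \<le> L * norm (x - y)"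
    using sig_lip[OF t gl_M2(1)[OF V u] gl_M2(1)[OF V u], of x y] WOP2_refl[OF M2_D(1)[OF gl_M2(1)[OF V u]]] by simp
  ultimately show ?thesis
    using mat_norm_diff_triangle[of "\<sigma> t x (gl U u)" "\<sigma> t y (gl V u)" "\<sigma> t x (gl V u)"] by (simp add: distrib_left)
qed

lemma family_zero: "family (\<lambda>v \<omega>. 0) 0"
  unfolding family_def
proof (intro conjI ballI)
  show "kernel_on_I (laws M (\<lambda>v \<omega>. 0))"
    unfolding laws_def by (simp add: space_prob_algebra prob_space_distr)
qed (auto simp: sq_moment_def)

text \<open>Comparison with the zero family: its laws are Dirac masses at 0, so \<sigma> is bounded
  there by \<open>\<kappa>\<close>, and every family with second moments at most C lies within
  \<open>sqrt C\<close> of it.\<close>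

lemma sig_growth:
  assumes U: "family U C" and t: "0 \<le> t" and u: "u \<in> unit_I"
  shows "mat_norm (\<sigma> t x (gl U u)) \<le> \<kappa> + L * (norm x + sqrt C)"
proof -
  have C: "0 \<le> C" by (rule familyD(1)[OF U])
  have "laws M (\<lambda>v \<omega>. 0 :: real^'d) = (\<lambda>v. return borel 0)"
    unfolding laws_def by (simp add: distr_const)
  then have z: "mat_norm (\<sigma> t 0 (gl (\<lambda>v \<omega>. 0) u)) \<le> \<kappa>" using sig_0[OF t u] by simp
  have "mat_norm (\<sigma> t x (gl U u) - \<sigma> t 0 (gl (\<lambda>v \<omega>. 0) u)) \<le> L * (norm (x - 0) + sqrt C)"
    by (rule sig_diff[OF U family_mono[OF family_zero C] _ _ t u]) (use familyD(4)[OF U] C in auto)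
  then show ?thesis using z mat_norm_triangle[of "\<sigma> t x (gl U u) - \<sigma> t 0 (gl (\<lambda>v \<omega>. 0) u)" "\<sigma> t 0 (gl (\<lambda>v \<omega>. 0) u)"] by simp
qed

text \<open>The distance in the time condition is bounded by moving all mass to the origin, at the
  cost of the second moment.\<close>

lemma sig_time_gl:
  assumes U: "family U C" and st: "0 \<le> s" "s \<le> t" and u: "u \<in> unit_I"
  shows "mat_norm (\<sigma> t x (gl U u) - \<sigma> s x (gl U u)) \<le> Lt * (1 + norm x + sqrt C) * (t - s) powr \<rho>"
proof -
  have C: "0 \<le> C" by (rule familyD(1)[OF U])
  note M2 = gl_M2[OF U u]
  note D = M2_D[OF M2(1)]
  let ?\<mu> = "gl U u"
  have [measurable]: "(\<lambda>x. x) \<in> borel_measurable ?\<mu>" using D(1) by (simp cong: measurable_cong_sets)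
  have id: "distr ?\<mu> borel (\<lambda>x. x) = ?\<mu>" using D(1) by (intro distr_id2) simp
  have c: "distr ?\<mu> borel (\<lambda>x. 0 :: real^'d) = scale_measure (ennreal (mass ?\<mu>)) (return borel 0)"
  proof (rule measure_eqI)
    fix A assume "A \<in> sets (distr ?\<mu> borel (\<lambda>x. 0 :: real^'d))"
    then have A: "A \<in> sets borel" by simp
    have "(\<lambda>x :: real^'d. 0 :: real^'d) -` A = (if 0 \<in> A then UNIV else {})" by auto
    then show "emeasure (distr ?\<mu> borel (\<lambda>x. 0 :: real^'d)) A = emeasure (scale_measure (ennreal (mass ?\<mu>)) (return borel 0)) A"
      using A D by (auto simp: emeasure_distr finite_measure.emeasure_eq_measure[OF D(3)])
  qed simp
  have "distr ?\<mu> (borel \<Otimes>\<^sub>M borel) (\<lambda>x. (x, 0)) \<in> couplings ?\<mu> (scale_measure (ennreal (mass ?\<mu>)) (return borel 0))"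
    unfolding couplings_def c[symmetric] by (simp add: distr_distr o_def id)
  from WOP2_le_coupling[OF this D(3) M2(3), of "sqrt C"] C M2(2)
  have W: "WOP2 x0 ?\<mu> (scale_measure (ennreal (mass ?\<mu>)) (return borel 0)) \<le> sqrt C"
    by (simp add: nn_integral_distr sq_moment_def)
  have "mat_norm (\<sigma> t x ?\<mu> - \<sigma> s x ?\<mu>) \<le> Lt * (1 + norm x + WOP2 x0 ?\<mu> (scale_measure (ennreal (mass ?\<mu>)) (return borel 0))) * (t - s) powr \<rho>"
    by (rule sig_time[OF st M2(1)])
  also have "\<dots> \<le> Lt * (1 + norm x + sqrt C) * (t - s) powr \<rho>"
    using W Lt by (intro mult_right_mono mult_left_mono) auto
  finally show ?thesis .
qed

lemma norm_le_mat: "norm (A :: real^'q^'d) \<le> sqrt (real CARD('q)) * mat_norm A"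
  using norm_le_mat_norm[of A] mat_norm_nonneg[of A]
  by (metis norm_ge_zero real_le_rsqrt real_sqrt_mult real_sqrt_abs abs_of_nonneg real_sqrt_le_iff real_sqrt_power)

lemma sig_continuous:
  assumes "0 \<le> t" "\<mu> \<in> M2" shows "continuous_on UNIV (\<lambda>x. \<sigma> t x \<mu>)"
proof (rule lipschitz_on_continuous_on[of "sqrt (real CARD('q)) * L"], rule lipschitz_onI)
  fix x y
  have "dist (\<sigma> t x \<mu>) (\<sigma> t y \<mu>) \<le> sqrt (real CARD('q)) * mat_norm (\<sigma> t x \<mu> - \<sigma> t y \<mu>)"
    unfolding dist_norm by (rule norm_le_mat)
  also have "mat_norm (\<sigma> t x \<mu> - \<sigma> t y \<mu>) \<le> L * (norm (x - y) + WOP2 x0 \<mu> \<mu>)"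
    by (rule sig_lip[OF assms(1,2,2)])
  finally show "dist (\<sigma> t x \<mu>) (\<sigma> t y \<mu>) \<le> sqrt (real CARD('q)) * L * dist x y"
    using WOP2_refl[OF M2_D(1)[OF assms(2)]] by (simp add: dist_norm mult.assoc)
qed (use L in auto)

lemma b_continuous:
  assumes "0 \<le> t" shows "continuous_on UNIV (b t)"
  by (rule lipschitz_on_continuous_on[of L], rule lipschitz_onI)
     (use b_lip[OF assms] L in \<open>auto simp: dist_norm\<close>)

lemma sig_measurable_index:
  assumes U: "family U C" and t: "0 \<le> t"
  shows "(\<lambda>u. \<sigma> t x (gl U u)) \<in> borel_measurable (restrict_space borel unit_I)"
  unfolding borel_measurable_euclidean_space[of "\<lambda>u. \<sigma> t x (gl U u)"]
proof
  fix e :: "real^'q^'d" assume e: "e \<in> Basis"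
  show "(\<lambda>u. \<sigma> t x (gl U u) \<bullet> e) \<in> borel_measurable (restrict_space borel unit_I)"
  proof (rule borel_measurable_lipschitz_graphon_op[OF graphon familyD(2)[OF U] familyD(1)[OF U] family_laws_sq[OF U], where f="\<lambda>\<mu>. \<sigma> t x \<mu> \<bullet> e" and L="sqrt (real CARD('q)) * L"])
    fix \<mu> \<nu> :: "(real^'d) measure" assume m: "\<mu> \<in> M2" "\<nu> \<in> M2"
    have "\<bar>\<sigma> t x \<mu> \<bullet> e - \<sigma> t x \<nu> \<bullet> e\<bar> \<le> norm (\<sigma> t x \<mu> - \<sigma> t x \<nu>)"
      unfolding inner_diff_left[symmetric] by (rule Basis_le_norm[OF e])
    also have "\<dots> \<le> sqrt (real CARD('q)) * mat_norm (\<sigma> t x \<mu> - \<sigma> t x \<nu>)" by (rule norm_le_mat)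
    also have "\<dots> \<le> sqrt (real CARD('q)) * (L * (norm (x - x) + WOP2 x0 \<mu> \<nu>))"
      by (intro mult_left_mono sig_lip t m) auto
    finally show "\<bar>\<sigma> t x \<mu> \<bullet> e - \<sigma> t x \<nu> \<bullet> e\<bar> \<le> sqrt (real CARD('q)) * L * WOP2 x0 \<mu> \<nu>" by (simp add: mult.assoc)
  qed (use L in auto)
qed

lemma b_growth: "0 \<le> t \<Longrightarrow> norm (b t x) \<le> \<kappa> + L * norm x"
  using b_lip[of t x 0] b_0[of t] norm_triangle_ineq[of "b t x - b t 0" "b t 0"] by simp

lemma b_growth_sq: assumes "0 \<le> t" shows "(norm (b t x))\<^sup>2 \<le> 2 * \<kappa>\<^sup>2 + 2 * L\<^sup>2 * (norm x)\<^sup>2"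
proof -
  have "(norm (b t x))\<^sup>2 \<le> (\<kappa> + L * norm x)\<^sup>2" using b_growth[OF assms] by (intro power_mono) auto
  also have "\<dots> \<le> 2 * \<kappa>\<^sup>2 + 2 * (L * norm x)\<^sup>2" by (rule sum_sq_le2)
  finally show ?thesis by (simp add: power_mult_distrib)
qed

lemma sig_growth_sq:
  assumes U: "family U C" and t: "0 \<le> t" and u: "u \<in> unit_I"
  shows "(norm (\<sigma> t x (gl U u)))\<^sup>2 \<le> real CARD('q) * (2 * \<kappa>\<^sup>2 + 4 * L\<^sup>2 * C) + 4 * real CARD('q) * L\<^sup>2 * (norm x)\<^sup>2"
proof -
  have C: "0 \<le> C" by (rule familyD(1)[OF U])
  have "(norm (\<sigma> t x (gl U u)))\<^sup>2 \<le> real CARD('q) * (mat_norm (\<sigma> t x (gl U u)))\<^sup>2" by (rule norm_le_mat_norm)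
  also have "\<dots> \<le> real CARD('q) * (2 * \<kappa>\<^sup>2 + 2 * (L\<^sup>2 * (2 * (norm x)\<^sup>2 + 2 * C)))"
  proof (rule mult_left_mono)
    have "(mat_norm (\<sigma> t x (gl U u)))\<^sup>2 \<le> (\<kappa> + L * (norm x + sqrt C))\<^sup>2"
      using sig_growth[OF assms] mat_norm_nonneg by (intro power_mono) auto
    also have "\<dots> \<le> 2 * \<kappa>\<^sup>2 + 2 * (L * (norm x + sqrt C))\<^sup>2" by (rule sum_sq_le2)
    also have "(L * (norm x + sqrt C))\<^sup>2 \<le> L\<^sup>2 * (2 * (norm x)\<^sup>2 + 2 * (sqrt C)\<^sup>2)"
      unfolding power_mult_distrib by (intro mult_left_mono sum_sq_le2) auto
    finally show "(mat_norm (\<sigma> t x (gl U u)))\<^sup>2 \<le> 2 * \<kappa>\<^sup>2 + 2 * (L\<^sup>2 * (2 * (norm x)\<^sup>2 + 2 * C))" using C by simp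
  qed simp
  also have "\<dots> = real CARD('q) * (2 * \<kappa>\<^sup>2 + 4 * L\<^sup>2 * C) + 4 * real CARD('q) * L\<^sup>2 * (norm x)\<^sup>2" by (simp add: algebra_simps)
  finally show ?thesis .
qed

end

section \<open>The Euler scheme\<close>

context graphon_sde
begin

lemma filtered_bm: "u \<in> unit_I \<Longrightarrow> filtered_bm M F (B u)"
  using prob_space_axioms filtered bm by (auto simp: filtered_bm_def filtered_bm_axioms_def)

text \<open>Dissipativity gives the rate \<open>2 * c0\<close>. Young's inequality for the value of
  the drift at 0 uses up \<open>c0 / 2\<close>, and the quadratic term uses up \<open>c0 / 4\<close>
  by the restriction on \<tau>; this leaves 5/4.\<close>

lemma drift_step_sq:
  assumes t: "0 \<le> t" and \<tau>: "0 \<le> \<tau>" "\<tau> \<le> 1" "8 * L\<^sup>2 * \<tau> \<le> c0"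
  shows "(norm (x + \<tau> *\<^sub>R b t x))\<^sup>2 \<le> \<tau> * (2 * \<kappa>\<^sup>2 / c0 + 2 * \<kappa>\<^sup>2) + (1 - 5 / 4 * c0 * \<tau>) * (norm x)\<^sup>2"
proof -
  let ?n = "norm x"
  have eq: "(norm (x + \<tau> *\<^sub>R b t x))\<^sup>2 = ?n\<^sup>2 + 2 * \<tau> * (x \<bullet> b t x) + \<tau>\<^sup>2 * (norm (b t x))\<^sup>2"
    by (rule norm_add_scaleR_sq)
  have x: "x \<bullet> b t x \<le> - (3 / 4) * c0 * ?n\<^sup>2 + \<kappa>\<^sup>2 / c0"
  proof -
    have "x \<bullet> b t x = (x - 0) \<bullet> (b t x - b t 0) + x \<bullet> b t 0" by (simp add: inner_diff_right)
    also have "\<dots> \<le> - c0 * (norm (x - 0))\<^sup>2 + ?n * \<kappa>"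
    proof (rule add_mono[OF b_mono[OF t]])
      have "x \<bullet> b t 0 \<le> ?n * norm (b t 0)" by (rule norm_cauchy_schwarz)
      also have "\<dots> \<le> ?n * \<kappa>" using b_0[OF t] by (intro mult_left_mono) auto
      finally show "x \<bullet> b t 0 \<le> ?n * \<kappa>" .
    qed
    also have "?n * \<kappa> \<le> c0 / 4 * ?n\<^sup>2 + \<kappa>\<^sup>2 / c0"
    proof -
      have "0 \<le> (c0 * ?n - 2 * \<kappa>)\<^sup>2 / (4 * c0)" using c0 by simp
      also have "\<dots> = c0 / 4 * ?n\<^sup>2 - ?n * \<kappa> + \<kappa>\<^sup>2 / c0" using c0 by (simp add: power2_eq_square field_simps)
      finally show ?thesis by simp
    qed
    finally show ?thesis by (simp add: algebra_simps)
  qed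
  have "\<tau>\<^sup>2 * (norm (b t x))\<^sup>2 \<le> \<tau>\<^sup>2 * (2 * \<kappa>\<^sup>2 + 2 * L\<^sup>2 * ?n\<^sup>2)"
    by (intro mult_left_mono b_growth_sq t) auto
  also have "\<dots> = \<tau> * (\<tau> * (2 * \<kappa>\<^sup>2)) + \<tau> * (2 * L\<^sup>2 * \<tau>) * ?n\<^sup>2" by (simp add: power2_eq_square algebra_simps)
  also have "\<dots> \<le> \<tau> * (1 * (2 * \<kappa>\<^sup>2)) + \<tau> * (c0 / 4) * ?n\<^sup>2"
    using \<tau> by (intro add_mono mult_left_mono mult_right_mono) auto
  finally have y: "\<tau>\<^sup>2 * (norm (b t x))\<^sup>2 \<le> \<tau> * (2 * \<kappa>\<^sup>2) + \<tau> * (c0 / 4) * ?n\<^sup>2" by simp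
  have "2 * \<tau> * (x \<bullet> b t x) \<le> 2 * \<tau> * (- (3 / 4) * c0 * ?n\<^sup>2 + \<kappa>\<^sup>2 / c0)" using x \<tau> by (intro mult_left_mono) auto
  then show ?thesis unfolding eq using y by (simp add: algebra_simps)
qed

text \<open>The level at which one step cannot increase the moments: of the rate
  \<open>5 / 4 * c0\<close> the diffusion consumes less than \<open>c0\<close>, and
  \<open>c0 / 4\<close> times the level has to outweigh the constant terms. The maximum with
  \<open>C0\<close> covers the initial values.\<close>

definition euler_bound :: real where
  "euler_bound = max C0 (4 * (2 * \<kappa>\<^sup>2 / c0 + 2 * \<kappa>\<^sup>2 + 2 * real CARD('q) * \<kappa>\<^sup>2) / c0)"

lemma euler_bound: "C0 \<le> euler_bound" "0 \<le> euler_bound"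
  "2 * \<kappa>\<^sup>2 / c0 + 2 * \<kappa>\<^sup>2 + 2 * real CARD('q) * \<kappa>\<^sup>2 \<le> c0 / 4 * euler_bound"
proof -
  show "C0 \<le> euler_bound" "0 \<le> euler_bound" using C0 by (auto simp: euler_bound_def)
  have "4 * (2 * \<kappa>\<^sup>2 / c0 + 2 * \<kappa>\<^sup>2 + 2 * real CARD('q) * \<kappa>\<^sup>2) / c0 \<le> euler_bound" by (simp add: euler_bound_def)
  then show "2 * \<kappa>\<^sup>2 / c0 + 2 * \<kappa>\<^sup>2 + 2 * real CARD('q) * \<kappa>\<^sup>2 \<le> c0 / 4 * euler_bound"
    using c0 by (simp add: divide_le_eq mult.commute)
qed

text \<open>The 8 is 4 for the state plus 4 for the laws, since both have second moments at most
  C.\<close>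

lemma sig_moment_le:
  assumes U: "family U C" and t: "0 \<le> t" and u: "u \<in> unit_I"
  shows "sq_moment M (\<lambda>\<omega>. \<sigma> t (U u \<omega>) (gl U u)) \<le> ennreal (real CARD('q) * (2 * \<kappa>\<^sup>2 + 8 * L\<^sup>2 * C))"
proof -
  have C: "0 \<le> C" by (rule familyD(1)[OF U])
  have "sq_moment M (\<lambda>\<omega>. \<sigma> t (U u \<omega>) (gl U u)) \<le> ennreal (real CARD('q) * (2 * \<kappa>\<^sup>2 + 4 * L\<^sup>2 * C) + 4 * real CARD('q) * L\<^sup>2 * C + 0 * C)"
    by (rule sq_moment_affine_le[OF familyD(3)[OF U u] familyD(3)[OF U u]])
       (use sig_growth_sq[OF U t u] C familyD(4)[OF U u] in auto)
  then show ?thesis by (simp add: algebra_simps)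
qed

context
  fixes h :: real and Z :: "real \<Rightarrow> real \<Rightarrow> 'w \<Rightarrow> real^'d"
  assumes h: "0 < h" "h \<le> 1" "8 * L\<^sup>2 * h \<le> c0" "2 * c0 * h \<le> 1"
    and scheme: "euler_scheme M B G b \<sigma> X0 h Z"
begin

abbreviation T :: "nat \<Rightarrow> real" where "T m \<equiv> real m * h"

lemma T_nonneg: "0 \<le> T m" and T_less: "T m < T (Suc m)" and T_Suc: "T (Suc m) - T m = h"
  using h by (auto simp: algebra_simps)

lemma euler_step:
  assumes "u \<in> unit_I" "\<omega> \<in> space M" "t \<in> {T m..T (Suc m)}"
  shows "Z u t \<omega> = (Z u (T m) \<omega> + (t - T m) *\<^sub>R b (T m) (Z u (T m) \<omega>)) +
      \<sigma> (T m) (Z u (T m) \<omega>) (gl (\<lambda>v. Z v (T m)) u) *v (B u t \<omega> - B u (T m) \<omega>)"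
proof -
  have "\<forall>t\<in>{T m..real (Suc m) * h}. Z u t \<omega> = Z u (T m) \<omega> + (t - T m) *\<^sub>R b (T m) (Z u (T m) \<omega>) +
        \<sigma> (T m) (Z u (T m) \<omega>) (gl (\<lambda>v. Z v (T m)) u) *v (B u t \<omega> - B u (T m) \<omega>)"
    using scheme assms(1,2) unfolding euler_scheme_def Let_def by blast
  then show ?thesis using assms(3) by blast
qed

context
  fixes m :: nat
  assumes fam: "family (\<lambda>v. Z v (T m)) euler_bound"
    and adapted: "\<And>u. u \<in> unit_I \<Longrightarrow> Z u (T m) \<in> borel_measurable (F (T m))"
begin

lemma euler_coeff_measurable:
  assumes u: "u \<in> unit_I"
  shows "(\<lambda>\<omega>. b (T m) (Z u (T m) \<omega>)) \<in> borel_measurable (F (T m))"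
    "(\<lambda>\<omega>. \<sigma> (T m) (Z u (T m) \<omega>) (gl (\<lambda>v. Z v (T m)) u)) \<in> borel_measurable (F (T m))"
  using measurable_compose[OF adapted[OF u] borel_measurable_continuous_onI[OF b_continuous[OF T_nonneg]]]
    measurable_compose[OF adapted[OF u] borel_measurable_continuous_onI[OF sig_continuous[OF T_nonneg gl_M2(1)[OF fam u]]]] by auto

text \<open>The Brownian increment is orthogonal to everything known at the grid point, so the
  moment is that of the drift step plus \<tau> times that of the diffusion coefficient. The rates
  5/4 of \<open>c0\<close> and \<open>8 * L^2 * q\<close> then make \<open>euler_bound\<close>
  invariant, at every time of the grid interval and not only at its end.\<close>

lemma euler_step_moment:
  assumes u: "u \<in> unit_I" and t: "t \<in> {T m..T (Suc m)}"
  shows "sq_moment M (Z u t) \<le> ennreal euler_bound" "Z u t \<in> borel_measurable (F t)"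
    "sq_moment M (\<lambda>\<omega>. Z u t \<omega> - Z u (T m) \<omega>) \<le>
      ennreal ((2 * \<kappa>\<^sup>2 + 2 * L\<^sup>2 * euler_bound + real CARD('q) * (2 * \<kappa>\<^sup>2 + 8 * L\<^sup>2 * euler_bound)) * (t - T m))"
proof -
  interpret W: filtered_bm M F "B u" by (rule filtered_bm[OF u])
  let ?E = euler_bound and ?q = "real CARD('q)"
  let ?b = "\<lambda>\<omega>. b (T m) (Z u (T m) \<omega>)" and ?s = "\<lambda>\<omega>. \<sigma> (T m) (Z u (T m) \<omega>) (gl (\<lambda>v. Z v (T m)) u)"
  define \<tau> where "\<tau> = t - T m"
  have tm: "0 \<le> T m" "T m \<le> t" "0 \<le> t" using t T_nonneg[of m] by auto
  have \<tau>: "0 \<le> \<tau>" "\<tau> \<le> h" using t T_Suc[of m] by (auto simp: \<tau>_def)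
  have \<tau>1: "\<tau> \<le> 1" using \<tau> h by simp
  have \<tau>L: "8 * L\<^sup>2 * \<tau> \<le> c0"
    using mult_left_mono[OF \<tau>(2), of "8 * L\<^sup>2"] h(3) by simp
  have \<tau>c: "0 \<le> 1 - 5 / 4 * c0 * \<tau>" 
  proof -
    have "c0 * \<tau> \<le> c0 * h" using \<tau>(2) c0 by (intro mult_left_mono) auto
    then show ?thesis using h(4) by linarith
  qed
  note Zm = adapted[OF u] and [measurable] = adapted[OF u] euler_coeff_measurable[OF u]
  have ZM: "Z u (T m) \<in> borel_measurable M" by (rule familyD(3)[OF fam u])
  have Zsq: "sq_moment M (Z u (T m)) \<le> ennreal ?E" by (rule familyD(4)[OF fam u])
  have sm: "sq_moment M ?s \<le> ennreal (?q * (2 * \<kappa>\<^sup>2 + 8 * L\<^sup>2 * ?E))" by (rule sig_moment_le[OF fam tm(1) u])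
  have E0: "0 \<le> ?E" by (rule euler_bound)
  have P1: "(\<lambda>\<omega>. Z u (T m) \<omega> + \<tau> *\<^sub>R ?b \<omega>) \<in> borel_measurable (F (T m))" and P2: "(\<lambda>\<omega>. \<tau> *\<^sub>R ?b \<omega>) \<in> borel_measurable (F (T m))" by measurable
  have eq: "Z u t \<omega> = (Z u (T m) \<omega> + \<tau> *\<^sub>R ?b \<omega>) + ?s \<omega> *v (B u t \<omega> - B u (T m) \<omega>)" if "\<omega> \<in> space M" for \<omega>
    unfolding \<tau>_def by (rule euler_step[OF u that t])
  have "sq_moment M (Z u t) = sq_moment M (\<lambda>\<omega>. (Z u (T m) \<omega> + \<tau> *\<^sub>R ?b \<omega>) + ?s \<omega> *v (B u t \<omega> - B u (T m) \<omega>))"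
    by (rule sq_moment_cong[OF eq])
  also have "\<dots> = sq_moment M (\<lambda>\<omega>. Z u (T m) \<omega> + \<tau> *\<^sub>R ?b \<omega>) + ennreal \<tau> * sq_moment M ?s"
    using W.sq_moment_add_increment[OF tm(1,2) P1 euler_coeff_measurable(2)[OF u]] by (simp only: \<tau>_def)
  also have "\<dots> \<le> ennreal (\<tau> * (2 * \<kappa>\<^sup>2 / c0 + 2 * \<kappa>\<^sup>2) + (1 - 5 / 4 * c0 * \<tau>) * ?E + 0 * ?E) + ennreal \<tau> * ennreal (?q * (2 * \<kappa>\<^sup>2 + 8 * L\<^sup>2 * ?E))"
  proof (rule add_mono[OF _ mult_left_mono[OF sm]])
    show "sq_moment M (\<lambda>\<omega>. Z u (T m) \<omega> + \<tau> *\<^sub>R ?b \<omega>) \<le> ennreal (\<tau> * (2 * \<kappa>\<^sup>2 / c0 + 2 * \<kappa>\<^sup>2) + (1 - 5 / 4 * c0 * \<tau>) * ?E + 0 * ?E)"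
      using drift_step_sq[OF tm(1) \<tau>(1) \<tau>1 \<tau>L] c0 \<tau>
      by (intro sq_moment_affine_le[OF ZM ZM _ _ \<tau>c _ E0 E0 Zsq Zsq]) auto
  qed simp
  also have "\<dots> = ennreal (\<tau> * (2 * \<kappa>\<^sup>2 / c0 + 2 * \<kappa>\<^sup>2) + (1 - 5 / 4 * c0 * \<tau>) * ?E + \<tau> * (?q * (2 * \<kappa>\<^sup>2 + 8 * L\<^sup>2 * ?E)))"
    using \<tau> \<tau>c E0 c0 by (subst ennreal_mult[symmetric], simp, simp, subst ennreal_plus[symmetric]) (auto intro!: add_nonneg_nonneg mult_nonneg_nonneg)
  also have "\<dots> \<le> ennreal ?E"
  proof (rule ennreal_leI)
    have "8 * L\<^sup>2 * ?q * ?E \<le> c0 * ?E" using gap E0 by (intro mult_right_mono) auto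
    then have "2 * \<kappa>\<^sup>2 / c0 + 2 * \<kappa>\<^sup>2 + 2 * ?q * \<kappa>\<^sup>2 + 8 * L\<^sup>2 * ?q * ?E \<le> 5 / 4 * c0 * ?E" using euler_bound(3) by simp
    from mult_left_mono[OF this \<tau>(1)]
    show "\<tau> * (2 * \<kappa>\<^sup>2 / c0 + 2 * \<kappa>\<^sup>2) + (1 - 5 / 4 * c0 * \<tau>) * ?E + \<tau> * (?q * (2 * \<kappa>\<^sup>2 + 8 * L\<^sup>2 * ?E)) \<le> ?E"
      by (simp add: algebra_simps)
  qed
  finally show "sq_moment M (Z u t) \<le> ennreal ?E" .
  have Bm: "B u t \<in> borel_measurable (F t)" "B u (T m) \<in> borel_measurable (F t)"
    using W.W_measurable[OF tm(3)] W.measurable_F_mono[OF tm(1,2) W.W_measurable[OF tm(1)]] by auto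
  have Zt: "(\<lambda>\<omega>. (Z u (T m) \<omega> + \<tau> *\<^sub>R ?b \<omega>) + ?s \<omega> *v (B u t \<omega> - B u (T m) \<omega>)) \<in> borel_measurable (F t)"
    by (intro borel_measurable_add W.measurable_F_mono[OF tm(1,2) P1] borel_measurable_matrix_vector_mult
        W.measurable_F_mono[OF tm(1,2) euler_coeff_measurable(2)[OF u]] borel_measurable_diff Bm)
  show "Z u t \<in> borel_measurable (F t)"
    by (rule measurable_cong[THEN iffD1, OF _ Zt]) (simp add: W.space_F[OF tm(3)] eq)
  have "sq_moment M (\<lambda>\<omega>. Z u t \<omega> - Z u (T m) \<omega>) = sq_moment M (\<lambda>\<omega>. \<tau> *\<^sub>R ?b \<omega> + ?s \<omega> *v (B u t \<omega> - B u (T m) \<omega>))"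
    by (rule sq_moment_cong) (simp add: eq)
  also have "\<dots> = sq_moment M (\<lambda>\<omega>. \<tau> *\<^sub>R ?b \<omega>) + ennreal \<tau> * sq_moment M ?s"
    using W.sq_moment_add_increment[OF tm(1,2) P2 euler_coeff_measurable(2)[OF u]] by (simp add: \<tau>_def)
  also have "\<dots> \<le> ennreal (\<tau> * (2 * \<kappa>\<^sup>2) + (\<tau> * (2 * L\<^sup>2)) * ?E + 0 * ?E) + ennreal \<tau> * ennreal (?q * (2 * \<kappa>\<^sup>2 + 8 * L\<^sup>2 * ?E))"
  proof (rule add_mono[OF _ mult_left_mono[OF sm]])
    have "(norm (\<tau> *\<^sub>R b (T m) x))\<^sup>2 \<le> \<tau> * (2 * \<kappa>\<^sup>2) + (\<tau> * (2 * L\<^sup>2)) * (norm x)\<^sup>2" for x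
    proof -
      have "(norm (\<tau> *\<^sub>R b (T m) x))\<^sup>2 = \<tau> * (\<tau> * (norm (b (T m) x))\<^sup>2)" using \<tau> by (simp add: power_mult_distrib power2_eq_square)
      also have "\<dots> \<le> \<tau> * (1 * (2 * \<kappa>\<^sup>2 + 2 * L\<^sup>2 * (norm x)\<^sup>2))"
        using \<tau> \<tau>1 b_growth_sq[OF tm(1), of x] by (intro mult_left_mono mult_mono) auto
      finally show ?thesis by (simp add: algebra_simps)
    qed
    then show "sq_moment M (\<lambda>\<omega>. \<tau> *\<^sub>R ?b \<omega>) \<le> ennreal (\<tau> * (2 * \<kappa>\<^sup>2) + (\<tau> * (2 * L\<^sup>2)) * ?E + 0 * ?E)"
      using \<tau> by (intro sq_moment_affine_le[OF ZM ZM _ _ _ _ E0 E0 Zsq Zsq]) auto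
  qed simp
  also have "\<dots> = ennreal (\<tau> * (2 * \<kappa>\<^sup>2) + (\<tau> * (2 * L\<^sup>2)) * ?E + \<tau> * (?q * (2 * \<kappa>\<^sup>2 + 8 * L\<^sup>2 * ?E)))"
    using \<tau> E0 by (subst ennreal_mult[symmetric], simp, simp, subst ennreal_plus[symmetric]) (auto intro!: add_nonneg_nonneg mult_nonneg_nonneg)
  also have "\<tau> * (2 * \<kappa>\<^sup>2) + (\<tau> * (2 * L\<^sup>2)) * ?E + \<tau> * (?q * (2 * \<kappa>\<^sup>2 + 8 * L\<^sup>2 * ?E)) =
    (2 * \<kappa>\<^sup>2 + 2 * L\<^sup>2 * ?E + ?q * (2 * \<kappa>\<^sup>2 + 8 * L\<^sup>2 * ?E)) * (t - T m)" by (simp add: \<tau>_def algebra_simps)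
  finally show "sq_moment M (\<lambda>\<omega>. Z u t \<omega> - Z u (T m) \<omega>) \<le>
      ennreal ((2 * \<kappa>\<^sup>2 + 2 * L\<^sup>2 * ?E + ?q * (2 * \<kappa>\<^sup>2 + 8 * L\<^sup>2 * ?E)) * (t - T m))" .
qed

text \<open>Nothing is assumed about how the scheme depends on the index, yet the operator at the
  next grid point needs measurable laws. The new law is the image of the old law times a Gaussian
  under \<open>\<Phi> v\<close>, and \<Phi> is jointly measurable because \<sigma> is measurable in
  the index and continuous in the state.\<close>

lemma euler_step_kernel: "kernel_on_I (laws M (\<lambda>v. Z v (T (Suc m))))"
proof -
  let ?t = "T (Suc m)" and ?I = "restrict_space borel unit_I :: real measure"
  have tin: "?t \<in> {T m..T (Suc m)}" using T_less[of m] by auto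
  have ZM: "Z v ?t \<in> borel_measurable M" if "v \<in> unit_I" for v
    using filtered_bm.measurable_F_M[OF filtered_bm[OF that] T_nonneg euler_step_moment(2)[OF that tin]] .
  interpret g: prob_space "gauss h :: (real^'q) measure" by (rule prob_space_gauss[OF h(1)])
  define \<Phi> where "\<Phi> v x z = x + h *\<^sub>R b (T m) x + \<sigma> (T m) x (gl (\<lambda>v. Z v (T m)) v) *v z" for v x z
  have sigm: "(\<lambda>p. \<sigma> (T m) (snd p) (gl (\<lambda>v. Z v (T m)) (fst p))) \<in> borel_measurable (?I \<Otimes>\<^sub>M borel)"
    by (rule borel_measurable_caratheodory[where f="\<lambda>v x. \<sigma> (T m) x (gl (\<lambda>v. Z v (T m)) v)", OF sig_measurable_index[OF fam T_nonneg] sig_continuous[OF T_nonneg gl_M2(1)[OF fam]]])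
       (auto simp: space_restrict_space)
  have bmeas: "b (T m) \<in> borel_measurable borel" by (rule borel_measurable_continuous_onI[OF b_continuous[OF T_nonneg]])
  have \<Phi>m: "(\<lambda>p. \<Phi> (fst (fst p)) (snd (fst p)) (snd p)) \<in> borel_measurable ((?I \<Otimes>\<^sub>M borel) \<Otimes>\<^sub>M borel)"
  proof -
    have s2: "(\<lambda>p. \<sigma> (T m) (snd (fst p)) (gl (\<lambda>v. Z v (T m)) (fst (fst p))) *v snd p) \<in> borel_measurable ((?I \<Otimes>\<^sub>M borel) \<Otimes>\<^sub>M borel)"
      by (intro borel_measurable_matrix_vector_mult measurable_compose[OF measurable_fst sigm] measurable_snd)
    have x1: "(\<lambda>p. snd (fst p)) \<in> measurable ((?I \<Otimes>\<^sub>M (borel :: (real^'d) measure)) \<Otimes>\<^sub>M (borel :: (real^'q) measure)) borel" by measurable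
    show ?thesis unfolding \<Phi>_def
      by (intro borel_measurable_add borel_measurable_scaleR measurable_compose[OF x1 bmeas] x1 s2) auto
  qed
  have law: "emeasure (laws M (\<lambda>v. Z v ?t) v) A =
      (\<integral>\<^sup>+x. (\<integral>\<^sup>+z. indicator A (\<Phi> v x z) \<partial>gauss h) \<partial>laws M (\<lambda>v. Z v (T m)) v)"
    if v: "v \<in> unit_I" and A: "A \<in> sets borel" for v A
  proof -
    interpret W: filtered_bm M F "B v" by (rule filtered_bm[OF v])
    have ind: "(\<lambda>p. indicator A (\<Phi> v (fst p) (snd p)) :: ennreal) \<in> borel_measurable (borel \<Otimes>\<^sub>M borel)"
    proof -
      have "(\<lambda>p. ((v, fst p), snd p)) \<in> measurable (borel \<Otimes>\<^sub>M borel) ((?I \<Otimes>\<^sub>M borel) \<Otimes>\<^sub>M borel)"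
        by (intro measurable_Pair measurable_const) (use v in \<open>auto simp: space_restrict_space\<close>)
      from measurable_compose[OF this \<Phi>m] A show ?thesis by (simp add: measurable_compose[OF _ borel_measurable_indicator])
    qed
    have inner: "(\<lambda>x. \<integral>\<^sup>+z. indicator A (\<Phi> v x z) \<partial>gauss h) \<in> borel_measurable (borel :: (real^'d) measure)"
      by (intro g.borel_measurable_nn_integral) (use ind in \<open>simp add: case_prod_beta' cong: measurable_cong_sets sets_pair_measure_cong\<close>)
    have "emeasure (laws M (\<lambda>v. Z v ?t) v) A = (\<integral>\<^sup>+\<omega>. indicator A (Z v ?t \<omega>) \<partial>M)"
      unfolding laws_def using nn_integral_distr[OF ZM[OF v], of "indicator A"] A by simp
    also have "\<dots> = (\<integral>\<^sup>+\<omega>. indicator A (\<Phi> v (Z v (T m) \<omega>) (B v ?t \<omega> - B v (T m) \<omega>)) \<partial>M)"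
      using T_Suc[of m] by (intro nn_integral_cong) (simp add: \<Phi>_def euler_step[OF v _ tin] del: of_nat_Suc)
    also have "\<dots> = (\<integral>\<^sup>+\<omega>. (\<integral>\<^sup>+z. indicator A (\<Phi> v (Z v (T m) \<omega>) z) \<partial>gauss (?t - T m)) \<partial>M)"
      using W.nn_integral_increment[OF T_nonneg T_less adapted[OF v] ind] by simp
    also have "\<dots> = (\<integral>\<^sup>+x. (\<integral>\<^sup>+z. indicator A (\<Phi> v x z) \<partial>gauss h) \<partial>laws M (\<lambda>v. Z v (T m)) v)"
      unfolding T_Suc laws_def using inner familyD(3)[OF fam v] by (subst nn_integral_distr) auto
    finally show ?thesis .
  qed
  show ?thesis
    unfolding kernel_on_I_iff
  proof (intro conjI ballI)
    fix v assume v: "v \<in> unit_I"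
    show "prob_space (laws M (\<lambda>v. Z v ?t) v)" unfolding laws_def by (rule prob_space_distr[OF ZM[OF v]])
    show "sets (laws M (\<lambda>v. Z v ?t) v) = sets borel" by (simp add: laws_def)
  next
    fix A :: "(real^'d) set" assume A: "A \<in> sets borel"
    have "(\<lambda>p. \<integral>\<^sup>+z. indicator A (\<Phi> (fst p) (snd p) z) \<partial>gauss h) \<in> borel_measurable (?I \<Otimes>\<^sub>M borel)"
      by (intro g.borel_measurable_nn_integral)
         (use measurable_compose[OF \<Phi>m borel_measurable_indicator[OF A]] in \<open>simp add: case_prod_beta' cong: measurable_cong_sets sets_pair_measure_cong\<close>)
    then have "(\<lambda>v. \<integral>\<^sup>+x. (\<integral>\<^sup>+z. indicator A (\<Phi> v x z) \<partial>gauss h) \<partial>laws M (\<lambda>v. Z v (T m)) v) \<in> borel_measurable ?I"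
      by (intro nn_integral_measurable_subprob_algebra2[where N=borel])
         (auto simp: case_prod_beta' intro: measurable_prob_algebraD[OF familyD(2)[OF fam]])
    then show "(\<lambda>v. emeasure (laws M (\<lambda>v. Z v ?t) v) A) \<in> borel_measurable ?I"
      by (rule measurable_cong[THEN iffD1, rotated]) (use law A in \<open>simp add: space_restrict_space\<close>)
  qed
qed

end

text \<open>Moment bound, adaptedness and measurability of the laws form one induction: the
  coefficient of the next step is under control only when all three hold for the whole
  family.\<close>

lemma euler_invariant:
  "family (\<lambda>v. Z v (T m)) euler_bound \<and> (\<forall>u\<in>unit_I. Z u (T m) \<in> borel_measurable (F (T m)))"
proof (induction m)
  case 0
  have Z0: "Z u 0 \<omega> = X0 u \<omega>" if "u \<in> unit_I" "\<omega> \<in> space M" for u \<omega>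
    using scheme that by (simp add: euler_scheme_def)
  have sp: "space (F 0) = space M" if "u \<in> unit_I" for u
    using filtered_bm.space_F[OF filtered_bm[OF that]] by simp
  have ad: "Z u 0 \<in> borel_measurable (F 0)" if "u \<in> unit_I" for u
    by (rule measurable_cong[THEN iffD1, OF _ X0_meas[OF that]]) (simp add: sp[OF that] Z0[OF that])
  have law: "laws M (\<lambda>v. Z v 0) u = laws M X0 u" if "u \<in> unit_I" for u
    unfolding laws_def by (intro distr_cong) (auto simp: Z0[OF that])
  have "kernel_on_I (laws M (\<lambda>v. Z v 0))"
    by (rule measurable_cong[THEN iffD1, OF _ X0_kernel]) (simp add: law space_restrict_space)
  moreover have "sq_moment M (Z u 0) \<le> ennreal euler_bound" if "u \<in> unit_I" for u
  proof -
    have "sq_moment M (Z u 0) = sq_moment M (X0 u)" by (rule sq_moment_cong[OF Z0[OF that]])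
    then show ?thesis using order_trans[OF X0_sq[OF that] ennreal_leI[OF euler_bound(1)]] by simp
  qed
  ultimately show ?case
    using ad filtered_bm.measurable_F_M[OF filtered_bm _ ad] euler_bound(2) by (auto simp: family_def)
next
  case (Suc m)
  note s = Suc[THEN conjunct1] and a = Suc[THEN conjunct2, rule_format]
  have tin: "T (Suc m) \<in> {T m..T (Suc m)}" using T_less[of m] by auto
  show ?case unfolding family_def
    using euler_step_moment(1,2)[OF s a _ tin] euler_step_kernel[OF s a] euler_bound(2)
      filtered_bm.measurable_F_M[OF filtered_bm T_nonneg euler_step_moment(2)[OF s a _ tin]] by blast
qed

end

end

section \<open>Regularity of the solution\<close>

context filtered_bm
begin

lemma ito_integral_time_bound:
  fixes H :: "real \<Rightarrow> 'w \<Rightarrow> real^'q^'d"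
  assumes H: "progressive F H" and st: "0 \<le> s" "s \<le> t" and A: "A \<in> borel_measurable M"
    and K: "0 \<le> K" "\<And>r. r \<in> {s..t} \<Longrightarrow> sq_moment M (\<lambda>\<omega>. H r \<omega> - A \<omega>) \<le> ennreal K"
  shows "(\<integral>\<^sup>+\<omega>. (\<integral>\<^sup>+r\<in>{s..t}. ennreal ((norm (H r \<omega> - A \<omega>))\<^sup>2) \<partial>lborel) \<partial>M) \<le> ennreal ((t - s) * K)"
proof -
  have m: "(\<lambda>(r, \<omega>). ennreal ((norm (H r \<omega> - A \<omega>))\<^sup>2)) \<in> borel_measurable (restrict_space borel {s..t} \<Otimes>\<^sub>M M)"
    using progressive_measurable[OF H st] measurable_compose[OF measurable_snd A]
    unfolding case_prod_beta' by measurable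
  have "(\<integral>\<^sup>+\<omega>. (\<integral>\<^sup>+r\<in>{s..t}. ennreal ((norm (H r \<omega> - A \<omega>))\<^sup>2) \<partial>lborel) \<partial>M) =
     (\<integral>\<^sup>+r\<in>{s..t}. (\<integral>\<^sup>+\<omega>. ennreal ((norm (H r \<omega> - A \<omega>))\<^sup>2) \<partial>M) \<partial>lborel)"
    by (rule iterated_time_integral(2)[OF m])
  also have "\<dots> \<le> (\<integral>\<^sup>+r. ennreal K * indicator {s..t} r \<partial>lborel)"
    using K(2) by (intro nn_integral_mono) (auto simp: indicator_def sq_moment_def)
  also have "\<dots> = ennreal ((t - s) * K)"
    using st K(1) by (simp add: nn_integral_cmult_indicator ennreal_mult mult.commute)
  finally show ?thesis .
qed

text \<open>The value at time 0 is not prescribed in the definition; it is the mean square limit of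
  simple integrals, all of which vanish there.\<close>

lemma ito_integral_at_0:
  fixes H :: "real \<Rightarrow> 'w \<Rightarrow> real^'q^'d"
  assumes "ito_integral M F W H J"
  shows "AE \<omega> in M. J 0 \<omega> = 0"
proof -
  have Jm: "J 0 \<in> borel_measurable M" using assms by (simp add: ito_integral_def)
  from assms obtain n \<tau> \<xi> where si: "\<And>k. simple_integrand M F (n k) (\<tau> k) (\<xi> k)"
    and lim: "\<And>T. 0 \<le> T \<Longrightarrow> (\<lambda>k. sq_moment M (\<lambda>\<omega>. simple_integral (n k) (\<tau> k) (\<xi> k) W T \<omega> - J T \<omega>)) \<longlonglongrightarrow> 0"
    unfolding ito_integral_def by blast
  have \<tau>nn: "0 \<le> \<tau> k i" if "i \<le> n k" for k i
    using that
  proof (induction i)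
    case 0 show ?case using si[of k] by (simp add: simple_integrand_def)
  next
    case (Suc i)
    then have "\<tau> k i < \<tau> k (Suc i)" using si[of k] by (simp add: simple_integrand_def)
    then show ?case using Suc by simp
  qed
  have "simple_integral (n k) (\<tau> k) (\<xi> k) W 0 \<omega> = 0" for k \<omega>
    unfolding simple_integral_def using \<tau>nn[of _ k] by (intro sum.neutral ballI) (simp add: min_def)
  then have "(\<lambda>k::nat. sq_moment M (J 0)) \<longlonglongrightarrow> 0" using lim[of 0] by (simp add: sq_moment_minus)
  then have "sq_moment M (J 0) = 0" by (simp add: LIMSEQ_const_iff)
  then have "AE \<omega> in M. ennreal ((norm (J 0 \<omega>))\<^sup>2) = 0"
    unfolding sq_moment_def using Jm by (subst (asm) nn_integral_0_iff_AE) auto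
  then show ?thesis by eventually_elim simp
qed

end

context graphon_sde
begin

text \<open>The change of time is charged to the old point x, so the growth factor stays fixed while
  r and y vary.\<close>

lemma b_diff:
  assumes "0 \<le> r" "0 \<le> s"
  shows "norm (b r y - b s x) \<le> L * norm (y - x) + Lt * (1 + norm x) * \<bar>r - s\<bar> powr \<rho>"
proof -
  have "norm (b r x - b s x) \<le> Lt * (1 + norm x) * \<bar>r - s\<bar> powr \<rho>"
  proof (cases "s \<le> r")
    case True then show ?thesis using b_time[of s r x] assms by simp
  next
    case False then show ?thesis using b_time[of r s x] assms by (simp add: norm_minus_commute)
  qed
  moreover have "norm (b r y - b s x) \<le> norm (b r y - b r x) + norm (b r x - b s x)"
    using norm_triangle_ineq[of "b r y - b r x" "b r x - b s x"] by simp
  ultimately show ?thesis using b_lip[OF assms(1), of y x] by linarith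
qed

lemma b_path_continuous:
  assumes x: "continuous_on {0..} x" shows "continuous_on {0..} (\<lambda>r. b r (x r))"
  unfolding continuous_on_def
proof
  fix s :: real assume s: "s \<in> {0..}"
  have xs: "(x \<longlongrightarrow> x s) (at s within {0..})" using x s by (auto simp: continuous_on_def)
  have ids: "((\<lambda>r. \<bar>r - s\<bar>) \<longlongrightarrow> \<bar>s - s\<bar>) (at s within {0..})" by (intro tendsto_intros)
  have "((\<lambda>r. L * norm (x r - x s) + Lt * (1 + norm (x s)) * \<bar>r - s\<bar> powr \<rho>) \<longlongrightarrow> L * norm (x s - x s) + Lt * (1 + norm (x s)) * 0) (at s within {0..})"
    using ids \<rho> by (intro tendsto_intros xs tendsto_zero_powrI[where b=\<rho>]) auto
  then have z: "((\<lambda>r. L * norm (x r - x s) + Lt * (1 + norm (x s)) * \<bar>r - s\<bar> powr \<rho>) \<longlongrightarrow> 0) (at s within {0..})" by simp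
  have "((\<lambda>r. b r (x r) - b s (x s)) \<longlongrightarrow> 0) (at s within {0..})"
    by (rule Lim_null_comparison[OF _ z]) (use s in \<open>auto simp: eventually_at_filter intro!: always_eventually b_diff\<close>)
  then show "((\<lambda>r. b r (x r)) \<longlongrightarrow> b s (x s)) (at s within {0..})" by (simp add: LIM_zero_iff)
qed

lemma b_comp_measurable:
  assumes "U \<in> borel_measurable N" "0 \<le> t" shows "(\<lambda>\<omega>. b t (U \<omega>)) \<in> borel_measurable N"
  by (rule measurable_compose[OF assms(1) borel_measurable_continuous_onI[OF b_continuous[OF assms(2)]]])

lemma sig_comp_measurable:
  assumes "U \<in> borel_measurable N" "0 \<le> t" "\<mu> \<in> M2" shows "(\<lambda>\<omega>. \<sigma> t (U \<omega>) \<mu>) \<in> borel_measurable N"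
  by (rule measurable_compose[OF assms(1) borel_measurable_continuous_onI[OF sig_continuous[OF assms(2,3)]]])

context
  fixes X :: "real \<Rightarrow> real \<Rightarrow> 'w \<Rightarrow> real^'d"
  assumes sol: "graphon_sde_solution M F B G b \<sigma> X0 X"
begin

lemma X_adapted: "u \<in> unit_I \<Longrightarrow> 0 \<le> t \<Longrightarrow> X u t \<in> borel_measurable (F t)"
  and X_continuous: "u \<in> unit_I \<Longrightarrow> AE \<omega> in M. continuous_on {0..} (\<lambda>t. X u t \<omega>)"
  using sol by (auto simp: graphon_sde_solution_def)

lemma X_measurable: "u \<in> unit_I \<Longrightarrow> 0 \<le> t \<Longrightarrow> X u t \<in> borel_measurable M"
  using filtered_bm.measurable_F_M[OF filtered_bm _ X_adapted] by blast

lemma X_kernel: assumes "0 \<le> t" shows "kernel_on_I (laws M (\<lambda>v. X v t))"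
proof -
  have lf: "laws M (\<lambda>v. X v t) \<in> law_families" using sol assms by (simp add: graphon_sde_solution_def)
  then show ?thesis unfolding kernel_on_I_iff by (auto simp: law_families_def P2_def)
qed

lemma X_family_ex: assumes t: "0 \<le> t" shows "\<exists>C. family (\<lambda>v. X v t) C"
proof -
  have lf: "laws M (\<lambda>v. X v t) \<in> law_families" using sol t by (simp add: graphon_sde_solution_def)
  define S where "S = (SUP u\<in>unit_I. sq_moment (laws M (\<lambda>v. X v t) u) (\<lambda>x. x))"
  have "S < \<infinity>" using lf by (simp add: law_families_def S_def)
  then have S: "S = ennreal (enn2real S)" by simp
  have "sq_moment M (X u t) \<le> ennreal (enn2real S)" if u: "u \<in> unit_I" for u
  proof -
    have "sq_moment M (X u t) = sq_moment (laws M (\<lambda>v. X v t) u) (\<lambda>x. x)"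
      using sq_moment_laws[of "\<lambda>v. X v t" u] X_measurable[OF u t] by simp
    also have "\<dots> \<le> S" unfolding S_def using u by (rule SUP_upper)
    finally show ?thesis using S by simp
  qed
  then show ?thesis unfolding family_def using X_kernel[OF t] X_measurable t by (intro exI[of _ "enn2real S"]) auto
qed

lemma X_family: "0 \<le> t \<Longrightarrow> 0 \<le> C \<Longrightarrow> (\<And>u. u \<in> unit_I \<Longrightarrow> sq_moment M (X u t) \<le> ennreal C) \<Longrightarrow> family (\<lambda>v. X v t) C"
  unfolding family_def using X_kernel X_measurable by auto

abbreviation diffusion :: "real \<Rightarrow> real \<Rightarrow> 'w \<Rightarrow> real^'q^'d" where
  "diffusion u \<equiv> \<lambda>s \<omega>. \<sigma> s (X u s \<omega>) (gl (\<lambda>v. X v s) u)"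

lemma diffusion_measurable:
  assumes u: "u \<in> unit_I" and s: "0 \<le> s" shows "diffusion u s \<in> borel_measurable (F s)"
proof -
  obtain C where "family (\<lambda>v. X v s) C" using X_family_ex[OF s] by auto
  then show ?thesis by (intro sig_comp_measurable[OF X_adapted[OF u s] s] gl_M2(1)[OF _ u])
qed

context
  fixes u :: real and J :: "real \<Rightarrow> 'w \<Rightarrow> real^'d"
  assumes u: "u \<in> unit_I" and ito: "ito_integral M F (B u) (diffusion u) J"
    and eqn_all: "\<forall>t\<ge>0. AE \<omega> in M. X u t \<omega> = X0 u \<omega> + integral {0..t} (\<lambda>s. b s (X u s \<omega>)) + J t \<omega>"
begin

lemmas eqn = eqn_all[rule_format]

interpretation W: filtered_bm M F "B u" by (rule filtered_bm[OF u])

lemma J_measurable: "0 \<le> t \<Longrightarrow> J t \<in> borel_measurable M"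
  and J_continuous: "AE \<omega> in M. continuous_on {0..} (\<lambda>t. J t \<omega>)"
  and diffusion_progressive: "progressive F (diffusion u)"
  using ito by (auto simp: ito_integral_def)

lemma increment_eq:
  assumes st: "0 \<le> s" "s \<le> t"
  shows "AE \<omega> in M. X u t \<omega> - X u s \<omega> - (J t \<omega> - J s \<omega>) = integral {s..t} (\<lambda>r. b r (X u r \<omega>))"
  using eqn[OF st(1)] eqn[OF order_trans[OF st]] X_continuous[OF u]
proof eventually_elim
  case (elim \<omega>)
  have "(\<lambda>r. b r (X u r \<omega>)) integrable_on {0..t}"
    by (intro integrable_continuous_real continuous_on_subset[OF b_path_continuous[OF elim(3)]]) auto
  then have "integral {0..s} (\<lambda>r. b r (X u r \<omega>)) + integral {s..t} (\<lambda>r. b r (X u r \<omega>)) = integral {0..t} (\<lambda>r. b r (X u r \<omega>))"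
    by (intro Henstock_Kurzweil_Integration.integral_combine st)
  then show ?case using elim(1,2) by (simp add: algebra_simps)
qed

text \<open>Once the martingale part is removed, only the time integral of the drift is left.
  \<open>V\<close> is a reference drift to be subtracted: 0 for growth bounds, the drift at s for
  the error analysis.\<close>

lemma increment_drift:
  assumes st: "0 \<le> s" "s \<le> t" and V: "V \<in> borel_measurable M"
    and K: "0 \<le> K" "\<And>r. r \<in> {s..t} \<Longrightarrow> sq_moment M (\<lambda>\<omega>. b r (X u r \<omega>) - V \<omega>) \<le> ennreal K"
  shows "sq_moment M (\<lambda>\<omega>. X u t \<omega> - X u s \<omega> - (J t \<omega> - J s \<omega>) - (t - s) *\<^sub>R V \<omega>) \<le> ennreal ((t - s)\<^sup>2 * K)"
proof -
  have Xc: "AE \<omega> in M. continuous_on {s..t} (\<lambda>r. b r (X u r \<omega>))"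
    using X_continuous[OF u]
    by eventually_elim (rule continuous_on_subset[OF b_path_continuous], use st in auto)
  have "sq_moment M (\<lambda>\<omega>. X u t \<omega> - X u s \<omega> - (J t \<omega> - J s \<omega>) - (t - s) *\<^sub>R V \<omega>) =
     sq_moment M (\<lambda>\<omega>. integral {s..t} (\<lambda>r. b r (X u r \<omega>) - V \<omega>))"
  proof (rule sq_moment_cong_AE)
    show "AE \<omega> in M. X u t \<omega> - X u s \<omega> - (J t \<omega> - J s \<omega>) - (t - s) *\<^sub>R V \<omega> = integral {s..t} (\<lambda>r. b r (X u r \<omega>) - V \<omega>)"
      using increment_eq[OF st] Xc
    proof eventually_elim
      case (elim \<omega>)
      have "integral {s..t} (\<lambda>r. b r (X u r \<omega>) - V \<omega>) = integral {s..t} (\<lambda>r. b r (X u r \<omega>)) - integral {s..t} (\<lambda>r. V \<omega>)"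
        using elim(2) by (intro Henstock_Kurzweil_Integration.integral_diff integrable_continuous_real) auto
      then show ?case using elim(1) st by simp
    qed
  qed
  also have "\<dots> \<le> ennreal ((t - s)\<^sup>2 * K)"
  proof (rule sq_moment_time_integral_le[OF st(2) _ _ K])
    show "(\<lambda>\<omega>. b r (X u r \<omega>) - V \<omega>) \<in> borel_measurable M" if "r \<in> {s..t}" for r
      using st that by (intro borel_measurable_diff V b_comp_measurable X_measurable u) auto
    show "AE \<omega> in M. continuous_on {s..t} (\<lambda>r. b r (X u r \<omega>) - V \<omega>)"
      using Xc by eventually_elim (intro continuous_intros)
  qed auto
  finally show ?thesis .
qed

lemma drift_moment:
  assumes st: "0 \<le> s" "s \<le> t" and S: "0 \<le> S" "\<And>r. r \<in> {s..t} \<Longrightarrow> sq_moment M (X u r) \<le> ennreal S"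
  shows "sq_moment M (\<lambda>\<omega>. X u t \<omega> - X u s \<omega> - (J t \<omega> - J s \<omega>)) \<le> ennreal ((t - s)\<^sup>2 * (2 * \<kappa>\<^sup>2 + 2 * L\<^sup>2 * S))"
proof -
  have "sq_moment M (\<lambda>\<omega>. b r (X u r \<omega>) - 0) \<le> ennreal (2 * \<kappa>\<^sup>2 + 2 * L\<^sup>2 * S)" if r: "r \<in> {s..t}" for r
  proof -
    have r0: "0 \<le> r" using r st by auto
    have "sq_moment M (\<lambda>\<omega>. b r (X u r \<omega>) - 0) \<le> ennreal (2 * \<kappa>\<^sup>2 + 2 * L\<^sup>2 * S + 0 * S)"
      by (rule sq_moment_affine_le[OF X_measurable[OF u r0] X_measurable[OF u r0]])
         (use b_growth_sq[OF r0] S r in auto)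
    then show ?thesis by simp
  qed
  from increment_drift[OF st _ _ this] S(1) show ?thesis by simp
qed

text \<open>The exceptional set in the equation depends on the time. Countably many rational times
  share one such set, and both sides are continuous in time.\<close>

lemma solution_eq_everywhere:
  "AE \<omega> in M. \<forall>t\<ge>0. X u t \<omega> = X0 u \<omega> + integral {0..t} (\<lambda>s. b s (X u s \<omega>)) + J t \<omega>"
proof -
  have "AE \<omega> in M. \<forall>t\<in>\<rat> \<inter> {0..}. X u t \<omega> = X0 u \<omega> + integral {0..t} (\<lambda>s. b s (X u s \<omega>)) + J t \<omega>"
    using eqn by (subst AE_ball_countable) (auto intro: countable_Int1 countable_rat)
  then show ?thesis using X_continuous[OF u] J_continuous
  proof eventually_elim
    case (elim \<omega>)
    let ?g = "\<lambda>t. X0 u \<omega> + integral {0..t} (\<lambda>s. b s (X u s \<omega>)) + J t \<omega>"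
    show ?case
    proof (intro allI impI)
      fix t :: real assume t: "0 \<le> t"
      have "\<exists>r\<in>\<rat>. t < r \<and> r < t + 1 / real (Suc n)" for n
        by (rule Rats_dense_in_real) simp
      then obtain r where r: "\<And>n. r n \<in> \<rat>" "\<And>n. t < r n" "\<And>n. r n < t + 1 / real (Suc n)" by metis
      have rt: "r \<longlonglongrightarrow> t"
      proof (rule tendsto_sandwich[of "\<lambda>_. t" _ _ "\<lambda>n. t + 1 / real (Suc n)"])
        have "(\<lambda>n. t + 1 / real (Suc n)) \<longlonglongrightarrow> t + 0" by (intro tendsto_intros LIMSEQ_Suc[OF lim_1_over_n])
        then show "(\<lambda>n. t + 1 / real (Suc n)) \<longlonglongrightarrow> t" by simp
      qed (use r in \<open>auto intro!: always_eventually less_imp_le\<close>)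
      have rin: "r n \<in> {0..t + 1}" for n
      proof -
        have 1: "1 / real (Suc n) \<le> 1" by simp
        have "r n \<le> t + 1" using r(3)[of n] 1 by linarith
        moreover have "0 \<le> r n" using r(2)[of n] t by linarith
        ultimately show ?thesis by simp
      qed
      have ci: "continuous_on {0..t + 1} (\<lambda>t. integral {0..t} (\<lambda>s. b s (X u s \<omega>)))"
        by (intro indefinite_integral_continuous_1 integrable_continuous_real continuous_on_subset[OF b_path_continuous[OF elim(2)]]) auto
      have cg: "continuous_on {0..t + 1} ?g"
        by (intro continuous_intros ci continuous_on_subset[OF elim(3)]) auto
      have cx: "continuous_on {0..t + 1} (\<lambda>t. X u t \<omega>)"
        by (intro continuous_on_subset[OF elim(2)]) auto
      have "(\<lambda>n. X u (r n) \<omega>) \<longlonglongrightarrow> X u t \<omega>"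
        by (rule continuous_on_tendsto_compose[OF cx rt]) (use t rin in auto)
      moreover have "(\<lambda>n. ?g (r n)) \<longlonglongrightarrow> ?g t"
        by (rule continuous_on_tendsto_compose[OF cg rt]) (use t rin in auto)
      moreover have "X u (r n) \<omega> = ?g (r n)" for n
        using elim(1) r(1)[of n] rin[of n] by auto
      ultimately show "X u t \<omega> = ?g t" by (simp add: LIMSEQ_unique)
    qed
  qed
qed

text \<open>The isometry with \<open>Z\<close> and \<open>A\<close> equal to 0; the energy increases
  with the end point, so its value over the whole window bounds all the others.\<close>

lemma diffusion_energy_finite:
  assumes st: "0 \<le> s" "s \<le> t"
  shows "\<exists>K\<ge>0. \<forall>r\<in>{s..t}. sq_moment M (\<lambda>\<omega>. J r \<omega> - J s \<omega>) \<le> ennreal K"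
proof -
  let ?E = "\<lambda>r. \<integral>\<^sup>+\<omega>. (\<integral>\<^sup>+x\<in>{s..r}. ennreal ((norm (diffusion u x \<omega> - 0))\<^sup>2) \<partial>lborel) \<partial>M"
  have z: "sq_moment M (\<lambda>\<omega>. 0 :: 'x::real_normed_vector) = 0" by (simp add: sq_moment_def)
  have iso: "sq_moment M (\<lambda>\<omega>. J r \<omega> - J s \<omega>) = ?E r" if "s \<le> r" for r
    using W.ito_isometry(1)[OF ito st(1) that, of "\<lambda>_. 0" "\<lambda>_. 0"] by (simp add: z)
  have fin: "?E t < \<infinity>"
    using W.ito_isometry(2)[OF ito st, of "\<lambda>_. 0" "\<lambda>_. 0"] by (simp add: z)
  have "sq_moment M (\<lambda>\<omega>. J r \<omega> - J s \<omega>) \<le> ennreal (enn2real (?E t))" if r: "r \<in> {s..t}" for r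
  proof -
    have "?E r \<le> ?E t" using r by (intro nn_integral_mono mult_left_mono) (auto simp: indicator_def)
    then show ?thesis using iso[of r] r fin by simp
  qed
  then show ?thesis by (intro exI[of _ "enn2real (?E t)"]) simp
qed

end

end


section \<open>Moments and increments of the solution on short windows\<close>

definition reg_const :: real where
  "reg_const = 2 * (2 * \<kappa>\<^sup>2 + 2 * L\<^sup>2) + 2 * (real CARD('q) * (2 * \<kappa>\<^sup>2 + 8 * L\<^sup>2))"

lemma reg_const_nonneg: "0 \<le> reg_const" by (simp add: reg_const_def)

context
  fixes X :: "real \<Rightarrow> real \<Rightarrow> 'w \<Rightarrow> real^'d"
  assumes sol: "graphon_sde_solution M F B G b \<sigma> X0 X"
begin

lemma solution_ito:
  assumes "u \<in> unit_I"
  shows "\<exists>J. ito_integral M F (B u) (diffusion X u) J \<and>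
    (\<forall>t\<ge>0. AE \<omega> in M. X u t \<omega> = X0 u \<omega> + integral {0..t} (\<lambda>s. b s (X u s \<omega>)) + J t \<omega>)"
  using sol assms unfolding graphon_sde_solution_def by blast

text \<open>A pathwise Gronwall argument.  The bound still depends on the index.\<close>

lemma window_finite:
  assumes u: "u \<in> unit_I" and st: "0 \<le> s" "s < t" and w: "2 * (L * (t - s)) \<le> 1"
  shows "\<exists>K\<ge>0. \<forall>r\<in>{s..t}. sq_moment M (X u r) \<le> ennreal K"
proof -
  obtain J where J1: "ito_integral M F (B u) (diffusion X u) J"
    and J2: "\<forall>t\<ge>0. AE \<omega> in M. X u t \<omega> = X0 u \<omega> + integral {0..t} (\<lambda>s. b s (X u s \<omega>)) + J t \<omega>"
    using solution_ito[OF u] by blast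
  note J = J1 J2
  have st': "s \<le> t" using st by simp
  note Jm = J_measurable[OF sol u J] and Xm = X_measurable[OF sol u]
  obtain KJ where KJ: "0 \<le> KJ" "\<forall>r\<in>{s..t}. sq_moment M (\<lambda>\<omega>. J r \<omega> - J s \<omega>) \<le> ennreal KJ"
    using diffusion_energy_finite[OF sol u J st(1) st'] by blast
  obtain C where C: "family (\<lambda>v. X v s) C" using X_family_ex[OF sol st(1)] by auto
  define \<Delta> where "\<Delta> = t - s"
  have \<Delta>: "0 < \<Delta>" "2 * (L * \<Delta>) \<le> 1" using st w by (auto simp: \<Delta>_def)
  \<comment> \<open>Everything in the bound for X at time r except the time integral of its own
    norm.\<close>
  define a where "a r \<omega> = norm (X u s \<omega>) + \<kappa> * \<Delta> + norm (J r \<omega> - J s \<omega>)" for r \<omega>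
  have a0: "0 \<le> a r \<omega>" for r \<omega> using \<kappa> \<Delta> by (simp add: a_def)
  have am: "a r \<in> borel_measurable M" if "r \<in> {s..t}" for r
    unfolding a_def using Jm[of r] Jm[OF st(1)] Xm[OF st(1)] that st by (auto intro!: borel_measurable_add borel_measurable_norm borel_measurable_diff)
  define Ka where "Ka = 3 * (\<kappa> * \<Delta>)\<^sup>2 + 3 * C + 3 * KJ"
  have Ka: "0 \<le> Ka" using familyD(1)[OF C] KJ by (simp add: Ka_def)
  have asq: "sq_moment M (a r) \<le> ennreal Ka" if r: "r \<in> {s..t}" for r
  proof -
    have r0: "0 \<le> r" using r st by auto
    have JJ: "(\<lambda>\<omega>. J r \<omega> - J s \<omega>) \<in> borel_measurable M" by (intro borel_measurable_diff Jm r0 st)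
    have pw: "(norm (a r \<omega>))\<^sup>2 \<le> 3 * (\<kappa> * \<Delta>)\<^sup>2 + 3 * (norm (X u s \<omega>))\<^sup>2 + 3 * (norm (J r \<omega> - J s \<omega>))\<^sup>2" for \<omega>
      using sum_sq_le3[of "norm (X u s \<omega>)" "\<kappa> * \<Delta>" "norm (J r \<omega> - J s \<omega>)"] a0[of r \<omega>] by (simp add: a_def)
    show ?thesis unfolding Ka_def
      by (rule sq_moment_affine_le[OF Xm[OF st(1)] JJ pw])
         (use familyD(1)[OF C] familyD(4)[OF C u] KJ r in auto)
  qed
  have path: "AE \<omega> in M. \<forall>r\<in>{s..t}. norm (X u r \<omega>) \<le> a r \<omega> + 2 * L * integral {s..t} (\<lambda>x. a x \<omega>)"
    using solution_eq_everywhere[OF sol u J] X_continuous[OF sol u] J_continuous[OF sol u J]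
  proof eventually_elim
    case (elim \<omega>)
    let ?b = "\<lambda>r. b r (X u r \<omega>)"
    have sub: "{s..t} \<subseteq> {0..}" using st by auto
    have Xc: "continuous_on {s..t} (\<lambda>r. X u r \<omega>)" by (rule continuous_on_subset[OF elim(2) sub])
    have Jc: "continuous_on {s..t} (\<lambda>r. J r \<omega>)" by (rule continuous_on_subset[OF elim(3) sub])
    have nX: "(\<lambda>r. norm (X u r \<omega>)) integrable_on {s..t}" by (intro integrable_continuous_real continuous_intros Xc)
    have aI: "(\<lambda>r. a r \<omega>) integrable_on {s..t}" unfolding a_def by (intro integrable_continuous_real continuous_intros Jc)
    let ?f = "integral {s..t} (\<lambda>r. norm (X u r \<omega>))"
    have le: "norm (X u r \<omega>) \<le> a r \<omega> + L * ?f" if r: "r \<in> {s..t}" for r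
    proof -
      have r0: "0 \<le> r" "s \<le> r" using r st by auto
      have bI: "?b integrable_on {0..r}"
        by (intro integrable_continuous_real continuous_on_subset[OF b_path_continuous[OF elim(2)]]) auto
      have "integral {0..s} ?b + integral {s..r} ?b = integral {0..r} ?b"
        by (rule Henstock_Kurzweil_Integration.integral_combine[OF st(1) r0(2) bI])
      moreover have "X u r \<omega> = X0 u \<omega> + integral {0..r} ?b + J r \<omega>" "X u s \<omega> = X0 u \<omega> + integral {0..s} ?b + J s \<omega>"
        using elim(1) r0 st by auto
      ultimately have eq: "X u r \<omega> = X u s \<omega> + integral {s..r} ?b + (J r \<omega> - J s \<omega>)" by (simp add: algebra_simps)
      have sr: "{s..r} \<subseteq> {s..t}" using r by auto
      have "norm (integral {s..r} ?b) \<le> integral {s..r} (\<lambda>x. \<kappa> + L * norm (X u x \<omega>))"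
      proof (rule integral_norm_bound_integral)
        show "?b integrable_on {s..r}"
          by (intro integrable_continuous_real continuous_on_subset[OF b_path_continuous[OF elim(2)]]) (use st in auto)
        show "(\<lambda>x. \<kappa> + L * norm (X u x \<omega>)) integrable_on {s..r}"
          by (intro integrable_continuous_real continuous_intros continuous_on_subset[OF Xc sr])
        show "norm (?b x) \<le> \<kappa> + L * norm (X u x \<omega>)" if "x \<in> {s..r}" for x
          using that st by (intro b_growth) auto
      qed
      also have "\<dots> \<le> integral {s..t} (\<lambda>x. \<kappa> + L * norm (X u x \<omega>))"
        using \<kappa> L by (intro integral_subset_le sr integrable_continuous_real continuous_intros continuous_on_subset[OF Xc sr] Xc) auto
      also have "\<dots> = \<kappa> * \<Delta> + L * ?f"
      proof -
        have "(\<lambda>x. L * norm (X u x \<omega>)) integrable_on {s..t}" by (intro integrable_continuous_real continuous_intros Xc)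
        then show ?thesis using st by (subst Henstock_Kurzweil_Integration.integral_add) (auto simp: \<Delta>_def)
      qed
      finally have "norm (integral {s..r} ?b) \<le> \<kappa> * \<Delta> + L * ?f" .
      then show ?thesis unfolding eq a_def
        using norm_triangle_ineq[of "X u s \<omega> + integral {s..r} ?b" "J r \<omega> - J s \<omega>"] norm_triangle_ineq[of "X u s \<omega>" "integral {s..r} ?b"] by linarith
    qed
    have f0: "0 \<le> ?f" by (rule Henstock_Kurzweil_Integration.integral_nonneg[OF nX]) simp
    \<comment> \<open>Integrating the pathwise bound over the window puts the same unknown integral
      on both sides; \<open>L * \<Delta>\<close> is at most 1/2 and absorbs it.\<close>
    have "?f \<le> integral {s..t} (\<lambda>r. a r \<omega> + L * ?f)"
      using le by (intro integral_le nX integrable_add aI) auto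
    also have "\<dots> = integral {s..t} (\<lambda>r. a r \<omega>) + (L * \<Delta>) * ?f"
      using aI st by (subst Henstock_Kurzweil_Integration.integral_add) (auto simp: \<Delta>_def)
    also have "(L * \<Delta>) * ?f \<le> 1 / 2 * ?f" using \<Delta> f0 by (intro mult_right_mono) auto
    finally have "?f \<le> 2 * integral {s..t} (\<lambda>r. a r \<omega>)" by simp
    from mult_left_mono[OF this, of L] L have "L * ?f \<le> 2 * L * integral {s..t} (\<lambda>r. a r \<omega>)" by simp
    then show ?case using le by fastforce
  qed
  define K where "K = \<Delta>\<^sup>2 * (2 * (1 / \<Delta>)\<^sup>2 * Ka + 2 * (2 * L)\<^sup>2 * Ka)"
  have K0: "0 \<le> K" using Ka by (simp add: K_def)
  have "sq_moment M (X u r) \<le> ennreal K" if r: "r \<in> {s..t}" for r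
  proof -
    \<comment> \<open>The pathwise bound is rewritten as one time integral, with the factor
      \<open>1 / \<Delta>\<close> making up for the length of the window, so that
      \<open>sq_moment_time_integral_le\<close> applies to it.\<close>
    define Y where "Y x \<omega> = 1 / \<Delta> * a r \<omega> + 2 * L * a x \<omega>" for x \<omega>
    have "sq_moment M (X u r) \<le> sq_moment M (\<lambda>\<omega>. integral {s..t} (\<lambda>x. Y x \<omega>))"
    proof (rule sq_moment_mono)
      show "AE \<omega> in M. norm (X u r \<omega>) \<le> norm (integral {s..t} (\<lambda>x. Y x \<omega>))"
        using path J_continuous[OF sol u J]
      proof eventually_elim
        case (elim \<omega>)
        have "continuous_on {s..t} (\<lambda>r. J r \<omega>)" by (rule continuous_on_subset[OF elim(2)]) (use st in auto)
        then have aI: "(\<lambda>r. a r \<omega>) integrable_on {s..t}" unfolding a_def by (intro integrable_continuous_real continuous_intros)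
        have "integral {s..t} (\<lambda>x. Y x \<omega>) = \<Delta> * (1 / \<Delta> * a r \<omega>) + 2 * L * integral {s..t} (\<lambda>x. a x \<omega>)"
        proof -
          have "(\<lambda>x. 2 * L * a x \<omega>) integrable_on {s..t}" using integrable_on_cmult_left[OF aI, of "2 * L"] by simp
          then show ?thesis unfolding Y_def using st' by (subst Henstock_Kurzweil_Integration.integral_add) (auto simp: \<Delta>_def)
        qed
        then have "integral {s..t} (\<lambda>x. Y x \<omega>) = a r \<omega> + 2 * L * integral {s..t} (\<lambda>x. a x \<omega>)" using \<Delta> by simp
        then show ?case using elim(1) r by force
      qed
    qed
    also have "\<dots> \<le> ennreal ((t - s)\<^sup>2 * (2 * (1 / \<Delta>)\<^sup>2 * Ka + 2 * (2 * L)\<^sup>2 * Ka))"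
    proof (rule sq_moment_time_integral_le[OF st'])
      show "Y x \<in> borel_measurable M" if "x \<in> {s..t}" for x unfolding Y_def using am[OF r] am[OF that] by measurable
      show "AE \<omega> in M. continuous_on {s..t} (\<lambda>x. Y x \<omega>)"
        using J_continuous[OF sol u J]
      proof eventually_elim
        case (elim \<omega>)
        have "continuous_on {s..t} (\<lambda>r. J r \<omega>)" by (rule continuous_on_subset[OF elim]) (use st in auto)
        then show ?case unfolding Y_def a_def by (intro continuous_intros)
      qed
      show "0 \<le> 2 * (1 / \<Delta>)\<^sup>2 * Ka + 2 * (2 * L)\<^sup>2 * Ka" using Ka by simp
      fix x assume x: "x \<in> {s..t}"
      have pw: "(norm (Y x \<omega>))\<^sup>2 \<le> 0 + 2 * (1 / \<Delta>)\<^sup>2 * (norm (a r \<omega>))\<^sup>2 + 2 * (2 * L)\<^sup>2 * (norm (a x \<omega>))\<^sup>2" for \<omega>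
      proof -
        have "(norm (Y x \<omega>))\<^sup>2 = (1 / \<Delta> * a r \<omega> + 2 * L * a x \<omega>)\<^sup>2" by (simp add: Y_def)
        also have "\<dots> \<le> 2 * (1 / \<Delta> * a r \<omega>)\<^sup>2 + 2 * (2 * L * a x \<omega>)\<^sup>2" by (rule sum_sq_le2)
        finally show ?thesis by (simp only: power_mult_distrib real_norm_def power2_abs mult.assoc add_0_left)
      qed
      have "sq_moment M (Y x) \<le> ennreal (0 + 2 * (1 / \<Delta>)\<^sup>2 * Ka + 2 * (2 * L)\<^sup>2 * Ka)"
        by (rule sq_moment_affine_le[OF am[OF r] am[OF x] pw]) (use Ka asq[OF r] asq[OF x] in auto)
      then show "sq_moment M (Y x) \<le> ennreal (2 * (1 / \<Delta>)\<^sup>2 * Ka + 2 * (2 * L)\<^sup>2 * Ka)" by simp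
    qed
    finally show ?thesis by (simp add: K_def \<Delta>_def)
  qed
  then show ?thesis using K0 by blast
qed

text \<open>The drift is bounded from both sides, so the second moment at the end of a window controls
  the whole window.  This makes the bound uniform in the index.\<close>

lemma window_uniform:
  assumes st: "0 \<le> s" "s < t" and w: "3 * (L * (t - s)) \<le> 1" and C: "family (\<lambda>v. X v t) C"
    and u: "u \<in> unit_I" and r: "r \<in> {s..t}"
  shows "sq_moment M (X u r) \<le> ennreal (4 * C + 8 * ((t - s)\<^sup>2 * \<kappa>\<^sup>2))"
proof -
  obtain J where J1: "ito_integral M F (B u) (diffusion X u) J"
    and J2: "\<forall>t\<ge>0. AE \<omega> in M. X u t \<omega> = X0 u \<omega> + integral {0..t} (\<lambda>s. b s (X u s \<omega>)) + J t \<omega>"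
    using solution_ito[OF u] by blast
  note J = J1 J2
  interpret W: filtered_bm M F "B u" by (rule filtered_bm[OF u])
  note Jm = J_measurable[OF sol u J] and Xm = X_measurable[OF sol u]
  have L0: "0 \<le> L * (t - s)" using L st by simp
  have "2 * (L * (t - s)) \<le> 1" using w L0 by linarith
  then obtain K where K: "0 \<le> K" "\<forall>r\<in>{s..t}. sq_moment M (X u r) \<le> ennreal K"
    using window_finite[OF u st] by blast
  \<comment> \<open>The index-dependent bound only shows that this supremum is finite, which allows
    it to be absorbed below; the bound itself disappears from the result.\<close>
  define Ss where "Ss = (SUP r\<in>{s..t}. sq_moment M (X u r))"
  have "Ss \<le> ennreal K" unfolding Ss_def using K by (intro SUP_least) auto
  then have fin: "Ss < \<infinity>" by (rule le_less_trans) simp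
  define S where "S = enn2real Ss"
  have S: "Ss = ennreal S" "0 \<le> S" using fin by (auto simp: S_def)
  have le: "sq_moment M (X u r) \<le> ennreal S" if "r \<in> {s..t}" for r
    unfolding S(1)[symmetric] Ss_def using that by (rule SUP_upper)
  have C0': "0 \<le> C" by (rule familyD(1)[OF C])
  let ?w = "t - s"
  have t0: "0 \<le> t" using st by simp
  have step: "sq_moment M (X u r) \<le> ennreal (2 * C + 2 * (?w\<^sup>2 * (2 * \<kappa>\<^sup>2 + 2 * L\<^sup>2 * S)))" if r: "r \<in> {s..t}" for r
  proof -
    have r0: "0 \<le> r" "r \<le> t" using r st by auto
    let ?D = "\<lambda>\<omega>. X u t \<omega> - X u r \<omega> - (J t \<omega> - J r \<omega>)"
    have Dm: "?D \<in> borel_measurable M" by (intro borel_measurable_diff Xm Jm r0 t0)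
    have "sq_moment M (X u r) < \<infinity>" using le[OF r] by (rule le_less_trans) simp
    from W.ito_isometry(1)[OF J(1) r0 X_adapted[OF sol u r0(1)] this, of "\<lambda>_. 0"]
    have "sq_moment M (X u r) \<le> sq_moment M (\<lambda>\<omega>. X u r \<omega> + (J t \<omega> - J r \<omega>))"
      by (simp add: sq_moment_def)
    also have "(\<lambda>\<omega>. X u r \<omega> + (J t \<omega> - J r \<omega>)) = (\<lambda>\<omega>. X u t \<omega> - ?D \<omega>)" by auto
    also have "sq_moment M \<dots> \<le> 2 * sq_moment M (X u t) + 2 * sq_moment M ?D"
      by (rule sq_moment_diff_le2[OF Xm[OF t0] Dm])
    also have "\<dots> \<le> 2 * ennreal C + 2 * ennreal (?w\<^sup>2 * (2 * \<kappa>\<^sup>2 + 2 * L\<^sup>2 * S))"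
    proof (intro add_mono mult_left_mono familyD(4)[OF C u])
      have "sq_moment M ?D \<le> ennreal ((t - r)\<^sup>2 * (2 * \<kappa>\<^sup>2 + 2 * L\<^sup>2 * S))"
        by (rule drift_moment[OF sol u J r0 S(2)]) (use le r in auto)
      also have "\<dots> \<le> ennreal (?w\<^sup>2 * (2 * \<kappa>\<^sup>2 + 2 * L\<^sup>2 * S))"
        using r S by (intro ennreal_leI mult_right_mono power_mono) auto
      finally show "sq_moment M ?D \<le> ennreal (?w\<^sup>2 * (2 * \<kappa>\<^sup>2 + 2 * L\<^sup>2 * S))" .
    qed auto
    also have "\<dots> = ennreal (2 * C + 2 * (?w\<^sup>2 * (2 * \<kappa>\<^sup>2 + 2 * L\<^sup>2 * S)))"
      using C0' S by (simp add: ennreal_mult ennreal_plus)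
    finally show ?thesis .
  qed
  have "Ss \<le> ennreal (2 * C + 2 * (?w\<^sup>2 * (2 * \<kappa>\<^sup>2 + 2 * L\<^sup>2 * S)))"
    unfolding Ss_def by (intro SUP_least step)
  then have "S \<le> 2 * C + 2 * (?w\<^sup>2 * (2 * \<kappa>\<^sup>2 + 2 * L\<^sup>2 * S))"
    unfolding S(1) using C0' S(2) by (subst (asm) ennreal_le_iff) auto
  also have "\<dots> = 2 * C + 4 * (?w\<^sup>2 * \<kappa>\<^sup>2) + 4 * (L * ?w)\<^sup>2 * S"
    unfolding power_mult_distrib by (simp add: distrib_left mult_ac)
  \<comment> \<open>The window condition gives 4/9 here, so half of \<open>S\<close> remains on the
    left.\<close>
  also have "4 * (L * ?w)\<^sup>2 * S \<le> 1 / 2 * S"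
  proof (rule mult_right_mono)
    have "(L * ?w)\<^sup>2 \<le> (1 / 3)\<^sup>2" using w L0 by (intro power_mono) auto
    then show "4 * (L * ?w)\<^sup>2 \<le> 1 / 2" by (simp add: power2_eq_square)
  qed (rule S)
  finally have "S \<le> 4 * C + 8 * (?w\<^sup>2 * \<kappa>\<^sup>2)" by simp
  then show ?thesis using le[OF r] by (meson ennreal_leI order_trans)
qed

text \<open>The drift part has mean square of order \<open>(t - s)^2\<close> and the martingale
  part, by the isometry, of order \<open>t - s\<close>. \<open>reg_const\<close> collects both, each
  doubled by the splitting and with S replaced by 1 + S.\<close>

lemma increment_moment_le:
  assumes st: "0 \<le> s" "s \<le> t" "t - s \<le> 1" and S: "0 \<le> S" "\<And>v r. v \<in> unit_I \<Longrightarrow> r \<in> {s..t} \<Longrightarrow> sq_moment M (X v r) \<le> ennreal S"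
    and u: "u \<in> unit_I"
  shows "sq_moment M (\<lambda>\<omega>. X u t \<omega> - X u s \<omega>) \<le> ennreal ((t - s) * (reg_const * (1 + S)))"
proof -
  obtain J where J1: "ito_integral M F (B u) (diffusion X u) J"
    and J2: "\<forall>t\<ge>0. AE \<omega> in M. X u t \<omega> = X0 u \<omega> + integral {0..t} (\<lambda>s. b s (X u s \<omega>)) + J t \<omega>"
    using solution_ito[OF u] by blast
  note J = J1 J2
  interpret W: filtered_bm M F "B u" by (rule filtered_bm[OF u])
  note Jm = J_measurable[OF sol u J] and Xm = X_measurable[OF sol u]
  have t0: "0 \<le> t" using st by simp
  let ?w = "t - s" and ?D = "\<lambda>\<omega>. X u t \<omega> - X u s \<omega> - (J t \<omega> - J s \<omega>)" and ?J = "\<lambda>\<omega>. J t \<omega> - J s \<omega>"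
  let ?q = "real CARD('q)"
  have Jd: "?J \<in> borel_measurable M" by (intro borel_measurable_diff Jm st t0)
  have Dm: "?D \<in> borel_measurable M" by (intro borel_measurable_diff Jd Xm st t0)
  have D: "sq_moment M ?D \<le> ennreal (?w\<^sup>2 * (2 * \<kappa>\<^sup>2 + 2 * L\<^sup>2 * S))"
    by (rule drift_moment[OF sol u J st(1,2) S(1)]) (use S u in auto)
  have z: "sq_moment M (\<lambda>\<omega>. 0 :: 'x::real_normed_vector) = 0" by (simp add: sq_moment_def)
  have "sq_moment M ?J = (\<integral>\<^sup>+\<omega>. (\<integral>\<^sup>+r\<in>{s..t}. ennreal ((norm (diffusion X u r \<omega> - 0))\<^sup>2) \<partial>lborel) \<partial>M)"
    using W.ito_isometry(1)[OF J(1) st(1,2), of "\<lambda>_. 0" "\<lambda>_. 0"] by (simp add: z)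
  also have "\<dots> \<le> ennreal (?w * (?q * (2 * \<kappa>\<^sup>2 + 8 * L\<^sup>2 * S)))"
  proof (rule W.ito_integral_time_bound[OF diffusion_progressive[OF sol u J] st(1,2)])
    fix r assume r: "r \<in> {s..t}"
    have "family (\<lambda>v. X v r) S" using r st S by (intro X_family[OF sol]) auto
    then show "sq_moment M (\<lambda>\<omega>. diffusion X u r \<omega> - 0) \<le> ennreal (?q * (2 * \<kappa>\<^sup>2 + 8 * L\<^sup>2 * S))"
      using sig_moment_le[of "\<lambda>v. X v r" S r u] r st u by simp
  qed (use S in auto)
  finally have JJ: "sq_moment M ?J \<le> ennreal (?w * (?q * (2 * \<kappa>\<^sup>2 + 8 * L\<^sup>2 * S)))" .
  have "sq_moment M (\<lambda>\<omega>. X u t \<omega> - X u s \<omega>) = sq_moment M (\<lambda>\<omega>. ?D \<omega> + ?J \<omega>)" by simp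
  also have "\<dots> \<le> 2 * sq_moment M ?D + 2 * sq_moment M ?J" by (rule sq_moment_add_le2[OF Dm Jd])
  also have "\<dots> \<le> 2 * ennreal (?w\<^sup>2 * (2 * \<kappa>\<^sup>2 + 2 * L\<^sup>2 * S)) + 2 * ennreal (?w * (?q * (2 * \<kappa>\<^sup>2 + 8 * L\<^sup>2 * S)))"
    by (intro add_mono mult_left_mono D JJ) auto
  also have "\<dots> = ennreal (2 * (?w\<^sup>2 * (2 * \<kappa>\<^sup>2 + 2 * L\<^sup>2 * S)) + 2 * (?w * (?q * (2 * \<kappa>\<^sup>2 + 8 * L\<^sup>2 * S))))"
    using st S by (simp add: ennreal_mult ennreal_plus)
  also have "\<dots> \<le> ennreal (?w * (reg_const * (1 + S)))"
  proof (rule ennreal_leI)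
    have w2: "?w\<^sup>2 \<le> ?w * 1" unfolding power2_eq_square using st by (intro mult_left_mono) auto
    have "2 * (?w\<^sup>2 * (2 * \<kappa>\<^sup>2 + 2 * L\<^sup>2 * S)) \<le> 2 * (?w * (2 * \<kappa>\<^sup>2 + 2 * L\<^sup>2 * S))"
      using w2 S by (intro mult_left_mono mult_right_mono) auto
    moreover have "2 * \<kappa>\<^sup>2 + 2 * L\<^sup>2 * S \<le> (2 * \<kappa>\<^sup>2 + 2 * L\<^sup>2) * (1 + S)" "2 * \<kappa>\<^sup>2 + 8 * L\<^sup>2 * S \<le> (2 * \<kappa>\<^sup>2 + 8 * L\<^sup>2) * (1 + S)"
      using S by (auto simp: algebra_simps)
    then have "2 * (2 * \<kappa>\<^sup>2 + 2 * L\<^sup>2 * S) + 2 * (?q * (2 * \<kappa>\<^sup>2 + 8 * L\<^sup>2 * S)) \<le> 2 * ((2 * \<kappa>\<^sup>2 + 2 * L\<^sup>2) * (1 + S)) + 2 * (?q * ((2 * \<kappa>\<^sup>2 + 8 * L\<^sup>2) * (1 + S)))"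
      by (intro add_mono mult_left_mono) auto
    then have "2 * (2 * \<kappa>\<^sup>2 + 2 * L\<^sup>2 * S) + 2 * (?q * (2 * \<kappa>\<^sup>2 + 8 * L\<^sup>2 * S)) \<le> reg_const * (1 + S)"
      by (simp add: reg_const_def algebra_simps)
    from mult_left_mono[OF this, of ?w] st
    have "2 * (?w * (2 * \<kappa>\<^sup>2 + 2 * L\<^sup>2 * S)) + 2 * (?w * (?q * (2 * \<kappa>\<^sup>2 + 8 * L\<^sup>2 * S))) \<le> ?w * (reg_const * (1 + S))"
      by (simp add: distrib_left mult.left_commute)
    ultimately show "2 * (?w\<^sup>2 * (2 * \<kappa>\<^sup>2 + 2 * L\<^sup>2 * S)) + 2 * (?w * (?q * (2 * \<kappa>\<^sup>2 + 8 * L\<^sup>2 * S))) \<le> ?w * (reg_const * (1 + S))"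
      by linarith
  qed
  finally show ?thesis .
qed

text \<open>\<open>window_uniform\<close> bounds the window by an uncontrolled moment at its end,
  which serves only to make the supremum S finite. The increment bound then gives
  \<open>S \<le> 2 * C + 2 * Y\<close>, and the smallness of the window gives
  \<open>4 * Y \<le> 1 + S\<close>; together these bound S by the moment at the start. The supremum
  runs over time and index jointly because the diffusion at one index sees the laws at all
  others.\<close>

lemma window_moments:
  assumes st: "0 \<le> s" "s < t" "t - s \<le> 1" "3 * (L * (t - s)) \<le> 1" "4 * ((t - s) * reg_const) \<le> 1"
    and C: "family (\<lambda>v. X v s) C" and u: "u \<in> unit_I" and r: "r \<in> {s..t}"
  shows "sq_moment M (X u r) \<le> ennreal (4 * C + 1)"
    "sq_moment M (\<lambda>\<omega>. X u r \<omega> - X u s \<omega>) \<le> ennreal ((r - s) * (reg_const * (4 * C + 2)))"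
proof -
  obtain Ct where Ct: "family (\<lambda>v. X v t) Ct" using X_family_ex[OF sol, of t] st by auto
  have C0': "0 \<le> C" by (rule familyD(1)[OF C])
  define Ss where "Ss = (SUP p\<in>unit_I \<times> {s..t}. sq_moment M (X (fst p) (snd p)))"
  have "Ss \<le> ennreal (4 * Ct + 8 * ((t - s)\<^sup>2 * \<kappa>\<^sup>2))" unfolding Ss_def
    using window_uniform[OF st(1,2,4) Ct] by (intro SUP_least) auto
  then have fin: "Ss < \<infinity>" by (rule le_less_trans) simp
  define S where "S = enn2real Ss"
  have S: "Ss = ennreal S" "0 \<le> S" using fin by (auto simp: S_def)
  have le: "sq_moment M (X v r) \<le> ennreal S" if "v \<in> unit_I" "r \<in> {s..t}" for v r
    unfolding S(1)[symmetric] Ss_def using that by (intro SUP_upper2[of "(v, r)"]) auto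
  have inc: "sq_moment M (\<lambda>\<omega>. X v r \<omega> - X v s \<omega>) \<le> ennreal ((r - s) * (reg_const * (1 + S)))" if "v \<in> unit_I" "r \<in> {s..t}" for v r
    using le that st by (intro increment_moment_le[OF st(1) _ _ S(2) _ that(1)]) auto
  have "sq_moment M (X v r) \<le> ennreal (2 * C + 2 * ((t - s) * (reg_const * (1 + S))))" if v: "v \<in> unit_I" and r: "r \<in> {s..t}" for v r
  proof -
    have r0: "0 \<le> r" using r st by auto
    have "sq_moment M (X v r) = sq_moment M (\<lambda>\<omega>. X v s \<omega> + (X v r \<omega> - X v s \<omega>))" by simp
    also have "\<dots> \<le> 2 * sq_moment M (X v s) + 2 * sq_moment M (\<lambda>\<omega>. X v r \<omega> - X v s \<omega>)"
      using v r0 st by (intro sq_moment_add_le2 borel_measurable_diff X_measurable[OF sol])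
    also have "\<dots> \<le> 2 * ennreal C + 2 * ennreal ((t - s) * (reg_const * (1 + S)))"
    proof (intro add_mono mult_left_mono familyD(4)[OF C v])
      have "(r - s) * (reg_const * (1 + S)) \<le> (t - s) * (reg_const * (1 + S))"
        using r reg_const_nonneg S by (intro mult_right_mono) auto
      then show "sq_moment M (\<lambda>\<omega>. X v r \<omega> - X v s \<omega>) \<le> ennreal ((t - s) * (reg_const * (1 + S)))"
        using inc[OF v r] by (meson ennreal_leI order_trans)
    qed auto
    also have "\<dots> = ennreal (2 * C + 2 * ((t - s) * (reg_const * (1 + S))))"
      using C0' S st reg_const_nonneg by (simp add: ennreal_mult ennreal_plus)
    finally show ?thesis .
  qed
  then have "Ss \<le> ennreal (2 * C + 2 * ((t - s) * (reg_const * (1 + S))))" unfolding Ss_def by (intro SUP_least) auto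
  then have S2: "S \<le> 2 * C + 2 * ((t - s) * (reg_const * (1 + S)))"
    unfolding S(1) using C0' S(2) st reg_const_nonneg by (subst (asm) ennreal_le_iff) auto
  define Y where "Y = (t - s) * (reg_const * (1 + S))"
  have "4 * ((t - s) * reg_const) * (1 + S) \<le> 1 * (1 + S)" using st(5) S by (intro mult_right_mono) auto
  then have "4 * Y \<le> 1 + S" by (simp add: Y_def mult.assoc)
  with S2 have S4: "S \<le> 4 * C + 1" unfolding Y_def by linarith
  then show "sq_moment M (X u r) \<le> ennreal (4 * C + 1)" using le[OF u r] by (meson ennreal_leI order_trans)
  have "(r - s) * (reg_const * (1 + S)) \<le> (r - s) * (reg_const * (4 * C + 2))"
    using r reg_const_nonneg S4 by (intro mult_left_mono) auto
  then show "sq_moment M (\<lambda>\<omega>. X u r \<omega> - X u s \<omega>) \<le> ennreal ((r - s) * (reg_const * (4 * C + 2)))"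
    using inc[OF u r] by (meson ennreal_leI order_trans)
qed

end


section \<open>Error over one step and the constants that close the induction\<close>

definition sol_bound :: real where "sol_bound = 2 * euler_bound + 2"

text \<open>Up to the factor \<open>h powr p\<close>, a bound for the squared change of the drift
  over one step, and after multiplication by q also for that of the diffusion. The first summand
  comes from increments of state and laws, 4 for each. In the second, the growth factor of the time
  condition is a sum of three terms whose square gives 3 for the constant and 3 each for state and
  laws.\<close>

definition coeff_const :: real where
  "coeff_const = 8 * L\<^sup>2 * (reg_const * (4 * sol_bound + 2)) + 2 * Lt\<^sup>2 * (3 + 6 * sol_bound)"

text \<open>Chosen for \<open>error_recursion\<close>: there \<open>5 / 8 * c0\<close> times this
  constant becomes \<open>5 * (1 + 1 / c0)\<close> times the regularity constant, and
  \<open>4 * (1 + 1 / c0)\<close> is what has to be covered.\<close>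

definition err_const :: real where
  "err_const = 8 * (real CARD('q) * coeff_const) * (1 + 1 / c0) / c0"

lemma const_nonneg: "0 \<le> sol_bound" "0 \<le> coeff_const" "0 \<le> err_const"
proof -
  show 1: "0 \<le> sol_bound" using euler_bound(2) by (simp add: sol_bound_def)
  have "0 \<le> reg_const" by (simp add: reg_const_def)
  with 1 show 2: "0 \<le> coeff_const" by (simp add: coeff_const_def)
  then show "0 \<le> err_const" using c0 by (simp add: err_const_def)
qed

text \<open>State and laws contribute \<open>2 * q * L^2 * \<beta>\<close> each. The contribution of
  the laws is the reason why the error must be bounded uniformly in the index.\<close>

lemma sigma_error:
  assumes fX: "family U C" and fZ: "family V C" and \<beta>: "0 \<le> \<beta>" "\<And>v. v \<in> unit_I \<Longrightarrow> sq_moment M (\<lambda>\<omega>. U v \<omega> - V v \<omega>) \<le> ennreal \<beta>"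
    and u: "u \<in> unit_I" and s: "0 \<le> s"
  shows "sq_moment M (\<lambda>\<omega>. \<sigma> s (U u \<omega>) (gl U u) - \<sigma> s (V u \<omega>) (gl V u)) \<le> ennreal (4 * real CARD('q) * L\<^sup>2 * \<beta>)"
proof -
  let ?q = "real CARD('q)"
  have dm: "(\<lambda>\<omega>. U u \<omega> - V u \<omega>) \<in> borel_measurable M" by (intro borel_measurable_diff familyD(3)[OF fX u] familyD(3)[OF fZ u])
  have pw: "(norm (\<sigma> s (U u \<omega>) (gl U u) - \<sigma> s (V u \<omega>) (gl V u)))\<^sup>2 \<le> ?q * L\<^sup>2 * 2 * \<beta> + ?q * L\<^sup>2 * 2 * (norm (U u \<omega> - V u \<omega>))\<^sup>2 + 0 * (norm (U u \<omega> - V u \<omega>))\<^sup>2" for \<omega>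
  proof -
    have "(norm (\<sigma> s (U u \<omega>) (gl U u) - \<sigma> s (V u \<omega>) (gl V u)))\<^sup>2 \<le> ?q * (mat_norm (\<sigma> s (U u \<omega>) (gl U u) - \<sigma> s (V u \<omega>) (gl V u)))\<^sup>2"
      by (rule norm_le_mat_norm)
    also have "\<dots> \<le> ?q * (L * (norm (U u \<omega> - V u \<omega>) + sqrt \<beta>))\<^sup>2"
      by (intro mult_left_mono power_mono mat_norm_nonneg sig_diff[OF fX fZ _ _ s u]) (use \<beta> in auto)
    also have "\<dots> \<le> ?q * (L\<^sup>2 * (2 * (norm (U u \<omega> - V u \<omega>))\<^sup>2 + 2 * (sqrt \<beta>)\<^sup>2))"
      unfolding power_mult_distrib by (intro mult_left_mono sum_sq_le2) auto
    also have "(sqrt \<beta>)\<^sup>2 = \<beta>" using \<beta> by simp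
    finally show ?thesis by (simp add: algebra_simps)
  qed
  have "sq_moment M (\<lambda>\<omega>. \<sigma> s (U u \<omega>) (gl U u) - \<sigma> s (V u \<omega>) (gl V u)) \<le> ennreal (?q * L\<^sup>2 * 2 * \<beta> + ?q * L\<^sup>2 * 2 * \<beta> + 0 * \<beta>)"
    by (rule sq_moment_affine_le[OF dm dm pw]) (use \<beta> u in auto)
  then show ?thesis by (simp add: algebra_simps)
qed

text \<open>Dissipativity is used in the term linear in \<tau> and the Lipschitz bound in the
  quadratic one.\<close>

lemma drift_error_sq:
  assumes s: "0 \<le> s" and \<tau>: "0 \<le> \<tau>"
  shows "(norm ((x - z) + \<tau> *\<^sub>R (b s x - b s z)))\<^sup>2 \<le> (1 - 2 * c0 * \<tau> + L\<^sup>2 * \<tau>\<^sup>2) * (norm (x - z))\<^sup>2"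
proof -
  let ?e = "x - z" and ?d = "b s x - b s z"
  have eq: "(norm (?e + \<tau> *\<^sub>R ?d))\<^sup>2 = (norm ?e)\<^sup>2 + 2 * \<tau> * (?e \<bullet> ?d) + \<tau>\<^sup>2 * (norm ?d)\<^sup>2"
    by (rule norm_add_scaleR_sq)
  have "(norm ?d)\<^sup>2 \<le> (L * norm ?e)\<^sup>2" using b_lip[OF s] by (intro power_mono) auto
  then have 1: "\<tau>\<^sup>2 * (norm ?d)\<^sup>2 \<le> \<tau>\<^sup>2 * (L\<^sup>2 * (norm ?e)\<^sup>2)" by (intro mult_left_mono) (auto simp: power_mult_distrib)
  have 2: "2 * \<tau> * (?e \<bullet> ?d) \<le> 2 * \<tau> * (- c0 * (norm ?e)\<^sup>2)" using b_mono[OF s] \<tau> by (intro mult_left_mono) auto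
  have "(1 - 2 * c0 * \<tau> + L\<^sup>2 * \<tau>\<^sup>2) * (norm ?e)\<^sup>2 = (norm ?e)\<^sup>2 + 2 * \<tau> * (- c0 * (norm ?e)\<^sup>2) + \<tau>\<^sup>2 * (L\<^sup>2 * (norm ?e)\<^sup>2)"
    by algebra
  then show ?thesis unfolding eq using 1 2 by linarith
qed

context
  fixes X :: "real \<Rightarrow> real \<Rightarrow> 'w \<Rightarrow> real^'d" and h p :: real and Z :: "real \<Rightarrow> real \<Rightarrow> 'w \<Rightarrow> real^'d"
  assumes sol: "graphon_sde_solution M F B G b \<sigma> X0 X"
    and h: "0 < h" "h \<le> 1" "8 * L\<^sup>2 * h \<le> c0" "2 * c0 * h \<le> 1"
    and scheme: "euler_scheme M B G b \<sigma> X0 h Z"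
    and h': "3 * (L * h) \<le> 1" "4 * (h * reg_const) \<le> 1" "err_const * h powr p \<le> 1"
    and p: "p \<le> 1" "p \<le> 2 * \<rho>"
begin

abbreviation hp :: real where "hp \<equiv> h powr p"

lemma hp: "0 < hp" "h \<le> hp"
proof -
  show "0 < hp" using h by simp
  have "h powr 1 \<le> h powr p" using h p by (intro powr_mono') auto
  then show "h \<le> hp" using h by simp
qed

lemma powr_sq_le_hp: assumes "0 \<le> w" "w \<le> h" shows "(w powr \<rho>)\<^sup>2 \<le> hp"
proof -
  have "(w powr \<rho>)\<^sup>2 = w powr (2 * \<rho>)" by (simp add: power2_eq_square powr_add[symmetric])
  also have "\<dots> \<le> h powr (2 * \<rho>)" using assms \<rho> by (intro powr_mono2) auto
  also have "\<dots> \<le> h powr p" using h p by (intro powr_mono') auto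
  finally show ?thesis .
qed

context
  fixes s t :: real and u :: real
  assumes st: "0 \<le> s" "s < t" "t - s \<le> h" and fam: "family (\<lambda>v. X v s) sol_bound" and u: "u \<in> unit_I"
begin

lemma step_small: "t - s \<le> 1" "3 * (L * (t - s)) \<le> 1" "4 * ((t - s) * reg_const) \<le> 1"
proof -
  show "t - s \<le> 1" using st h by simp
  have "L * (t - s) \<le> L * h" using st L by (intro mult_left_mono) auto
  then show "3 * (L * (t - s)) \<le> 1" using h' by simp
  have "(t - s) * reg_const \<le> h * reg_const" using st by (intro mult_right_mono) (auto simp: reg_const_def)
  then show "4 * ((t - s) * reg_const) \<le> 1" using h' by simp
qed

lemma step_increment:
  assumes v: "v \<in> unit_I" and r: "r \<in> {s..t}"
  shows "sq_moment M (\<lambda>\<omega>. X v r \<omega> - X v s \<omega>) \<le> ennreal (hp * (reg_const * (4 * sol_bound + 2)))"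
proof -
  have "sq_moment M (\<lambda>\<omega>. X v r \<omega> - X v s \<omega>) \<le> ennreal ((r - s) * (reg_const * (4 * sol_bound + 2)))"
    by (rule window_moments(2)[OF sol st(1,2) step_small fam v r])
  also have "\<dots> \<le> ennreal (hp * (reg_const * (4 * sol_bound + 2)))"
    using r st hp const_nonneg by (intro ennreal_leI mult_right_mono) (auto simp: reg_const_def)
  finally show ?thesis .
qed

lemma drift_regularity:
  assumes r: "r \<in> {s..t}"
  shows "sq_moment M (\<lambda>\<omega>. b r (X u r \<omega>) - b s (X u s \<omega>)) \<le> ennreal (coeff_const * hp)"
proof -
  have r0: "0 \<le> r" "\<bar>r - s\<bar> \<le> h" "r - s \<le> h" using r st by auto
  let ?K = "reg_const * (4 * sol_bound + 2)"
  have K: "0 \<le> ?K" using const_nonneg by (simp add: reg_const_def)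
  note Xm = X_measurable[OF sol u]
  have dm: "(\<lambda>\<omega>. X u r \<omega> - X u s \<omega>) \<in> borel_measurable M" by (intro borel_measurable_diff Xm r0 st)
  have pw: "(norm (b r (X u r \<omega>) - b s (X u s \<omega>)))\<^sup>2 \<le> 4 * Lt\<^sup>2 * hp + 2 * L\<^sup>2 * (norm (X u r \<omega> - X u s \<omega>))\<^sup>2 + 4 * Lt\<^sup>2 * hp * (norm (X u s \<omega>))\<^sup>2" for \<omega>
  proof -
    let ?n = "norm (X u s \<omega>)" and ?w = "\<bar>r - s\<bar> powr \<rho>"
    have "(norm (b r (X u r \<omega>) - b s (X u s \<omega>)))\<^sup>2 \<le> (L * norm (X u r \<omega> - X u s \<omega>) + Lt * (1 + ?n) * ?w)\<^sup>2"
      using b_diff[OF r0(1) st(1)] by (intro power_mono) auto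
    also have "\<dots> \<le> 2 * (L * norm (X u r \<omega> - X u s \<omega>))\<^sup>2 + 2 * (Lt * (1 + ?n) * ?w)\<^sup>2" by (rule sum_sq_le2)
    also have "(Lt * (1 + ?n) * ?w)\<^sup>2 \<le> Lt\<^sup>2 * (2 * 1\<^sup>2 + 2 * ?n\<^sup>2) * hp"
      unfolding power_mult_distrib using powr_sq_le_hp[of "\<bar>r - s\<bar>"] r0(2)
      by (intro mult_mono mult_left_mono sum_sq_le2) auto
    finally show ?thesis by (simp add: power_mult_distrib algebra_simps)
  qed
  have "sq_moment M (\<lambda>\<omega>. b r (X u r \<omega>) - b s (X u s \<omega>)) \<le> ennreal (4 * Lt\<^sup>2 * hp + 2 * L\<^sup>2 * (hp * ?K) + 4 * Lt\<^sup>2 * hp * sol_bound)"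
    by (rule sq_moment_affine_le[OF dm Xm[OF st(1)] pw])
       (use hp const_nonneg K step_increment[OF u r] familyD(4)[OF fam u] in auto)
  also have "\<dots> \<le> ennreal (coeff_const * hp)"
  proof (rule ennreal_leI)
    have "4 * Lt\<^sup>2 + 2 * L\<^sup>2 * ?K + 4 * Lt\<^sup>2 * sol_bound \<le> coeff_const"
    proof -
      have "2 * L\<^sup>2 * ?K \<le> 8 * L\<^sup>2 * ?K" using K by (intro mult_right_mono) auto
      moreover have "4 * Lt\<^sup>2 \<le> 6 * Lt\<^sup>2" "4 * Lt\<^sup>2 * sol_bound \<le> 12 * Lt\<^sup>2 * sol_bound" using const_nonneg by (auto intro!: mult_right_mono)
      moreover have "coeff_const = 8 * L\<^sup>2 * ?K + 6 * Lt\<^sup>2 + 12 * Lt\<^sup>2 * sol_bound" by (simp add: coeff_const_def algebra_simps)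
      ultimately show ?thesis by linarith
    qed
    from mult_right_mono[OF this less_imp_le[OF hp(1)]]
    have "(4 * Lt\<^sup>2 + 2 * L\<^sup>2 * ?K + 4 * Lt\<^sup>2 * sol_bound) * hp \<le> coeff_const * hp" .
    also have "(4 * Lt\<^sup>2 + 2 * L\<^sup>2 * ?K + 4 * Lt\<^sup>2 * sol_bound) * hp = 4 * Lt\<^sup>2 * hp + 2 * L\<^sup>2 * (hp * ?K) + 4 * Lt\<^sup>2 * hp * sol_bound"
      by algebra
    finally show "4 * Lt\<^sup>2 * hp + 2 * L\<^sup>2 * (hp * ?K) + 4 * Lt\<^sup>2 * hp * sol_bound \<le> coeff_const * hp" .
  qed
  finally show ?thesis .
qed

text \<open>The change is split at the old state and old laws read at the new time: state and laws
  move at the fixed time r, then time moves with both fixed.\<close>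

lemma diffusion_regularity:
  assumes r: "r \<in> {s..t}"
  shows "sq_moment M (\<lambda>\<omega>. diffusion X u r \<omega> - diffusion X u s \<omega>) \<le> ennreal (real CARD('q) * coeff_const * hp)"
proof -
  have r0: "0 \<le> r" "0 \<le> r - s" "r - s \<le> h" "s \<le> r" using r st by auto
  let ?K = "reg_const * (4 * sol_bound + 2)" and ?q = "real CARD('q)"
  have K: "0 \<le> ?K" using const_nonneg by (simp add: reg_const_def)
  note Xm = X_measurable[OF sol u]
  have dm: "(\<lambda>\<omega>. X u r \<omega> - X u s \<omega>) \<in> borel_measurable M" by (intro borel_measurable_diff Xm r0 st)
  have S4: "0 \<le> 4 * sol_bound + 1" "sol_bound \<le> 4 * sol_bound + 1" using const_nonneg by auto
  have famr: "family (\<lambda>v. X v r) (4 * sol_bound + 1)"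
    by (rule X_family[OF sol r0(1) S4(1) window_moments(1)[OF sol st(1,2) step_small fam _ r]])
  have pw: "(norm (diffusion X u r \<omega> - diffusion X u s \<omega>))\<^sup>2 \<le> ?q * (4 * L\<^sup>2 * (hp * ?K) + 6 * Lt\<^sup>2 * hp * (1 + sol_bound))
      + ?q * (4 * L\<^sup>2) * (norm (X u r \<omega> - X u s \<omega>))\<^sup>2 + ?q * (6 * Lt\<^sup>2 * hp) * (norm (X u s \<omega>))\<^sup>2" for \<omega>
  proof -
    let ?n = "norm (X u s \<omega>)" and ?d = "norm (X u r \<omega> - X u s \<omega>)" and ?w = "(r - s) powr \<rho>"
    have 1: "mat_norm (diffusion X u r \<omega> - \<sigma> r (X u s \<omega>) (gl (\<lambda>v. X v s) u)) \<le> L * (?d + sqrt (hp * ?K))"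
      by (rule sig_diff[OF famr family_mono[OF fam S4(2)] _ _ r0(1) u]) (use step_increment[OF _ r] hp K in auto)
    have 2: "mat_norm (\<sigma> r (X u s \<omega>) (gl (\<lambda>v. X v s) u) - diffusion X u s \<omega>) \<le> Lt * (1 + ?n + sqrt sol_bound) * ?w"
      by (rule sig_time_gl[OF fam st(1) r0(4) u])
    have "mat_norm (diffusion X u r \<omega> - diffusion X u s \<omega>) \<le> L * (?d + sqrt (hp * ?K)) + Lt * (1 + ?n + sqrt sol_bound) * ?w"
      using mat_norm_diff_triangle[of "diffusion X u r \<omega>" "diffusion X u s \<omega>" "\<sigma> r (X u s \<omega>) (gl (\<lambda>v. X v s) u)"] 1 2 by linarith
    then have "(mat_norm (diffusion X u r \<omega> - diffusion X u s \<omega>))\<^sup>2 \<le> (L * (?d + sqrt (hp * ?K)) + Lt * (1 + ?n + sqrt sol_bound) * ?w)\<^sup>2"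
      by (intro power_mono mat_norm_nonneg)
    also have "\<dots> \<le> 2 * (L * (?d + sqrt (hp * ?K)))\<^sup>2 + 2 * (Lt * (1 + ?n + sqrt sol_bound) * ?w)\<^sup>2" by (rule sum_sq_le2)
    also have "\<dots> \<le> 2 * (L\<^sup>2 * (2 * ?d\<^sup>2 + 2 * (sqrt (hp * ?K))\<^sup>2)) + 2 * (Lt\<^sup>2 * (3 * 1\<^sup>2 + 3 * ?n\<^sup>2 + 3 * (sqrt sol_bound)\<^sup>2) * hp)"
      unfolding power_mult_distrib using powr_sq_le_hp[OF r0(2,3)]
      by (intro add_mono mult_left_mono mult_mono sum_sq_le2 sum_sq_le3) auto
    also have "(sqrt (hp * ?K))\<^sup>2 = hp * ?K" using hp K by simp
    also have "(sqrt sol_bound)\<^sup>2 = sol_bound" using const_nonneg by simp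
    finally have m: "(mat_norm (diffusion X u r \<omega> - diffusion X u s \<omega>))\<^sup>2 \<le> 2 * (L\<^sup>2 * (2 * ?d\<^sup>2 + 2 * (hp * ?K))) + 2 * (Lt\<^sup>2 * (3 * 1\<^sup>2 + 3 * ?n\<^sup>2 + 3 * sol_bound) * hp)" .
    have "(norm (diffusion X u r \<omega> - diffusion X u s \<omega>))\<^sup>2 \<le> ?q * (mat_norm (diffusion X u r \<omega> - diffusion X u s \<omega>))\<^sup>2"
      by (rule norm_le_mat_norm)
    also have "\<dots> \<le> ?q * (2 * (L\<^sup>2 * (2 * ?d\<^sup>2 + 2 * (hp * ?K))) + 2 * (Lt\<^sup>2 * (3 * 1\<^sup>2 + 3 * ?n\<^sup>2 + 3 * sol_bound) * hp))"
      by (intro mult_left_mono m) auto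
    also have "\<dots> = ?q * (4 * L\<^sup>2 * (hp * ?K) + 6 * Lt\<^sup>2 * hp * (1 + sol_bound)) + ?q * (4 * L\<^sup>2) * ?d\<^sup>2 + ?q * (6 * Lt\<^sup>2 * hp) * ?n\<^sup>2"
      by (simp add: algebra_simps)
    finally show ?thesis .
  qed
  have "sq_moment M (\<lambda>\<omega>. diffusion X u r \<omega> - diffusion X u s \<omega>) \<le> ennreal (?q * (4 * L\<^sup>2 * (hp * ?K) + 6 * Lt\<^sup>2 * hp * (1 + sol_bound))
      + ?q * (4 * L\<^sup>2) * (hp * ?K) + ?q * (6 * Lt\<^sup>2 * hp) * sol_bound)"
    by (rule sq_moment_affine_le[OF dm Xm[OF st(1)] pw])
       (use hp const_nonneg K step_increment[OF u r] familyD(4)[OF fam u] in auto)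
  also have "?q * (4 * L\<^sup>2 * (hp * ?K) + 6 * Lt\<^sup>2 * hp * (1 + sol_bound)) + ?q * (4 * L\<^sup>2) * (hp * ?K) + ?q * (6 * Lt\<^sup>2 * hp) * sol_bound
     = ?q * coeff_const * hp"
    by (simp add: coeff_const_def algebra_simps)
  finally show ?thesis .
qed

end

text \<open>Write A for \<open>c0 * \<tau>\<close> and K for the diffusion regularity. Of the rate 2
  A, the quadratic drift term takes A / 8 and the diffusion error takes A by the gap condition,
  which leaves 7/8; the weight 1 + A / 4 reduces this to 5/8. The regularity terms sum to at most
  \<open>4 * (1 + 1 / c0) * \<tau> * K\<close>, where \<open>4 / c0\<close> comes from dividing by
  the weight A / 4: with a weight of order \<tau>, a remainder of order \<tau>^2 still contributes
  only order \<tau>.\<close>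

lemma error_recursion:
  assumes \<tau>: "0 < \<tau>" "\<tau> \<le> h" and \<beta>: "\<beta> = err_const * hp"
  shows "(1 + c0 * \<tau> / 4) * ((1 - 2 * c0 * \<tau> + L\<^sup>2 * \<tau>\<^sup>2) * \<beta> + \<tau> * (2 * (real CARD('q) * coeff_const * hp) + 2 * (4 * real CARD('q) * L\<^sup>2 * \<beta>)))
    + (1 + 1 / (c0 * \<tau> / 4)) * (\<tau>\<^sup>2 * (coeff_const * hp)) \<le> \<beta>"
    "0 \<le> 1 - 2 * c0 * \<tau> + L\<^sup>2 * \<tau>\<^sup>2"
proof -
  let ?q = "real CARD('q)"
  define K where "K = real CARD('q) * coeff_const * hp"
  \<comment> \<open>The regularity of the drift carries no factor q; as q is at least 1, the
    constant K covers both coefficients.\<close>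
  have q1: "1 \<le> ?q" using zero_less_card_finite[where 'a='q] by linarith
  have \<beta>0: "0 \<le> \<beta>" unfolding \<beta> using const_nonneg hp by simp
  have K0: "0 \<le> K" unfolding K_def using const_nonneg hp by simp
  have K3: "coeff_const * hp \<le> K" unfolding K_def using mult_right_mono[OF q1, of "coeff_const * hp"] const_nonneg hp by (simp add: mult.assoc)
  have \<tau>1: "\<tau> \<le> 1" using \<tau> h by simp
  have ct: "c0 * \<tau> \<le> 1 / 2"
  proof -
    have "c0 * \<tau> \<le> c0 * h" using \<tau> c0 by (intro mult_left_mono) auto
    then show ?thesis using h(4) by linarith
  qed
  have ct0: "0 < c0 * \<tau>" using c0 \<tau> by simp
  have Lt': "L\<^sup>2 * \<tau>\<^sup>2 \<le> c0 * \<tau> / 8"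
  proof -
    have "8 * L\<^sup>2 * \<tau> \<le> 8 * L\<^sup>2 * h" using \<tau> by (intro mult_left_mono) auto
    then have "8 * L\<^sup>2 * \<tau> \<le> c0" using h(3) by simp
    from mult_right_mono[OF this, of \<tau>] \<tau> show ?thesis by (simp add: power2_eq_square)
  qed
  show "0 \<le> 1 - 2 * c0 * \<tau> + L\<^sup>2 * \<tau>\<^sup>2" using ct zero_le_power2[of "L * \<tau>"] unfolding power_mult_distrib by linarith
  define A where "A = c0 * \<tau>"
  have A: "0 < A" "A \<le> 1 / 2" using ct ct0 by (auto simp: A_def)
  have qL: "2 * (4 * ?q * L\<^sup>2 * \<beta>) * \<tau> \<le> A * \<beta>"
  proof -
    have "8 * L\<^sup>2 * ?q * (\<beta> * \<tau>) \<le> c0 * (\<beta> * \<tau>)" using gap \<beta>0 \<tau> by (intro mult_right_mono) auto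
    then show ?thesis by (simp add: A_def mult_ac)
  qed
  have "(1 - 2 * c0 * \<tau> + L\<^sup>2 * \<tau>\<^sup>2) * \<beta> \<le> (1 - 15 / 8 * A) * \<beta>"
    using Lt' \<beta>0 by (intro mult_right_mono) (auto simp: A_def)
  then have i1: "(1 - 2 * c0 * \<tau> + L\<^sup>2 * \<tau>\<^sup>2) * \<beta> + \<tau> * (2 * K + 2 * (4 * ?q * L\<^sup>2 * \<beta>)) \<le> (1 - 7 / 8 * A) * \<beta> + 2 * \<tau> * K"
    using qL by (simp add: algebra_simps)
  have "(1 + A / 4) * ((1 - 2 * c0 * \<tau> + L\<^sup>2 * \<tau>\<^sup>2) * \<beta> + \<tau> * (2 * K + 2 * (4 * ?q * L\<^sup>2 * \<beta>))) \<le> (1 + A / 4) * ((1 - 7 / 8 * A) * \<beta> + 2 * \<tau> * K)"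
    using A by (intro mult_left_mono i1) auto
  also have "\<dots> = ((1 + A / 4) * (1 - 7 / 8 * A)) * \<beta> + (1 + A / 4) * (2 * \<tau> * K)" by (simp add: algebra_simps)
  also have "\<dots> \<le> (1 - 5 / 8 * A) * \<beta> + 3 / 2 * (2 * \<tau> * K)"
  proof (intro add_mono mult_right_mono)
    have "(1 + A / 4) * (1 - 7 / 8 * A) = 1 - 5 / 8 * A - 7 / 32 * (A * A)" by (simp add: algebra_simps)
    then show "(1 + A / 4) * (1 - 7 / 8 * A) \<le> 1 - 5 / 8 * A" by simp
  qed (use A \<beta>0 K0 \<tau> in auto)
  also have "3 / 2 * (2 * \<tau> * K) = 3 * (\<tau> * K)" by simp
  finally have j1: "(1 + A / 4) * ((1 - 2 * c0 * \<tau> + L\<^sup>2 * \<tau>\<^sup>2) * \<beta> + \<tau> * (2 * K + 2 * (4 * ?q * L\<^sup>2 * \<beta>))) \<le> (1 - 5 / 8 * A) * \<beta> + 3 * (\<tau> * K)"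
    .
  have "(1 + 1 / (A / 4)) * (\<tau>\<^sup>2 * (coeff_const * hp)) \<le> (1 + 1 / (A / 4)) * (\<tau>\<^sup>2 * K)"
    using A K3 by (intro mult_left_mono) auto
  also have "(1 + 1 / (A / 4)) * (\<tau>\<^sup>2 * K) = \<tau> * (\<tau> * K) + 4 / c0 * (\<tau> * K)"
    using \<tau> c0 by (simp add: A_def power2_eq_square field_simps)
  also have "\<tau> * (\<tau> * K) \<le> 1 * (\<tau> * K)" using \<tau>1 \<tau> K0 by (intro mult_right_mono) auto
  finally have j2: "(1 + 1 / (A / 4)) * (\<tau>\<^sup>2 * (coeff_const * hp)) \<le> \<tau> * K + 4 / c0 * (\<tau> * K)" by simp
  have "5 / 8 * A * \<beta> = 5 * (1 + 1 / c0) * (\<tau> * K)"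
    using c0 by (simp add: A_def K_def \<beta> err_const_def field_simps)
  also have "\<dots> \<ge> 4 * (1 + 1 / c0) * (\<tau> * K)"
    using c0 K0 \<tau> by (intro mult_right_mono) auto
  finally have "4 * (\<tau> * K) + 4 / c0 * (\<tau> * K) \<le> 5 / 8 * A * \<beta>" by (simp add: algebra_simps)
  then have "(1 + A / 4) * ((1 - 2 * c0 * \<tau> + L\<^sup>2 * \<tau>\<^sup>2) * \<beta> + \<tau> * (2 * K + 2 * (4 * ?q * L\<^sup>2 * \<beta>)))
    + (1 + 1 / (A / 4)) * (\<tau>\<^sup>2 * (coeff_const * hp)) \<le> \<beta>" using j1 j2 by (simp add: left_diff_distrib)
  then show "(1 + c0 * \<tau> / 4) * ((1 - 2 * c0 * \<tau> + L\<^sup>2 * \<tau>\<^sup>2) * \<beta> + \<tau> * (2 * (real CARD('q) * coeff_const * hp) + 2 * (4 * ?q * L\<^sup>2 * \<beta>)))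
    + (1 + 1 / (c0 * \<tau> / 4)) * (\<tau>\<^sup>2 * (coeff_const * hp)) \<le> \<beta>" unfolding A_def K_def .
qed

end

end

lemma ennreal_double_sum: "0 \<le> x \<Longrightarrow> 0 \<le> y \<Longrightarrow> 2 * ennreal x + 2 * ennreal y = ennreal (2 * x + 2 * y)"
  by (simp add: ennreal_plus ennreal_mult)

context graphon_sde
begin

context
  fixes X :: "real \<Rightarrow> real \<Rightarrow> 'w \<Rightarrow> real^'d" and h p :: real and Z :: "real \<Rightarrow> real \<Rightarrow> 'w \<Rightarrow> real^'d"
  assumes sol: "graphon_sde_solution M F B G b \<sigma> X0 X"
    and h: "0 < h" "h \<le> 1" "8 * L\<^sup>2 * h \<le> c0" "2 * c0 * h \<le> 1"
    and scheme: "euler_scheme M B G b \<sigma> X0 h Z"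
    and h': "3 * (L * h) \<le> 1" "4 * (h * reg_const) \<le> 1" "err_const * h powr p \<le> 1"
    and p: "p \<le> 1" "p \<le> 2 * \<rho>"
begin

lemma Z_family: "family (\<lambda>v. Z v (real m * h)) euler_bound"
  and Z_adapted: "u \<in> unit_I \<Longrightarrow> Z u (real m * h) \<in> borel_measurable (F (real m * h))"
  using euler_invariant[OF h scheme, of m] by auto

lemma Z_moments:
  assumes "u \<in> unit_I" "t \<in> {real m * h..real (Suc m) * h}"
  shows "sq_moment M (Z u t) \<le> ennreal euler_bound" "Z u t \<in> borel_measurable M"
    "sq_moment M (\<lambda>\<omega>. Z u t \<omega> - Z u (real m * h) \<omega>) \<le>
      ennreal ((2 * \<kappa>\<^sup>2 + 2 * L\<^sup>2 * euler_bound + real CARD('q) * (2 * \<kappa>\<^sup>2 + 8 * L\<^sup>2 * euler_bound)) * (t - real m * h))"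
proof -
  note step = euler_step_moment[OF h scheme Z_family Z_adapted assms]
  have "0 \<le> real m * h" using h by simp
  then have "0 \<le> t" using assms(2) by (meson atLeastAtMost_iff order_trans)
  then show "sq_moment M (Z u t) \<le> ennreal euler_bound" "Z u t \<in> borel_measurable M"
    "sq_moment M (\<lambda>\<omega>. Z u t \<omega> - Z u (real m * h) \<omega>) \<le>
      ennreal ((2 * \<kappa>\<^sup>2 + 2 * L\<^sup>2 * euler_bound + real CARD('q) * (2 * \<kappa>\<^sup>2 + 8 * L\<^sup>2 * euler_bound)) * (t - real m * h))"
    using step filtered_bm.measurable_F_M[OF filtered_bm[OF assms(1)] _ step(2)] by auto
qed

lemma error_step:
  assumes err: "\<And>v. v \<in> unit_I \<Longrightarrow> sq_moment M (\<lambda>\<omega>. X v (real m * h) \<omega> - Z v (real m * h) \<omega>) \<le> ennreal (err_const * h powr p)"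
    and u: "u \<in> unit_I" and t: "t \<in> {real m * h..real (Suc m) * h}"
  shows "sq_moment M (\<lambda>\<omega>. X u t \<omega> - Z u t \<omega>) \<le> ennreal (err_const * h powr p)"
proof (cases "t = real m * h")
  case True then show ?thesis using err[OF u] by simp
next
  case False
  define s where "s = real m * h"
  define \<beta> where "\<beta> = err_const * h powr p"
  define \<tau> where "\<tau> = t - s"
  have s0: "0 \<le> s" using h by (simp add: s_def)
  have st: "s < t" "t - s \<le> h" using t False by (auto simp: s_def algebra_simps)
  then have \<tau>: "0 < \<tau>" "\<tau> \<le> h" by (auto simp: \<tau>_def)
  have t0: "0 \<le> t" "s \<le> t" using s0 st by auto
  have \<beta>: "0 \<le> \<beta>" "\<beta> \<le> 1" using const_nonneg h' by (auto simp: \<beta>_def)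
  have err': "sq_moment M (\<lambda>\<omega>. X v s \<omega> - Z v s \<omega>) \<le> ennreal \<beta>" if "v \<in> unit_I" for v
    using err[OF that] by (simp add: s_def \<beta>_def)
  have Zf: "family (\<lambda>v. Z v s) euler_bound" and Za: "Z u s \<in> borel_measurable (F s)"
    using Z_family Z_adapted[OF u] by (auto simp: s_def)
  have eb: "euler_bound \<le> sol_bound" using euler_bound(2) by (simp add: sol_bound_def)
  note Xm = X_measurable[OF sol] and Zm = familyD(3)[OF Zf]
  \<comment> \<open>Here the induction closes: an error of at most 1 gives moments of the solution
    at s that do not depend on the step number, and the window estimates apply with the same
    constants at every step.\<close>
  have Xf: "family (\<lambda>v. X v s) sol_bound"
  proof (rule X_family[OF sol s0 const_nonneg(1)])
    fix v assume v: "v \<in> unit_I"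
    have "sq_moment M (X v s) = sq_moment M (\<lambda>\<omega>. (X v s \<omega> - Z v s \<omega>) + Z v s \<omega>)" by simp
    also have "\<dots> \<le> 2 * sq_moment M (\<lambda>\<omega>. X v s \<omega> - Z v s \<omega>) + 2 * sq_moment M (Z v s)"
      using v s0 by (intro sq_moment_add_le2 borel_measurable_diff Xm Zm)
    also have "\<dots> \<le> 2 * ennreal 1 + 2 * ennreal euler_bound"
      using order_trans[OF err'[OF v] ennreal_leI[OF \<beta>(2)]] by (intro add_mono mult_left_mono familyD(4)[OF Zf v]) auto
    also have "\<dots> = ennreal sol_bound"
      using euler_bound(2) by (simp add: sol_bound_def ennreal_plus ennreal_mult add.commute)
    finally show "sq_moment M (X v s) \<le> ennreal sol_bound" .
  qed
  obtain J where J1: "ito_integral M F (B u) (diffusion X u) J"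
    and J2: "\<forall>t\<ge>0. AE \<omega> in M. X u t \<omega> = X0 u \<omega> + integral {0..t} (\<lambda>s. b s (X u s \<omega>)) + J t \<omega>"
    using solution_ito[OF sol u] by blast
  note J = J1 J2
  interpret W: filtered_bm M F "B u" by (rule filtered_bm[OF u])
  let ?q = "real CARD('q)" and ?hp = "h powr p"
  let ?A = "\<lambda>\<omega>. \<sigma> s (Z u s \<omega>) (gl (\<lambda>v. Z v s) u)"
  let ?V = "\<lambda>\<omega>. b s (X u s \<omega>)"
  let ?P = "\<lambda>\<omega>. (X u s \<omega> - Z u s \<omega>) + \<tau> *\<^sub>R (b s (X u s \<omega>) - b s (Z u s \<omega>))"
  let ?R = "\<lambda>\<omega>. X u t \<omega> - X u s \<omega> - (J t \<omega> - J s \<omega>) - (t - s) *\<^sub>R ?V \<omega>"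
  let ?PN = "\<lambda>\<omega>. ?P \<omega> + (J t \<omega> - J s \<omega>) - ?A \<omega> *v (B u t \<omega> - B u s \<omega>)"
  have Xa: "X u s \<in> borel_measurable (F s)" by (rule X_adapted[OF sol u s0])
  have Am: "?A \<in> borel_measurable (F s)" by (rule sig_comp_measurable[OF Za s0 gl_M2(1)[OF Zf u]])
  have Pm: "?P \<in> borel_measurable (F s)"
    using Xa Za b_comp_measurable[OF Xa s0] b_comp_measurable[OF Za s0] by measurable
  have AM: "?A \<in> borel_measurable M" by (rule W.measurable_F_M[OF s0 Am])
  have PM: "?P \<in> borel_measurable M" by (rule W.measurable_F_M[OF s0 Pm])
  have Jm: "J t \<in> borel_measurable M" "J s \<in> borel_measurable M" using J_measurable[OF sol u J] t0 s0 by auto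
  have Vm: "?V \<in> borel_measurable M" by (rule b_comp_measurable[OF Xm[OF u s0] s0])
  have Bm: "B u t \<in> borel_measurable M" "B u s \<in> borel_measurable M"
    using W.measurable_F_M[OF t0(1) W.W_measurable[OF t0(1)]] W.measurable_F_M[OF s0 W.W_measurable[OF s0]] by auto
  have Rm: "?R \<in> borel_measurable M" by (intro borel_measurable_diff borel_measurable_scaleR borel_measurable_const Xm u t0 s0 Jm Vm)
  have PNm: "?PN \<in> borel_measurable M"
    by (intro borel_measurable_diff borel_measurable_add PM Jm borel_measurable_matrix_vector_mult AM Bm)
  have coeff0: "0 \<le> 1 - 2 * c0 * \<tau> + L\<^sup>2 * \<tau>\<^sup>2"
    by (rule error_recursion(2)[OF sol h scheme h' p \<tau> refl])
  have em: "(\<lambda>\<omega>. X u s \<omega> - Z u s \<omega>) \<in> borel_measurable M" by (intro borel_measurable_diff Xm Zm u s0)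
  have Psq: "sq_moment M ?P \<le> ennreal ((1 - 2 * c0 * \<tau> + L\<^sup>2 * \<tau>\<^sup>2) * \<beta>)"
  proof -
    have "sq_moment M ?P \<le> ennreal (0 + (1 - 2 * c0 * \<tau> + L\<^sup>2 * \<tau>\<^sup>2) * \<beta> + 0 * \<beta>)"
      by (rule sq_moment_affine_le[OF em em]) (use drift_error_sq[OF s0] \<tau> coeff0 \<beta> err'[OF u] in auto)
    then show ?thesis by simp
  qed
  have Asq: "sq_moment M ?A < \<infinity>" using sig_moment_le[OF Zf s0 u] by (rule le_less_trans) simp
  have Pfin: "sq_moment M ?P < \<infinity>" using Psq by (rule le_less_trans) simp
  let ?Nb = "2 * (?q * coeff_const * ?hp) + 2 * (4 * ?q * L\<^sup>2 * \<beta>)"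
  have Nb0: "0 \<le> ?Nb" using const_nonneg \<beta> by simp
  have "(\<integral>\<^sup>+\<omega>. (\<integral>\<^sup>+r\<in>{s..t}. ennreal ((norm (diffusion X u r \<omega> - ?A \<omega>))\<^sup>2) \<partial>lborel) \<partial>M) \<le> ennreal ((t - s) * ?Nb)"
  proof (rule W.ito_integral_time_bound[OF diffusion_progressive[OF sol u J] s0 t0(2) AM Nb0])
    fix r assume r: "r \<in> {s..t}"
    have r0: "0 \<le> r" using r s0 by auto
    have dm: "diffusion X u r \<in> borel_measurable M" "diffusion X u s \<in> borel_measurable M"
      using W.measurable_F_M[OF r0 diffusion_measurable[OF sol u r0]] W.measurable_F_M[OF s0 diffusion_measurable[OF sol u s0]] by auto
    have "sq_moment M (\<lambda>\<omega>. diffusion X u r \<omega> - ?A \<omega>) = sq_moment M (\<lambda>\<omega>. (diffusion X u r \<omega> - diffusion X u s \<omega>) + (diffusion X u s \<omega> - ?A \<omega>))"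
      by simp
    also have "\<dots> \<le> 2 * sq_moment M (\<lambda>\<omega>. diffusion X u r \<omega> - diffusion X u s \<omega>) + 2 * sq_moment M (\<lambda>\<omega>. diffusion X u s \<omega> - ?A \<omega>)"
      by (intro sq_moment_add_le2 borel_measurable_diff dm AM)
    also have "\<dots> \<le> 2 * ennreal (?q * coeff_const * ?hp) + 2 * ennreal (4 * ?q * L\<^sup>2 * \<beta>)"
      by (intro add_mono mult_left_mono diffusion_regularity[OF sol h scheme h' p s0 st Xf u r]
          sigma_error[OF Xf family_mono[OF Zf eb] \<beta>(1) err' u s0]) auto
    also have "\<dots> = ennreal ?Nb" using const_nonneg \<beta> by (intro ennreal_double_sum) auto
    finally show "sq_moment M (\<lambda>\<omega>. diffusion X u r \<omega> - ?A \<omega>) \<le> ennreal ?Nb" .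
  qed
  then have PNsq: "sq_moment M ?PN \<le> ennreal ((1 - 2 * c0 * \<tau> + L\<^sup>2 * \<tau>\<^sup>2) * \<beta>) + ennreal (\<tau> * ?Nb)"
    unfolding W.ito_isometry(1)[OF J1 s0 t0(2) Pm Pfin Am Asq] \<tau>_def[symmetric] using Psq by (intro add_mono) auto
  have Rsq: "sq_moment M ?R \<le> ennreal (\<tau>\<^sup>2 * (coeff_const * ?hp))"
    unfolding \<tau>_def
    by (rule increment_drift[OF sol u J s0 t0(2) Vm _ drift_regularity[OF sol h scheme h' p s0 st Xf u]])
       (use const_nonneg in auto)
  \<comment> \<open>A fraction of the contraction rate, small enough that the weight 1 + e spoils
    only a quarter of \<open>c0 * \<tau>\<close>.\<close>
  define e where "e = c0 * \<tau> / 4"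
  have e: "0 < e" using c0 \<tau> by (simp add: e_def)
  have "sq_moment M (\<lambda>\<omega>. X u t \<omega> - Z u t \<omega>) = sq_moment M (\<lambda>\<omega>. ?PN \<omega> + ?R \<omega>)"
  proof (rule sq_moment_cong)
    fix \<omega> assume \<omega>: "\<omega> \<in> space M"
    have "Z u t \<omega> = (Z u s \<omega> + \<tau> *\<^sub>R b s (Z u s \<omega>)) + ?A \<omega> *v (B u t \<omega> - B u s \<omega>)"
      using euler_step[OF h scheme u \<omega> t] by (simp add: s_def \<tau>_def)
    then show "X u t \<omega> - Z u t \<omega> = ?PN \<omega> + ?R \<omega>" by (simp add: \<tau>_def algebra_simps)
  qed
  also have "\<dots> \<le> ennreal (1 + e) * sq_moment M ?PN + ennreal (1 + 1 / e) * sq_moment M ?R"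
    by (rule sq_moment_add_le[OF PNm Rm e])
  also have "\<dots> \<le> ennreal (1 + e) * (ennreal ((1 - 2 * c0 * \<tau> + L\<^sup>2 * \<tau>\<^sup>2) * \<beta>) + ennreal (\<tau> * ?Nb)) + ennreal (1 + 1 / e) * ennreal (\<tau>\<^sup>2 * (coeff_const * ?hp))"
    by (intro add_mono mult_left_mono PNsq Rsq) auto
  also have "\<dots> = ennreal ((1 + e) * ((1 - 2 * c0 * \<tau> + L\<^sup>2 * \<tau>\<^sup>2) * \<beta> + \<tau> * ?Nb) + (1 + 1 / e) * (\<tau>\<^sup>2 * (coeff_const * ?hp)))"
  proof -
    have nn: "0 \<le> (1 - 2 * c0 * \<tau> + L\<^sup>2 * \<tau>\<^sup>2) * \<beta>" "0 \<le> \<tau> * ?Nb" "0 \<le> \<tau>\<^sup>2 * (coeff_const * ?hp)" "0 \<le> 1 + e" "0 \<le> 1 + 1 / e"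
      using coeff0 \<beta> \<tau> Nb0 const_nonneg e by (auto intro!: mult_nonneg_nonneg)
    show ?thesis
      using nn by (simp only: ennreal_plus[symmetric] ennreal_mult[symmetric] add_nonneg_nonneg mult_nonneg_nonneg)
  qed
  also have "\<dots> \<le> ennreal \<beta>"
    using error_recursion(1)[OF sol h scheme h' p \<tau> \<beta>_def] by (intro ennreal_leI) (simp only: e_def)
  finally show ?thesis by (simp add: \<beta>_def)
qed

lemma error_grid:
  assumes "u \<in> unit_I"
  shows "sq_moment M (\<lambda>\<omega>. X u (real m * h) \<omega> - Z u (real m * h) \<omega>) \<le> ennreal (err_const * h powr p)"
  using assms
proof (induction m arbitrary: u)
  case 0
  obtain J where J1: "ito_integral M F (B u) (diffusion X u) J"
    and J2: "\<forall>t\<ge>0. AE \<omega> in M. X u t \<omega> = X0 u \<omega> + integral {0..t} (\<lambda>s. b s (X u s \<omega>)) + J t \<omega>"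
    using solution_ito[OF sol 0] by blast
  have "AE \<omega> in M. X u 0 \<omega> = X0 u \<omega> + integral {0..0} (\<lambda>s. b s (X u s \<omega>)) + J 0 \<omega>" using J2 by blast
  moreover have "AE \<omega> in M. Z u 0 \<omega> = X0 u \<omega>" using scheme 0 by (intro AE_I2) (simp add: euler_scheme_def)
  ultimately have "AE \<omega> in M. X u 0 \<omega> - Z u 0 \<omega> = 0"
    using filtered_bm.ito_integral_at_0[OF filtered_bm[OF 0] J1] by eventually_elim simp
  from sq_moment_cong_AE[OF this] show ?case by (simp add: sq_moment_def)
next
  case (Suc m)
  have "real (Suc m) * h \<in> {real m * h..real (Suc m) * h}" using h by (simp add: algebra_simps)
  from error_step[OF Suc.IH Suc.prems this] show ?case by blast
qed

lemma grid_interval: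
  assumes "0 \<le> t" shows "t \<in> {real (nat \<lfloor>t / h\<rfloor>) * h..real (Suc (nat \<lfloor>t / h\<rfloor>)) * h}"
proof -
  have "0 \<le> t / h" using assms h by simp
  then have "real (nat \<lfloor>t / h\<rfloor>) \<le> t / h" "t / h \<le> real (Suc (nat \<lfloor>t / h\<rfloor>))" by linarith+
  then show ?thesis using h by (auto simp: le_divide_eq divide_le_eq)
qed

lemma strong_error:
  assumes "u \<in> unit_I" "0 \<le> t"
  shows "sq_moment M (\<lambda>\<omega>. X u t \<omega> - Z u t \<omega>) \<le> ennreal (err_const * h powr p)"
  by (rule error_step[OF error_grid assms(1) grid_interval[OF assms(2)]])

text \<open>The solution inherits the moments of the scheme, at the price of an error of at most 1.
  The bound does not depend on h, so a single admissible step size proves it.\<close>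

lemma solution_moment:
  assumes "u \<in> unit_I" "0 \<le> t"
  shows "sq_moment M (X u t) \<le> ennreal sol_bound"
proof -
  note Zt = Z_moments[OF assms(1) grid_interval[OF assms(2)]] and Xt = X_measurable[OF sol assms]
  have "sq_moment M (X u t) = sq_moment M (\<lambda>\<omega>. (X u t \<omega> - Z u t \<omega>) + Z u t \<omega>)" by simp
  also have "\<dots> \<le> 2 * sq_moment M (\<lambda>\<omega>. X u t \<omega> - Z u t \<omega>) + 2 * sq_moment M (Z u t)"
    by (intro sq_moment_add_le2 borel_measurable_diff Xt Zt)
  also have "\<dots> \<le> 2 * ennreal 1 + 2 * ennreal euler_bound"
    using order_trans[OF strong_error[OF assms] ennreal_leI[OF h'(3)]] by (intro add_mono mult_left_mono Zt) auto
  also have "\<dots> = ennreal sol_bound"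
    using euler_bound(2) by (simp add: sol_bound_def ennreal_plus ennreal_mult add.commute)
  finally show ?thesis .
qed

end

lemma exists_step_size:
  assumes p: "0 < p"
  shows "\<exists>h0>0. \<forall>h\<in>{0<..<h0}. h \<le> 1 \<and> 8 * L\<^sup>2 * h \<le> c0 \<and> 2 * c0 * h \<le> 1 \<and>
    3 * (L * h) \<le> 1 \<and> 4 * (h * reg_const) \<le> 1 \<and> err_const * h powr p \<le> 1"
proof -
  have lin: "eventually (\<lambda>h. a * h < d) (at_right 0)" if "0 < d" for a d :: real
  proof -
    have "((\<lambda>h. a * h) \<longlongrightarrow> a * 0) (at_right 0)" by (intro tendsto_intros)
    then show ?thesis using that by (intro order_tendstoD(2)) auto
  qed
  have pw: "eventually (\<lambda>h. err_const * h powr p < 1) (at_right 0)"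
  proof -
    have "((\<lambda>h. h powr p) \<longlongrightarrow> 0) (at_right (0::real))"
      by (rule tendsto_zero_powrI[OF tendsto_ident_at tendsto_const _ p]) (simp add: eventually_at_filter)
    then have "((\<lambda>h. err_const * h powr p) \<longlongrightarrow> err_const * 0) (at_right 0)" by (intro tendsto_intros)
    then show ?thesis by (intro order_tendstoD(2)) auto
  qed
  have "eventually (\<lambda>h. 1 * h < 1 \<and> 8 * L\<^sup>2 * h < c0 \<and> 2 * c0 * h < 1 \<and> (3 * L) * h < 1 \<and> (4 * reg_const) * h < 1 \<and> err_const * h powr p < 1) (at_right 0)"
    by (intro eventually_conj lin pw) (use c0 in auto)
  then obtain h0 where h0: "0 < h0" "\<And>h. 0 < h \<Longrightarrow> h < h0 \<Longrightarrow> 1 * h < 1 \<and> 8 * L\<^sup>2 * h < c0 \<and> 2 * c0 * h < 1 \<and> (3 * L) * h < 1 \<and> (4 * reg_const) * h < 1 \<and> err_const * h powr p < 1"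
    unfolding eventually_at_right_field by metis
  show ?thesis
    using h0 by (intro exI[of _ h0]) (fastforce simp: mult_ac)
qed

end

theorem lemma4p2:
  fixes M :: "'w measure" and F :: "real \<Rightarrow> 'w measure"
    and G K :: "real \<Rightarrow> real \<Rightarrow> real"
    and b :: "real \<Rightarrow> real^'d \<Rightarrow> real^'d"
    and \<sigma> \<theta> :: "real \<Rightarrow> real^'d \<Rightarrow> (real^'d) measure \<Rightarrow> real^'q^'d"
    and X0 Y0 :: "real \<Rightarrow> 'w \<Rightarrow> real^'d"
    and B :: "real \<Rightarrow> real \<Rightarrow> 'w \<Rightarrow> real^'q"
    and X :: "real \<Rightarrow> real \<Rightarrow> 'w \<Rightarrow> real^'d"
    and Xbar :: "real \<Rightarrow> real \<Rightarrow> real \<Rightarrow> 'w \<Rightarrow> real^'d"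
    and x0 :: "real^'d" and \<rho> Lt L c0 :: real
  assumes "graphon G" and "graphon K"
    and "random_inputs M F X0 Y0 B"
    and "RD x0 M G K b \<sigma> \<theta> X0 Y0 \<rho> Lt L c0"
    and "graphon_sde_solution M F B G b \<sigma> X0 X"
    and "\<And>h. h > 0 \<Longrightarrow> euler_scheme M B G b \<sigma> X0 h (Xbar h)"
  shows "\<exists>h0>0.
    (\<exists>C>0.
       max (SUP t\<in>{0..}. SUP u\<in>unit_I. sq_moment M (X u t))
           (SUP h\<in>{0<..<h0}. SUP t\<in>{0..}. SUP u\<in>unit_I. sq_moment M (Xbar h u t))
       \<le> ennreal C) \<and>
    (\<exists>\<kappa>. \<forall>h\<in>{0<..<h0}. \<forall>t\<ge>0.
       let m = nat \<lfloor>t / h\<rfloor>; tm = real m * h in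
         (SUP u\<in>unit_I. sq_moment M (\<lambda>\<omega>. Xbar h u t \<omega> - Xbar h u tm \<omega>))
           \<le> ennreal (\<kappa> * (t - tm)) \<and>
         \<kappa> * (t - tm) \<le> \<kappa> * h) \<and>
    (\<exists>\<gamma>>0. \<forall>h\<in>{0<..<h0}.
       (SUP t\<in>{0..}. SUP u\<in>unit_I. sq_moment M (\<lambda>\<omega>. X u t \<omega> - Xbar h u t \<omega>))
         \<le> ennreal (\<gamma> * h powr (min 1 (2 * \<rho>))))"
proof -
  note rd = assms(4)[unfolded RD_def]
  define C0 where "C0 = enn2real (SUP u\<in>unit_I. sq_moment M (X0 u))"
  define N where "N = max (max (SUP t\<in>{0..}. ennreal (norm (b t 0)))
              (SUP t\<in>{0..}. SUP u\<in>unit_I. ennreal (mat_norm (\<sigma> t 0 (graphon_op G (\<lambda>v. return borel 0) u)))))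
         (SUP t\<in>{0..}. SUP u\<in>unit_I. ennreal (mat_norm (\<theta> t 0 (graphon_op K (\<lambda>v. return borel 0) u))))"
  define \<kappa> where "\<kappa> = enn2real N"
  have C0: "(SUP u\<in>unit_I. sq_moment M (X0 u)) = ennreal C0" using rd by (simp add: C0_def)
  have "N < \<infinity>" using rd by (simp add: N_def)
  then have \<kappa>: "N = ennreal \<kappa>" "0 \<le> \<kappa>" by (simp_all add: \<kappa>_def)
  \<comment> \<open>A test measure: the Dirac mass at 0 has distance 0 to itself and to its own
    reference in the time condition, so conditions on the drift alone can be read off.\<close>
  have \<delta>0: "return borel (0 :: real^'d) \<in> M2"
    by (auto simp: M2_def sq_moment_def nn_integral_return prob_space_return prob_space.finite_measure)
  have \<delta>W: "WOP2 x0 (return borel 0) (scale_measure (ennreal (mass (return borel (0 :: real^'d)))) (return borel 0)) = 0"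
    using WOP2_refl[of "return borel (0 :: real^'d)" x0] by (simp add: measure_return)
  interpret graphon_sde M F G b \<sigma> X0 B x0 \<rho> Lt L c0 \<kappa> C0
  proof (unfold_locales)
    show "graphon G" by fact
    show "filtered_prob_space M F" using assms(3) by (simp add: random_inputs_def)
    show "brownian_motion M F (B u)" "X0 u \<in> borel_measurable (F 0)" if "u \<in> unit_I" for u
      using assms(3) that by (auto simp: random_inputs_def)
    show "kernel_on_I (laws M X0)" using rd by blast
    show "sq_moment M (X0 u) \<le> ennreal C0" if "u \<in> unit_I" for u
      unfolding C0[symmetric] using that by (rule SUP_upper)
    show "0 \<le> C0" by (simp add: C0_def)
    show "0 < \<rho>" "\<rho> \<le> 1" "0 < Lt" "0 < L" "0 < c0" using rd by auto
    show "8 * L\<^sup>2 * real CARD('q) < c0" using rd by auto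
    show "0 \<le> \<kappa>" by fact
    show "norm (b t x - b t y) \<le> L * norm (x - y)" if "0 \<le> t" for t x y
    proof -
      have "max (max (norm (b t x - b t y)) (mat_norm (\<sigma> t x (return borel 0) - \<sigma> t y (return borel 0))))
            (mat_norm (\<theta> t x (return borel 0) - \<theta> t y (return borel 0)))
        \<le> L * (norm (x - y) + WOP2 x0 (return borel 0) (return borel 0))"
        using rd that \<delta>0 by blast
      then show ?thesis using WOP2_refl[of "return borel (0 :: real^'d)" x0] by simp
    qed
    show "norm (b t x - b s x) \<le> Lt * (1 + norm x) * (t - s) powr \<rho>" if "0 \<le> s" "s \<le> t" for s t x
    proof -
      have "max (max (norm (b t x - b s x)) (mat_norm (\<sigma> t x (return borel 0) - \<sigma> s x (return borel 0))))
            (mat_norm (\<theta> t x (return borel 0) - \<theta> s x (return borel 0)))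
        \<le> Lt * (1 + norm x + WOP2 x0 (return borel 0) (scale_measure (ennreal (mass (return borel (0 :: real^'d)))) (return borel 0)))
             * (t - s) powr \<rho>"
        using rd that \<delta>0 by blast
      then show ?thesis unfolding \<delta>W by simp
    qed
    show "(x - y) \<bullet> (b t x - b t y) \<le> - c0 * (norm (x - y))\<^sup>2" if "0 \<le> t" for t x y
      using rd that by blast
    show "norm (b t 0) \<le> \<kappa>" if "0 \<le> t" for t
    proof -
      have "ennreal (norm (b t 0)) \<le> (SUP t\<in>{0..}. ennreal (norm (b t 0)))" using that by (intro SUP_upper) simp
      also have "\<dots> \<le> N" by (simp add: N_def le_max_iff_disj)
      finally show ?thesis using \<kappa> by simp
    qed
    show "mat_norm (\<sigma> t x \<mu> - \<sigma> t y \<nu>) \<le> L * (norm (x - y) + WOP2 x0 \<mu> \<nu>)"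
      if "0 \<le> t" "\<mu> \<in> M2" "\<nu> \<in> M2" for t x y \<mu> \<nu>
    proof -
      have "max (max (norm (b t x - b t y)) (mat_norm (\<sigma> t x \<mu> - \<sigma> t y \<nu>))) (mat_norm (\<theta> t x \<mu> - \<theta> t y \<nu>))
        \<le> L * (norm (x - y) + WOP2 x0 \<mu> \<nu>)"
        using rd that by blast
      then show ?thesis by simp
    qed
    show "mat_norm (\<sigma> t x \<mu> - \<sigma> s x \<mu>) \<le>
          Lt * (1 + norm x + WOP2 x0 \<mu> (scale_measure (ennreal (mass \<mu>)) (return borel 0))) * (t - s) powr \<rho>"
      if "0 \<le> s" "s \<le> t" "\<mu> \<in> M2" for s t x \<mu>
    proof -
      have "max (max (norm (b t x - b s x)) (mat_norm (\<sigma> t x \<mu> - \<sigma> s x \<mu>))) (mat_norm (\<theta> t x \<mu> - \<theta> s x \<mu>))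
        \<le> Lt * (1 + norm x + WOP2 x0 \<mu> (scale_measure (ennreal (mass \<mu>)) (return borel 0))) * (t - s) powr \<rho>"
        using rd that by blast
      then show ?thesis by simp
    qed
    show "mat_norm (\<sigma> t 0 (graphon_op G (\<lambda>v. return borel 0) u)) \<le> \<kappa>" if "0 \<le> t" "u \<in> unit_I" for t u
    proof -
      have "ennreal (mat_norm (\<sigma> t 0 (graphon_op G (\<lambda>v. return borel 0) u)))
          \<le> (SUP u\<in>unit_I. ennreal (mat_norm (\<sigma> t 0 (graphon_op G (\<lambda>v. return borel 0) u))))"
        using that by (intro SUP_upper)
      also have "\<dots> \<le> (SUP t\<in>{0..}. SUP u\<in>unit_I. ennreal (mat_norm (\<sigma> t 0 (graphon_op G (\<lambda>v. return borel 0) u))))"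
        using that by (intro SUP_upper) simp
      also have "\<dots> \<le> N" by (simp add: N_def le_max_iff_disj)
      finally show ?thesis using \<kappa> by simp
    qed
  qed
  note sol = assms(5) and scheme = assms(6)
  define p where "p = min 1 (2 * \<rho>)"
  have p: "0 < p" "p \<le> 1" "p \<le> 2 * \<rho>" using \<rho> by (auto simp: p_def)
  obtain h0 where h0: "0 < h0" and small: "\<forall>h\<in>{0<..<h0}. h \<le> 1 \<and> 8 * L\<^sup>2 * h \<le> c0 \<and> 2 * c0 * h \<le> 1 \<and>
    3 * (L * h) \<le> 1 \<and> 4 * (h * reg_const) \<le> 1 \<and> err_const * h powr p \<le> 1"
    using exists_step_size[OF p(1)] by blast
  define k where "k = 2 * \<kappa>\<^sup>2 + 2 * L\<^sup>2 * euler_bound + real CARD('q) * (2 * \<kappa>\<^sup>2 + 8 * L\<^sup>2 * euler_bound)"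
  have k: "0 \<le> k" using euler_bound(2) by (simp add: k_def)
  have eb: "euler_bound \<le> sol_bound" "0 < sol_bound" using euler_bound(2) by (auto simp: sol_bound_def)
  have good: "0 < h" "h \<le> 1" "8 * L\<^sup>2 * h \<le> c0" "2 * c0 * h \<le> 1" "3 * (L * h) \<le> 1" "4 * (h * reg_const) \<le> 1" "err_const * h powr p \<le> 1"
    if "h \<in> {0<..<h0}" for h
    using small that by auto
  show ?thesis
  proof (rule exI[of _ h0], intro conjI h0)
    have X: "sq_moment M (X u t) \<le> ennreal sol_bound" if "u \<in> unit_I" "t \<in> {0..}" for u t
    proof -
      \<comment> \<open>Any admissible step size would do; the statement about the solution does not
        involve it.\<close>
      have h: "h0 / 2 \<in> {0<..<h0}" using h0 by simp
      show ?thesis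
        using solution_moment[OF sol good(1-4)[OF h] scheme[OF good(1)[OF h]] good(5-7)[OF h] p(2,3)] that by simp
    qed
    have Y: "sq_moment M (Xbar h u t) \<le> ennreal sol_bound" if "u \<in> unit_I" "t \<in> {0..}" "h \<in> {0<..<h0}" for u t h
      using order_trans[OF Z_moments(1)[OF sol good(1-4)[OF that(3)] scheme[OF good(1)[OF that(3)]] good(5-7)[OF that(3)] p(2,3) that(1)
          grid_interval[OF sol good(1-4)[OF that(3)] scheme[OF good(1)[OF that(3)]] good(5-7)[OF that(3)] p(2,3)]] ennreal_leI[OF eb(1)]] that(2) by simp
    show "\<exists>C>0. max (SUP t\<in>{0..}. SUP u\<in>unit_I. sq_moment M (X u t))
           (SUP h\<in>{0<..<h0}. SUP t\<in>{0..}. SUP u\<in>unit_I. sq_moment M (Xbar h u t)) \<le> ennreal C"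
      by (intro exI[of _ sol_bound] conjI eb(2) max.boundedI SUP_least X Y)
    show "\<exists>\<kappa>. \<forall>h\<in>{0<..<h0}. \<forall>t\<ge>0.
       let m = nat \<lfloor>t / h\<rfloor>; tm = real m * h in
         (SUP u\<in>unit_I. sq_moment M (\<lambda>\<omega>. Xbar h u t \<omega> - Xbar h u tm \<omega>)) \<le> ennreal (\<kappa> * (t - tm)) \<and>
         \<kappa> * (t - tm) \<le> \<kappa> * h"
      unfolding Let_def
    proof (intro exI[of _ k] ballI allI impI conjI SUP_least)
      fix h t assume h: "h \<in> {0<..<h0}" and t: "(0::real) \<le> t"
      note g = sol good(1-4)[OF h] scheme[OF good(1)[OF h]] good(5-7)[OF h] p(2,3)
      note gi = grid_interval[OF g t]
      show "sq_moment M (\<lambda>\<omega>. Xbar h u t \<omega> - Xbar h u (real (nat \<lfloor>t / h\<rfloor>) * h) \<omega>) \<le> ennreal (k * (t - real (nat \<lfloor>t / h\<rfloor>) * h))"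
        if "u \<in> unit_I" for u
        unfolding k_def by (rule Z_moments(3)[OF g that gi])
      have "t - real (nat \<lfloor>t / h\<rfloor>) * h \<le> h" using gi by (simp add: algebra_simps)
      then show "k * (t - real (nat \<lfloor>t / h\<rfloor>) * h) \<le> k * h" using k by (rule mult_left_mono)
    qed
    show "\<exists>\<gamma>>0. \<forall>h\<in>{0<..<h0}. (SUP t\<in>{0..}. SUP u\<in>unit_I. sq_moment M (\<lambda>\<omega>. X u t \<omega> - Xbar h u t \<omega>))
         \<le> ennreal (\<gamma> * h powr (min 1 (2 * \<rho>)))"
    proof (intro exI[of _ "err_const + 1"] conjI ballI SUP_least)
      \<comment> \<open>\<open>err_const\<close> is only known to be nonnegative, and a positive
        constant is demanded.\<close>
      show "0 < err_const + 1" using const_nonneg(3) by simp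
      fix h t u assume h: "h \<in> {0<..<h0}" and t: "t \<in> {0::real..}" and u: "u \<in> unit_I"
      note g = sol good(1-4)[OF h] scheme[OF good(1)[OF h]] good(5-7)[OF h] p(2,3)
      have "sq_moment M (\<lambda>\<omega>. X u t \<omega> - Xbar h u t \<omega>) \<le> ennreal (err_const * h powr p)"
        using strong_error[OF g u] t by simp
      also have "\<dots> \<le> ennreal ((err_const + 1) * h powr p)" by (intro ennreal_leI mult_right_mono) auto
      finally show "sq_moment M (\<lambda>\<omega>. X u t \<omega> - Xbar h u t \<omega>) \<le> ennreal ((err_const + 1) * h powr (min 1 (2 * \<rho>)))"
        by (simp add: p_def)
    qed
  qed
qed

end
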